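(* There exists a Goryainov–Ba evolution family $(\varphi_{s,t})$, $s\in[0,+\infty)$, $t\in[s,+\infty)$, of order $d=\infty$ such that (i) $\ell(\varphi_{s,t})=t-s$ for all $s\ge0$ and $t\ge s$; (ii) $\varphi_{s,t}\in\mathcal{A}$ for all $s\ge0$ and $t\ge s$; (iii) for each Loewner chain $(f_t)$ associated with the evolution family $(\varphi_{s,t})$ and for any $t\ge0$ the prime end $f_t^{p.e.}(1)$ is non-trivial and does not contain reachable points; in particular $\partial_\infty f_t(\mathbb{D})$ fails to be locally connected.
   Context: $\mathbb{D}=\{z:|z|<1\}$, $\mathbb{T}=\partial\mathbb{D}$, $\mathbb{H}=\{z:\mathrm{Im}\,z>0\}$; $H(\zeta):=i\frac{1+\zeta}{1-\zeta}$ maps $\mathbb{D}$ onto $\mathbb{H}$; $\partial_\infty E$ is the boundary of $E$ in the Riemann sphere. $\mathcal{A}$ is the disk algebra: holomorphic functions in $\mathbb{D}$ with continuous extension to the closed unit disk. Evolution family of order $d\in[1,+\infty]$: a family $(\varphi_{s,t})_{0\le s\le t<+\infty}$ of holomorphic self-maps of $\mathbb{D}$ with (EF1) $\varphi_{s,s}=\mathrm{id}_{\mathbb{D}}$; (EF2) $\varphi_{s,t}=\varphi_{u,t}\circ\varphi_{s,u}$ for $0\le s\le u\le t$; (EF3) for all $z\in\mathbb{D}$, $T>0$ there is a non-negative $k_{z,T}\in L^d([0,T],\mathbb{R})$ with $|\varphi_{s,u}(z)-\varphi_{s,t}(z)|\le\int_u^t k_{z,T}(\xi)\,d\xi$ for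 $0\le s\le u\le t\le T$. Loewner chain of order $d\in[1,+\infty]$: a family $(f_t)_{t\ge0}$ of holomorphic maps $f_t:\mathbb{D}\to\mathbb{C}$ such that (LC1) each $f_t$ is univalent; (LC2) $f_s(\mathbb{D})\subset f_t(\mathbb{D})$ for $0\le s\le t$; (LC3) for any compact $K\subset\mathbb{D}$ and $T>0$ there is a non-negative $k_{K,T}\in L^d([0,T],\mathbb{R})$ with $|f_s(z)-f_t(z)|\le\int_s^t k_{K,T}(\xi)\,d\xi$ for all $z\in K$, $0\le s\le t\le T$. A Loewner chain without specified order is one of some order. $(f_t)$ is associated with $(\varphi_{s,t})$ if $f_t\circ\varphi_{s,t}=f_s$ for all $0\le s\le t$. $\mathfrak{P}_0$ is the class of all univalent holomorphic $G:\mathbb{H}\to\mathbb{H}$ for which there is $C>0$ with $|G(z)-z|\le C/\mathrm{Im}\,z$ for all $z\in\mathbb{H}$; $\ell(G)$ denotes the minimal constant $C$ for which this estimate holds ($\ell(\mathrm{id})=0$). $\mathcal{P}_0:=\{H^{-1}\circ G\circ H:G\in\mathfrak{P}_0\}$, and $\ell(\varphi):=\ell(H\circ\varphi\circ H^{-1})$ for $\varphi\in\mathcal{P}_0$. A Goryainov–Ba evolution family is an evolution family $(\varphi_{s,t})$ contained in $\mathcal{P}_0$ such that $t\mapsto\ell(\varphi_{0,t})$ is locally absolutely continuous on $[0,+\infty)$; its order is its order as an evolution family. For a conformal map $F$ of $\mathbb{D}$ onto a domain $D$, $F^{p.e.}$ denotes the induced bijection from $\mathbb{T}$ (identified with the set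 of prime ends of $\mathbb{D}$) onto the set of (Carathéodory) prime ends of $D$. A prime end is trivial if its impression is a single point, and non-trivial otherwise. A prime end $P$ of $D$ contains a reachable point $A$ if there is a Jordan arc in $D$ landing at $A\in\partial_\infty D$ that tends to the prime end $P$. *)

theory Defs
  imports "HOL-Analysis.Analysis"
begin

section \<open>Disk, half-plane and Riemann sphere\<close>

abbreviation unit_disk :: "complex set" ("\<bbbD>")
  where "\<bbbD> \<equiv> ball 0 1"

definition upper_half_plane :: "complex set" ("\<bbbH>")
  where "\<bbbH> = {z. Im z > 0}"

definition cayley :: "complex \<Rightarrow> complex"
  where "cayley \<zeta> = \<i> * (1 + \<zeta>) / (1 - \<zeta>)"

abbreviation cayley_inv :: "complex \<Rightarrow> complex"
  where "cayley_inv \<equiv> inv_into \<bbbD> cayley"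

text \<open>The Riemann sphere is the one-point compactification of the plane:
  \<open>Some z\<close> is the finite point \<open>z\<close> and \<open>None\<close> is \<open>\<infinity>\<close>.\<close>

definition riemann_sphere :: "complex option topology"
  where "riemann_sphere = Alexandroff_compactification euclidean"

definition sphere_closure :: "complex set \<Rightarrow> complex option set"
  where "sphere_closure E = riemann_sphere closure_of (Some ` E)"

definition sphere_boundary :: "complex set \<Rightarrow> complex option set"
  where "sphere_boundary E = riemann_sphere frontier_of (Some ` E)"

definition chordal_dist :: "complex \<Rightarrow> complex \<Rightarrow> real"
  where "chordal_dist z w =
    2 * cmod (z - w) / (sqrt (1 + (cmod z)\<^sup>2) * sqrt (1 + (cmod w)\<^sup>2))"

definition spherical_diameter :: "complex set \<Rightarrow> real"
  where "spherical_diameter E = (SUP (z, w) \<in> E \<times> E. chordal_dist z w)"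

definition univalent_on :: "(complex \<Rightarrow> complex) \<Rightarrow> complex set \<Rightarrow> bool"
  where "univalent_on f A \<longleftrightarrow> f holomorphic_on A \<and> inj_on f A"

definition disk_algebra :: "(complex \<Rightarrow> complex) set"
  where "disk_algebra =
    {f. f holomorphic_on \<bbbD> \<and>
        (\<exists>g. continuous_on (cball 0 1) g \<and> (\<forall>z\<in>\<bbbD>. g z = f z))}"


section \<open>Evolution families and Loewner chains\<close>

text \<open>Non-negative functions in \<open>L\<^sup>d([0,T])\<close>. As only integrals of \<open>k\<close> are used below,
  the representative may be taken to be non-negative everywhere.\<close>

definition nonneg_Ld :: "ereal \<Rightarrow> real \<Rightarrow> (real \<Rightarrow> real) \<Rightarrow> bool"
  where "nonneg_Ld d T k \<longleftrightarrow>
    k \<in> borel_measurable (lebesgue_on {0..T}) \<and> (\<forall>x\<in>{0..T}. 0 \<le> k x) \<and>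
    (if d = \<infinity> then \<exists>M. AE x in lebesgue_on {0..T}. k x \<le> M
     else integrable (lebesgue_on {0..T}) (\<lambda>x. k x powr real_of_ereal d))"

definition evolution_family :: "ereal \<Rightarrow> (real \<Rightarrow> real \<Rightarrow> complex \<Rightarrow> complex) \<Rightarrow> bool"
  where "evolution_family d \<phi> \<longleftrightarrow>
    1 \<le> d \<and>
    (\<forall>s t. 0 \<le> s \<and> s \<le> t \<longrightarrow> \<phi> s t holomorphic_on \<bbbD> \<and> \<phi> s t ` \<bbbD> \<subseteq> \<bbbD>) \<and>
    (\<forall>s\<ge>0. \<forall>z\<in>\<bbbD>. \<phi> s s z = z) \<and>
    (\<forall>s u t. 0 \<le> s \<and> s \<le> u \<and> u \<le> t \<longrightarrow> (\<forall>z\<in>\<bbbD>. \<phi> s t z = \<phi> u t (\<phi> s u z))) \<and>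
    (\<forall>z\<in>\<bbbD>. \<forall>T>0. \<exists>k. nonneg_Ld d T k \<and>
       (\<forall>s u t. 0 \<le> s \<and> s \<le> u \<and> u \<le> t \<and> t \<le> T \<longrightarrow>
          cmod (\<phi> s u z - \<phi> s t z) \<le> (LINT \<xi>:{u..t}|lebesgue. k \<xi>)))"

definition loewner_chain_of_order :: "ereal \<Rightarrow> (real \<Rightarrow> complex \<Rightarrow> complex) \<Rightarrow> bool"
  where "loewner_chain_of_order d f \<longleftrightarrow>
    1 \<le> d \<and>
    (\<forall>t\<ge>0. univalent_on (f t) \<bbbD>) \<and>
    (\<forall>s t. 0 \<le> s \<and> s \<le> t \<longrightarrow> f s ` \<bbbD> \<subseteq> f t ` \<bbbD>) \<and>
    (\<forall>K T. compact K \<and> K \<subseteq> \<bbbD> \<and> 0 < T \<longrightarrow> (\<exists>k. nonneg_Ld d T k \<and>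
       (\<forall>z\<in>K. \<forall>s t. 0 \<le> s \<and> s \<le> t \<and> t \<le> T \<longrightarrow>
          cmod (f s z - f t z) \<le> (LINT \<xi>:{s..t}|lebesgue. k \<xi>))))"

definition loewner_chain :: "(real \<Rightarrow> complex \<Rightarrow> complex) \<Rightarrow> bool"
  where "loewner_chain f \<longleftrightarrow> (\<exists>d. loewner_chain_of_order d f)"

definition chain_associated_with ::
  "(real \<Rightarrow> complex \<Rightarrow> complex) \<Rightarrow> (real \<Rightarrow> real \<Rightarrow> complex \<Rightarrow> complex) \<Rightarrow> bool"
  where "chain_associated_with f \<phi> \<longleftrightarrow>
    (\<forall>s t. 0 \<le> s \<and> s \<le> t \<longrightarrow> (\<forall>z\<in>\<bbbD>. f t (\<phi> s t z) = f s z))"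


section \<open>Goryainov--Ba evolution families\<close>

definition half_plane_P0 :: "(complex \<Rightarrow> complex) set"
  where "half_plane_P0 =
    {G. univalent_on G \<bbbH> \<and> G ` \<bbbH> \<subseteq> \<bbbH> \<and>
        (\<exists>C>0. \<forall>z\<in>\<bbbH>. cmod (G z - z) \<le> C / Im z)}"

definition half_plane_ell :: "(complex \<Rightarrow> complex) \<Rightarrow> real"
  where "half_plane_ell G = (LEAST C. \<forall>z\<in>\<bbbH>. cmod (G z - z) \<le> C / Im z)"

definition disk_P0 :: "(complex \<Rightarrow> complex) set"
  where "disk_P0 =
    {\<phi>. \<exists>G\<in>half_plane_P0. \<forall>z\<in>\<bbbD>. \<phi> z = (cayley_inv \<circ> G \<circ> cayley) z}"

definition ell :: "(complex \<Rightarrow> complex) \<Rightarrow> real"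
  where "ell \<phi> = half_plane_ell (cayley \<circ> \<phi> \<circ> cayley_inv)"

definition abs_continuous_on_interval :: "real \<Rightarrow> real \<Rightarrow> (real \<Rightarrow> real) \<Rightarrow> bool"
  where "abs_continuous_on_interval a b h \<longleftrightarrow>
    (\<forall>\<epsilon>>0. \<exists>\<delta>>0. \<forall>(n::nat) l r.
       (\<forall>i<n. a \<le> l i \<and> l i \<le> r i \<and> r i \<le> b) \<and>
       disjoint_family_on (\<lambda>i. {l i<..<r i}) {..<n} \<and>
       (\<Sum>i<n. r i - l i) < \<delta> \<longrightarrow>
       (\<Sum>i<n. \<bar>h (r i) - h (l i)\<bar>) < \<epsilon>)"

definition goryainov_ba_family :: "ereal \<Rightarrow> (real \<Rightarrow> real \<Rightarrow> complex \<Rightarrow> complex) \<Rightarrow> bool"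
  where "goryainov_ba_family d \<phi> \<longleftrightarrow>
    evolution_family d \<phi> \<and>
    (\<forall>s t. 0 \<le> s \<and> s \<le> t \<longrightarrow> \<phi> s t \<in> disk_P0) \<and>
    (\<forall>T>0. abs_continuous_on_interval 0 T (\<lambda>t. ell (\<phi> 0 t)))"


section \<open>Prime ends\<close>

text \<open>Carath\'eodory's prime ends, as classes of null-chains of crosscuts. A crosscut is an open
  Jordan arc in \<open>G\<close> with one-sided limits on the boundary of \<open>G\<close> in the sphere; the two limits
  are allowed to coincide.\<close>

definition crosscut :: "complex set \<Rightarrow> complex set \<Rightarrow> bool"
  where "crosscut G C \<longleftrightarrow>
    (\<exists>\<gamma>::real \<Rightarrow> complex. \<exists>a b.
       continuous_on {0<..<1} \<gamma> \<and> inj_on \<gamma> {0<..<1} \<and> \<gamma> ` {0<..<1} = C \<and> C \<subseteq> G \<and>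
       a \<in> sphere_boundary G \<and> b \<in> sphere_boundary G \<and>
       limitin riemann_sphere (\<lambda>x. Some (\<gamma> x)) a (at_right 0) \<and>
       limitin riemann_sphere (\<lambda>x. Some (\<gamma> x)) b (at_left 1))"

definition separates_in :: "complex set \<Rightarrow> complex set \<Rightarrow> complex set \<Rightarrow> complex set \<Rightarrow> bool"
  where "separates_in G C A B \<longleftrightarrow>
    A \<subseteq> G - C \<and> B \<subseteq> G - C \<and> (\<forall>a\<in>A. \<forall>b\<in>B. \<not> connected_component (G - C) a b)"

definition null_chain :: "complex set \<Rightarrow> (nat \<Rightarrow> complex set) \<Rightarrow> bool"
  where "null_chain G C \<longleftrightarrow>
    (\<forall>n. crosscut G (C n)) \<and>
    (\<forall>n. sphere_closure (C n) \<inter> sphere_closure (C (Suc n)) = {}) \<and>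
    (\<forall>n\<ge>1. separates_in G (C n) (C 0) (C (Suc n))) \<and>
    (\<lambda>n. spherical_diameter (C n)) \<longlonglongrightarrow> 0"

text \<open>The component of \<open>G - C n\<close> containing \<open>C (n+1)\<close>; for \<open>n \<ge> 1\<close> this is the component
  not containing \<open>C 0\<close>.\<close>

definition chain_region :: "complex set \<Rightarrow> (nat \<Rightarrow> complex set) \<Rightarrow> nat \<Rightarrow> complex set"
  where "chain_region G C n = (\<Union>w\<in>C (Suc n). connected_component_set (G - C n) w)"

definition chain_equiv :: "complex set \<Rightarrow> ((nat \<Rightarrow> complex set) \<times> (nat \<Rightarrow> complex set)) set"
  where "chain_equiv G =
    {(C, C'). null_chain G C \<and> null_chain G C' \<and>
       (\<forall>m. \<exists>n. chain_region G C' n \<subseteq> chain_region G C m) \<and>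
       (\<forall>m. \<exists>n. chain_region G C n \<subseteq> chain_region G C' m)}"

definition prime_ends :: "complex set \<Rightarrow> (nat \<Rightarrow> complex set) set set"
  where "prime_ends G = {C. null_chain G C} // chain_equiv G"

definition chain_impression :: "complex set \<Rightarrow> (nat \<Rightarrow> complex set) \<Rightarrow> complex option set"
  where "chain_impression G C = (\<Inter>n. sphere_closure (chain_region G C n))"

text \<open>Equivalent null-chains have the same impression, so intersecting over all representatives
  amounts to choosing any one of them.\<close>

definition impression :: "complex set \<Rightarrow> (nat \<Rightarrow> complex set) set \<Rightarrow> complex option set"
  where "impression G P = (\<Inter>C\<in>P. chain_impression G C)"

definition trivial_prime_end :: "complex set \<Rightarrow> (nat \<Rightarrow> complex set) set \<Rightarrow> bool"
  where "trivial_prime_end G P \<longleftrightarrow> (\<exists>A. impression G P = {A})"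

definition contains_reachable_point ::
  "complex set \<Rightarrow> (nat \<Rightarrow> complex set) set \<Rightarrow> complex option \<Rightarrow> bool"
  where "contains_reachable_point G P A \<longleftrightarrow>
    A \<in> sphere_boundary G \<and>
    (\<exists>\<gamma>::real \<Rightarrow> complex.
       continuous_on {0..<1} \<gamma> \<and> inj_on \<gamma> {0..<1} \<and> \<gamma> ` {0..<1} \<subseteq> G \<and>
       limitin riemann_sphere (\<lambda>x. Some (\<gamma> x)) A (at_left 1) \<and>
       (\<forall>C\<in>P. \<forall>n. \<forall>\<^sub>F x in at_left 1. \<gamma> x \<in> chain_region G C n))"

text \<open>The prime end of the disk identified with the boundary point \<open>\<zeta>\<close> is the one with
  impression \<open>{\<zeta>}\<close>. The induced map sends it to the prime end of \<open>F ` \<bbbD>\<close> formed by the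
  null-chains whose preimages under \<open>F\<close> represent it. (Images of null-chains of the disk need
  not be null-chains, as their diameters need not tend to 0.)\<close>

definition disk_prime_end :: "complex \<Rightarrow> (nat \<Rightarrow> complex set) set"
  where "disk_prime_end \<zeta> = {C. null_chain \<bbbD> C \<and> chain_impression \<bbbD> C = {Some \<zeta>}}"

definition prime_end_map :: "(complex \<Rightarrow> complex) \<Rightarrow> complex \<Rightarrow> (nat \<Rightarrow> complex set) set"
  where "prime_end_map F \<zeta> =
    {C. null_chain (F ` \<bbbD>) C \<and> (\<lambda>n. {z\<in>\<bbbD>. F z \<in> C n}) \<in> disk_prime_end \<zeta>}"

end

theory Submission
  imports Defs "HOL-Complex_Analysis.Complex_Analysis"
begin

text \<open>
  The family is built in the half-plane by running, one after the other, the flows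
  \<open>w' = -1 / (w - p)\<close> with poles \<open>p\<close> below the real line. Whatever the poles and the durations
  are, \<open>\<ell>\<close> of a transition map is the elapsed time, and the maps extend continuously and
  injectively to the closed half-plane. The freedom left in the poles and durations is used to
  spoil the boundary behaviour of the Loewner chains at the point \<open>1\<close>.

  The basic observation is that a flow can rotate. After composition with the affine map that
  returns the image of \<open>\<i>\<close> to \<open>\<i>\<close>, one suitable flow becomes a self-map of the disk that fixes \<open>0\<close>
  and the boundary point \<open>1\<close> and whose derivative at \<open>0\<close> is close to \<open>exp (\<i> pi / m)\<close>
  (\<open>normal_step_deriv\<close>). The composition \<open>block m\<close> of \<open>m\<close> such maps still fixes \<open>1\<close>, but by the
  Schwarz lemma it is within \<open>O(1/m)\<close> of \<open>z \<mapsto> -z\<close> on compact subsets of the disk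
  (\<open>block_derivative\<close>, \<open>near_minus_identity\<close>).

  The evolution family runs through blocks \<open>B n = block (M n)\<close> with rapidly growing \<open>M n\<close>. Then
  \<open>(-1)^n B (n-1) \<circ> \<dots> \<circ> B k\<close> converges to a univalent self-map
  \<open>limit_map k\<close> of the disk as \<open>n\<close> grows, and every associated Loewner chain, at the times at which blocks
  begin and read in suitable affine frames, has the form \<open>F \<circ> limit_map k\<close> with one univalent \<open>F\<close>
  on the disk (\<open>factor_exists\<close>). A curve that tends to \<open>1\<close> meets every small circle
  \<open>\<bar>z - 1\<bar> = \<delta> n\<close>. The radius \<open>\<delta> n\<close> is chosen when only the first \<open>n\<close> blocks are known, so small
  that by continuity these blocks keep the crossing point near \<open>1\<close>; the later blocks are then
  chosen so close to \<open>z \<mapsto> -z\<close> that they merely change the sign. Hence the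
  image of the curve under \<open>limit_map k\<close> is near \<open>(-1)^n\<close> for every large \<open>n\<close>, while its modulus
  tends to \<open>1\<close>. Along a curve that oscillates in this way no univalent function has a limit,
  in the manner of Koebe's lemma (\<open>oscillating_curve_no_limit\<close>). So \<open>f t\<close> has no limit
  along any curve tending to \<open>1\<close> (\<open>no_limit_at_1\<close>).

  The conclusions about the boundary follow topologically (\<open>nonlanding_boundary\<close>). Because a
  transition map sends the closed disk without \<open>1\<close> into the open disk, \<open>f t\<close> extends
  continuously and injectively to the closed disk without \<open>1\<close>. By a length-area estimate there
  are geodesics \<open>\<bar>H\<bar> = R n\<close> with short images; these form a null-chain, and
  they represent the prime end at \<open>1\<close>. If its impression were a point then \<open>f t x\<close> would
  converge as \<open>x \<rightarrow> 1\<close>; a reachable point in it would give a curve that tends to \<open>1\<close>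
  and whose image converges; and a locally connected boundary could not contain the image of
  the circular arc ending at \<open>1\<close>, whose pieces are open in the boundary and
  cluster at two different points.
\<close>

section \<open>Length and area\<close>

lemma exists_2: "(\<exists>i::2. P i) \<longleftrightarrow> P 1 \<or> P 2"
  using forall_2[of "\<lambda>i. \<not> P i"] by blast

text \<open>The change of variables theorem is about \<open>real^2\<close>, while Fubini's theorem for integrals over
  boxes is about \<open>real \<times> real\<close>; this carries an integral from the one to the other.\<close>

lemma has_integral_cart2_imp_pair:
  fixes f :: "real^2 \<Rightarrow> real"
  assumes "(f has_integral i) (cbox (vector [a, c]) (vector [b, d]))"
  shows "((\<lambda>(x,y). f (vector [x, y])) has_integral i) (cbox (a, c) (b, d))"
proof -
  define g :: "real \<times> real \<Rightarrow> real^2" where "g = (\<lambda>p. vector [fst p, snd p])"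
  define h :: "real^2 \<Rightarrow> real \<times> real" where "h = (\<lambda>v. (v $ 1, v $ 2))"
  have gh: "g (h v) = v" for v by (simp add: g_def h_def vec_eq_iff forall_2)
  have hg: "h (g p) = p" for p by (simp add: g_def h_def)
  have gc: "g ` cbox (p, q) (p', q') = cbox (vector [p, q]) (vector [p', q'])" for p q p' q'
  proof (intro set_eqI iffI)
    fix v assume "v \<in> cbox (vector [p, q]) (vector [p', q'] :: real^2)"
    then have "h v \<in> cbox (p, q) (p', q')"
      by (auto simp: h_def cbox_Pair_eq mem_box_cart forall_2)
    then show "v \<in> g ` cbox (p, q) (p', q')" using gh by (metis imageI)
  qed (auto simp: g_def cbox_Pair_eq mem_box_cart forall_2)
  have hc: "h ` cbox u v = cbox (h u) (h v)" for u v
  proof -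
    have "cbox u v = g ` cbox (h u) (h v)"
      using gc[of "u$1" "u$2" "v$1" "v$2"] gh[of u] gh[of v] by (simp add: h_def g_def)
    then show ?thesis by (simp add: image_image hg)
  qed
  have cont: "continuous (at x) g" for x
  proof -
    have "g = (\<lambda>p. \<chi> i. if i = 1 then fst p else snd p)"
      by (auto simp: g_def fun_eq_iff vec_eq_iff forall_2)
    moreover have "continuous_on UNIV (\<lambda>p::real\<times>real. \<chi> i::2. if i = 1 then fst p else snd p)"
      by (rule continuous_on_vec_lambda, case_tac "i = 1") (auto intro!: continuous_intros)
    ultimately show ?thesis using continuous_on_eq_continuous_at[OF open_UNIV] by auto
  qed
  have content: "measure lborel (g ` cbox u v) = 1 * measure lborel (cbox u v)" for u v
  proof -
    obtain p q p' q' where uv: "u = (p, q)" "v = (p', q')" by (cases u, cases v)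
    have "measure lborel (cbox (vector [p, q]) (vector [p', q'] :: real^2))
        = measure lborel (cbox p p') * measure lborel (cbox q q')"
    proof (cases "p \<le> p' \<and> q \<le> q'")
      case True
      then show ?thesis
        by (subst content_cbox_cart) (auto simp: interval_eq_empty_cart UNIV_2 exists_2)
    next
      case False
      then have "cbox (vector [p, q]) (vector [p', q'] :: real^2) = {}"
        by (auto simp: interval_eq_empty_cart exists_2)
      then show ?thesis using False by (auto simp: measure_def)
    qed
    then show ?thesis by (simp add: uv gc content_Pair)
  qed
  have "((\<lambda>p. f (g p)) has_integral (1 / 1) *\<^sub>R i) (h ` cbox (vector [a, c]) (vector [b, d]))"
  proof (rule has_integral_twiddle[OF _ hg gh cont _ _ content assms])
    show "\<exists>w z. g ` cbox u v = cbox w z" for u v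
      by (cases u, cases v) (metis gc)
    show "\<exists>w z. h ` cbox u v = cbox w z" for u v using hc by blast
  qed auto
  moreover have "h ` cbox (vector [a, c]) (vector [b, d]) = cbox (a, c) (b, d)"
    unfolding hc by (simp add: h_def)
  ultimately show ?thesis by (simp add: g_def case_prod_beta')
qed

text \<open>The integrand is the Jacobian of \<open>g\<close>, so for injective \<open>g\<close> the integral is the area of the
  image, and the image lies in a square of side \<open>2 B\<close>.\<close>

lemma area_of_rectangle_image_le:
  fixes g :: "complex \<Rightarrow> complex"
  assumes S: "open S" and holg: "g holomorphic_on S" and inj: "inj_on g S"
    and Q: "\<And>x y. x \<in> {a..b} \<Longrightarrow> y \<in> {c..d} \<Longrightarrow> Complex x y \<in> S \<and> cmod (g (Complex x y)) \<le> B"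
    and "0 \<le> B"
  shows "integral (cbox (a, c) (b, d)) (\<lambda>(x,y). (cmod (deriv g (Complex x y)))\<^sup>2) \<le> 4 * B\<^sup>2"
proof -
  define e :: "real^2 \<Rightarrow> complex" where "e = (\<lambda>v. Complex (v $ 1) (v $ 2))"
  define e' :: "complex \<Rightarrow> real^2" where "e' = (\<lambda>z. vector [Re z, Im z])"
  define Q where "Q = cbox (vector [a, c]) (vector [b, d] :: real^2)"
  define G where "G = (\<lambda>v. e' (g (e v)))"
  define G' where "G' = (\<lambda>v h. e' (deriv g (e v) * e h))"
  have e'_alt: "e' = (\<lambda>z. \<chi> i. if i = 1 then Re z else Im z)"
    by (auto simp: e'_def fun_eq_iff vec_eq_iff forall_2)
  have lin: "bounded_linear e" unfolding e_def
    by (rule linear_conv_bounded_linear[THEN iffD1], rule linearI) (auto simp: complex_eq_iff)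
  have lin': "bounded_linear e'" unfolding e'_def
    by (rule linear_conv_bounded_linear[THEN iffD1], rule linearI) (auto simp: vec_eq_iff forall_2)
  have QS: "e v \<in> S" "cmod (g (e v)) \<le> B" if "v \<in> Q" for v
    using that assms(4) by (auto simp: Q_def e_def mem_box_cart forall_2)
  have der: "(G has_derivative G' v) (at v within Q)" if "v \<in> Q" for v
  proof -
    have "(g has_derivative (\<lambda>h. deriv g (e v) * h)) (at (e v))"
      using holomorphic_derivI[OF holg S QS(1)[OF that], of UNIV] by (simp add: has_field_derivative_def)
    from has_derivative_compose[OF bounded_linear_imp_has_derivative[OF lin, of "at v within Q"] this]
    show ?thesis unfolding G_def G'_def by (rule bounded_linear.has_derivative[OF lin'])
  qed
  have injG: "inj_on G Q"
  proof (rule inj_onI)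
    fix u v assume uv: "u \<in> Q" "v \<in> Q" "G u = G v"
    then have "g (e u) = g (e v)" by (simp add: G_def e'_def vec_eq_iff forall_2 complex_eq_iff)
    then have "e u = e v" using inj QS(1) uv by (meson inj_onD)
    then show "u = v" by (simp add: e_def vec_eq_iff forall_2)
  qed
  have det: "\<bar>det (matrix (G' v))\<bar> = (cmod (deriv g (e v)))\<^sup>2" for v
    by (simp add: det_2 matrix_def G'_def e_def e'_def axis_def cmod_power2 flip: power2_eq_square)
  have contd: "continuous_on S (deriv g)"
    using holomorphic_deriv[OF holg S] holomorphic_on_imp_continuous_on by blast
  have cont: "continuous_on Q (\<lambda>v. (cmod (deriv g (e v)))\<^sup>2)"
    by (intro continuous_intros continuous_on_compose2[OF contd]
         linear_continuous_on[OF lin]) (use QS in auto)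
  then have int: "(\<lambda>v. \<bar>det (matrix (G' v))\<bar>) integrable_on Q"
    unfolding det Q_def by (rule integrable_continuous)
  have Qm: "Q \<in> sets lebesgue" by (simp add: Q_def)
  have "integral Q (\<lambda>v. \<bar>det (matrix (G' v))\<bar>) = measure lebesgue (G ` Q)"
    by (rule measure_differentiable_image_eq[OF Qm der injG int, symmetric])
  also have "\<dots> \<le> measure lebesgue (cbox (vector [-B, -B]) (vector [B, B] :: real^2))"
  proof (rule measure_mono_fmeasurable)
    have "e' z \<in> cbox (vector [-B, -B]) (vector [B, B])" if "cmod z \<le> B" for z
      using that abs_Re_le_cmod[of z] abs_Im_le_cmod[of z]
      by (simp add: e'_def mem_box_cart forall_2) linarith
    then show "G ` Q \<subseteq> cbox (vector [-B, -B]) (vector [B, B])"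
      using QS(2) by (auto simp: G_def)
    show "G ` Q \<in> sets lebesgue"
      using measurable_differentiable_image_eq[OF Qm der injG] int by blast
  qed simp
  also have "\<dots> = 4 * B\<^sup>2"
    using \<open>0 \<le> B\<close> by (simp add: content_cbox_cart interval_eq_empty_cart exists_2 UNIV_2 power2_eq_square)
  finally have le: "integral Q (\<lambda>v. (cmod (deriv g (e v)))\<^sup>2) \<le> 4 * B\<^sup>2" by (simp add: det)
  have "((\<lambda>v. (cmod (deriv g (e v)))\<^sup>2) has_integral integral Q (\<lambda>v. (cmod (deriv g (e v)))\<^sup>2)) Q"
    using int by (simp add: det integrable_integral)
  from has_integral_cart2_imp_pair[OF this[unfolded Q_def]] le show ?thesis
    by (simp add: e_def Q_def integral_unique)
qed

text \<open>The arithmetic-geometric mean inequality \<open>2 x \<le> k + x\<^sup>2 / k\<close> replaces Cauchy-Schwarz here: it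
  reduces the integral of \<open>\<bar>g'\<bar>\<close> to the area bound, and the caller picks the best \<open>k\<close>.\<close>

lemma integral_norm_deriv_rectangle_le:
  fixes g :: "complex \<Rightarrow> complex"
  assumes S: "open S" and holg: "g holomorphic_on S" and inj: "inj_on g S"
    and Q: "\<And>x y. x \<in> {a..b} \<Longrightarrow> y \<in> {c..d} \<Longrightarrow> Complex x y \<in> S \<and> cmod (g (Complex x y)) \<le> B"
    and "0 \<le> B" "0 < k" "a \<le> b" "c \<le> d"
  shows "integral (cbox (a, c) (b, d)) (\<lambda>(x,y). cmod (deriv g (Complex x y)))
           \<le> (k * ((b - a) * (d - c)) + 4 * B\<^sup>2 / k) / 2"
    and "continuous_on (cbox (a, c) (b, d)) (\<lambda>(x,y). cmod (deriv g (Complex x y)))"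
proof -
  let ?f = "\<lambda>(x,y). cmod (deriv g (Complex x y))"
  have contd: "continuous_on S (deriv g)"
    using holomorphic_deriv[OF holg S] holomorphic_on_imp_continuous_on by blast
  show cont: "continuous_on (cbox (a, c) (b, d)) ?f"
    unfolding case_prod_beta'
    by (intro continuous_intros continuous_on_compose2[OF contd])
       (use Q in \<open>auto simp: cbox_Pair_eq\<close>)
  have cont2: "continuous_on (cbox (a, c) (b, d)) (\<lambda>p. (?f p)\<^sup>2)"
    by (intro continuous_intros cont)
  have "integral (cbox (a, c) (b, d)) ?f
      \<le> integral (cbox (a, c) (b, d)) (\<lambda>p. k / 2 + (1 / (2 * k)) * (?f p)\<^sup>2)"
  proof (rule integral_le)
    show "(\<lambda>p. k / 2 + (1 / (2 * k)) * (?f p)\<^sup>2) integrable_on cbox (a, c) (b, d)"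
      by (intro integrable_continuous continuous_intros cont2)
    show "?f p \<le> k / 2 + (1 / (2 * k)) * (?f p)\<^sup>2" for p
    proof -
      have "0 \<le> (?f p - k)\<^sup>2" by simp
      then show ?thesis using \<open>0 < k\<close> by (simp add: power2_eq_square field_simps)
    qed
  qed (intro integrable_continuous cont)
  also have "\<dots> = k / 2 * ((b - a) * (d - c)) + (1 / (2 * k)) * integral (cbox (a, c) (b, d)) (\<lambda>p. (?f p)\<^sup>2)"
  proof -
    have "integral (cbox (a, c) (b, d)) (\<lambda>p. k / 2 + (1 / (2 * k)) * (?f p)\<^sup>2)
       = integral (cbox (a, c) (b, d)) (\<lambda>p. k / 2) + integral (cbox (a, c) (b, d)) (\<lambda>p. (1 / (2 * k)) * (?f p)\<^sup>2)"
      by (intro Henstock_Kurzweil_Integration.integral_add integrable_continuous continuous_intros cont2)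
    then show ?thesis using assms(7,8) by (simp add: content_Pair)
  qed
  also have "\<dots> \<le> k / 2 * ((b - a) * (d - c)) + (1 / (2 * k)) * (4 * B\<^sup>2)"
    using area_of_rectangle_image_le[OF S holg inj Q \<open>0 \<le> B\<close>] \<open>0 < k\<close>
    by (intro add_left_mono mult_left_mono) (auto simp: case_prod_beta')
  finally show "integral (cbox (a, c) (b, d)) ?f \<le> (k * ((b - a) * (d - c)) + 4 * B\<^sup>2 / k) / 2"
    by (simp add: field_simps)
qed

text \<open>The length-area principle: the lengths of the images of the vertical segments over
  \<open>{X..X+L}\<close> integrate to at most a multiple of \<open>sqrt L\<close>, so one of them is
  \<open>O(1 / sqrt L)\<close>.\<close>

lemma exists_short_crosscut_strip:
  fixes g :: "complex \<Rightarrow> complex"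
  assumes holg: "g holomorphic_on {z. 0 < Im z \<and> Im z < pi}"
    and inj: "inj_on g {z. 0 < Im z \<and> Im z < pi}"
    and bd: "\<And>z. 0 < Im z \<Longrightarrow> Im z < pi \<Longrightarrow> cmod (g z) \<le> B" and "0 < L"
  shows "\<exists>x\<in>{X..X+L}. \<forall>y\<in>{0<..<pi}. \<forall>y'\<in>{0<..<pi}.
           cmod (g (Complex x y) - g (Complex x y')) \<le> (pi / 2 + 2 * B\<^sup>2) / sqrt L"
proof -
  define S where "S = {z. 0 < Im z \<and> Im z < pi}"
  define l where "l = (pi / 2 + 2 * B\<^sup>2) / sqrt L"
  have S: "open S" unfolding S_def Collect_conj_eq
    by (intro open_Int open_halfspace_Im_gt open_halfspace_Im_lt)
  have "0 \<le> B" using order_trans[OF norm_ge_zero bd[of \<i>]] pi_gt3 by simp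
  have contg: "continuous_on S g" using holg holomorphic_on_imp_continuous_on S_def by blast
  \<comment> \<open>Area bounds need a closed rectangle inside the open strip, so the segments are first shortened
    by \<open>\<delta>\<close> at both ends. The sets \<open>E k\<close> below are the solutions for \<open>\<delta> = 1 / (k + 2)\<close>;
    they are compact and nested, and a common point serves all \<open>\<delta>\<close> at once.\<close>
  have step: "\<exists>x\<in>{X..X+L}. \<forall>y\<in>{\<delta>..pi-\<delta>}. \<forall>y'\<in>{\<delta>..pi-\<delta>}. cmod (g (Complex x y) - g (Complex x y')) \<le> l"
    if \<delta>: "0 < \<delta>" "\<delta> < pi / 2" for \<delta>
  proof (rule ccontr)
    assume contra: "\<not> ?thesis"
    let ?f = "\<lambda>x y. cmod (deriv g (Complex x y))"
    have Q: "Complex x y \<in> S \<and> cmod (g (Complex x y)) \<le> B" if "x \<in> {X..X+L}" "y \<in> {\<delta>..pi-\<delta>}" for x y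
      using that \<delta> bd[of "Complex x y"] by (simp add: S_def)
    have cd: "\<delta> \<le> pi - \<delta>" "X \<le> X + L" using \<delta> \<open>0 < L\<close> by auto
    note R = integral_norm_deriv_rectangle_le[OF S holg[folded S_def] inj[folded S_def] Q \<open>0 \<le> B\<close> _ cd(2) cd(1), of "1 / sqrt L"]
    have gt: "l < integral {\<delta>..pi-\<delta>} (?f x)" if x: "x \<in> {X..X+L}" for x
    proof -
      obtain y y' where y: "y \<in> {\<delta>..pi-\<delta>}" "y' \<in> {\<delta>..pi-\<delta>}" and big: "l < cmod (g (Complex x y) - g (Complex x y'))"
      proof -
        have "\<not> (\<forall>y\<in>{\<delta>..pi-\<delta>}. \<forall>y'\<in>{\<delta>..pi-\<delta>}. cmod (g (Complex x y) - g (Complex x y')) \<le> l)"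
          using contra x by blast
        then show thesis using that by (auto simp: not_le simp del: atLeastAtMost_iff)
      qed
      have *: "cmod (g (Complex x y) - g (Complex x y')) \<le> integral {\<delta>..pi-\<delta>} (?f x)"
        if y: "y \<in> {\<delta>..pi-\<delta>}" "y' \<in> {\<delta>..pi-\<delta>}" "y' \<le> y" for y y'
      proof -
        have der: "((\<lambda>y. g (Complex x y)) has_vector_derivative deriv g (Complex x u) * \<i>) (at u within {y'..y})"
          if "u \<in> {y'..y}" for u
        proof -
          have 1: "((\<lambda>u. Complex x u) has_vector_derivative \<i>) (at u within {y'..y})"
          proof -
            have "((\<lambda>u. of_real x + of_real u * \<i>) has_vector_derivative \<i>) (at u within {y'..y})"
              by (auto intro!: derivative_eq_intros)
            moreover have "Complex x = (\<lambda>u. of_real x + of_real u * \<i>)" by (simp add: fun_eq_iff complex_eq_iff)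
            ultimately show ?thesis by simp
          qed
          have "(g has_field_derivative deriv g (Complex x u)) (at (Complex x u))"
            by (rule holomorphic_derivI[OF holg[folded S_def] S]) (use Q x y that in auto)
          from field_vector_diff_chain_within[OF 1 has_field_derivative_at_within[OF this]]
          show ?thesis by (simp add: o_def mult.commute)
        qed
        have I: "((\<lambda>u. deriv g (Complex x u) * \<i>) has_integral (g (Complex x y) - g (Complex x y'))) {y'..y}"
          by (rule fundamental_theorem_of_calculus[OF y(3) der])
        have contf: "continuous_on {\<delta>..pi-\<delta>} (?f x)"
        proof -
          have "continuous_on {\<delta>..pi-\<delta>} (\<lambda>y. (\<lambda>(x,y). ?f x y) (x, y))"
            by (rule continuous_on_compose2[OF R(2)])
               (use x \<open>0 < L\<close> in \<open>auto simp: cbox_Pair_eq intro!: continuous_intros\<close>)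
          then show ?thesis by simp
        qed
        have int: "?f x integrable_on {y'..y}"
          by (rule integrable_continuous_real, rule continuous_on_subset[OF contf]) (use y in auto)
        have "cmod (g (Complex x y) - g (Complex x y')) \<le> integral {y'..y} (?f x)"
          unfolding integral_unique[OF I, symmetric]
          by (rule integral_norm_bound_integral[OF has_integral_integrable[OF I] int]) (simp add: norm_mult)
        also have "\<dots> \<le> integral {\<delta>..pi-\<delta>} (?f x)"
          by (rule integral_subset_le) (use y int contf in \<open>auto intro: integrable_continuous_real\<close>)
        finally show ?thesis .
      qed
      show ?thesis using *[of y y'] *[of y' y] y big by (cases "y' \<le> y") (auto simp: norm_minus_commute)
    qed
    have contI: "continuous_on {X..X+L} (\<lambda>x. integral {\<delta>..pi-\<delta>} (?f x))"
      using integral_continuous_on_param[of "{X..X+L}" \<delta> "pi-\<delta>" ?f] R(2) \<open>0 < L\<close> by (simp add: cbox_Pair_eq)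
    obtain x0 where x0: "x0 \<in> {X..X+L}" "\<And>x. x \<in> {X..X+L} \<Longrightarrow> integral {\<delta>..pi-\<delta>} (?f x0) \<le> integral {\<delta>..pi-\<delta>} (?f x)"
      using continuous_attains_inf[OF _ _ contI] \<open>0 < L\<close> by auto
    have "l * L < integral {\<delta>..pi-\<delta>} (?f x0) * L" using gt[OF x0(1)] \<open>0 < L\<close> by simp
    also have "\<dots> = integral {X..X+L} (\<lambda>x. integral {\<delta>..pi-\<delta>} (?f x0))" using \<open>0 < L\<close> by simp
    also have "\<dots> \<le> integral {X..X+L} (\<lambda>x. integral {\<delta>..pi-\<delta>} (?f x))"
      by (rule integral_le) (use x0 in \<open>auto intro: integrable_continuous_real contI\<close>)
    also have "\<dots> = integral (cbox (X, \<delta>) (X+L, pi-\<delta>)) (\<lambda>(x,y). ?f x y)"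
      using integral_prod_continuous[OF R(2)] \<open>0 < L\<close> by simp
    also have "\<dots> \<le> (1 / sqrt L * (L * (pi - 2 * \<delta>)) + 4 * B\<^sup>2 / (1 / sqrt L)) / 2"
      using R(1) \<open>0 < L\<close> by simp
    also have "\<dots> \<le> (1 / sqrt L * (L * pi) + 4 * B\<^sup>2 / (1 / sqrt L)) / 2"
      using \<delta> \<open>0 < L\<close> by (intro divide_right_mono add_right_mono mult_left_mono) auto
    also have "\<dots> = l * L" 
      using \<open>0 < L\<close> real_sqrt_mult_self[of L] by (simp add: l_def field_simps)
    finally show False by simp
  qed
  define E where "E k = {x\<in>{X..X+L}. \<forall>y\<in>{1/real (k+2)..pi-1/real (k+2)}. \<forall>y'\<in>{1/real (k+2)..pi-1/real (k+2)}. cmod (g (Complex x y) - g (Complex x y')) \<le> l}" for k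
  have kp: "0 < 1 / real (k+2)" "1/real (k+2) < pi / 2" for k
  proof -
    have "1 / real (k+2) \<le> 1 / 2" by (simp add: field_simps)
    then show "1/real (k+2) < pi / 2" using pi_gt3 by linarith
  qed simp
  have cl: "compact (E k)" for k
  proof -
    have "closed ({x\<in>{X..X+L}. cmod (g (Complex x y) - g (Complex x y')) \<le> l})"
      if "y\<in>{1/real (k+2)..pi-1/real (k+2)}" "y'\<in>{1/real (k+2)..pi-1/real (k+2)}" for y y'
    proof -
      have "0 < y" "y < pi" "0 < y'" "y' < pi"
        using that kp(1)[of k] unfolding atLeastAtMost_iff by linarith+
      then have "continuous_on {X..X+L} (\<lambda>x. cmod (g (Complex x y) - g (Complex x y')))"
        by (intro continuous_intros continuous_on_compose2[OF contg]) (auto simp: S_def)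
      then show ?thesis
        by (intro continuous_closed_preimage[of _ _ "{..l}", simplified vimage_def Int_def, simplified]) auto
    qed
    then have "closed (\<Inter>y\<in>{1/real (k+2)..pi-1/real (k+2)}. \<Inter>y'\<in>{1/real (k+2)..pi-1/real (k+2)}. {x\<in>{X..X+L}. cmod (g (Complex x y) - g (Complex x y')) \<le> l})"
      by (intro closed_INT) auto
    moreover have "E k = {X..X+L} \<inter> (\<Inter>y\<in>{1/real (k+2)..pi-1/real (k+2)}. \<Inter>y'\<in>{1/real (k+2)..pi-1/real (k+2)}. {x\<in>{X..X+L}. cmod (g (Complex x y) - g (Complex x y')) \<le> l})"
      unfolding E_def by auto
    ultimately show ?thesis by (simp add: compact_Int_closed)
  qed
  have ne: "E k \<noteq> {}" for k using step[OF kp[of k]] unfolding E_def by blast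
  have mono: "E n \<subseteq> E m" if "m \<le> n" for m n
  proof -
    have "1 / real (n+2) \<le> 1 / real (m+2)" using that by (simp add: field_simps)
    then show ?thesis unfolding E_def by auto
  qed
  have "\<Inter>(range E) \<noteq> {}" by (rule compact_nest[OF cl ne mono])
  then obtain x where x: "\<And>k. x \<in> E k" by auto
  show ?thesis
  proof (intro bexI ballI)
    show "x \<in> {X..X+L}" using x[of 0] by (simp add: E_def)
    fix y y' assume y: "y \<in> {0<..<pi}" "y' \<in> {0<..<pi}"
    define m where "m = min (min y (pi - y)) (min y' (pi - y'))"
    have "0 < m" using y by (auto simp: m_def)
    then obtain k where k: "inverse (real (Suc k)) < m" using reals_Archimedean by blast
    have "1 / real (k+2) \<le> inverse (real (Suc k))" by (simp add: field_simps)
    with k have "1 / real (k+2) < m" by linarith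
    then have "y \<in> {1/real (k+2)..pi-1/real (k+2)}" "y' \<in> {1/real (k+2)..pi-1/real (k+2)}"
      by (auto simp: m_def)
    then show "cmod (g (Complex x y) - g (Complex x y')) \<le> (pi / 2 + 2 * B\<^sup>2) / sqrt L"
      using x[of k] unfolding E_def l_def by blast
  qed
qed

section \<open>Univalent functions of the disk as maps into the sphere\<close>

lemma limitin_riemann_sphere_Some:
  "limitin riemann_sphere (\<lambda>x. Some (f x)) (Some a) F \<longleftrightarrow> (f \<longlongrightarrow> a) F"
proof
  assume L: "limitin riemann_sphere (\<lambda>x. Some (f x)) (Some a) F"
  show "(f \<longlongrightarrow> a) F"
  proof (rule topological_tendstoI)
    fix S :: "complex set" assume "open S" "a \<in> S"
    then have "openin riemann_sphere (Some ` S)" "Some a \<in> Some ` S" by (auto simp: riemann_sphere_def)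
    with L have "\<forall>\<^sub>F x in F. Some (f x) \<in> Some ` S" unfolding limitin_def by blast
    then show "\<forall>\<^sub>F x in F. f x \<in> S" by eventually_elim auto
  qed
next
  assume L: "(f \<longlongrightarrow> a) F"
  show "limitin riemann_sphere (\<lambda>x. Some (f x)) (Some a) F"
    unfolding limitin_def
  proof (intro conjI allI impI)
    show "Some a \<in> topspace riemann_sphere" by (simp add: riemann_sphere_def)
    fix U assume U: "openin riemann_sphere U \<and> Some a \<in> U"
    then have "open (Some -` U)"
      using openin_continuous_map_preimage[OF continuous_map_Some, of euclidean U]
      by (simp add: riemann_sphere_def vimage_def)
    then have "\<forall>\<^sub>F x in F. f x \<in> Some -` U"
      using L U unfolding tendsto_def by auto
    then show "\<forall>\<^sub>F x in F. Some (f x) \<in> U" by simp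
  qed
qed

lemma limitin_riemann_sphere_None:
  fixes f :: "'a \<Rightarrow> complex"
  shows "limitin riemann_sphere (\<lambda>x. Some (f x)) None F \<longleftrightarrow> filterlim f at_infinity F"
proof
  assume L: "limitin riemann_sphere (\<lambda>x. Some (f x)) None F"
  show "filterlim f at_infinity F"
  proof (subst filterlim_at_infinity[of 0], simp, intro allI impI)
    fix r :: real
    have "openin riemann_sphere (insert None (Some ` (UNIV - cball 0 r)))"
      unfolding riemann_sphere_def openin_Alexandroff_compactification
      by (intro disjI2 exI[of _ "cball 0 r"]) auto
    with L have "\<forall>\<^sub>F x in F. Some (f x) \<in> insert None (Some ` (UNIV - cball 0 r))" unfolding limitin_def by blast
    then show "\<forall>\<^sub>F x in F. r \<le> norm (f x)" by eventually_elim auto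
  qed
next
  assume L: "filterlim f at_infinity F"
  show "limitin riemann_sphere (\<lambda>x. Some (f x)) None F"
    unfolding limitin_def
  proof (intro conjI allI impI)
    show "None \<in> topspace riemann_sphere" by (simp add: riemann_sphere_def)
    fix U assume "openin riemann_sphere U \<and> None \<in> U"
    then obtain C where C: "compact C" "U = insert None (Some ` (UNIV - C))"
      unfolding riemann_sphere_def openin_Alexandroff_compactification by auto
    from compact_imp_bounded[OF C(1)] obtain B where B: "\<And>x. x \<in> C \<Longrightarrow> norm x \<le> B" unfolding bounded_iff by blast
    have "\<forall>\<^sub>F x in F. norm (f x) \<ge> \<bar>B\<bar> + 1" using L filterlim_at_infinity[of 0 f F] by simp
    then show "\<forall>\<^sub>F x in F. Some (f x) \<in> U"
    proof eventually_elim
      case (elim x) then show ?case using B[of "f x"] unfolding C(2) by auto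
    qed
  qed
qed

lemma univalent_disk_not_surj:
  assumes "F holomorphic_on ball 0 1" "inj_on F (ball 0 1)"
  shows "\<exists>a. a \<notin> F ` ball 0 1"
proof (rule ccontr)
  assume "\<not> ?thesis"
  then have im: "F ` ball 0 1 = UNIV" by auto
  obtain g where g: "g holomorphic_on F ` ball 0 1" "\<And>z. z \<in> ball 0 1 \<Longrightarrow> g (F z) = z"
    using holomorphic_has_inverse[OF assms(1) open_ball assms(2)] by metis
  have "bounded (range g)" unfolding im[symmetric] bounded_iff
    using g(2) by (intro exI[of _ 1]) auto
  then obtain c where c: "\<And>w. g w = c"
    using Liouville_theorem[of g] g(1) im by (metis UNIV_I constant_on_def)
  show False using c g(2)[of 0] g(2)[of "1/2"] by (simp add: norm_divide)
qed

text \<open>Koebe's square root device: if \<open>F\<close> omits \<open>\<alpha>\<close> and \<open>q\<^sup>2 = F - \<alpha>\<close>, then \<open>q\<close> never takes both \<open>w\<close> and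
  \<open>- w\<close>. As \<open>q\<close> covers a neighbourhood of \<open>q 0\<close>, it stays away from \<open>- q 0\<close>, and
  \<open>b = 1 / (q + q 0)\<close> is bounded. So every univalent \<open>F\<close> is a fixed rational function of
  a bounded univalent one.\<close>

lemma univalent_disk_bounded_model:
  assumes F: "F holomorphic_on ball 0 1" "inj_on F (ball 0 1)"
  obtains b \<alpha> s B where "b holomorphic_on ball 0 1" "inj_on b (ball 0 1)" "0 < B"
    "\<And>z. z \<in> ball 0 1 \<Longrightarrow> b z \<noteq> 0 \<and> cmod (b z) \<le> B \<and> F z = \<alpha> + (1 / b z - s)\<^sup>2"
proof -
  obtain \<alpha> where \<alpha>: "\<alpha> \<notin> F ` ball 0 1" using univalent_disk_not_surj[OF F] by blast
  have "(\<lambda>z. F z - \<alpha>) holomorphic_on ball 0 1" by (intro holomorphic_intros F)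
  then obtain q where q: "q holomorphic_on ball 0 1" "\<And>z. z \<in> ball 0 1 \<Longrightarrow> F z - \<alpha> = (q z)\<^sup>2"
  proof (rule contractible_imp_holomorphic_sqrt[OF _ convex_imp_contractible[OF convex_ball]])
    show "F z - \<alpha> \<noteq> 0" if "z \<in> ball 0 1" for z using \<alpha> that by auto
  qed blast
  have q0: "q z \<noteq> 0" if "z \<in> ball 0 1" for z using q(2)[OF that] \<alpha> that by force
  have qinj: "inj_on q (ball 0 1)"
    using F(2) q(2) unfolding inj_on_def by (metis diff_add_cancel)
  have "open (q ` ball 0 1)"
    by (rule open_mapping_thm3[OF q(1) open_ball qinj])
  then obtain r where r: "r > 0" "ball (q 0) r \<subseteq> q ` ball 0 1"
    using open_contains_ball_eq[of "q ` ball 0 1" "q 0"] by auto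
  have low: "r \<le> cmod (q z + q 0)" if z: "z \<in> ball 0 1" for z
  proof (rule ccontr)
    assume "\<not> ?thesis"
    then have "- q z \<in> ball (q 0) r" by (simp add: dist_norm add.commute)
    then obtain z' where z': "z' \<in> ball 0 1" "- q z = q z'" using r(2) by blast
    then have "F z' = F z" using q(2)[OF z'(1)] q(2)[OF z] by (metis diff_add_cancel power2_minus)
    then have "z' = z" using F(2) z z'(1) by (meson inj_onD)
    then show False using z'(2) q0[OF z] by simp
  qed
  show thesis
  proof (rule that[of "\<lambda>z. 1 / (q z + q 0)" "1 / r" \<alpha> "q 0"])
    show "(\<lambda>z. 1 / (q z + q 0)) holomorphic_on ball 0 1"
      using low r(1) by (intro holomorphic_intros q) force
    show "inj_on (\<lambda>z. 1 / (q z + q 0)) (ball 0 1)"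
    proof (rule inj_onI)
      fix x y assume xy: "x \<in> ball 0 1" "y \<in> ball 0 1" "1 / (q x + q 0) = 1 / (q y + q 0)"
      moreover have "q x + q 0 \<noteq> 0" "q y + q 0 \<noteq> 0" using low[OF xy(1)] low[OF xy(2)] r(1) by auto
      ultimately have "q x = q y" by (simp add: divide_simps)
      then show "x = y" using qinj xy by (meson inj_onD)
    qed
    show "0 < 1 / r" using r by simp
    fix z :: complex assume z: "z \<in> ball 0 1"
    have "q z + q 0 \<noteq> 0" using low[OF z] r(1) by force
    moreover have "cmod (1 / (q z + q 0)) \<le> 1 / r"
      using low[OF z] r(1) by (simp add: norm_divide frac_le)
    ultimately show "1 / (q z + q 0) \<noteq> 0 \<and> cmod (1 / (q z + q 0)) \<le> 1 / r \<and>
       F z = \<alpha> + (1 / (1 / (q z + q 0)) - q 0)\<^sup>2"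
      using q(2)[OF z] by (simp add: algebra_simps)
  qed
qed

text \<open>The rational function \<open>\<alpha> + (1 / w - s)\<^sup>2\<close> of the bounded model is a smooth map into the sphere, also at
  its pole \<open>0\<close>. Written as \<open>N w / w\<^sup>2\<close>, its numerator and denominator have no common zero, so
  \<open>\<bar>w\<bar>^4 + \<bar>N w\<bar>\<^sup>2\<close> has a positive minimum on the closed disk of radius \<open>B\<close>.\<close>

lemma chordal_dist_Lipschitz:
  assumes "0 < B"
  obtains C where "0 \<le> C" "\<And>w w'. w \<noteq> 0 \<Longrightarrow> w' \<noteq> 0 \<Longrightarrow> cmod w \<le> B \<Longrightarrow> cmod w' \<le> B \<Longrightarrow>
      chordal_dist (\<alpha> + (1 / w - s)\<^sup>2) (\<alpha> + (1 / w' - s)\<^sup>2) \<le> C * cmod (w - w')"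
proof -
  define N where "N w = (1 - s * w)\<^sup>2 + \<alpha> * w\<^sup>2" for w
  define f where "f w = (cmod w)^4 + (cmod (N w))\<^sup>2" for w
  have "continuous_on (cball 0 B) f" unfolding f_def N_def by (intro continuous_intros)
  then obtain w0 where w0: "w0 \<in> cball 0 B" "\<And>w. w \<in> cball 0 B \<Longrightarrow> f w0 \<le> f w"
    using continuous_attains_inf[of "cball 0 B" f] assms by (metis cball_eq_empty compact_cball less_le_not_le not_less)
  define m where "m = f w0"
  have m: "m > 0"
  proof (cases "w0 = 0")
    case True then show ?thesis by (simp add: m_def f_def N_def)
  next
    case False then show ?thesis by (simp add: m_def f_def add_pos_nonneg)
  qed
  have R: "\<alpha> + (1 / w - s)\<^sup>2 = N w / w\<^sup>2" if "w \<noteq> 0" for w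
    using that by (simp add: N_def field_simps power2_eq_square)
  have sq: "sqrt m / (cmod w)\<^sup>2 \<le> sqrt (1 + (cmod (N w / w\<^sup>2))\<^sup>2)" if w: "w \<noteq> 0" "cmod w \<le> B" for w
  proof -
    have "m / (cmod w)^4 \<le> f w / (cmod w)^4" using w0(2)[of w] w by (simp add: m_def divide_right_mono)
    also have "\<dots> = 1 + (cmod (N w / w\<^sup>2))\<^sup>2"
      using w by (simp add: f_def norm_divide norm_power field_simps)
    finally have "sqrt (m / (cmod w)^4) \<le> sqrt (1 + (cmod (N w / w\<^sup>2))\<^sup>2)" by simp
    moreover have "sqrt ((cmod w)^4) = (cmod w)\<^sup>2"
      by (rule real_sqrt_unique) auto
    ultimately show ?thesis by (simp add: real_sqrt_divide)
  qed
  show thesis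
  proof (rule that[of "2 * (2 * B + 2 * cmod s * B\<^sup>2) / m"])
    show "0 \<le> 2 * (2 * B + 2 * cmod s * B\<^sup>2) / m" using m assms by simp
    fix w w' :: complex assume w: "w \<noteq> 0" "w' \<noteq> 0" "cmod w \<le> B" "cmod w' \<le> B"
    define u u' where "u = cmod w" "u' = cmod w'"
    have u: "0 < u" "0 < u'" "u \<le> B" "u' \<le> B" using w by (auto simp: u_u'_def)
    let ?D = "cmod (N w / w\<^sup>2 - N w' / w'\<^sup>2)"
    have "chordal_dist (\<alpha> + (1 / w - s)\<^sup>2) (\<alpha> + (1 / w' - s)\<^sup>2)
       \<le> 2 * ?D / ((sqrt m / u\<^sup>2) * (sqrt m / u'\<^sup>2))"
      unfolding chordal_dist_def R[OF w(1)] R[OF w(2)] u_u'_def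
      using sq[OF w(1,3)] sq[OF w(2,4)] m w by (intro divide_left_mono mult_mono mult_pos_pos) (auto simp: add_pos_nonneg)
    also have "\<dots> = 2 * (?D * u\<^sup>2 * u'\<^sup>2) / m" using m by (simp add: real_sqrt_mult_self)
    also have "?D * u\<^sup>2 * u'\<^sup>2 = cmod ((w' - w) * ((w + w') - 2 * s * (w * w')))"
    proof -
      have "(N w / w\<^sup>2 - N w' / w'\<^sup>2) * w\<^sup>2 * w'\<^sup>2 = N w * w'\<^sup>2 - N w' * w\<^sup>2"
        using w by (simp add: field_simps)
      also have "\<dots> = (w' - w) * ((w + w') - 2 * s * (w * w'))"
        by (simp add: N_def power2_eq_square algebra_simps)
      finally show ?thesis unfolding u_u'_def by (metis norm_mult norm_power)
    qed
    also have "\<dots> \<le> cmod (w - w') * (2 * B + 2 * cmod s * B\<^sup>2)"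
    proof -
      have "cmod ((w + w') - 2 * s * (w * w')) \<le> cmod (w + w') + cmod (2 * s * (w * w'))" by (rule norm_triangle_ineq4)
      also have "\<dots> \<le> (u + u') + 2 * cmod s * (u * u')"
        using norm_triangle_ineq[of w w'] by (simp add: u_u'_def norm_mult)
      also have "\<dots> \<le> (B + B) + 2 * cmod s * (B * B)"
        using u by (intro add_mono mult_left_mono mult_mono) auto
      finally show ?thesis
        by (simp add: norm_mult norm_minus_commute power2_eq_square mult_left_mono)
    qed
    finally show "chordal_dist (\<alpha> + (1 / w - s)\<^sup>2) (\<alpha> + (1 / w' - s)\<^sup>2)
         \<le> 2 * (2 * B + 2 * cmod s * B\<^sup>2) / m * cmod (w - w')"
      using m by (simp add: divide_right_mono field_simps)
  qed
qed

lemma limit_not_in_image: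
  assumes F: "F holomorphic_on ball 0 1" "inj_on F (ball 0 1)"
    and E: "\<forall>\<^sub>F x in net. E x \<in> ball 0 1" "((\<lambda>x. cmod (E x)) \<longlongrightarrow> 1) net" "net \<noteq> bot"
    and lim: "((\<lambda>x. F (E x)) \<longlongrightarrow> a) net"
  shows "a \<notin> F ` ball 0 1"
proof
  assume a: "a \<in> F ` ball 0 1"
  obtain g where g: "g holomorphic_on F ` ball 0 1" "\<And>z. z \<in> ball 0 1 \<Longrightarrow> g (F z) = z"
    using holomorphic_has_inverse[OF F(1) open_ball F(2)] by metis
  have "open (F ` ball 0 1)" by (rule open_mapping_thm3[OF F(1) open_ball F(2)])
  then have "isCont g a"
    using holomorphic_on_imp_continuous_on[OF g(1)] a continuous_on_eq_continuous_at by blast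
  from isCont_tendsto_compose[OF this lim] have "((\<lambda>x. g (F (E x))) \<longlongrightarrow> g a) net" .
  moreover have "\<forall>\<^sub>F x in net. g (F (E x)) = E x" using E(1) by eventually_elim (rule g(2))
  ultimately have "(E \<longlongrightarrow> g a) net" using tendsto_cong by fast
  then have "cmod (g a) = 1" using tendsto_unique[OF E(3) tendsto_norm E(2)] by blast
  moreover have "g a \<in> ball 0 1" using a g(2) by auto
  ultimately show False by simp
qed

text \<open>If \<open>F\<close> has a limit \<open>A\<close> in the sphere along \<open>E\<close>, this is turned into a bounded zero-free function
  \<open>p\<close> that tends to \<open>0\<close> along \<open>E\<close>, and whose derivative is controlled by that of the bounded univalent \<open>b\<close>. For
  \<open>A = Some a\<close> one takes \<open>p = (F - a) b\<^sup>2\<close>, a quadratic polynomial in \<open>b\<close>, which has no zero because a limit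
  towards the circle is not a value of \<open>F\<close>; for \<open>A = None\<close> one takes \<open>p = b\<close>.\<close>

lemma vanishing_function_along_limit:
  assumes F: "F holomorphic_on ball 0 1" "inj_on F (ball 0 1)"
    and E: "\<forall>\<^sub>F x in net. E x \<in> ball 0 1" "((\<lambda>x. cmod (E x)) \<longlongrightarrow> 1) net" "net \<noteq> bot"
    and lim: "limitin riemann_sphere (\<lambda>x. Some (F (E x))) A net"
  obtains b B p C where "b holomorphic_on ball 0 1" "inj_on b (ball 0 1)" "0 < B"
    "\<And>z. z \<in> ball 0 1 \<Longrightarrow> cmod (b z) \<le> B"
    "p holomorphic_on ball 0 1" "0 < C" "\<And>z. z \<in> ball 0 1 \<Longrightarrow> p z \<noteq> 0"
    "\<And>z. z \<in> ball 0 1 \<Longrightarrow> cmod (p z) \<le> C"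
    "\<And>z. z \<in> ball 0 1 \<Longrightarrow> cmod (deriv p z) \<le> C * cmod (deriv b z)"
    "((\<lambda>x. p (E x)) \<longlongrightarrow> 0) net"
proof -
  obtain b \<alpha> s B where b: "b holomorphic_on ball 0 1" "inj_on b (ball 0 1)" "0 < B" and
    bF: "\<And>z. z \<in> ball 0 1 \<Longrightarrow> b z \<noteq> 0 \<and> cmod (b z) \<le> B \<and> F z = \<alpha> + (1 / b z - s)\<^sup>2"
    using univalent_disk_bounded_model[OF F] by metis
  show thesis
  proof (cases A)
    case (Some a)
    then have l: "((\<lambda>x. F (E x)) \<longlongrightarrow> a) net" using lim by (simp add: limitin_riemann_sphere_Some)
    have a: "a \<notin> F ` ball 0 1" by (rule limit_not_in_image[OF F E l])
    define p where "p z = (1 - s * b z)\<^sup>2 + (\<alpha> - a) * (b z)\<^sup>2" for z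
    have pF: "p z = (F z - a) * (b z)\<^sup>2" if "z \<in> ball 0 1" for z
    proof -
      have "(1 - s * b z) = (1 / b z - s) * b z" using bF[OF that] by (simp add: field_simps)
      then have p: "p z = ((1 / b z - s) * b z)\<^sup>2 + (\<alpha> - a) * (b z)\<^sup>2" unfolding p_def by (rule ssubst) (rule refl)
      also have "\<dots> = ((1 / b z - s)\<^sup>2 + (\<alpha> - a)) * (b z)\<^sup>2" by (simp only: power_mult_distrib distrib_right)
      also have "(1 / b z - s)\<^sup>2 + (\<alpha> - a) = F z - a" using bF[OF that] by simp
      finally show ?thesis .
    qed
    define C where "C = (1 + cmod s * B)\<^sup>2 + cmod (\<alpha> - a) * B\<^sup>2 + 2 * (1 + cmod s * B) * cmod s + 2 * cmod (\<alpha> - a) * B"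
    have "1 \<le> (1 + cmod s * B)\<^sup>2" using b(3) by (simp add: one_le_power)
    moreover have "0 \<le> cmod (\<alpha> - a) * B\<^sup>2 + 2 * (1 + cmod s * B) * cmod s + 2 * cmod (\<alpha> - a) * B"
      using b(3) by (intro add_nonneg_nonneg mult_nonneg_nonneg) auto
    ultimately have C: "0 < C" by (simp add: C_def)
    have sb: "cmod (1 - s * b z) \<le> 1 + cmod s * B" if "z \<in> ball 0 1" for z
    proof -
      have "cmod (1 - s * b z) \<le> 1 + cmod s * cmod (b z)"
        using norm_triangle_ineq4[of 1 "s * b z"] by (simp add: norm_mult)
      also have "\<dots> \<le> 1 + cmod s * B" using bF[OF that] by (simp add: mult_left_mono)
      finally show ?thesis .
    qed
    show thesis
    proof (rule that[OF b, of p C])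
      show "p holomorphic_on ball 0 1" unfolding p_def by (intro holomorphic_intros b)
      show "0 < C" by (rule C)
      show "cmod (b z) \<le> B" if "z \<in> ball 0 1" for z using bF[OF that] by blast
      show "p z \<noteq> 0" if "z \<in> ball 0 1" for z 
      proof
        assume "p z = 0"
        then have "F z = a" using bF[OF that] pF[OF that] by simp
        then show False using a that by blast
      qed
      show "cmod (p z) \<le> C" if z: "z \<in> ball 0 1" for z
      proof -
        have "cmod (p z) \<le> cmod (1 - s * b z)^2 + cmod (\<alpha> - a) * cmod (b z)^2"
          unfolding p_def by (rule order_trans[OF norm_triangle_ineq]) (simp add: norm_mult norm_power)
        also have "\<dots> \<le> (1 + cmod s * B)\<^sup>2 + cmod (\<alpha> - a) * B\<^sup>2"
          using sb[OF z] bF[OF z] by (intro add_mono mult_left_mono power_mono) auto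
        also have "\<dots> \<le> C" unfolding C_def using b(3) by (simp add: add.assoc)
        finally show ?thesis .
      qed
      show "cmod (deriv p z) \<le> C * cmod (deriv b z)" if z: "z \<in> ball 0 1" for z
      proof -
        have db: "(b has_field_derivative deriv b z) (at z)"
          by (rule holomorphic_derivI[OF b(1) open_ball z])
        have "(p has_field_derivative (2 * (1 - s * b z) * (- s) + 2 * (\<alpha> - a) * b z) * deriv b z) (at z)"
          unfolding p_def by (auto intro!: derivative_eq_intros db simp: algebra_simps)
        then have "deriv p z = (2 * (1 - s * b z) * (- s) + 2 * (\<alpha> - a) * b z) * deriv b z" by (rule DERIV_imp_deriv)
        moreover have "cmod (2 * (1 - s * b z) * (- s) + 2 * (\<alpha> - a) * b z) \<le> C"
        proof -
          have "cmod (2 * (1 - s * b z) * (- s) + 2 * (\<alpha> - a) * b z)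
            \<le> 2 * cmod (1 - s * b z) * cmod s + 2 * cmod (\<alpha> - a) * cmod (b z)"
            using norm_triangle_ineq[of "2 * (1 - s * b z) * (- s)" "2 * (\<alpha> - a) * b z"]
            by (simp only: norm_mult norm_minus_cancel norm_numeral)
          also have "\<dots> \<le> 2 * (1 + cmod s * B) * cmod s + 2 * cmod (\<alpha> - a) * B"
            using sb[OF z] bF[OF z] by (intro add_mono mult_left_mono mult_right_mono) auto
          also have "\<dots> \<le> C" unfolding C_def by simp
          finally show ?thesis .
        qed
        ultimately show ?thesis by (simp add: norm_mult mult_right_mono)
      qed
      show "((\<lambda>x. p (E x)) \<longlongrightarrow> 0) net"
      proof (rule Lim_null_comparison)
        show "\<forall>\<^sub>F x in net. norm (p (E x)) \<le> cmod (F (E x) - a) * B\<^sup>2"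
          using E(1) by eventually_elim (use bF pF in \<open>auto simp: norm_mult norm_power intro!: mult_left_mono power_mono\<close>)
        show "((\<lambda>x. cmod (F (E x) - a) * B\<^sup>2) \<longlongrightarrow> 0) net"
          using tendsto_mult[OF tendsto_norm[OF tendsto_diff[OF l tendsto_const[of a]]] tendsto_const[of "B\<^sup>2"]] by simp
      qed
    qed
  next
    case None
    then have l: "filterlim (\<lambda>x. F (E x)) at_infinity net" using lim by (simp add: limitin_riemann_sphere_None)
    have bE: "((\<lambda>x. b (E x)) \<longlongrightarrow> 0) net"
    proof (rule tendstoI)
      fix \<epsilon> :: real assume \<epsilon>: "0 < \<epsilon>"
      have "\<forall>\<^sub>F x in net. cmod (F (E x)) \<ge> cmod \<alpha> + (1 / \<epsilon> + cmod s)\<^sup>2 + 1"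
      proof -
        have "0 < cmod \<alpha> + (1 / \<epsilon> + cmod s)\<^sup>2 + 1" by (intro add_nonneg_pos add_nonneg_nonneg) auto
        then show ?thesis using l filterlim_at_infinity[of 0 "\<lambda>x. F (E x)" net] by blast
      qed
      then show "\<forall>\<^sub>F x in net. dist (b (E x)) 0 < \<epsilon>" using E(1)
      proof eventually_elim
        case (elim x)
        show ?case
        proof (rule ccontr)
          assume "\<not> ?thesis"
          then have "\<epsilon> \<le> cmod (b (E x))" by simp
          then have "cmod (1 / b (E x)) \<le> 1 / \<epsilon>" using \<epsilon> by (simp add: norm_divide frac_le)
          then have "cmod (1 / b (E x) - s) \<le> 1 / \<epsilon> + cmod s" using norm_triangle_ineq4[of "1 / b (E x)" s] by linarith
          then have "(cmod (1 / b (E x) - s))\<^sup>2 \<le> (1 / \<epsilon> + cmod s)\<^sup>2" by (rule power_mono) simp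
          then have "cmod (F (E x)) \<le> cmod \<alpha> + (1 / \<epsilon> + cmod s)\<^sup>2"
            using bF[OF elim(2)] norm_triangle_ineq[of \<alpha> "(1 / b (E x) - s)\<^sup>2"] by (simp add: norm_power)
          then show False using elim(1) by linarith
        qed
      qed
    qed
    show thesis
      by (rule that[OF b _ b(1), of "B + 1"]) (use bF b(3) bE in \<open>auto simp: add_increasing2 mult_le_cancel_right1\<close>)
  qed
qed

section \<open>Curves that oscillate while tending to the circle\<close>

text \<open>The mean value property for a function invariant under rotation by a right angle: the integral
  over a quarter of the circle of radius \<open>exp s\<close>, starting at any angle, already determines \<open>P 0\<close>. With \<open>K\<close>
  a primitive of \<open>(P z - P 0) / z\<close>, invariance of \<open>P\<close> makes \<open>K (\<i> z) - K z\<close> constant, hence \<open>0\<close>.\<close>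

lemma quarter_rotation_mean_value:
  assumes P: "P holomorphic_on ball 0 1" and inv: "\<And>z. z \<in> ball 0 1 \<Longrightarrow> P (\<i> * z) = P z"
    and s: "s < 0"
  shows "((\<lambda>\<theta>. P (exp (Complex s \<theta>))) has_integral of_real (pi / 2) * P 0) {\<theta>..\<theta> + pi / 2}"
proof -
  have hol: "(\<lambda>z. P z - P 0) holomorphic_on ball 0 1" by (intro holomorphic_intros P)
  obtain h where h: "h holomorphic_on ball 0 1" "\<And>z. cmod z < 1 \<Longrightarrow> P z - P 0 = z * h z"
    using Schwarz3[OF hol] by auto
  obtain K where K: "\<And>z. z \<in> ball 0 1 \<Longrightarrow> (K has_field_derivative h z) (at z)"
    using holomorphic_convex_primitive'[OF convex_ball open_ball h(1)] at_within_open[OF _ open_ball] by metis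
  define D where "D z = \<i> * h (\<i> * z) - h z" for z
  have Dz: "D z = 0" if z: "z \<in> ball 0 1" "z \<noteq> 0" for z
  proof -
    have "z * D z = (P (\<i> * z) - P 0) - (P z - P 0)"
      using h(2)[of "\<i> * z"] h(2)[of z] z by (simp add: D_def norm_mult algebra_simps)
    then show ?thesis using inv[OF z(1)] z by simp
  qed
  have "D 0 = 0"
  proof -
    have ic: "isCont h 0"
      using holomorphic_on_imp_continuous_on[OF h(1)] by (simp add: continuous_on_eq_continuous_at)
    have "((\<lambda>z. \<i> * h (\<i> * z) - h z) \<longlongrightarrow> \<i> * h (\<i> * 0) - h 0) (at 0)"
    proof (intro tendsto_intros)
      show "((\<lambda>z. h (\<i> * z)) \<longlongrightarrow> h (\<i> * 0)) (at 0)"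
      proof (rule isCont_tendsto_compose[where g = h])
        show "isCont h (\<i> * 0)" using ic by simp
        show "((\<lambda>z. \<i> * z) \<longlongrightarrow> \<i> * 0) (at 0)" by (intro tendsto_intros)
      qed
      show "(h \<longlongrightarrow> h 0) (at 0)" using ic by (simp add: isCont_def)
    qed
    moreover have "\<forall>\<^sub>F z in at 0. \<i> * h (\<i> * z) - h z = 0"
      using Dz by (auto simp: eventually_at dist_norm D_def intro!: exI[of _ 1])
    ultimately have "((\<lambda>z::complex. 0) \<longlongrightarrow> \<i> * h (\<i> * 0) - h 0) (at 0)"
      using tendsto_cong[of "\<lambda>z. \<i> * h (\<i> * z) - h z" "\<lambda>z. 0" "at 0"] by blast
    from tendsto_unique[OF at_neq_bot this tendsto_const] show ?thesis by (simp add: D_def)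
  qed
  with Dz have D0: "D z = 0" if "z \<in> ball 0 1" for z using that by (cases "z = 0") auto
  have "((\<lambda>z. K (\<i> * z) - K z) has_field_derivative 0) (at z within ball 0 1)" if z: "z \<in> ball 0 1" for z
  proof -
    have "((\<lambda>z. K (\<i> * z)) has_field_derivative h (\<i> * z) * \<i>) (at z)"
      by (rule DERIV_chain2[of K]) (use z in \<open>auto intro!: K derivative_eq_intros simp: norm_mult\<close>)
    from DERIV_diff[OF this K[OF z]] have "((\<lambda>z. K (\<i> * z) - K z) has_field_derivative D z) (at z)"
      by (simp add: D_def mult.commute)
    then show ?thesis using D0[OF z] by (simp add: has_field_derivative_at_within)
  qed
  then have "\<exists>c. \<forall>z\<in>ball 0 1. K (\<i> * z) - K z = c"
    by (rule has_field_derivative_zero_constant[OF convex_ball])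
  then obtain c where c: "\<And>z. z \<in> ball 0 1 \<Longrightarrow> K (\<i> * z) - K z = c" by blast
  then have c0: "K (\<i> * z) = K z" if "z \<in> ball 0 1" for z
    using that c[of 0] c[of z] by simp
  have eb: "exp (Complex s t) \<in> ball 0 1" for t using s by (simp add: norm_exp_eq_Re)
  have vd: "((\<lambda>t. K (exp (Complex s t))) has_vector_derivative \<i> * (P (exp (Complex s t)) - P 0)) (at t within T)" for t T
  proof -
    have 1: "((\<lambda>t. exp (Complex s t)) has_vector_derivative \<i> * exp (Complex s t)) (at t within T)"
    proof -
      have "((\<lambda>t. of_real s + of_real t * \<i>) has_vector_derivative \<i>) (at t within T)"
        by (auto intro!: derivative_eq_intros)
      moreover have "Complex s = (\<lambda>t. of_real s + of_real t * \<i>)" by (simp add: fun_eq_iff complex_eq_iff)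
      ultimately have "(Complex s has_vector_derivative \<i>) (at t within T)" by simp
      from field_vector_diff_chain_within[OF this has_field_derivative_at_within[OF DERIV_exp]]
      show ?thesis by (simp add: o_def)
    qed
    from field_vector_diff_chain_within[OF 1 has_field_derivative_at_within[OF K[OF eb]]]
    have "((\<lambda>t. K (exp (Complex s t))) has_vector_derivative \<i> * exp (Complex s t) * h (exp (Complex s t))) (at t within T)"
      by (simp add: o_def)
    then show ?thesis using h(2)[of "exp (Complex s t)"] eb[of t] by (simp add: mult.assoc)
  qed
  have "((\<lambda>t. \<i> * (P (exp (Complex s t)) - P 0)) has_integral
      (K (exp (Complex s (\<theta> + pi / 2))) - K (exp (Complex s \<theta>)))) {\<theta>..\<theta> + pi / 2}"
    by (rule fundamental_theorem_of_calculus) (use vd in auto)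
  moreover have "exp (Complex s (\<theta> + pi / 2)) = \<i> * exp (Complex s \<theta>)"
    by (simp add: exp_eq_polar cis_mult[symmetric] cis.code flip: cis_mult) (simp add: complex_eq_iff cos_add sin_add)
  ultimately have "((\<lambda>t. \<i> * (P (exp (Complex s t)) - P 0)) has_integral 0) {\<theta>..\<theta> + pi / 2}"
    using c0[OF eb] by simp
  from has_integral_mult_right[OF this, of "- \<i>"]
  have "((\<lambda>t. P (exp (Complex s t)) - P 0) has_integral 0) {\<theta>..\<theta> + pi / 2}" by (simp flip: mult.assoc)
  from has_integral_add[OF this has_integral_const_real[of "P 0" \<theta> "\<theta> + pi / 2"]]
  show ?thesis by (simp add: scaleR_conv_of_real)
qed

text \<open>By a continuous choice of the argument: between two points at an angle of at least \<open>pi / 2\<close> the path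
  takes all arguments in some interval of length \<open>pi / 2\<close>.\<close>

lemma path_crosses_quarter_sector:
  fixes E :: "real \<Rightarrow> complex"
  assumes cont: "continuous_on {u..v} E" and nz: "\<And>x. x \<in> {u..v} \<Longrightarrow> E x \<noteq> 0" and uv: "u \<le> v"
    and ends: "Re (E u * cnj (E v)) \<le> 0"
  shows "\<exists>\<theta>0. \<forall>\<theta>\<in>{\<theta>0..\<theta>0 + pi / 2}. \<exists>x\<in>{u..v}. E x = exp (Complex (ln (cmod (E x))) \<theta>)"
proof -
  have "contractible {u..v}" by (simp add: convex_imp_contractible)
  then obtain L where L: "continuous_on {u..v} L" "\<And>x. x \<in> {u..v} \<Longrightarrow> E x = exp (L x)"
    using continuous_logarithm_on_contractible[OF cont _ nz] by metis
  define t where "t x = Im (L x)" for x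
  have conti: "continuous_on {u..v} t" unfolding t_def by (intro continuous_intros L)
  have Ex: "E x = exp (Complex (ln (cmod (E x))) (t x))" if "x \<in> {u..v}" for x
    using L(2)[OF that] by (simp add: t_def)
  have "\<not> \<bar>t u - t v\<bar> < pi / 2"
  proof
    assume "\<bar>t u - t v\<bar> < pi / 2"
    then have "- (pi / 2) < t u - t v" "t u - t v < pi / 2" by linarith+
    then have "cos (t u - t v) > 0" by (rule cos_gt_zero_pi)
    moreover have "Re (E u * cnj (E v)) = exp (Re (L u)) * exp (Re (L v)) * cos (t u - t v)"
      using L(2)[of u] L(2)[of v] uv by (simp add: t_def Re_exp Im_exp cos_diff algebra_simps)
    ultimately show False using ends by (simp add: mult_le_0_iff)
  qed
  then have gap: "min (t u) (t v) + pi / 2 \<le> max (t u) (t v)" by linarith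
  show ?thesis
  proof (intro exI ballI)
    fix \<theta> assume "\<theta> \<in> {min (t u) (t v)..min (t u) (t v) + pi / 2}"
    then have th: "min (t u) (t v) \<le> \<theta>" "\<theta> \<le> max (t u) (t v)" using gap by auto
    have "\<exists>x. u \<le> x \<and> x \<le> v \<and> t x = \<theta>"
    proof (cases "t u \<le> t v")
      case True then show ?thesis using IVT'[of t u \<theta> v] th uv conti by auto
    next
      case False then show ?thesis using IVT2'[of t v \<theta> u] th uv conti by auto
    qed
    then obtain x where "x \<in> {u..v}" "t x = \<theta>" by auto
    then show "\<exists>x\<in>{u..v}. E x = exp (Complex (ln (cmod (E x))) \<theta>)" using Ex[of x] by (intro bexI[of _ x]) auto
  qed
qed

text \<open>On each ray of the sector there is a point where \<open>p\<close> is at most \<open>\<epsilon>\<close>, and moving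
  from there along the ray to the circle of radius \<open>exp s\<close> costs at most the
  integral of \<open>\<bar>p'\<bar>\<close>, which is at most \<open>C\<close> times that of \<open>\<bar>b'\<bar>\<close>. In logarithmic coordinates
  the sector piece is a rectangle of width at most \<open>- s\<close>, so integrating over the angle the
  area bound makes the total of order \<open>sqrt (- s)\<close>.\<close>

lemma sector_integral_bound:
  fixes \<theta>0 s :: real
  assumes b: "b holomorphic_on ball 0 1" "inj_on b (ball 0 1)" "0 < B" "\<And>z. z \<in> ball 0 1 \<Longrightarrow> cmod (b z) \<le> B"
    and p: "p holomorphic_on ball 0 1" "0 < C"
      "\<And>z. z \<in> ball 0 1 \<Longrightarrow> cmod (deriv p z) \<le> C * cmod (deriv b z)"
    and s: "s < 0" "s \<le> s2" "s2 < 0"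
    and hit: "\<And>\<theta>. \<theta> \<in> {\<theta>0..\<theta>0 + pi / 2} \<Longrightarrow> \<exists>\<sigma>\<in>{s..s2}. cmod (p (exp (Complex \<sigma> \<theta>))) \<le> \<epsilon>"
  shows "integral {\<theta>0..\<theta>0 + pi / 2} (\<lambda>\<theta>. cmod (p (exp (Complex s \<theta>))))
    \<le> \<epsilon> * (pi / 2) + C * (sqrt (- s) * (pi / 2 + 4 * B\<^sup>2) / 2)"
proof -
  define g where "g = (\<lambda>w. b (exp w))"
  define S where "S = {w. Re w < 0 \<and> \<theta>0 - 1 < Im w \<and> Im w < \<theta>0 + pi / 2 + 1}"
  have S: "open S" unfolding S_def Collect_conj_eq
    by (intro open_Int open_halfspace_Im_gt open_halfspace_Im_lt open_halfspace_Re_lt)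
  have eb: "exp w \<in> ball 0 1" if "Re w < 0" for w using that by (simp add: norm_exp_eq_Re)
  have eS: "exp ` S \<subseteq> ball 0 1" using eb by (auto simp: S_def)
  have holg: "g holomorphic_on S" unfolding g_def
    using holomorphic_on_compose_gen[OF holomorphic_on_exp b(1) eS] by (simp add: o_def)
  have injg: "inj_on g S"
  proof (rule inj_onI)
    fix w w' assume w: "w \<in> S" "w' \<in> S" "g w = g w'"
    then have "exp w = exp w'" using b(2) eS unfolding g_def by (meson image_subset_iff inj_onD)
    moreover have "\<bar>Im w - Im w'\<bar> < 2 * pi"
    proof -
      have "Im w - Im w' < pi / 2 + 2" "Im w' - Im w < pi / 2 + 2" using w(1,2) by (auto simp: S_def)
      then show ?thesis using pi_gt3 by linarith
    qed
    ultimately show "w = w'" by (rule exp_complex_eqI[rotated])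
  qed
  have Q: "Complex x y \<in> S \<and> cmod (g (Complex x y)) \<le> B" if "x \<in> {s..s2}" "y \<in> {\<theta>0..\<theta>0 + pi / 2}" for x y
    using that s b(4) eb by (auto simp: S_def g_def)
  \<comment> \<open>This \<open>k\<close> balances the two terms of the length-area bound for a rectangle of width \<open>- s\<close>.\<close>
  define k where "k = 1 / sqrt (- s)"
  have k: "0 < k" using s by (simp add: k_def)
  have th: "\<theta>0 \<le> \<theta>0 + pi / 2" by simp
  note R = integral_norm_deriv_rectangle_le[OF S holg injg Q less_imp_le[OF b(3)] k s(2) th]
  let ?f = "\<lambda>x y. cmod (deriv g (Complex x y))"
  have point: "cmod (p (exp (Complex s \<theta>))) \<le> \<epsilon> + C * integral {s..s2} (\<lambda>x. ?f x \<theta>)"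
    if \<theta>: "\<theta> \<in> {\<theta>0..\<theta>0 + pi / 2}" for \<theta>
  proof -
    obtain \<sigma> where \<sigma>: "\<sigma> \<in> {s..s2}" "cmod (p (exp (Complex \<sigma> \<theta>))) \<le> \<epsilon>" using hit[OF \<theta>] by blast
    have neg: "x < 0" if "x \<in> {s..\<sigma>}" for x using that \<sigma> s by auto
    have vd: "((\<lambda>x. p (exp (Complex x \<theta>))) has_vector_derivative exp (Complex x \<theta>) * deriv p (exp (Complex x \<theta>))) (at x within {s..\<sigma>})"
      if x: "x \<in> {s..\<sigma>}" for x
    proof -
      have 1: "((\<lambda>x. exp (Complex x \<theta>)) has_vector_derivative exp (Complex x \<theta>)) (at x within {s..\<sigma>})"
      proof -
        have "((\<lambda>x. of_real x + of_real \<theta> * \<i>) has_vector_derivative 1) (at x within {s..\<sigma>})"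
          by (auto intro!: derivative_eq_intros)
        moreover have "(\<lambda>x. Complex x \<theta>) = (\<lambda>x. of_real x + of_real \<theta> * \<i>)" by (simp add: fun_eq_iff complex_eq_iff)
        ultimately have "((\<lambda>x. Complex x \<theta>) has_vector_derivative 1) (at x within {s..\<sigma>})" by simp
        from field_vector_diff_chain_within[OF this has_field_derivative_at_within[OF DERIV_exp]]
        show ?thesis by (simp add: o_def)
      qed
      have "(p has_field_derivative deriv p (exp (Complex x \<theta>))) (at (exp (Complex x \<theta>)))"
        by (rule holomorphic_derivI[OF p(1) open_ball eb]) (use neg[OF x] in simp)
      from field_vector_diff_chain_within[OF 1 has_field_derivative_at_within[OF this]]
      show ?thesis by (simp add: o_def)
    qed
    have I: "((\<lambda>x. exp (Complex x \<theta>) * deriv p (exp (Complex x \<theta>))) has_integral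
        (p (exp (Complex \<sigma> \<theta>)) - p (exp (Complex s \<theta>)))) {s..\<sigma>}"
      by (rule fundamental_theorem_of_calculus) (use vd \<sigma> in auto)
    have contf: "continuous_on {s..s2} (\<lambda>x. ?f x \<theta>)"
    proof -
      have "continuous_on {s..s2} (\<lambda>x. (\<lambda>(x,y). ?f x y) (x, \<theta>))"
        by (rule continuous_on_compose2[OF R(2)])
           (use \<theta> in \<open>auto simp: cbox_Pair_eq intro!: continuous_intros\<close>)
      then show ?thesis by simp
    qed
    have int: "(\<lambda>x. ?f x \<theta>) integrable_on {s..\<sigma>}"
      by (rule integrable_continuous_real, rule continuous_on_subset[OF contf]) (use \<sigma> in auto)
    have "cmod (p (exp (Complex \<sigma> \<theta>)) - p (exp (Complex s \<theta>))) \<le> integral {s..\<sigma>} (\<lambda>x. C * ?f x \<theta>)"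
      unfolding integral_unique[OF I, symmetric]
    proof (rule integral_norm_bound_integral[OF has_integral_integrable[OF I]])
      show "(\<lambda>x. C * ?f x \<theta>) integrable_on {s..\<sigma>}" using integrable_cmul[OF int, of C] by simp
      fix x assume x: "x \<in> {s..\<sigma>}"
      have "(g has_field_derivative deriv b (exp (Complex x \<theta>)) * exp (Complex x \<theta>)) (at (Complex x \<theta>))"
        unfolding g_def
        by (rule DERIV_chain2[OF holomorphic_derivI[OF b(1) open_ball eb] DERIV_exp]) (use neg[OF x] in simp)
      then have "deriv g (Complex x \<theta>) = deriv b (exp (Complex x \<theta>)) * exp (Complex x \<theta>)" by (rule DERIV_imp_deriv)
      then show "cmod (exp (Complex x \<theta>) * deriv p (exp (Complex x \<theta>))) \<le> C * ?f x \<theta>"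
        using p(3)[OF eb, of "Complex x \<theta>"] neg[OF x]
          mult_right_mono[of "cmod (deriv p (exp (Complex x \<theta>)))" "C * cmod (deriv b (exp (Complex x \<theta>)))" "cmod (exp (Complex x \<theta>))"]
        by (simp add: norm_mult mult_ac)
    qed
    also have "\<dots> = C * integral {s..\<sigma>} (\<lambda>x. ?f x \<theta>)" by simp
    also have "\<dots> \<le> C * integral {s..s2} (\<lambda>x. ?f x \<theta>)"
      using p(2) \<sigma> int contf by (intro mult_left_mono integral_subset_le) (auto intro: integrable_continuous_real)
    finally show ?thesis using \<sigma>(2) norm_triangle_ineq2[of "p (exp (Complex s \<theta>))" "p (exp (Complex \<sigma> \<theta>))"]
      by (simp add: norm_minus_commute)
  qed
  have "continuous_on (cbox s s2 \<times> cbox \<theta>0 (\<theta>0 + pi/2)) (\<lambda>(x,y). ?f x y)"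
    using R(2) by (simp add: cbox_Pair_eq)
  then have sw: "continuous_on (cbox \<theta>0 (\<theta>0 + pi/2) \<times> cbox s s2) (\<lambda>(y,x). ?f x y)"
    by (rule continuous_on_swap_args)
  have contI: "continuous_on {\<theta>0..\<theta>0 + pi/2} (\<lambda>y. integral {s..s2} (\<lambda>x. ?f x y))"
    using integral_continuous_on_param[of "{\<theta>0..\<theta>0 + pi/2}" s s2 "\<lambda>y x. ?f x y"] sw by (simp add: cbox_Pair_eq)
  have contp: "continuous_on {\<theta>0..\<theta>0 + pi / 2} (\<lambda>\<theta>. cmod (p (exp (Complex s \<theta>))))"
  proof -
    have "continuous_on {\<theta>0..\<theta>0 + pi / 2} (\<lambda>\<theta>. exp (of_real s + \<i> * of_real \<theta>))" by (intro continuous_intros)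
    moreover have "Complex s = (\<lambda>\<theta>. of_real s + \<i> * of_real \<theta>)" by (simp add: fun_eq_iff complex_eq_iff)
      ultimately have "continuous_on {\<theta>0..\<theta>0 + pi / 2} (\<lambda>\<theta>. exp (Complex s \<theta>))" by simp
    then show ?thesis
      by (intro continuous_on_norm continuous_on_compose2[OF holomorphic_on_imp_continuous_on[OF p(1)]])
         (use s in \<open>auto intro!: eb simp del: mem_ball mem_ball_0\<close>)
  qed
  have "integral {\<theta>0..\<theta>0 + pi / 2} (\<lambda>\<theta>. cmod (p (exp (Complex s \<theta>))))
     \<le> integral {\<theta>0..\<theta>0 + pi / 2} (\<lambda>\<theta>. \<epsilon> + C * integral {s..s2} (\<lambda>x. ?f x \<theta>))"
    by (rule integral_le) (use point in \<open>auto intro!: integrable_continuous_real contp continuous_intros contI\<close>)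
  also have "\<dots> = integral {\<theta>0..\<theta>0 + pi / 2} (\<lambda>\<theta>. \<epsilon>) + integral {\<theta>0..\<theta>0 + pi / 2} (\<lambda>\<theta>. C * integral {s..s2} (\<lambda>x. ?f x \<theta>))"
    by (rule Henstock_Kurzweil_Integration.integral_add) (auto intro!: integrable_continuous_real continuous_intros contI)
  also have "\<dots> = \<epsilon> * (pi / 2) + C * integral {\<theta>0..\<theta>0 + pi / 2} (\<lambda>\<theta>. integral {s..s2} (\<lambda>x. ?f x \<theta>))" by simp
  also have "integral {\<theta>0..\<theta>0 + pi / 2} (\<lambda>\<theta>. integral {s..s2} (\<lambda>x. ?f x \<theta>))
     = integral (cbox (s, \<theta>0) (s2, \<theta>0 + pi / 2)) (\<lambda>(x,y). ?f x y)"
    using integral_prod_continuous[OF R(2)] integral_swap_continuous[OF R(2)] by simp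
  also have "\<dots> \<le> (k * ((s2 - s) * (pi / 2)) + 4 * B\<^sup>2 / k) / 2" using R(1) by simp
  also have "\<dots> \<le> (k * ((- s) * (pi / 2)) + 4 * B\<^sup>2 / k) / 2"
    using k s by (intro divide_right_mono add_right_mono mult_left_mono mult_right_mono) auto
  also have "\<dots> = sqrt (- s) * (pi / 2 + 4 * B\<^sup>2) / 2"
  proof -
    have "k * (- s) = sqrt (- s)" unfolding k_def using s real_sqrt_mult_self[of "- s"] by (simp add: field_simps)
    moreover have "4 * B\<^sup>2 / k = sqrt (- s) * (4 * B\<^sup>2)" by (simp add: k_def)
    moreover have "k * (- s * (pi / 2)) = k * (- s) * (pi / 2)" by (simp only: mult.assoc)
    ultimately show ?thesis by (simp only: distrib_left)
  qed
  finally show ?thesis using p(2) by (simp add: mult_left_mono)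
qed

text \<open>Otherwise a bounded zero-free \<open>p\<close> tends to \<open>0\<close> along the curve. Going back and forth between
  \<open>1\<close> and \<open>-1\<close> the curve crosses a quarter sector arbitrarily close to the circle, so \<open>p\<close> is small on
  average over a quarter circle. The product \<open>P\<close> of the four rotated copies of \<open>p\<close> is then small
  in mean as well, and as \<open>P\<close> is invariant under the rotation, \<open>P 0 = 0\<close>; but \<open>P 0\<close> is \<open>p 0\<close> to the
  fourth power.\<close>

theorem oscillating_curve_no_limit:
  fixes E :: "real \<Rightarrow> complex"
  assumes F: "F holomorphic_on ball 0 1" "inj_on F (ball 0 1)"
    and contE: "continuous_on {0<..<1} E" and E: "\<And>x. x \<in> {0<..<1} \<Longrightarrow> E x \<in> ball 0 1"
    and lim1: "((\<lambda>x. cmod (E x)) \<longlongrightarrow> 1) (at_left 1)"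
    and near1: "\<And>X. X < 1 \<Longrightarrow> \<exists>x. X < x \<and> 0 < x \<and> x < 1 \<and> cmod (E x - 1) \<le> 1 / 2"
    and nearm1: "\<And>X. X < 1 \<Longrightarrow> \<exists>x. X < x \<and> 0 < x \<and> x < 1 \<and> cmod (E x + 1) \<le> 1 / 2"
  shows "\<not> limitin riemann_sphere (\<lambda>x. Some (F (E x))) A (at_left 1)"
proof
  assume lim: "limitin riemann_sphere (\<lambda>x. Some (F (E x))) A (at_left 1)"
  have ev01: "\<forall>\<^sub>F x in at_left (1::real). x \<in> {0<..<1}"
    using eventually_at_left_real[of 0 "1::real"] by simp
  have "\<forall>\<^sub>F x in at_left 1. E x \<in> ball 0 1" using ev01 by eventually_elim (rule E)
  from vanishing_function_along_limit[OF F this lim1 _ lim]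
  obtain b B p C where b: "b holomorphic_on ball 0 1" "inj_on b (ball 0 1)" "0 < B"
    "\<And>z. z \<in> ball 0 1 \<Longrightarrow> cmod (b z) \<le> B"
    and p: "p holomorphic_on ball 0 1" "0 < C" "\<And>z. z \<in> ball 0 1 \<Longrightarrow> p z \<noteq> 0"
    "\<And>z. z \<in> ball 0 1 \<Longrightarrow> cmod (p z) \<le> C"
    "\<And>z. z \<in> ball 0 1 \<Longrightarrow> cmod (deriv p z) \<le> C * cmod (deriv b z)"
    "((\<lambda>x. p (E x)) \<longlongrightarrow> 0) (at_left 1)"
    by (metis trivial_limit_at_left_real)
  define P where "P z = p z * (p (\<i> * z) * p (- z) * p (- \<i> * z))" for z
  have holP: "P holomorphic_on ball 0 1" unfolding P_def
  proof -
    have rot: "(\<lambda>z. p (c * z)) holomorphic_on ball 0 1" if "cmod c = 1" for c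
    proof -
      have "(\<lambda>z. c * z) holomorphic_on ball 0 1" by (intro holomorphic_intros)
      from holomorphic_on_compose_gen[OF this p(1)] show ?thesis
        using that by (simp add: o_def image_subset_iff norm_mult)
    qed
    show "(\<lambda>z. p z * (p (\<i> * z) * p (- z) * p (- \<i> * z))) holomorphic_on ball 0 1"
    proof -
      have r2: "(\<lambda>z. p (- z)) holomorphic_on ball 0 1" using rot[of "-1"] by simp
      have r1: "(\<lambda>z. p (\<i> * z)) holomorphic_on ball 0 1" "(\<lambda>z. p (- \<i> * z)) holomorphic_on ball 0 1"
        by (rule rot; simp)+
      show ?thesis by (intro holomorphic_on_mult p(1) r1 r2)
    qed
  qed
  have invP: "P (\<i> * z) = P z" for z
  proof -
    have "\<i> * (\<i> * z) = - z" "- \<i> * (\<i> * z) = z" by (simp_all flip: mult.assoc)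
    then show ?thesis unfolding P_def by (simp add: mult_ac)
  qed
  \<comment> \<open>The constant that comes out of the estimate \<open>key\<close>: \<open>C^3\<close> bounds three of the four factors of \<open>P\<close>,
    the bracket is the sector bound for the fourth, per unit of \<open>\<eta>\<close>.\<close>
  define M where "M = C^3 * (pi / 2 + C * (pi / 2 + 4 * B\<^sup>2) / 2)"
  have M: "0 \<le> M" using p(2) by (simp add: M_def)
  have key: "pi / 2 * cmod (P 0) \<le> M * \<eta>" if \<eta>: "0 < \<eta>" for \<eta>
  proof -
    \<comment> \<open>With this choice \<open>sqrt (- s) = \<eta>\<close>, and both terms of the sector bound are linear in \<open>\<eta>\<close>.\<close>
    define s where "s = - (\<eta>\<^sup>2)"
    have s: "s < 0" using \<eta> by (simp add: s_def)
    have "\<forall>\<^sub>F x in at_left 1. cmod (p (E x)) < \<eta>"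
      using tendstoD[OF p(6) \<eta>] by simp
    moreover have "\<forall>\<^sub>F x in at_left 1. exp s < cmod (E x)"
      using order_tendstoD(1)[OF lim1] s by simp
    ultimately have "\<forall>\<^sub>F x in at_left 1. cmod (p (E x)) < \<eta> \<and> exp s < cmod (E x)"
      by eventually_elim simp
    then obtain X where X: "X < 1" "\<And>x. X < x \<Longrightarrow> x < 1 \<Longrightarrow> cmod (p (E x)) < \<eta> \<and> exp s < cmod (E x)"
      unfolding eventually_at_left_field by blast
    obtain x1 where x1: "X < x1" "0 < x1" "x1 < 1" "cmod (E x1 - 1) \<le> 1 / 2" using near1[OF X(1)] by blast
    obtain x2 where x2: "X < x2" "0 < x2" "x2 < 1" "cmod (E x2 + 1) \<le> 1 / 2" using nearm1[OF X(1)] by blast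
    have neg: "Re (E x1 * cnj (E x2)) \<le> 0"
    proof -
      have "\<bar>Re (E x1) - 1\<bar> \<le> 1/2" "\<bar>Im (E x1)\<bar> \<le> 1/2" "\<bar>Re (E x2) + 1\<bar> \<le> 1/2" "\<bar>Im (E x2)\<bar> \<le> 1/2"
        using abs_Re_le_cmod[of "E x1 - 1"] abs_Im_le_cmod[of "E x1 - 1"]
          abs_Re_le_cmod[of "E x2 + 1"] abs_Im_le_cmod[of "E x2 + 1"] x1(4) x2(4) by auto
      note b = this
      have a: "1/2 \<le> Re (E x1)" "1/2 \<le> - Re (E x2)" using b by linarith+
      have a3: "\<bar>Im (E x1)\<bar> * \<bar>Im (E x2)\<bar> \<le> 1/2 * (1/2)" by (rule mult_mono) (use b in simp_all)
      have "1/2 * (1/2) \<le> Re (E x1) * (- Re (E x2))" using a(1,2) by (intro mult_mono) auto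
      moreover have "Im (E x1) * Im (E x2) \<le> 1/2 * (1/2)" using a3 abs_ge_self[of "Im (E x1) * Im (E x2)"] by (simp add: abs_mult)
      ultimately show ?thesis by simp
    qed
    define u v where "u = min x1 x2" "v = max x1 x2"
    have uv: "u \<le> v" "0 < u" "X < u" "v < 1" using x1 x2 by (auto simp: u_v_def)
    have ends: "Re (E u * cnj (E v)) \<le> 0" using neg by (auto simp: u_v_def min_def max_def algebra_simps)
    have Exp: "exp s < cmod (E x)" "cmod (p (E x)) < \<eta>" "E x \<in> ball 0 1" if "x \<in> {u..v}" for x
      using that uv X(2)[of x] E[of x] by auto
    have contuv: "continuous_on {u..v} E" using contE by (rule continuous_on_subset) (use uv in auto)
    have nz: "E x \<noteq> 0" if "x \<in> {u..v}" for x using Exp(1)[OF that] exp_gt_zero[of s] by auto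
    obtain \<theta>0 where th: "\<And>\<theta>. \<theta> \<in> {\<theta>0..\<theta>0 + pi / 2} \<Longrightarrow> \<exists>x\<in>{u..v}. E x = exp (Complex (ln (cmod (E x))) \<theta>)"
      using path_crosses_quarter_sector[OF contuv nz uv(1) ends] by blast
    obtain x0 where x0: "x0 \<in> {u..v}" "\<And>x. x \<in> {u..v} \<Longrightarrow> cmod (E x) \<le> cmod (E x0)"
      using continuous_attains_sup[OF _ _ continuous_on_norm[OF contuv]] uv by auto
    define s2 where "s2 = ln (cmod (E x0))"
    have s2: "s \<le> s2" "s2 < 0" 
    proof -
      show "s2 < 0" using Exp(3)[OF x0(1)] nz[OF x0(1)] by (simp add: s2_def)
      show "s \<le> s2" using Exp(1)[OF x0(1)] nz[OF x0(1)] unfolding s2_def by (simp add: ln_ge_iff less_imp_le)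
    qed
    have hit: "\<exists>\<sigma>\<in>{s..s2}. cmod (p (exp (Complex \<sigma> \<theta>))) \<le> \<eta>" if \<theta>: "\<theta> \<in> {\<theta>0..\<theta>0 + pi / 2}" for \<theta>
    proof -
      obtain x where x: "x \<in> {u..v}" "E x = exp (Complex (ln (cmod (E x))) \<theta>)" using th[OF \<theta>] by blast
      have "s \<le> ln (cmod (E x))" using Exp(1)[OF x(1)] nz[OF x(1)] by (simp add: ln_ge_iff less_imp_le)
      moreover have "ln (cmod (E x)) \<le> s2" using x0(2)[OF x(1)] nz[OF x(1)] nz[OF x0(1)] by (simp add: s2_def)
      moreover have "cmod (p (exp (Complex (ln (cmod (E x))) \<theta>))) \<le> \<eta>" using Exp(2)[OF x(1)] x(2) by simp
      ultimately show ?thesis by auto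
    qed
    have I: "integral {\<theta>0..\<theta>0 + pi / 2} (\<lambda>\<theta>. cmod (p (exp (Complex s \<theta>))))
      \<le> \<eta> * (pi / 2) + C * (sqrt (- s) * (pi / 2 + 4 * B\<^sup>2) / 2)"
      by (rule sector_integral_bound[OF b p(1,2,5) s s2 hit])
    have sq: "sqrt (- s) = \<eta>" using \<eta> by (simp add: s_def)
    have eb: "exp (Complex s t) \<in> ball 0 1" for t using s by (simp add: norm_exp_eq_Re)
    have mean: "((\<lambda>\<theta>. P (exp (Complex s \<theta>))) has_integral of_real (pi / 2) * P 0) {\<theta>0..\<theta>0 + pi / 2}"
      by (rule quarter_rotation_mean_value[OF holP invP s])
    have contp: "continuous_on {\<theta>0..\<theta>0 + pi / 2} (\<lambda>\<theta>. cmod (p (exp (Complex s \<theta>))))"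
    proof -
      have "continuous_on {\<theta>0..\<theta>0 + pi / 2} (\<lambda>\<theta>. exp (of_real s + \<i> * of_real \<theta>))" by (intro continuous_intros)
      moreover have "Complex s = (\<lambda>\<theta>. of_real s + \<i> * of_real \<theta>)" by (simp add: fun_eq_iff complex_eq_iff)
      ultimately have "continuous_on {\<theta>0..\<theta>0 + pi / 2} (\<lambda>\<theta>. exp (Complex s \<theta>))" by simp
      then show ?thesis
        by (intro continuous_on_norm continuous_on_compose2[OF holomorphic_on_imp_continuous_on[OF p(1)]])
           (auto intro!: eb simp del: mem_ball mem_ball_0)
    qed
    have "pi / 2 * cmod (P 0) = cmod (of_real (pi / 2) * P 0)" by (simp add: norm_mult)
    also have "\<dots> \<le> integral {\<theta>0..\<theta>0 + pi / 2} (\<lambda>\<theta>. C^3 * cmod (p (exp (Complex s \<theta>))))"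
      unfolding integral_unique[OF mean, symmetric]
    proof (rule integral_norm_bound_integral[OF has_integral_integrable[OF mean]])
      show "(\<lambda>\<theta>. C^3 * cmod (p (exp (Complex s \<theta>)))) integrable_on {\<theta>0..\<theta>0 + pi / 2}"
        by (intro integrable_continuous_real continuous_intros contp)
      fix \<theta>
      define z where "z = exp (Complex s \<theta>)"
      have z: "z \<in> ball 0 1" using eb by (simp add: z_def)
      have z': "\<i> * z \<in> ball 0 1" "- z \<in> ball 0 1" "- \<i> * z \<in> ball 0 1" using z by (auto simp: norm_mult)
      have "cmod (p (\<i> * z)) * cmod (p (- z)) * cmod (p (- \<i> * z)) \<le> C * C * C"
        using p(4)[OF z'(1)] p(4)[OF z'(2)] p(4)[OF z'(3)] p(2) by (intro mult_mono) auto
      from mult_right_mono[OF this norm_ge_zero[of "p z"]]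
      show "cmod (P (exp (Complex s \<theta>))) \<le> C^3 * cmod (p (exp (Complex s \<theta>)))"
        unfolding z_def[symmetric] P_def by (simp add: norm_mult mult_ac power3_eq_cube)
    qed
    also have "\<dots> = C^3 * integral {\<theta>0..\<theta>0 + pi / 2} (\<lambda>\<theta>. cmod (p (exp (Complex s \<theta>))))" by simp
    also have "\<dots> \<le> C^3 * (\<eta> * (pi / 2) + C * (\<eta> * (pi / 2 + 4 * B\<^sup>2) / 2))"
      using I p(2) unfolding sq by (intro mult_left_mono) auto
    also have "\<dots> = M * \<eta>" by (simp add: M_def algebra_simps)
    finally show ?thesis .
  qed
  have "P 0 = 0"
  proof (rule ccontr)
    assume "P 0 \<noteq> 0"
    define q where "q = pi / 2 * cmod (P 0)"
    have q: "q > 0" using \<open>P 0 \<noteq> 0\<close> by (simp add: q_def)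
    have "q \<le> M * (q / (2 * (M + 1)))" unfolding q_def[symmetric] using key[of "q / (2 * (M + 1))"] q M by (simp add: q_def)
    also have "\<dots> = q * (M / (2 * (M + 1)))" by simp
    also have "\<dots> \<le> q * (1 / 2)" using q M by (intro mult_left_mono) (auto simp: field_simps)
    finally show False using q by simp
  qed
  then show False using p(3)[of 0] by (simp add: P_def)
qed

section \<open>Chains of self-maps close to minus the identity\<close>

lemma geometric_increments_limit:
  fixes a :: "nat \<Rightarrow> complex"
  assumes "\<And>d. cmod (a (Suc d) - a d) \<le> M * (1/2)^d"
  shows "convergent a" "cmod (lim a - a d) \<le> 2 * M * (1/2)^d"
proof -
  have sm: "summable (\<lambda>d. M * (1/2)^d :: real)" by (intro summable_mult summable_geometric) simp
  have "summable (\<lambda>d. a (Suc d) - a d)"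
    by (rule summable_comparison_test'[OF sm, of 0]) (use assms in auto)
  then have "convergent (\<lambda>n. \<Sum>d<n. a (Suc d) - a d)" by (simp add: summable_iff_convergent)
  then have "convergent (\<lambda>n. a n - a 0)" by (simp add: sum_lessThan_telescope)
  from convergent_add[OF this convergent_const[of "a 0"]] show c: "convergent a" by simp
  have tele: "(\<lambda>i. a (Suc (i + d)) - a (i + d)) sums (lim a - a (0 + d))"
    by (rule telescope_sums[of "\<lambda>i. a (i + d)", simplified add_Suc])
       (use c in \<open>simp add: LIMSEQ_ignore_initial_segment convergent_LIMSEQ_iff\<close>)
  have geo: "(\<lambda>i. M * (1/2)^d * (1/2)^i) sums (M * (1/2)^d * 2)"
    using sums_mult[OF geometric_sums[of "1/2::real"], of "M * (1/2)^d"] by simp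
  have "norm (\<Sum>i. a (Suc (i + d)) - a (i + d)) \<le> (\<Sum>i. M * (1/2)^d * (1/2)^i)"
    by (rule norm_suminf_le[OF _ sums_summable[OF geo]])
       (use assms[of "_ + d"] in \<open>simp add: power_add mult_ac\<close>)
  then show "cmod (lim a - a d) \<le> 2 * M * (1/2)^d"
    using sums_unique[OF tele] sums_unique[OF geo] by (simp add: mult_ac)
qed

text \<open>If \<open>Y\<close> is large on the circle of radius \<open>s\<close> then the disk of radius \<open>\<rho>\<close> misses the image of that
  circle; being connected and meeting the image of the inside, it lies in it.\<close>

lemma ball_covered_by_perturbation:
  fixes Y :: "complex \<Rightarrow> complex"
  assumes Y: "Y holomorphic_on ball 0 1" "inj_on Y (ball 0 1)" and "Y 0 = 0"
    and \<rho>: "0 \<le> \<rho>" and s: "0 < s" "s < 1" and big: "\<And>z. cmod z = s \<Longrightarrow> \<rho> < cmod (Y z)"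
  shows "cball 0 \<rho> \<subseteq> Y ` ball 0 s"
proof -
  have sub: "ball (0::complex) s \<subseteq> ball 0 1" "cball 0 s \<subseteq> ball (0::complex) 1" "ball (0::complex) s \<subseteq> ball 0 1" using s by auto
  have o: "open (Y ` ball 0 s)"
    using open_mapping_thm3[OF holomorphic_on_subset[OF Y(1) sub(3)] open_ball inj_on_subset[OF Y(2) sub(3)]] .
  have "compact (Y ` cball 0 s)"
    using compact_continuous_image[OF continuous_on_subset[OF holomorphic_on_imp_continuous_on[OF Y(1)] sub(2)]] by simp
  then have c: "open (- (Y ` cball 0 s))" by (simp add: compact_imp_closed open_Compl)
  have cover: "cball 0 \<rho> \<subseteq> Y ` ball 0 s \<union> - (Y ` cball 0 s)"
  proof
    fix w :: complex assume w: "w \<in> cball 0 \<rho>"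
    show "w \<in> Y ` ball 0 s \<union> - (Y ` cball 0 s)"
    proof (rule ccontr)
      assume n: "\<not> ?thesis"
      then obtain z where z: "z \<in> cball 0 s" "w = Y z" by blast
      moreover have "z \<notin> ball 0 s" using n z(2) by blast
      ultimately have "cmod z = s" by simp
      from big[OF this] w z(2) show False by simp
    qed
  qed
  have "- (Y ` cball 0 s) \<inter> cball 0 \<rho> = {} \<or> Y ` ball 0 s \<inter> cball 0 \<rho> = {}"
  proof -
    have "Y ` ball 0 s \<inter> - (Y ` cball 0 s) \<inter> cball 0 \<rho> = {}" by force
    from connectedD[OF connected_cball o c this cover] show ?thesis by blast
  qed
  moreover have "0 \<in> Y ` ball 0 s \<inter> cball 0 \<rho>" using assms(3) \<rho> s by (auto intro!: image_eqI[of _ _ 0])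
  ultimately show ?thesis using cover by blast
qed

primrec compose_from :: "(nat \<Rightarrow> complex \<Rightarrow> complex) \<Rightarrow> nat \<Rightarrow> nat \<Rightarrow> complex \<Rightarrow> complex" where
  "compose_from B k 0 z = z"
| "compose_from B k (Suc d) z = B (k + d) (compose_from B k d z)"

text \<open>Self-maps of the closed disk that touch the circle at the fixed point \<open>1\<close> only.\<close>

locale disk_chain =
  fixes B :: "nat \<Rightarrow> complex \<Rightarrow> complex"
  assumes B_cont: "\<And>n. continuous_on (cball 0 1) (B n)"
    and B_inj: "\<And>n. inj_on (B n) (cball 0 1)"
    and B_hol: "\<And>n. B n holomorphic_on ball 0 1"
    and B_1: "\<And>n. B n 1 = 1"
    and B_ball: "\<And>n z. z \<in> cball 0 1 \<Longrightarrow> z \<noteq> 1 \<Longrightarrow> B n z \<in> ball 0 1"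
begin

abbreviation blocks :: "nat \<Rightarrow> nat \<Rightarrow> complex \<Rightarrow> complex" where "blocks \<equiv> compose_from B"

lemma blocks_Suc': "blocks k (Suc d) z = blocks (Suc k) d (B k z)"
  by (induction d) auto

lemma B_cball: "z \<in> cball 0 1 \<Longrightarrow> B n z \<in> cball 0 1"
  using B_ball[of z n] B_1[of n] by (cases "z = 1") auto

lemma B_in_ball: "z \<in> ball 0 1 \<Longrightarrow> B n z \<in> ball 0 1"
  by (rule B_ball) auto

lemma blocks_cball: "z \<in> cball 0 1 \<Longrightarrow> blocks k d z \<in> cball 0 1"
  by (induction d) (auto simp del: mem_cball mem_cball_0 simp: B_cball)

lemma blocks_ball: "z \<in> ball 0 1 \<Longrightarrow> blocks k d z \<in> ball 0 1"
  by (induction d) (auto simp del: mem_ball mem_ball_0 simp: B_in_ball)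

lemma blocks_1: "blocks k d 1 = 1"
  by (induction d) (auto simp: B_1)

lemma blocks_cont: "continuous_on (cball 0 1) (blocks k d)"
proof (induction d)
  case (Suc d)
  have "continuous_on (cball 0 1) (\<lambda>z. B (k + d) (blocks k d z))"
    by (rule continuous_on_compose2[OF B_cont Suc]) (use blocks_cball in blast)
  then show ?case by simp
qed simp

lemma blocks_hol: "blocks k d holomorphic_on ball 0 1"
proof (induction d)
  case (Suc d)
  have "(B (k + d) \<circ> blocks k d) holomorphic_on ball 0 1"
    by (rule holomorphic_on_compose_gen[OF Suc B_hol]) (use blocks_ball in blast)
  then show ?case by (simp add: o_def)
qed (simp add: holomorphic_on_ident)

lemma blocks_inj: "inj_on (blocks k d) (cball 0 1)"
proof (induction d)
  case (Suc d)
  have "inj_on (B (k + d) \<circ> blocks k d) (cball 0 1)"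
    by (rule comp_inj_on[OF Suc inj_on_subset[OF B_inj]]) (use blocks_cball in blast)
  then show ?case by (simp add: o_def)
qed (simp add: inj_on_def)

lemma blocks_strict: "z \<in> cball 0 1 \<Longrightarrow> z \<noteq> 1 \<Longrightarrow> 0 < d \<Longrightarrow> blocks k d z \<in> ball 0 1"
proof (induction d)
  case (Suc d)
  have "blocks k d z \<in> ball 0 1" if "0 < d" by (rule Suc.IH[OF Suc.prems(1,2) that])
  moreover have "blocks k d z = z" if "d = 0" using that by simp
  ultimately have "blocks k d z \<in> cball 0 1 \<and> blocks k d z \<noteq> 1"
    using Suc.prems(1,2) by (cases "d = 0") auto
  then show ?case by (auto simp del: mem_ball mem_ball_0 mem_cball mem_cball_0 simp: B_ball)
qed simp

text \<open>The radii are found by continuity of finitely many compositions at their fixed point \<open>1\<close>. The bound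
  \<open>r\<close> is by compactness: the composed maps send the arc \<open>\<bar>z - 1\<bar> = \<delta>\<close> of the closed disk into the open disk.
  Only the blocks before the \<open>n\<close>-th enter, so the later ones can be chosen afterwards.\<close>

lemma crossing_radius:
  obtains \<delta> r where "0 < \<delta>" "\<delta> \<le> 1 / real (Suc n)" "0 \<le> r" "r < 1"
    "\<And>k z. k < n \<Longrightarrow> z \<in> cball 0 1 \<Longrightarrow> cmod (z - 1) = \<delta> \<Longrightarrow>
       cmod (blocks k (n - k) z - 1) \<le> 1/4 \<and> cmod (blocks k (n - k) z) \<le> r"
proof -
  have ev: "\<forall>\<^sub>F \<delta> in at_right 0. \<forall>z\<in>cball 0 1. cmod (z - 1) = \<delta> \<longrightarrow> cmod (blocks k (n - k) z - 1) \<le> 1/4" for k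
  proof -
    have one: "(1::complex) \<in> cball 0 1" and e4: "(0::real) < 1/4" by simp_all
    from blocks_cont[of k "n - k", unfolded continuous_on_iff, rule_format, OF one e4]
    obtain d where d: "0 < d" "\<And>z. z \<in> cball 0 1 \<Longrightarrow> dist z 1 < d \<Longrightarrow> dist (blocks k (n - k) z) (blocks k (n - k) 1) < 1/4"
      by blast
    have "\<forall>\<^sub>F \<delta> in at_right 0. \<delta> < d" using d(1) by (simp add: eventually_at_right_field) blast
    then show ?thesis
    proof eventually_elim
      case (elim \<delta>)
      show ?case
      proof (intro ballI impI)
        fix z :: complex assume "z \<in> cball 0 1" "cmod (z - 1) = \<delta>"
        then show "cmod (blocks k (n - k) z - 1) \<le> 1/4"
          using d(2)[of z] elim by (simp add: dist_norm blocks_1)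
      qed
    qed
  qed
  have "\<forall>\<^sub>F \<delta> in at_right 0. \<forall>k\<in>{..<n}. \<forall>z\<in>cball 0 1. cmod (z - 1) = \<delta> \<longrightarrow> cmod (blocks k (n - k) z - 1) \<le> 1/4"
    by (rule eventually_ball_finite) (use ev in auto)
  moreover have "\<forall>\<^sub>F \<delta> in at_right 0. \<delta> \<in> {0<..<1 / real (Suc n)}"
    by (rule eventually_at_right_real) simp
  ultimately have "\<forall>\<^sub>F \<delta> in at_right 0. (\<forall>k\<in>{..<n}. \<forall>z\<in>cball 0 1. cmod (z - 1) = \<delta> \<longrightarrow> cmod (blocks k (n - k) z - 1) \<le> 1/4)
     \<and> \<delta> \<in> {0<..<1 / real (Suc n)}" by (rule eventually_conj)
  from eventually_happens'[OF trivial_limit_at_right_real this]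
  obtain \<delta> where all: "\<forall>k\<in>{..<n}. \<forall>z\<in>cball 0 1. cmod (z - 1) = \<delta> \<longrightarrow> cmod (blocks k (n - k) z - 1) \<le> 1/4"
    and "\<delta> \<in> {0<..<1 / real (Suc n)}" by blast
  then have \<delta>: "\<And>k z. k < n \<Longrightarrow> z \<in> cball 0 1 \<Longrightarrow> cmod (z - 1) = \<delta> \<Longrightarrow> cmod (blocks k (n - k) z - 1) \<le> 1/4"
    "0 < \<delta>" "\<delta> < 1 / real (Suc n)" by (blast, simp, simp)
  define S :: "complex set" where "S = {z \<in> cball 0 1. cmod (z - 1) = \<delta>}"
  define K where "K = insert 0 (\<Union>k\<in>{..<n}. blocks k (n - k) ` S)"
  have "S = cball 0 1 \<inter> sphere 1 \<delta>" by (auto simp: S_def dist_norm norm_minus_commute)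
  then have "compact S" by (simp add: compact_Int)
  then have "compact (blocks k (n - k) ` S)" for k
    by (intro compact_continuous_image continuous_on_subset[OF blocks_cont]) (auto simp: S_def)
  then have "compact K" unfolding K_def by (intro compact_insert compact_UN) auto
  moreover have "K \<noteq> {}" by (auto simp: K_def)
  ultimately obtain x where x: "x \<in> K" "\<And>y. y \<in> K \<Longrightarrow> cmod y \<le> cmod x"
    using continuous_attains_sup[of K cmod] continuous_on_norm_id by blast
  have Kb: "K \<subseteq> ball 0 1"
  proof
    fix y assume "y \<in> K"
    then consider "y = 0" | k z where "k < n" "z \<in> S" "y = blocks k (n - k) z" by (auto simp: K_def)
    then show "y \<in> ball 0 1"
    proof cases
      case 2
      then have "z \<in> cball 0 1" "z \<noteq> 1" "0 < n - k" using \<delta>(2) by (auto simp: S_def)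
      then show ?thesis using blocks_strict 2(3) by blast
    qed simp
  qed
  show thesis
  proof (rule that[OF \<delta>(2) less_imp_le[OF \<delta>(3)], of "cmod x"])
    show "cmod x < 1" using Kb x(1) by auto
    show "cmod (blocks k (n - k) z - 1) \<le> 1/4 \<and> cmod (blocks k (n - k) z) \<le> cmod x"
      if "k < n" "z \<in> cball 0 1" "cmod (z - 1) = \<delta>" for k z
      using \<delta>(1)[OF that] x(2)[of "blocks k (n - k) z"] that by (auto simp: K_def S_def)
  qed simp
qed

end

text \<open>The maps \<open>B n\<close> are close to minus the identity to the order \<open>\<kappa> n\<close>, which is small compared with
  \<open>1 - r i\<close> for all earlier \<open>i\<close>. So on each of the disks of radius \<open>r i\<close> the errors of all maps
  from the \<open>i\<close>-th on have a small sum.\<close>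

locale block_chain = disk_chain B
  for B :: "nat \<Rightarrow> complex \<Rightarrow> complex" +
  fixes \<kappa> \<delta> r :: "nat \<Rightarrow> real"
  assumes B_Schwarz: "\<And>n z. cmod z < 1 \<Longrightarrow> cmod (B n z) \<le> cmod z"
    and B_near: "\<And>n z. cmod z < 1 \<Longrightarrow> cmod (B n z + z) \<le> 2 * \<kappa> n / (1 - cmod z)"
    and \<kappa>_nonneg: "\<And>n. 0 \<le> \<kappa> n"
    and r: "\<And>n. 0 \<le> r n" "\<And>n. r n < 1"
    and \<kappa>_small: "\<And>i n. i \<le> n \<Longrightarrow> 2 * \<kappa> n / (1 - r i) \<le> (1/2)^(n + 4)"
    and \<delta>: "\<And>n. 0 < \<delta> n" "\<delta> \<longlonglongrightarrow> 0"
begin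

lemma blocks_Schwarz: "cmod z < 1 \<Longrightarrow> cmod (blocks k d z) \<le> cmod z"
proof (induction d)
  case (Suc d)
  then have "cmod (blocks k d z) < 1" using blocks_ball[of z k d] by simp
  from B_Schwarz[OF this, of "k + d"] Suc show ?case by simp
qed simp

text \<open>The sign \<open>(-1)^(k + d)\<close> and not \<open>(-1)^d\<close>: thus the limits for different \<open>k\<close> are compatible,
  as in \<open>limit_map_Suc\<close>.\<close>

definition signed_blocks :: "nat \<Rightarrow> nat \<Rightarrow> complex \<Rightarrow> complex" where
  "signed_blocks k d z = (-1)^(k + d) * blocks k d z"

definition limit_map :: "nat \<Rightarrow> complex \<Rightarrow> complex" where
  "limit_map k z = lim (\<lambda>d. signed_blocks k d z)"

text \<open>Adding one more block changes \<open>signed_blocks\<close> by \<open>\<bar>B w + w\<bar>\<close> at a point \<open>w\<close> that, by the Schwarz lemma,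
  still lies in the disk of radius \<open>\<rho>\<close>.\<close>

lemma limit_map_approx_gen:
  assumes z: "cmod z \<le> \<rho>" "\<rho> < 1" and M: "\<And>i. k \<le> i \<Longrightarrow> 2 * \<kappa> i / (1 - \<rho>) \<le> M * (1/2)^i"
  shows "convergent (\<lambda>d. signed_blocks k d z)" "cmod (limit_map k z - signed_blocks k d z) \<le> 2 * M * (1/2)^(k + d)"
proof -
  have inc: "cmod (signed_blocks k (Suc d) z - signed_blocks k d z) \<le> M * (1/2)^k * (1/2)^d" for d
  proof -
    define w where "w = blocks k d z"
    have w: "cmod w \<le> \<rho>" "cmod w < 1" using blocks_Schwarz[of z k d] z by (auto simp: w_def)
    have "signed_blocks k (Suc d) z - signed_blocks k d z = (-1)^(k+d) * - (B (k + d) w + w)"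
      by (simp add: signed_blocks_def w_def algebra_simps)
    then have "cmod (signed_blocks k (Suc d) z - signed_blocks k d z) = cmod (B (k + d) w + w)"
      by (simp only: norm_mult norm_power norm_minus_cancel norm_one power_one mult_1)
    also have "\<dots> \<le> 2 * \<kappa> (k + d) / (1 - cmod w)" by (rule B_near[OF w(2)])
    also have "\<dots> \<le> 2 * \<kappa> (k + d) / (1 - \<rho>)" using w z \<kappa>_nonneg[of "k + d"] by (intro divide_left_mono) auto
    also have "\<dots> \<le> M * (1/2)^(k + d)" by (rule M) simp
    finally show ?thesis by (simp add: power_add mult.assoc)
  qed
  show "convergent (\<lambda>d. signed_blocks k d z)" by (rule geometric_increments_limit(1)[OF inc])
  show "cmod (limit_map k z - signed_blocks k d z) \<le> 2 * M * (1/2)^(k + d)"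
    using geometric_increments_limit(2)[OF inc, of d] by (simp add: limit_map_def power_add mult_ac)
qed

lemma \<kappa>_bound: "\<rho> < 1 \<Longrightarrow> 2 * \<kappa> i / (1 - \<rho>) \<le> (1 / (16 * (1 - \<rho>))) * (1/2)^i"
proof -
  assume \<rho>: "\<rho> < 1"
  have "2 * \<kappa> i \<le> 2 * \<kappa> i / (1 - r 0)"
    using \<kappa>_nonneg[of i] r[of 0] by (simp add: le_divide_eq mult_left_le)
  also have "\<dots> \<le> (1/2)^(i + 4)" by (rule \<kappa>_small) simp
  also have "\<dots> = (1/2)^i / 16" by (simp add: power_add power_divide)
  finally have "2 * \<kappa> i \<le> (1/2)^i / 16" .
  then have "2 * \<kappa> i / (1 - \<rho>) \<le> ((1/2)^i / 16) / (1 - \<rho>)" using \<rho> by (intro divide_right_mono) auto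
  then show ?thesis by simp
qed

lemma limit_map_approx:
  assumes "cmod z \<le> \<rho>" "\<rho> < 1"
  shows "cmod (limit_map k z - signed_blocks k d z) \<le> (1 / (8 * (1 - \<rho>))) * (1/2)^(k + d)"
proof -
  have "2 * (1 / (16 * (1 - \<rho>))) = 1 / (8 * (1 - \<rho>))" using assms(2) by (simp add: divide_simps)
  then show ?thesis using limit_map_approx_gen(2)[OF assms \<kappa>_bound[OF assms(2)], of k d] by simp
qed

lemma limit_map_lim: "cmod z < 1 \<Longrightarrow> (\<lambda>d. signed_blocks k d z) \<longlonglongrightarrow> limit_map k z"
  using limit_map_approx_gen(1)[OF order_refl _ \<kappa>_bound] unfolding limit_map_def convergent_LIMSEQ_iff .

lemma limit_map_Suc: "z \<in> ball 0 1 \<Longrightarrow> limit_map k z = limit_map (Suc k) (B k z)"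
proof -
  assume z: "z \<in> ball 0 1"
  have "(\<lambda>d. signed_blocks k (Suc d) z) \<longlonglongrightarrow> limit_map k z" using limit_map_lim[of z k] z by (intro LIMSEQ_Suc) simp
  moreover have "(\<lambda>d. signed_blocks (Suc k) d (B k z)) \<longlonglongrightarrow> limit_map (Suc k) (B k z)"
    using limit_map_lim[of "B k z" "Suc k"] B_in_ball[OF z, of k] by simp
  moreover have "signed_blocks k (Suc d) z = signed_blocks (Suc k) d (B k z)" for d
    unfolding signed_blocks_def blocks_Suc' by simp
  ultimately show ?thesis using LIMSEQ_unique by simp
qed

lemma limit_map_blocks: "z \<in> ball 0 1 \<Longrightarrow> limit_map k z = limit_map (k + d) (blocks k d z)"
  by (induction d) (use limit_map_Suc blocks_ball in auto)

lemma limit_map_ball: "z \<in> ball 0 1 \<Longrightarrow> limit_map k z \<in> ball 0 1"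
proof -
  assume z: "z \<in> ball 0 1"
  have "cmod (limit_map k z) \<le> cmod z"
  proof (rule LIMSEQ_le_const2[OF tendsto_norm[OF limit_map_lim]])
    show "\<exists>N. \<forall>d\<ge>N. cmod (signed_blocks k d z) \<le> cmod z"
      using blocks_Schwarz z by (auto simp: signed_blocks_def norm_mult norm_power)
  qed (use z in simp)
  then show ?thesis using z by simp
qed

lemma limit_map_0: "limit_map k 0 = 0"
proof -
  have "cmod (limit_map k 0) \<le> cmod 0"
  proof (rule LIMSEQ_le_const2[OF tendsto_norm[OF limit_map_lim]])
    show "\<exists>N. \<forall>d\<ge>N. cmod (signed_blocks k d 0) \<le> cmod 0"
      using blocks_Schwarz[of 0] by (auto simp: signed_blocks_def norm_mult norm_power)
  qed simp
  then show ?thesis by simp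
qed

lemma limit_map_uniform_limit:
  assumes "compact K" "K \<subseteq> ball 0 1"
  shows "uniform_limit K (signed_blocks k) (limit_map k) sequentially"
proof -
  obtain \<rho> where \<rho>: "\<rho> < 1" "\<And>z. z \<in> K \<Longrightarrow> cmod z \<le> \<rho>"
  proof (cases "K = {}")
    case True then show thesis using that[of 0] by simp
  next
    case False
    then obtain x where "x \<in> K" "\<And>z. z \<in> K \<Longrightarrow> cmod z \<le> cmod x"
      using continuous_attains_sup[OF assms(1) False continuous_on_norm[OF continuous_on_id]] by auto
    then show thesis using that[of "cmod x"] assms(2) by auto
  qed
  have lim: "(\<lambda>d. (1 / (8 * (1 - \<rho>))) * (1/2)^(k + d)) \<longlonglongrightarrow> (1 / (8 * (1 - \<rho>))) * (1/2)^k * 0"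
    unfolding power_add mult.assoc[symmetric] by (intro tendsto_intros LIMSEQ_power_zero) simp
  show ?thesis
  proof (rule uniform_limitI)
    fix e :: real assume "0 < e"
    then have "\<forall>\<^sub>F d in sequentially. (1 / (8 * (1 - \<rho>))) * (1/2)^(k + d) < e"
      using order_tendstoD(2)[OF lim] by simp
    then show "\<forall>\<^sub>F d in sequentially. \<forall>z\<in>K. dist (signed_blocks k d z) (limit_map k z) < e"
    proof eventually_elim
      case (elim d)
      show ?case
      proof
        fix z assume "z \<in> K"
        from limit_map_approx[OF \<rho>(2)[OF this] \<rho>(1), of k d] elim
        show "dist (signed_blocks k d z) (limit_map k z) < e" by (simp add: dist_norm norm_minus_commute)
      qed
    qed
  qed
qed

lemma signed_blocks_hol: "signed_blocks k d holomorphic_on ball 0 1"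
  unfolding signed_blocks_def by (intro holomorphic_intros blocks_hol)

lemma limit_map_hol: "limit_map k holomorphic_on ball 0 1"
proof (rule holomorphic_uniform_sequence[OF open_ball signed_blocks_hol])
  fix x :: complex assume "x \<in> ball 0 1"
  then obtain d where "d > 0" "cball x d \<subseteq> ball 0 1"
    using open_contains_cball[THEN iffD1, OF open_ball] by blast
  then show "\<exists>d>0. cball x d \<subseteq> ball 0 1 \<and> uniform_limit (cball x d) (signed_blocks k) (limit_map k) sequentially"
    by (intro exI[of _ d] conjI limit_map_uniform_limit compact_cball)
qed

text \<open>Hurwitz's theorem; the limit is not constant since it is close to \<open>z \<mapsto> \<plusminus> z\<close>.\<close>

lemma limit_map_inj: "inj_on (limit_map k) (ball 0 1)"
proof (rule Hurwitz_injective[OF open_ball connected_ball signed_blocks_hol limit_map_hol limit_map_uniform_limit])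
  show "\<not> limit_map k constant_on ball 0 1"
  proof
    assume "limit_map k constant_on ball 0 1"
    moreover have "(1/2::complex) \<in> ball 0 1" "(0::complex) \<in> ball 0 1"
      by (auto simp: norm_divide)
    ultimately have "limit_map k (1/2) = limit_map k 0" unfolding constant_on_def by force
    then have "cmod (limit_map k (1/2) - signed_blocks k 0 (1/2)) = 1/2" 
      by (simp add: limit_map_0 signed_blocks_def norm_mult norm_power norm_divide)
    moreover have "cmod (limit_map k (1/2) - signed_blocks k 0 (1/2)) \<le> 1/4 * (1/2)^k"
      using limit_map_approx[of "1/2" "1/2" k 0] by (simp add: norm_divide)
    moreover have "(1/2::real)^k \<le> 1" by (rule power_le_one) auto
    ultimately show False by linarith
  qed
  show "inj_on (signed_blocks k d) (ball 0 1)" for d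
  proof -
    have "inj_on (blocks k d) (ball 0 1)" by (rule inj_on_subset[OF blocks_inj]) auto
    then show ?thesis unfolding signed_blocks_def inj_on_def by auto
  qed
qed auto

text \<open>The images of the limit maps exhaust the disk, because \<open>limit_map k\<close> approaches \<open>z \<mapsto> \<plusminus> z\<close> as \<open>k\<close> grows.\<close>

lemma limit_map_cover:
  assumes \<rho>: "0 \<le> \<rho>" "\<rho> < 1"
  shows "\<exists>s K. 0 < s \<and> s < 1 \<and> (\<forall>k\<ge>K. cball 0 \<rho> \<subseteq> limit_map k ` ball 0 s)"
proof -
  define s where "s = (1 + \<rho>) / 2"
  have s: "0 < s" "s < 1" "\<rho> < s" using \<rho> by (auto simp: s_def)
  have lim: "(\<lambda>k. (1 / (8 * (1 - s))) * (1/2)^k) \<longlonglongrightarrow> (1 / (8 * (1 - s))) * 0"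
    by (intro tendsto_intros LIMSEQ_power_zero) simp
  have "\<forall>\<^sub>F k in sequentially. (1 / (8 * (1 - s))) * (1/2)^k < s - \<rho>"
    using order_tendstoD(2)[OF lim] s by simp
  then obtain K where K: "\<And>k. k \<ge> K \<Longrightarrow> (1 / (8 * (1 - s))) * (1/2)^k < s - \<rho>"
    unfolding eventually_sequentially by blast
  have "cball 0 \<rho> \<subseteq> limit_map k ` ball 0 s" if "k \<ge> K" for k
  proof (rule ball_covered_by_perturbation[OF limit_map_hol limit_map_inj limit_map_0 \<rho>(1) s(1,2)])
    fix z assume z: "cmod z = s"
    have "cmod (limit_map k z - signed_blocks k 0 z) < s - \<rho>" using limit_map_approx[of z s k 0] K[OF that] z s by simp
    moreover have "cmod (signed_blocks k 0 z) = s" using z by (simp add: signed_blocks_def norm_mult norm_power)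
    ultimately show "\<rho> < cmod (limit_map k z)" using norm_triangle_ineq2[of "signed_blocks k 0 z" "limit_map k z"] by (simp add: norm_minus_commute)
  qed
  then show ?thesis using s by blast
qed

context
  fixes e :: "nat \<Rightarrow> complex \<Rightarrow> complex"
  assumes e_hol: "\<And>k. e k holomorphic_on ball 0 1" and e_inj: "\<And>k. inj_on (e k) (ball 0 1)"
    and e_Suc: "\<And>k z. z \<in> ball 0 1 \<Longrightarrow> e k z = e (Suc k) (B k z)"
begin

lemma e_blocks: "z \<in> ball 0 1 \<Longrightarrow> e k z = e (k + d) (blocks k d z)"
  by (induction d) (use e_Suc blocks_ball in auto)

text \<open>On the image of \<open>limit_map k\<close> set \<open>F = e k \<circ> (limit_map k)\<^sup>-\<^sup>1\<close>. The chain relations make these definitions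
  agree, and the images exhaust the disk.\<close>

lemma factor_exists:
  obtains F where "F holomorphic_on ball 0 1" "inj_on F (ball 0 1)"
    "\<And>k z. z \<in> ball 0 1 \<Longrightarrow> F (limit_map k z) = e k z"
proof -
  have ex: "\<exists>k. w \<in> limit_map k ` ball 0 1" if w: "w \<in> ball 0 1" for w
  proof -
    obtain s K where "0 < s" "s < 1" "\<forall>k\<ge>K. cball 0 (cmod w) \<subseteq> limit_map k ` ball 0 s"
      using limit_map_cover[of "cmod w"] w by auto
    then have "cball 0 (cmod w) \<subseteq> limit_map K ` ball 0 s" by blast
    then have "w \<in> limit_map K ` ball 0 s" by (rule subsetD) simp
    then show ?thesis using \<open>s < 1\<close> by force
  qed
  have cons: "e k z = e k' z'" if "z \<in> ball 0 1" "z' \<in> ball 0 1" "limit_map k z = limit_map k' z'" for k z k' z'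
  proof -
    define n where "n = max k k'"
    have n: "n = k + (n - k)" "n = k' + (n - k')" by (auto simp: n_def)
    have "limit_map n (blocks k (n - k) z) = limit_map n (blocks k' (n - k') z')"
      using that limit_map_blocks[of z k "n - k"] limit_map_blocks[of z' k' "n - k'"] n by simp
    then have "blocks k (n - k) z = blocks k' (n - k') z'"
      using limit_map_inj blocks_ball that by (meson inj_onD)
    then show ?thesis using e_blocks[OF that(1), of k "n - k"] e_blocks[OF that(2), of k' "n - k'"] n by simp
  qed
  define F where "F w = (SOME v. \<exists>k. \<exists>z\<in>ball 0 1. limit_map k z = w \<and> v = e k z)" for w
  have F: "F (limit_map k z) = e k z" if "z \<in> ball 0 1" for k z
    unfolding F_def by (rule some_equality) (use that cons in blast)+
  show thesis
  proof (rule that)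
    show "F (limit_map k z) = e k z" if "z \<in> ball 0 1" for k z by (rule F[OF that])
    show "F holomorphic_on ball 0 1"
    proof (rule holomorphic_on_subset)
      show "F holomorphic_on (\<Union>k. limit_map k ` ball 0 1)"
      proof (rule holomorphic_on_UN_open)
        fix k
        show "open (limit_map k ` ball 0 1)" by (rule open_mapping_thm3[OF limit_map_hol open_ball limit_map_inj])
        obtain g where g: "g holomorphic_on limit_map k ` ball 0 1" "\<And>z. z \<in> ball 0 1 \<Longrightarrow> g (limit_map k z) = z"
          using holomorphic_has_inverse[OF limit_map_hol open_ball limit_map_inj] by metis
        have "(e k \<circ> g) holomorphic_on limit_map k ` ball 0 1"
          by (rule holomorphic_on_compose_gen[OF g(1) e_hol]) (use g(2) in auto)
        then show "F holomorphic_on limit_map k ` ball 0 1"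
          by (rule holomorphic_transform) (use g(2) F in auto)
      qed
      show "ball 0 1 \<subseteq> (\<Union>k. limit_map k ` ball 0 1)" using ex by blast
    qed
    show "inj_on F (ball 0 1)"
    proof (rule inj_onI)
      fix v w assume vw: "v \<in> ball 0 1" "w \<in> ball 0 1" "F v = F w"
      obtain s K where sK: "0 < s" "s < 1" "\<forall>k\<ge>K. cball 0 (max (cmod v) (cmod w)) \<subseteq> limit_map k ` ball 0 s"
        using limit_map_cover[of "max (cmod v) (cmod w)"] vw by (auto simp: le_max_iff_disj)
      have sub: "cball 0 (max (cmod v) (cmod w)) \<subseteq> limit_map K ` ball 0 s" using sK(3) by blast
      have "v \<in> limit_map K ` ball 0 s" "w \<in> limit_map K ` ball 0 s" by (rule subsetD[OF sub]; simp)+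
      then obtain x y where "x \<in> ball 0 s" "v = limit_map K x" "y \<in> ball 0 s" "w = limit_map K y" by blast
      then have "x \<in> ball 0 1" "y \<in> ball 0 1" "v = limit_map K x" "w = limit_map K y" using sK(2) by auto
      then show "v = w" using F vw(3) e_inj by (metis inj_onD)
    qed
  qed
qed

text \<open>Fix \<open>n > k\<close>. Where \<open>\<eta>\<close> crosses the circle of radius \<open>\<delta> n\<close> about \<open>1\<close>, the blocks before the \<open>n\<close>-th move it to a point
  near \<open>1\<close> of modulus at most \<open>r n\<close>, and there \<open>limit_map n\<close> is nearly \<open>(-1)^n\<close> times the identity. So the curve
  \<open>E = limit_map k \<circ> \<eta>\<close> visits neighbourhoods of \<open>1\<close> and \<open>-1\<close> in turn, and \<open>e k \<circ> \<eta> = F \<circ> E\<close>.\<close>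

theorem no_limit_at_1:
  fixes \<eta> :: "real \<Rightarrow> complex"
  assumes cross: "\<And>k n z. k < n \<Longrightarrow> z \<in> cball 0 1 \<Longrightarrow> cmod (z - 1) = \<delta> n \<Longrightarrow>
        cmod (blocks k (n - k) z - 1) \<le> 1/4 \<and> cmod (blocks k (n - k) z) \<le> r n"
    and cont: "continuous_on {0<..<1} \<eta>" and \<eta>: "\<And>x. x \<in> {0<..<1} \<Longrightarrow> \<eta> x \<in> ball 0 1"
    and lim: "(\<eta> \<longlongrightarrow> 1) (at_left 1)"
  shows "\<not> limitin riemann_sphere (\<lambda>x. Some (e k (\<eta> x))) A (at_left 1)"
proof -
  obtain F where F: "F holomorphic_on ball 0 1" "inj_on F (ball 0 1)"
    "\<And>k z. z \<in> ball 0 1 \<Longrightarrow> F (limit_map k z) = e k z" using factor_exists by metis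
  define E where "E x = limit_map k (\<eta> x)" for x
  have contE: "continuous_on {0<..<1} E" unfolding E_def
    by (rule continuous_on_compose2[OF holomorphic_on_imp_continuous_on[OF limit_map_hol] cont]) (use \<eta> in blast)
  have E: "E x \<in> ball 0 1" if "x \<in> {0<..<1}" for x unfolding E_def by (rule limit_map_ball[OF \<eta>[OF that]])
  have ev01: "\<forall>\<^sub>F x in at_left (1::real). x \<in> {0<..<1}"
    using eventually_at_left_real[of 0 "1::real"] by simp
  \<comment> \<open>A disk of radius \<open>\<rho>\<close> is covered by the image under \<open>limit_map (k + K)\<close> of a disk of radius \<open>s < 1\<close>, while
    \<open>blocks k K \<circ> \<eta>\<close> tends to \<open>1\<close> and so leaves that smaller disk; by injectivity \<open>E\<close> leaves the
    disk of radius \<open>\<rho>\<close>.\<close>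
  have limE: "((\<lambda>x. cmod (E x)) \<longlongrightarrow> 1) (at_left 1)"
  proof (rule order_tendstoI)
    fix a :: real assume "a > 1"
    show "\<forall>\<^sub>F x in at_left 1. cmod (E x) < a" using ev01
      by eventually_elim (use E \<open>a > 1\<close> in force)
  next
    fix a :: real assume "a < 1"
    define \<rho> where "\<rho> = max a 0"
    have \<rho>: "0 \<le> \<rho>" "\<rho> < 1" "a \<le> \<rho>" using \<open>a < 1\<close> by (auto simp: \<rho>_def)
    obtain s K where sK: "0 < s" "s < 1" "\<And>k. k \<ge> K \<Longrightarrow> cball 0 \<rho> \<subseteq> limit_map k ` ball 0 s"
      using limit_map_cover[OF \<rho>(1,2)] by blast
    have "((\<lambda>x. blocks k K (\<eta> x)) \<longlongrightarrow> blocks k K 1) (at_left 1)"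
    proof (rule continuous_on_tendsto_compose[OF blocks_cont lim])
      show "\<forall>\<^sub>F x in at_left 1. \<eta> x \<in> cball 0 1"
        using ev01 by eventually_elim (use \<eta> in force)
    qed simp
    then have "((\<lambda>x. cmod (blocks k K (\<eta> x))) \<longlongrightarrow> 1) (at_left 1)"
      using tendsto_norm blocks_1 by fastforce
    then have "\<forall>\<^sub>F x in at_left 1. s < cmod (blocks k K (\<eta> x))" using order_tendstoD(1) sK(2) by blast
    then show "\<forall>\<^sub>F x in at_left 1. a < cmod (E x)" using ev01
    proof eventually_elim
      case (elim x)
      have b: "blocks k K (\<eta> x) \<in> ball 0 1" by (rule blocks_ball[OF \<eta>[OF elim(2)]])
      show ?case
      proof (rule ccontr)
        assume "\<not> ?thesis"
        then have "E x \<in> cball 0 \<rho>" using \<rho> by simp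
        then obtain z where z: "z \<in> ball 0 s" "E x = limit_map (k + K) z" using sK(3)[of "k + K"] by auto
        have "limit_map (k + K) (blocks k K (\<eta> x)) = limit_map (k + K) z"
          using z(2) limit_map_blocks[OF \<eta>[OF elim(2)], of k K] by (simp add: E_def)
        moreover have "z \<in> ball 0 1" using z(1) sK(2) by simp
        ultimately have "blocks k K (\<eta> x) = z" using inj_onD[OF limit_map_inj _ b] by blast
        then show False using z(1) elim(1) by simp
      qed
    qed
  qed
  have near: "cmod (E x - (-1)^n) \<le> 1/2" if x: "x \<in> {0<..<1}" "k < n" "cmod (\<eta> x - 1) = \<delta> n" for x n
  proof -
    define w where "w = blocks k (n - k) (\<eta> x)"
    have w: "cmod (w - 1) \<le> 1/4" "cmod w \<le> r n" using cross[OF x(2) _ x(3)] \<eta>[OF x(1)] by (auto simp: w_def)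
    have EY: "E x = limit_map n w" using limit_map_blocks[OF \<eta>[OF x(1)], of k "n - k"] x(2) by (simp add: E_def w_def)
    have M: "2 * \<kappa> i / (1 - r n) \<le> (1/16) * (1/2)^i" if "n \<le> i" for i
      using \<kappa>_small[OF that] by (simp add: power_add power_divide)
    have "cmod (limit_map n w - signed_blocks n 0 w) \<le> 2 * (1/16) * (1/2)^(n + 0)"
      by (rule limit_map_approx_gen(2)[OF w(2) r(2) M])
    also have "\<dots> \<le> 1/8" using power_le_one[of "1/2::real" n] by simp
    finally have "cmod (E x - (-1)^n * w) \<le> 1/8" by (simp add: EY signed_blocks_def)
    moreover have "cmod ((-1)^n * w - (-1)^n) \<le> 1/4"
    proof -
      have "(-1)^n * w - (-1)^n = (-1)^n * (w - 1)" by (simp add: algebra_simps)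
      then show ?thesis using w(1) by (simp add: norm_mult norm_power)
    qed
    ultimately show ?thesis using norm_triangle_ineq[of "E x - (-1)^n * w" "(-1)^n * w - (-1)^n"] by simp
  qed
  have hit: "\<exists>N. \<forall>n\<ge>N. \<exists>x. X < x \<and> 0 < x \<and> x < 1 \<and> cmod (E x - (-1)^n) \<le> 1/2" if X: "X < 1" for X
  proof -
    define x0 where "x0 = (max X 0 + 1) / 2"
    have x0: "X < x0" "0 < x0" "x0 < 1" using X by (auto simp: x0_def)
    have d0: "0 < cmod (\<eta> x0 - 1)" using \<eta>[of x0] x0 by auto
    have "\<forall>\<^sub>F n in sequentially. \<delta> n < cmod (\<eta> x0 - 1)" using order_tendstoD(2)[OF \<delta>(2) d0] .
    then obtain N where N: "\<And>n. n \<ge> N \<Longrightarrow> \<delta> n < cmod (\<eta> x0 - 1)" unfolding eventually_sequentially by blast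
    show ?thesis
    proof (rule exI[of _ "max N (Suc k)"], intro allI impI)
      fix n assume n: "max N (Suc k) \<le> n"
      have l0: "((\<lambda>x. cmod (\<eta> x - 1)) \<longlongrightarrow> 0) (at_left 1)"
        using tendsto_norm[OF tendsto_diff[OF lim tendsto_const[of 1]]] by simp
      have "\<forall>\<^sub>F x in at_left 1. cmod (\<eta> x - 1) < \<delta> n \<and> x0 < x \<and> x < 1"
        using order_tendstoD(2)[OF l0 \<delta>(1)[of n]] eventually_at_left_real[OF x0(3)]
        by eventually_elim simp
      then obtain x1 where x1: "cmod (\<eta> x1 - 1) < \<delta> n" "x0 < x1" "x1 < 1"
        using eventually_happens trivial_limit_at_left_real by blast
      have c: "continuous_on {x0..x1} (\<lambda>x. cmod (\<eta> x - 1))"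
        by (intro continuous_intros continuous_on_subset[OF cont]) (use x0 x1 in auto)
      obtain x where x: "x0 \<le> x" "x \<le> x1" "cmod (\<eta> x - 1) = \<delta> n"
        using IVT2'[of "\<lambda>x. cmod (\<eta> x - 1)" x1 "\<delta> n" x0] x1 N[of n] n c by auto
      show "\<exists>x. X < x \<and> 0 < x \<and> x < 1 \<and> cmod (E x - (-1)^n) \<le> 1/2"
        using near[of x n] x x0 x1 n by (intro exI[of _ x]) auto
    qed
  qed
  have n1: "\<exists>x. X < x \<and> 0 < x \<and> x < 1 \<and> cmod (E x - 1) \<le> 1 / 2" if X: "X < 1" for X
  proof -
    obtain N where "\<And>n. n \<ge> N \<Longrightarrow> \<exists>x. X < x \<and> 0 < x \<and> x < 1 \<and> cmod (E x - (-1)^n) \<le> 1/2" using hit[OF X] by blast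
    from this[of "2 * N"] show ?thesis by simp
  qed
  have n2: "\<exists>x. X < x \<and> 0 < x \<and> x < 1 \<and> cmod (E x + 1) \<le> 1 / 2" if X: "X < 1" for X
  proof -
    obtain N where "\<And>n. n \<ge> N \<Longrightarrow> \<exists>x. X < x \<and> 0 < x \<and> x < 1 \<and> cmod (E x - (-1)^n) \<le> 1/2" using hit[OF X] by blast
    from this[of "2 * N + 1"] show ?thesis by simp
  qed
  have notE: "\<not> limitin riemann_sphere (\<lambda>x. Some (F (E x))) A (at_left 1)"
    by (rule oscillating_curve_no_limit[OF F(1,2) contE E limE n1 n2])
  have "\<forall>\<^sub>F x in at_left 1. Some (F (E x)) = Some (e k (\<eta> x))"
    using ev01 by eventually_elim (use F(3) \<eta> in \<open>auto simp: E_def\<close>)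
  then have ev: "\<forall>\<^sub>F x in at_left 1. Some (e k (\<eta> x)) = Some (F (E x))" by eventually_elim simp
  show ?thesis
  proof
    assume "limitin riemann_sphere (\<lambda>x. Some (e k (\<eta> x))) A (at_left 1)"
    from limitin_transform_eventually[OF ev this] notE show False by blast
  qed
qed

end

end

section \<open>The square root flow of the half-plane\<close>

text \<open>The branch of \<open>sqrt (u\<^sup>2 - 2 a)\<close> with values in the upper half-plane, which is the time-\<open>a\<close> map of the flow \<open>w' = - 1 / w\<close>.\<close>

definition uhp_root :: "real \<Rightarrow> complex \<Rightarrow> complex" where
  "uhp_root a u = \<i> * csqrt (of_real (2 * a) - u\<^sup>2)"

lemma uhp_slit:
  assumes "Im u > 0" "0 \<le> a"
  shows "of_real (2 * a) - u\<^sup>2 \<notin> \<real>\<^sub>\<le>\<^sub>0"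
proof
  assume "of_real (2 * a) - u\<^sup>2 \<in> \<real>\<^sub>\<le>\<^sub>0"
  then have "Re u * Im u = 0" and le: "2 * a - ((Re u)\<^sup>2 - (Im u)\<^sup>2) \<le> 0"
    by (auto simp: complex_nonpos_Reals_iff Re_power2 Im_power2)
  with assms have "Re u = 0" by simp
  with le have "2 * a + (Im u)\<^sup>2 \<le> 0" by simp
  moreover have "(Im u)\<^sup>2 > 0" using assms by simp
  ultimately show False using assms by linarith
qed

lemma uhp_root_sq: "(uhp_root a u)\<^sup>2 = u\<^sup>2 - of_real (2 * a)"
  by (simp add: uhp_root_def power_mult_distrib)

lemma uhp_root_pos:
  assumes "Im u > 0" "0 \<le> a"
  shows "Im (uhp_root a u) > 0"
proof -
  define w where "w = csqrt (of_real (2 * a) - u\<^sup>2)"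
  have "Re w \<noteq> 0"
  proof
    assume "Re w = 0"
    then have "w\<^sup>2 = of_real (- ((Im w)\<^sup>2))" by (simp add: complex_eq_iff Re_power2 Im_power2)
    moreover have "w\<^sup>2 = of_real (2 * a) - u\<^sup>2" unfolding w_def by (rule power2_csqrt)
    ultimately have "of_real (2 * a) - u\<^sup>2 = of_real (- ((Im w)\<^sup>2))" by simp
    then have "of_real (2 * a) - u\<^sup>2 \<in> \<real>\<^sub>\<le>\<^sub>0"
      by (simp only: nonpos_Reals_of_real_iff) simp
    then show False using uhp_slit[OF assms] by simp
  qed
  moreover have "Re w \<ge> 0" unfolding w_def by (rule Re_csqrt)
  ultimately show ?thesis by (simp add: uhp_root_def w_def)
qed

lemma uhp_root_unique:
  assumes "Im u > 0" "0 \<le> a" "w\<^sup>2 = u\<^sup>2 - of_real (2 * a)" "Im w > 0"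
  shows "uhp_root a u = w"
proof -
  have "(uhp_root a u)\<^sup>2 = w\<^sup>2" by (simp add: uhp_root_sq assms)
  then have "uhp_root a u = w \<or> uhp_root a u = - w" by (simp add: power2_eq_iff)
  then show ?thesis using uhp_root_pos[OF assms(1,2)] assms(4) by auto
qed

lemma uhp_root_0: "Im u > 0 \<Longrightarrow> uhp_root 0 u = u"
  by (rule uhp_root_unique) auto

lemma uhp_root_add:
  assumes "Im u > 0" "0 \<le> a" "0 \<le> b"
  shows "uhp_root b (uhp_root a u) = uhp_root (a + b) u"
  using assms by (intro uhp_root_unique) (auto simp: uhp_root_sq uhp_root_pos algebra_simps)

lemma uhp_root_scale:
  assumes "Im u > 0" "0 \<le> a" "0 < y"
  shows "uhp_root (a * y\<^sup>2) (of_real y * u) = of_real y * uhp_root a u"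
  using assms by (intro uhp_root_unique) (auto simp: uhp_root_sq uhp_root_pos power_mult_distrib algebra_simps)

lemma uhp_root_Im_ge:
  assumes "Im u > 0" "0 \<le> a"
  shows "Im u \<le> Im (uhp_root a u)" "0 < a \<Longrightarrow> Im u < Im (uhp_root a u)"
proof -
  define p q x y where "p = Re (uhp_root a u)" "q = Im (uhp_root a u)" "x = Re u" "y = Im u"
  have q: "q > 0" "y > 0" using uhp_root_pos[OF assms] assms by (auto simp: p_q_x_y_def)
  have e1: "p * q = x * y"
    using arg_cong[OF uhp_root_sq[of a u], of Im] by (simp add: p_q_x_y_def Im_power2)
  have e2: "p\<^sup>2 - q\<^sup>2 = x\<^sup>2 - y\<^sup>2 - 2 * a"
    using arg_cong[OF uhp_root_sq[of a u], of Re] by (simp add: p_q_x_y_def Re_power2)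
  have key: "(q\<^sup>2 - y\<^sup>2) * (q\<^sup>2 + x\<^sup>2) = 2 * a * q\<^sup>2"
  proof -
    have "p\<^sup>2 * q\<^sup>2 = x\<^sup>2 * y\<^sup>2" using e1 by (metis power_mult_distrib)
    moreover have "p\<^sup>2 * q\<^sup>2 = (q\<^sup>2 + x\<^sup>2 - y\<^sup>2 - 2 * a) * q\<^sup>2" 
    proof -
      have "p\<^sup>2 = q\<^sup>2 + x\<^sup>2 - y\<^sup>2 - 2 * a" using e2 by linarith
      then show ?thesis by simp
    qed
    ultimately show ?thesis by (simp add: algebra_simps)
  qed
  have pos: "q\<^sup>2 + x\<^sup>2 > 0" using q by (simp add: add_pos_nonneg)
  have "0 \<le> (q\<^sup>2 - y\<^sup>2) * (q\<^sup>2 + x\<^sup>2)" unfolding key using assms(2) by simp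
  then have "y\<^sup>2 \<le> q\<^sup>2" using pos by (simp add: zero_le_mult_iff)
  then have "y \<le> q" by (rule power2_le_imp_le) (use q in simp)
  then show "Im u \<le> Im (uhp_root a u)" by (simp add: p_q_x_y_def)
  assume "0 < a"
  then have "0 < (q\<^sup>2 - y\<^sup>2) * (q\<^sup>2 + x\<^sup>2)" unfolding key using q by simp
  then have "y\<^sup>2 < q\<^sup>2" using pos by (simp add: zero_less_mult_iff)
  then have "y < q" by (rule power2_less_imp_less) (use q in simp)
  then show "Im u < Im (uhp_root a u)" by (simp add: p_q_x_y_def)
qed

lemma uhp_root_diff:
  assumes "Im u > 0" "0 \<le> a"
  shows "(uhp_root a u - u) * (uhp_root a u + u) = - of_real (2 * a)" "uhp_root a u + u \<noteq> 0"
    "cmod (uhp_root a u - u) \<le> a / Im u"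
proof -
  show 1: "(uhp_root a u - u) * (uhp_root a u + u) = - of_real (2 * a)"
    using uhp_root_sq[of a u] by (simp add: power2_eq_square algebra_simps)
  have I: "2 * Im u \<le> Im (uhp_root a u + u)" using uhp_root_Im_ge[OF assms] by simp
  then show "uhp_root a u + u \<noteq> 0" using assms(1) by (metis add_pos_pos mult_2 not_le zero_complex.simps(2))
  have c: "2 * Im u \<le> cmod (uhp_root a u + u)" using I abs_Im_le_cmod[of "uhp_root a u + u"] by linarith
  have "cmod (uhp_root a u - u) * (2 * Im u) \<le> cmod (uhp_root a u - u) * cmod (uhp_root a u + u)"
    using c by (intro mult_left_mono) auto
  also have "\<dots> = 2 * a" using 1 assms by (metis norm_minus_cancel norm_mult norm_of_real abs_of_nonneg mult_nonneg_nonneg zero_le_numeral)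
  finally show "cmod (uhp_root a u - u) \<le> a / Im u" using assms by (simp add: field_simps)
qed

lemma uhp_root_holomorphic: "0 \<le> a \<Longrightarrow> uhp_root a holomorphic_on {u. Im u > 0}"
  unfolding uhp_root_def by (intro holomorphic_intros) (use uhp_slit in auto)

lemma uhp_root_inj: 
  assumes "0 \<le> a" shows "inj_on (uhp_root a) {u. Im u > 0}"
proof (rule inj_onI)
  fix u v assume uv: "u \<in> {u. Im u > 0}" "v \<in> {u. Im u > 0}" and eq: "uhp_root a u = uhp_root a v"
  have "u\<^sup>2 = v\<^sup>2" using uhp_root_sq[of a u] uhp_root_sq[of a v] eq by simp
  then have "u = v \<or> u = - v" by (simp add: power2_eq_iff)
  then show "u = v" using uv by auto
qed

lemma uhp_root_has_field_derivative:
  assumes "Im u > 0" "0 \<le> a"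
  shows "(uhp_root a has_field_derivative u / uhp_root a u) (at u)"
proof -
  have *: "uhp_root a u \<noteq> 0" using uhp_root_pos[OF assms] by auto
  then have "csqrt (of_real (2 * a) - u\<^sup>2) \<noteq> 0" by (simp add: uhp_root_def)
  then show ?thesis unfolding uhp_root_def using uhp_slit[OF assms] *
    by (auto intro!: derivative_eq_intros simp: field_simps)
qed

abbreviation closed_uhp :: "complex set" where "closed_uhp \<equiv> {z. 0 \<le> Im z}"
text \<open>The neighbourhoods of infinity in the closed half-plane. All asymptotics are required up to the real
  line, so that maps extend continuously to \<open>1\<close> after passing to the disk.\<close>

abbreviation uhp_infinity :: "complex filter"
  where "uhp_infinity \<equiv> inf at_infinity (principal closed_uhp)"

text \<open>The flow \<open>w' = - 1 / (w - p)\<close> with pole \<open>p = l - \<i> c\<close>, at time \<open>a\<close>. For \<open>c > 0\<close> the closed half-plane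
  stays away from the branch points, and for \<open>a > 0\<close> it is mapped into the open one.\<close>

definition step :: "real \<Rightarrow> real \<Rightarrow> real \<Rightarrow> complex \<Rightarrow> complex" where
  "step l c a z = uhp_root a (z - (of_real l - \<i> * of_real c)) + (of_real l - \<i> * of_real c)"

text \<open>The elements of \<open>half_plane_P0\<close> that are used here, with \<open>a\<close> as the value of \<open>\<ell>\<close>: the bound \<open>a / Im z\<close> gives
  \<open>\<ell> \<le> a\<close>, and the asymptotics at infinity show that it is attained. Continuity and injectivity
  on the closed half-plane are kept track of for the disk algebra and for the boundary extension.\<close>

definition hydrodynamic :: "real \<Rightarrow> (complex \<Rightarrow> complex) \<Rightarrow> bool" where
  "hydrodynamic a G \<longleftrightarrow>
     continuous_on closed_uhp G \<and> inj_on G closed_uhp \<and> G holomorphic_on {z. 0 < Im z} \<and>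
     (\<forall>z\<in>closed_uhp. Im z \<le> Im (G z)) \<and>
     (\<forall>z. 0 < Im z \<longrightarrow> cmod (G z - z) \<le> a / Im z) \<and>
     ((\<lambda>z. z * (G z - z)) \<longlongrightarrow> - of_real a) uhp_infinity"

lemma tendsto_inverse_uhp_infinity: "((\<lambda>z. inverse z) \<longlongrightarrow> (0::complex)) uhp_infinity"
  by (rule tendsto_mono[OF inf_le1 tendsto_inverse_0])

lemma hydrodynamic_diff_tendsto:
  assumes "hydrodynamic a G" shows "((\<lambda>z. G z - z) \<longlongrightarrow> 0) uhp_infinity"
proof -
  have "((\<lambda>z. inverse z * (z * (G z - z))) \<longlongrightarrow> 0 * (- of_real a)) uhp_infinity"
    using assms unfolding hydrodynamic_def by (intro tendsto_mult tendsto_inverse_uhp_infinity) auto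
  moreover have "\<forall>\<^sub>F z in uhp_infinity. inverse z * (z * (G z - z)) = G z - z"
  proof -
    have "\<forall>\<^sub>F z::complex in at_infinity. z \<noteq> 0" 
      unfolding eventually_at_infinity by (rule exI[of _ 1]) auto
    then have "\<forall>\<^sub>F z::complex in uhp_infinity. z \<noteq> 0" by (rule filter_leD[OF inf_le1])
    then show ?thesis by eventually_elim auto
  qed
  ultimately show ?thesis by (simp add: tendsto_cong)
qed

lemma hydrodynamic_uhp_infinity:
  assumes "hydrodynamic a G" shows "filterlim G uhp_infinity uhp_infinity"
proof (rule filterlim_inf[THEN iffD2, OF conjI])
  have "filterlim (\<lambda>z. (G z - z) + z) at_infinity uhp_infinity"
    by (rule tendsto_add_filterlim_at_infinity[OF hydrodynamic_diff_tendsto[OF assms]])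
       (rule filterlim_mono[OF filterlim_ident order_refl inf_le1])
  then show "filterlim G at_infinity uhp_infinity" by simp
  have "\<forall>\<^sub>F z in uhp_infinity. z \<in> closed_uhp"
    by (rule filter_leD[OF inf_le2]) (simp add: eventually_principal)
  then show "filterlim G (principal closed_uhp) uhp_infinity"
    unfolding filterlim_principal
    by eventually_elim (use assms in \<open>auto simp: hydrodynamic_def intro: order_trans\<close>)
qed

lemma hydrodynamic_id: "hydrodynamic 0 (\<lambda>z. z)"
  by (auto simp: hydrodynamic_def)

lemma hydrodynamic_cong:
  assumes "hydrodynamic a G" "\<And>z. 0 \<le> Im z \<Longrightarrow> G z = G' z" shows "hydrodynamic a G'"
proof -
  have 1: "continuous_on closed_uhp G'" "inj_on G' closed_uhp"
    using assms continuous_on_cong[of closed_uhp closed_uhp G G'] inj_on_cong[of closed_uhp G G'] 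
    by (auto simp: hydrodynamic_def)
  have 2: "G' holomorphic_on {z. 0 < Im z}"
    using assms holomorphic_cong[of "{z. 0 < Im z}" "{z. 0 < Im z}" G G'] by (auto simp: hydrodynamic_def)
  have "\<forall>\<^sub>F z in uhp_infinity. z \<in> closed_uhp"
    by (rule filter_leD[OF inf_le2]) (simp add: eventually_principal)
  then have "\<forall>\<^sub>F z in uhp_infinity. z * (G z - z) = z * (G' z - z)"
    by eventually_elim (simp add: assms(2))
  from tendsto_cong[OF this]
  have 3: "((\<lambda>z. z * (G' z - z)) \<longlongrightarrow> - of_real a) uhp_infinity"
    using assms(1) unfolding hydrodynamic_def by blast
  have "\<forall>z\<in>closed_uhp. Im z \<le> Im (G' z)" "\<forall>z. 0 < Im z \<longrightarrow> cmod (G' z - z) \<le> a / Im z"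
    using assms(1) unfolding hydrodynamic_def by (simp_all flip: assms(2))
  with 1 2 3 show ?thesis unfolding hydrodynamic_def by blast
qed

text \<open>Both the bound and the coefficient at infinity are additive, whence \<open>\<ell>\<close> is exactly the
  elapsed time.\<close>

lemma hydrodynamic_compose:
  assumes "hydrodynamic a G" "hydrodynamic b K" "0 \<le> b"
  shows "hydrodynamic (a + b) (\<lambda>z. K (G z))"
  unfolding hydrodynamic_def
proof (intro conjI ballI allI impI)
  note G = assms(1)[unfolded hydrodynamic_def] and K = assms(2)[unfolded hydrodynamic_def]
  have im: "G ` closed_uhp \<subseteq> closed_uhp" using G by (auto intro: order_trans)
  have im': "G ` {z. 0 < Im z} \<subseteq> {z. 0 < Im z}"
  proof (rule image_subsetI)
    fix z assume "z \<in> {z. 0 < Im z}"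
    then show "G z \<in> {z. 0 < Im z}" using G by (auto intro: less_le_trans)
  qed
  show "continuous_on closed_uhp (\<lambda>z. K (G z))"
    using continuous_on_compose2[of closed_uhp K closed_uhp G] G K im by blast
  show "inj_on (\<lambda>z. K (G z)) closed_uhp"
    using comp_inj_on[of G closed_uhp K] G K im by (auto simp: o_def intro: inj_on_subset)
  show "(\<lambda>z. K (G z)) holomorphic_on {z. 0 < Im z}"
    using holomorphic_on_compose_gen[of G "{z. 0 < Im z}" K "{z. 0 < Im z}"] G K im' by (auto simp: o_def)
  show "Im z \<le> Im (K (G z))" if "z \<in> closed_uhp" for z
    using G K that im by (blast intro: order_trans)
  show "cmod (K (G z) - z) \<le> (a + b) / Im z" if z: "0 < Im z" for z
  proof -
    have Gz: "Im z \<le> Im (G z)" using G z by auto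
    have "cmod (K (G z) - z) \<le> cmod (K (G z) - G z) + cmod (G z - z)"
      using norm_triangle_ineq[of "K (G z) - G z" "G z - z"] by simp
    also have "\<dots> \<le> b / Im (G z) + a / Im z"
      using G K z less_le_trans[OF z Gz] by (intro add_mono) auto
    also have "\<dots> \<le> b / Im z + a / Im z"
      using z Gz assms(3) by (intro add_right_mono divide_left_mono) auto
    finally show ?thesis by (simp add: add_divide_distrib)
  qed
  have inf: "filterlim G uhp_infinity uhp_infinity" by (rule hydrodynamic_uhp_infinity[OF assms(1)])
  have K': "((\<lambda>z. G z * (K (G z) - G z)) \<longlongrightarrow> - of_real b) uhp_infinity"
    using filterlim_compose[OF _ inf, of "\<lambda>z. z * (K z - z)"] K by auto
  have KG: "((\<lambda>z. K (G z) - G z) \<longlongrightarrow> 0) uhp_infinity"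
    using filterlim_compose[OF hydrodynamic_diff_tendsto[OF assms(2)] inf] .
  have "((\<lambda>z. G z * (K (G z) - G z) - (G z - z) * (K (G z) - G z) + z * (G z - z))
      \<longlongrightarrow> - of_real b - 0 * 0 + - of_real a) uhp_infinity"
    using K' KG hydrodynamic_diff_tendsto[OF assms(1)] G by (intro tendsto_intros) auto
  then show "((\<lambda>z. z * (K (G z) - z)) \<longlongrightarrow> - of_real (a + b)) uhp_infinity"
    by (simp add: algebra_simps)
qed

lemma hydrodynamic_step:
  assumes "0 < c" "0 \<le> a" shows "hydrodynamic a (step l c a)"
    and "0 < a \<Longrightarrow> 0 \<le> Im z \<Longrightarrow> 0 < Im (step l c a z)"
proof -
  define p where "p = of_real l - \<i> * of_real c"
  have st: "step l c a = (\<lambda>z. uhp_root a (z - p) + p)" by (simp add: fun_eq_iff step_def p_def)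
  have u: "Im z + c = Im (z - p)" for z by (simp add: p_def)
  have up: "0 < Im (z - p)" if "0 \<le> Im z" for z using that assms u[of z] by linarith
  show "0 < a \<Longrightarrow> 0 \<le> Im z \<Longrightarrow> 0 < Im (step l c a z)"
    using uhp_root_Im_ge(2)[of "z - p" a] up[of z] by (simp add: st)
  have sub: "(\<lambda>z. z - p) ` closed_uhp \<subseteq> {u. 0 < Im u}" using up by auto
  have hol: "step l c a holomorphic_on closed_uhp"
  proof -
    have "(\<lambda>z. z - p) holomorphic_on closed_uhp" by (intro holomorphic_intros)
    from holomorphic_on_compose_gen[OF this uhp_root_holomorphic[OF assms(2)] sub]
    show ?thesis unfolding st by (intro holomorphic_on_add) (simp_all add: o_def)
  qed
  show "hydrodynamic a (step l c a)" unfolding hydrodynamic_def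
  proof (intro conjI ballI allI impI)
    show "continuous_on closed_uhp (step l c a)" by (rule holomorphic_on_imp_continuous_on[OF hol])
    show "step l c a holomorphic_on {z. 0 < Im z}" by (rule holomorphic_on_subset[OF hol]) auto
    show "inj_on (step l c a) closed_uhp"
    proof (rule inj_onI)
      fix x y assume "x \<in> closed_uhp" "y \<in> closed_uhp" "step l c a x = step l c a y"
      then have "x - p = y - p"
        using inj_onD[OF uhp_root_inj[OF assms(2)], of "x - p" "y - p"] up[of x] up[of y] by (simp add: st)
      then show "x = y" by simp
    qed
    show "Im z \<le> Im (step l c a z)" if "z \<in> closed_uhp" for z
      using uhp_root_Im_ge(1)[of "z - p" a] up[of z] that assms by (simp add: st)
    show "cmod (step l c a z - z) \<le> a / Im z" if z: "0 < Im z" for z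
    proof -
      have "cmod (step l c a z - z) = cmod (uhp_root a (z - p) - (z - p))" by (simp add: st algebra_simps)
      also have "\<dots> \<le> a / Im (z - p)" using uhp_root_diff(3)[OF up[of z] assms(2)] z by simp
      also have "\<dots> \<le> a / Im z" using z assms u[of z] up[of z] by (intro divide_left_mono mult_pos_pos) linarith+
      finally show ?thesis .
    qed
    have ev: "\<forall>\<^sub>F z in uhp_infinity. z \<in> closed_uhp"
      by (rule filter_leD[OF inf_le2]) (simp add: eventually_principal)
    have evn: "\<forall>\<^sub>F z in uhp_infinity. z \<noteq> 0"
    proof (rule filter_leD[OF inf_le1])
      show "\<forall>\<^sub>F z::complex in at_infinity. z \<noteq> 0" unfolding eventually_at_infinity by (rule exI[of _ 1]) auto
    qed
    have bd: "cmod (step l c a z - z) \<le> a / c" if "0 \<le> Im z" for z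
    proof -
      have "cmod (step l c a z - z) = cmod (uhp_root a (z - p) - (z - p))" by (simp add: st algebra_simps)
      also have "\<dots> \<le> a / Im (z - p)" using uhp_root_diff(3)[OF up[of z] assms(2)] that by simp
      also have "\<dots> \<le> a / c" using that assms u[of z] up[of z] by (intro divide_left_mono mult_pos_pos) linarith+
      finally show ?thesis .
    qed
    have small: "((\<lambda>z. inverse z * (step l c a z - z)) \<longlongrightarrow> 0) uhp_infinity"
    proof (rule Lim_null_comparison)
      show "\<forall>\<^sub>F z in uhp_infinity. norm (inverse z * (step l c a z - z)) \<le> norm (inverse z) * (a / c)"
        using ev
      proof eventually_elim
        case (elim z)
        then show ?case unfolding norm_mult by (intro mult_left_mono bd) auto
      qed
      show "((\<lambda>z::complex. norm (inverse z) * (a / c)) \<longlongrightarrow> 0) uhp_infinity"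
        using tendsto_mult[OF tendsto_norm[OF tendsto_inverse_uhp_infinity] tendsto_const, of "a/c"] by simp
    qed
    \<comment> \<open>From \<open>(S - u) (S + u) = - 2 a\<close> with \<open>u = z - p\<close>: here \<open>z (S - u) = - 2 a / ((S + u) / z)\<close> and \<open>(S + u) / z\<close> tends to \<open>2\<close>.\<close>
    have "((\<lambda>z. - of_real (2 * a) / (2 + inverse z * (step l c a z - z) - 2 * p * inverse z)) \<longlongrightarrow> - of_real (2 * a) / (2 + 0 - 2 * p * 0)) uhp_infinity"
      by (intro tendsto_intros small tendsto_inverse_uhp_infinity) auto
    moreover have "\<forall>\<^sub>F z in uhp_infinity. - of_real (2 * a) / (2 + inverse z * (step l c a z - z) - 2 * p * inverse z)
        = z * (step l c a z - z)"
      using ev evn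
    proof eventually_elim
      case (elim z)
      let ?S = "uhp_root a (z - p)"
      have n: "?S + (z - p) \<noteq> 0" and m: "(?S - (z - p)) * (?S + (z - p)) = - of_real (2 * a)"
        using uhp_root_diff(1,2)[OF up assms(2)] elim by auto
      have d: "2 + inverse z * (step l c a z - z) - 2 * p * inverse z = (?S + (z - p)) / z"
        using elim(2) by (simp add: st field_simps)
      have "- of_real (2 * a) / ((?S + (z - p)) / z) = z * (?S - (z - p))"
        unfolding m[symmetric] using n elim(2) by (simp add: field_simps)
      then show ?case unfolding d by (simp add: st)
    qed
    ultimately show "((\<lambda>z. z * (step l c a z - z)) \<longlongrightarrow> - of_real a) uhp_infinity"
      by (simp add: tendsto_cong)
  qed
qed

lemma step_0: "0 < c \<Longrightarrow> 0 \<le> Im z \<Longrightarrow> step l c 0 z = z"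
  unfolding step_def by (subst uhp_root_0) auto

lemma step_add: 
  assumes "0 < c" "0 \<le> Im z" "0 \<le> a" "0 \<le> b"
  shows "step l c b (step l c a z) = step l c (a + b) z"
  unfolding step_def using assms by (simp add: uhp_root_add)

text \<open>The flow is invariant under affine changes of the half-plane, if time is scaled by the square.\<close>

lemma step_scale:
  assumes "0 < c" "0 \<le> Im w" "0 \<le> a" "0 < y"
  shows "step (x + l * y) (c * y) (a * y\<^sup>2) (of_real x + of_real y * w) = of_real x + of_real y * step l c a w"
proof -
  have "of_real x + of_real y * w - (of_real (x + l * y) - \<i> * of_real (c * y)) = of_real y * (w - (of_real l - \<i> * of_real c))"
    by (simp add: algebra_simps)
  then show ?thesis unfolding step_def
    using uhp_root_scale[of "w - (of_real l - \<i> * of_real c)" a y] assms by (simp add: algebra_simps)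
qed

text \<open>On the imaginary axis \<open>z (G z - z)\<close> has modulus at most \<open>C\<close>, and it tends to \<open>- a\<close>.\<close>

lemma hydrodynamic_bound_ge:
  assumes G: "hydrodynamic a G" and C: "\<And>z. 0 < Im z \<Longrightarrow> cmod (G z - z) \<le> C / Im z"
    and a: "0 \<le> a"
  shows "a \<le> C"
proof -
  have lim: "filterlim (\<lambda>y. \<i> * of_real y) uhp_infinity at_top"
  proof (rule filterlim_inf[THEN iffD2, OF conjI])
    show "filterlim (\<lambda>y. \<i> * complex_of_real y) at_infinity at_top"
      unfolding filterlim_at_infinity_conv_norm_at_top
      by (simp add: norm_mult filterlim_abs_real)
    show "filterlim (\<lambda>y. \<i> * complex_of_real y) (principal closed_uhp) at_top"
      unfolding filterlim_principal using eventually_ge_at_top[of 0] by eventually_elim simp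
  qed
  have "((\<lambda>y. cmod ((\<i> * of_real y) * (G (\<i> * of_real y) - \<i> * of_real y))) \<longlongrightarrow> cmod (- of_real a)) at_top"
    using G filterlim_compose[OF _ lim] unfolding hydrodynamic_def by (intro tendsto_norm) blast
  moreover have "\<forall>\<^sub>F y in at_top. cmod ((\<i> * of_real y) * (G (\<i> * of_real y) - \<i> * of_real y)) \<le> C"
    using eventually_gt_at_top[of 0]
  proof eventually_elim
    case (elim y)
    have "cmod ((\<i> * of_real y) * (G (\<i> * of_real y) - \<i> * of_real y)) = y * cmod (G (\<i> * of_real y) - \<i> * of_real y)"
      using elim by (simp only: norm_mult norm_ii norm_of_real)
    also have "\<dots> \<le> C" using C[of "\<i> * of_real y"] elim by (simp add: field_simps)
    finally show ?case .
  qed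
  ultimately have "cmod (- of_real a) \<le> C" by (rule tendsto_upperbound) simp
  then show ?thesis using a by simp
qed

section \<open>Passing from the half-plane to the disk\<close>

text \<open>The inverse of the Cayley transform by its formula, which is also valid on the real line, where
  \<open>cayley_inv\<close> says nothing.\<close>

definition cinv :: "complex \<Rightarrow> complex" where "cinv w = (w - \<i>) / (w + \<i>)"

lemma plus_i_nonzero: "0 \<le> Im w \<Longrightarrow> w + \<i> \<noteq> 0"
  by (auto simp: complex_eq_iff)

lemma cinv_ne_1: "cinv w \<noteq> 1"
proof
  assume "cinv w = 1"
  then have "w - \<i> = w + \<i>" by (cases "w + \<i> = 0") (auto simp: cinv_def divide_eq_eq)
  then show False by (simp add: complex_eq_iff)
qed

lemma cayley_cinv: "0 \<le> Im w \<Longrightarrow> cayley (cinv w) = w"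
proof -
  assume "0 \<le> Im w"
  then have n: "w + \<i> \<noteq> 0" by (rule plus_i_nonzero)
  have "1 + cinv w = 2 * w / (w + \<i>)" "1 - cinv w = 2 * \<i> / (w + \<i>)"
    using n by (auto simp: cinv_def field_simps)
  then show ?thesis using n by (simp add: cayley_def)
qed

lemma cinv_cayley: "z \<noteq> 1 \<Longrightarrow> cinv (cayley z) = z"
proof -
  assume "z \<noteq> 1"
  then have n: "1 - z \<noteq> 0" by simp
  have "cayley z - \<i> = 2 * \<i> * z / (1 - z)" "cayley z + \<i> = 2 * \<i> / (1 - z)"
    using n by (auto simp: cayley_def field_simps)
  then show ?thesis using n by (simp add: cinv_def)
qed

lemma Im_cayley: "z \<noteq> 1 \<Longrightarrow> Im (cayley z) = (1 - (cmod z)\<^sup>2) / (cmod (1 - z))\<^sup>2"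
proof -
  assume "z \<noteq> 1"
  have "cayley z = \<i> * ((1 + z) * cnj (1 - z)) / of_real ((cmod (1 - z))\<^sup>2)"
    unfolding cayley_def using complex_div_cnj[of "\<i> * (1 + z)" "1 - z"] by (simp add: mult.assoc)
  then have "Im (cayley z) = Re ((1 + z) * cnj (1 - z)) / (cmod (1 - z))\<^sup>2"
    by (simp del: of_real_power of_real_diff)
  moreover have "Re ((1 + z) * cnj (1 - z)) = 1 - (cmod z)\<^sup>2"
    by (simp add: cmod_power2) (simp add: power2_eq_square algebra_simps)
  ultimately show ?thesis by simp
qed

lemma cayley_closed_uhp: "z \<in> cball 0 1 \<Longrightarrow> z \<noteq> 1 \<Longrightarrow> 0 \<le> Im (cayley z)"
  by (simp add: Im_cayley abs_square_le_1)

lemma cayley_uhp: "z \<in> ball 0 1 \<Longrightarrow> 0 < Im (cayley z)"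
proof -
  assume z: "z \<in> ball 0 1"
  then have "z \<noteq> 1" by auto
  then show ?thesis using z by (simp add: Im_cayley abs_square_less_1)
qed

lemma cmod_cinv_sq: "(cmod (w + \<i>))\<^sup>2 - (cmod (w - \<i>))\<^sup>2 = 4 * Im w"
  by (simp add: cmod_power2) (simp add: power2_eq_square algebra_simps)

lemma cinv_ball: "0 < Im w \<Longrightarrow> cinv w \<in> ball 0 1"
proof -
  assume w: "0 < Im w"
  then have "(cmod (w - \<i>))\<^sup>2 < (cmod (w + \<i>))\<^sup>2" using cmod_cinv_sq[of w] by linarith
  then have "cmod (w - \<i>) < cmod (w + \<i>)" by (rule power2_less_imp_less) simp
  then show ?thesis using plus_i_nonzero[of w] w by (simp add: cinv_def norm_divide)
qed

lemma cinv_real_sphere: "Im w = 0 \<Longrightarrow> cmod (cinv w) = 1"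
proof -
  assume w: "Im w = 0"
  then have "cmod (w - \<i>) = cmod (w + \<i>)" using cmod_cinv_sq[of w] by (simp add: power2_eq_iff_nonneg)
  then show ?thesis using plus_i_nonzero[of w] w by (simp add: cinv_def norm_divide)
qed

lemma cayley_inj: "inj_on cayley (- {1})"
  by (rule inj_on_inverseI[of _ cinv]) (use cinv_cayley in auto)

lemma cinv_inj: "inj_on cinv closed_uhp"
  by (rule inj_on_inverseI[of _ cayley]) (use cayley_cinv in auto)

lemma cinv_holomorphic: "cinv holomorphic_on closed_uhp"
  unfolding cinv_def by (intro holomorphic_intros) (use plus_i_nonzero in auto)

lemma cayley_holomorphic: "cayley holomorphic_on - {1}"
  unfolding cayley_def[abs_def] by (intro holomorphic_intros) auto

lemma cinv_Lipschitz:
  assumes "0 \<le> Im w" "0 \<le> Im w'" shows "cmod (cinv w - cinv w') \<le> 2 * cmod (w - w')"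
proof -
  have n: "w + \<i> \<noteq> 0" "w' + \<i> \<noteq> 0" using plus_i_nonzero assms by auto
  have "cinv w - cinv w' = 2 * \<i> * (w - w') / ((w + \<i>) * (w' + \<i>))"
    using n by (simp add: cinv_def field_simps)
  then have "cmod (cinv w - cinv w') = 2 * cmod (w - w') / (cmod (w + \<i>) * cmod (w' + \<i>))"
    by (simp add: norm_mult norm_divide)
  also have "\<dots> \<le> 2 * cmod (w - w') / 1"
  proof (intro divide_left_mono)
    have "1 \<le> cmod (w + \<i>)" "1 \<le> cmod (w' + \<i>)"
      using abs_Im_le_cmod[of "w + \<i>"] abs_Im_le_cmod[of "w' + \<i>"] assms by auto
    then show "1 \<le> cmod (w + \<i>) * cmod (w' + \<i>)" using mult_mono[of 1 "cmod (w + \<i>)" 1 "cmod (w' + \<i>)"] by simp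
  qed (use n in auto)
  finally show ?thesis by simp
qed

lemma cayley_inv_eq: 
  assumes "0 < Im w" shows "cayley_inv w = cinv w"
proof (rule inv_into_f_eq)
  show "inj_on cayley (ball 0 1)" by (rule inj_on_subset[OF cayley_inj]) auto
  show "cinv w \<in> ball 0 1" by (rule cinv_ball[OF assms])
  show "cayley (cinv w) = w" using assms by (intro cayley_cinv) auto
qed

lemma cayley_tendsto: "filterlim cayley uhp_infinity (at 1 within cball 0 1)"
proof (rule filterlim_inf[THEN iffD2, OF conjI])
  have "filterlim (\<lambda>z. \<i> * (1 + z) / (1 - z)) at_infinity (at 1)"
  proof (rule filterlim_divide_at_infinity[where c = "2 * \<i>"])
    show "((\<lambda>z. \<i> * (1 + z)) \<longlongrightarrow> 2 * \<i>) (at 1)" by (auto intro!: tendsto_eq_intros)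
    show "filterlim (\<lambda>z::complex. 1 - z) (at 0) (at 1)"
    proof (rule filterlim_atI)
      show "((\<lambda>z::complex. 1 - z) \<longlongrightarrow> 0) (at 1)" by (auto intro!: tendsto_eq_intros)
      show "\<forall>\<^sub>F z::complex in at 1. 1 - z \<noteq> 0" by (auto simp: eventually_at intro!: exI[of _ 1])
    qed
  qed simp
  then show "filterlim cayley at_infinity (at 1 within cball 0 1)"
    unfolding cayley_def[abs_def] by (rule filterlim_mono[OF _ order_refl at_le]) simp
  show "filterlim cayley (principal closed_uhp) (at 1 within cball 0 1)"
    unfolding filterlim_principal eventually_at
    by (intro exI[of _ 1]) (use cayley_closed_uhp in auto)
qed

lemma cinv_tendsto: "(cinv \<longlongrightarrow> 1) uhp_infinity"
proof -
  have "((\<lambda>w. 1 - 2 * \<i> * inverse (w + \<i>)) \<longlongrightarrow> 1 - 2 * \<i> * 0) uhp_infinity"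
  proof (intro tendsto_intros)
    have "filterlim (\<lambda>w::complex. \<i> + w) at_infinity at_infinity"
      by (rule tendsto_add_filterlim_at_infinity[OF tendsto_const filterlim_ident])
    then have "((\<lambda>w::complex. inverse (w + \<i>)) \<longlongrightarrow> 0) at_infinity"
      using filterlim_compose[OF tendsto_inverse_0] by (simp add: add.commute)
    then show "((\<lambda>w::complex. inverse (w + \<i>)) \<longlongrightarrow> 0) uhp_infinity" by (rule tendsto_mono[OF inf_le1])
  qed
  then have l: "((\<lambda>w. 1 - 2 * \<i> * inverse (w + \<i>)) \<longlongrightarrow> 1) uhp_infinity" by simp
  have "\<forall>\<^sub>F z in uhp_infinity. z \<in> closed_uhp"
    by (rule filter_leD[OF inf_le2]) (simp add: eventually_principal)
  then have "\<forall>\<^sub>F w in uhp_infinity. 1 - 2 * \<i> * inverse (w + \<i>) = cinv w"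
  proof eventually_elim
    case (elim w)
    then show ?case using plus_i_nonzero[of w] by (simp add: cinv_def field_simps)
  qed
  from tendsto_cong[OF this] l show ?thesis by blast
qed

text \<open>What a self-map of the half-plane needs in order to become, in the disk, a continuous injection of the
  closed disk that fixes \<open>1\<close>. Unlike \<open>hydrodynamic\<close> this includes affine maps.\<close>

definition uhp_embedding :: "(complex \<Rightarrow> complex) \<Rightarrow> bool" where
  "uhp_embedding K \<longleftrightarrow> continuous_on closed_uhp K \<and> inj_on K closed_uhp \<and>
     K holomorphic_on {z. 0 < Im z} \<and> (\<forall>z. 0 \<le> Im z \<longrightarrow> 0 \<le> Im (K z)) \<and>
     (\<forall>z. 0 < Im z \<longrightarrow> 0 < Im (K z)) \<and> filterlim K uhp_infinity uhp_infinity"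

lemma hydrodynamic_imp_embedding: "hydrodynamic a G \<Longrightarrow> uhp_embedding G"
  using hydrodynamic_uhp_infinity[of a G] unfolding hydrodynamic_def uhp_embedding_def
  by (auto intro: order_trans less_le_trans)

lemma uhp_embedding_compose:
  assumes "uhp_embedding K" "uhp_embedding G" shows "uhp_embedding (\<lambda>z. K (G z))"
  unfolding uhp_embedding_def
proof (intro conjI allI impI)
  note K = assms(1)[unfolded uhp_embedding_def] and G = assms(2)[unfolded uhp_embedding_def]
  have im: "G ` closed_uhp \<subseteq> closed_uhp" "G ` {z. 0 < Im z} \<subseteq> {z. 0 < Im z}" using G by auto
  show "continuous_on closed_uhp (\<lambda>z. K (G z))"
    using continuous_on_compose2[of closed_uhp K closed_uhp G] G K im by blast
  show "inj_on (\<lambda>z. K (G z)) closed_uhp"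
    using comp_inj_on[of G closed_uhp K] G K im by (auto simp: o_def intro: inj_on_subset)
  show "(\<lambda>z. K (G z)) holomorphic_on {z. 0 < Im z}"
    using holomorphic_on_compose_gen[of G "{z. 0 < Im z}" K "{z. 0 < Im z}"] G K im by (auto simp: o_def)
  show "filterlim (\<lambda>z. K (G z)) uhp_infinity uhp_infinity" using filterlim_compose G K by blast
qed (use assms in \<open>auto simp: uhp_embedding_def\<close>)

lemma uhp_embedding_cong:
  assumes "uhp_embedding G" "\<And>z. 0 \<le> Im z \<Longrightarrow> G z = G' z" shows "uhp_embedding G'"
proof -
  note G = assms(1)[unfolded uhp_embedding_def]
  have 1: "continuous_on closed_uhp G'" "inj_on G' closed_uhp"
    using G assms(2) continuous_on_cong[of closed_uhp closed_uhp G G'] inj_on_cong[of closed_uhp G G'] by auto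
  have 2: "G' holomorphic_on {z. 0 < Im z}"
    using G assms(2) holomorphic_cong[of "{z. 0 < Im z}" "{z. 0 < Im z}" G G'] by auto
  have "\<forall>\<^sub>F z in uhp_infinity. z \<in> closed_uhp"
    by (rule filter_leD[OF inf_le2]) (simp add: eventually_principal)
  then have "\<forall>\<^sub>F z in uhp_infinity. G z = G' z" by eventually_elim (simp add: assms(2))
  from filterlim_cong[OF refl refl this] have 3: "filterlim G' uhp_infinity uhp_infinity" using G by blast
  have 4: "\<forall>z. 0 \<le> Im z \<longrightarrow> 0 \<le> Im (G' z)" "\<forall>z. 0 < Im z \<longrightarrow> 0 < Im (G' z)"
    using G by (simp_all flip: assms(2))
  show ?thesis using 1 2 3 4 unfolding uhp_embedding_def by blast
qed

lemma uhp_embedding_affine: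
  assumes "0 < y" shows "uhp_embedding (\<lambda>z. of_real x + of_real y * z)"
  unfolding uhp_embedding_def
proof (intro conjI allI impI)
  show "inj_on (\<lambda>z. complex_of_real x + complex_of_real y * z) closed_uhp" using assms by (auto simp: inj_on_def)
  show "filterlim (\<lambda>z. complex_of_real x + complex_of_real y * z) uhp_infinity uhp_infinity"
  proof (rule filterlim_inf[THEN iffD2, OF conjI])
    have "filterlim (\<lambda>z::complex. of_real y * z) at_infinity at_infinity"
      by (rule tendsto_mult_filterlim_at_infinity[OF tendsto_const _ filterlim_ident]) (use assms in simp)
    then have "filterlim (\<lambda>z::complex. of_real x + of_real y * z) at_infinity at_infinity"
      by (rule tendsto_add_filterlim_at_infinity[OF tendsto_const])
    then show "filterlim (\<lambda>z::complex. of_real x + of_real y * z) at_infinity uhp_infinity"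
      by (rule filterlim_mono[OF _ order_refl inf_le1])
    have "\<forall>\<^sub>F z in uhp_infinity. z \<in> closed_uhp"
      by (rule filter_leD[OF inf_le2]) (simp add: eventually_principal)
    then show "filterlim (\<lambda>z. complex_of_real x + complex_of_real y * z) (principal closed_uhp) uhp_infinity"
      unfolding filterlim_principal by eventually_elim (use assms in simp)
  qed
qed (use assms in \<open>auto intro!: continuous_intros holomorphic_intros\<close>)

text \<open>At \<open>z = 1\<close> the formula would evaluate a division by zero; the value is set to the limit instead.\<close>

definition disk_conj :: "(complex \<Rightarrow> complex) \<Rightarrow> complex \<Rightarrow> complex" where
  "disk_conj K z = (if z = 1 then 1 else cinv (K (cayley z)))"

lemma disk_conj_1 [simp]: "disk_conj K 1 = 1"
  by (simp add: disk_conj_def)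

context
  fixes K assumes K: "uhp_embedding K"
begin

lemma disk_conj_ball: "z \<in> ball 0 1 \<Longrightarrow> disk_conj K z \<in> ball 0 1"
proof -
  assume z: "z \<in> ball 0 1"
  then have "z \<noteq> 1" by auto
  moreover have "0 < Im (K (cayley z))" using K cayley_uhp[OF z] by (auto simp: uhp_embedding_def)
  ultimately show ?thesis using cinv_ball by (simp add: disk_conj_def del: mem_ball mem_ball_0)
qed

lemma cayley_disk_conj: "z \<in> cball 0 1 \<Longrightarrow> z \<noteq> 1 \<Longrightarrow> cayley (disk_conj K z) = K (cayley z)"
  using K cayley_closed_uhp[of z] by (simp add: disk_conj_def cayley_cinv uhp_embedding_def)

lemma disk_conj_holomorphic: "disk_conj K holomorphic_on ball 0 1"
proof -
  have 1: "cayley holomorphic_on ball 0 1" by (rule holomorphic_on_subset[OF cayley_holomorphic]) auto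
  have "K holomorphic_on {z. 0 < Im z}" using K by (auto simp: uhp_embedding_def)
  from holomorphic_on_compose_gen[OF 1 this] have 2: "(K \<circ> cayley) holomorphic_on ball 0 1"
    using cayley_uhp by blast
  have "(cinv \<circ> (K \<circ> cayley)) holomorphic_on ball 0 1"
    by (rule holomorphic_on_compose_gen[OF 2 cinv_holomorphic])
       (use cayley_uhp K in \<open>force simp: uhp_embedding_def less_imp_le\<close>)
  then show ?thesis by (rule holomorphic_transform) (auto simp: disk_conj_def)
qed

lemma disk_conj_continuous: "continuous_on (cball 0 1) (disk_conj K)"
proof (rule continuous_on_eq_continuous_within[THEN iffD2], rule ballI)
  fix z :: complex assume z: "z \<in> cball 0 1"
  show "continuous (at z within cball 0 1) (disk_conj K)"
  proof (cases "z = 1")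
    case True
    have "filterlim (\<lambda>z. K (cayley z)) uhp_infinity (at 1 within cball 0 1)"
      using filterlim_compose[OF _ cayley_tendsto] K by (auto simp: uhp_embedding_def)
    from filterlim_compose[OF cinv_tendsto this]
    have l: "((\<lambda>z. cinv (K (cayley z))) \<longlongrightarrow> 1) (at 1 within cball 0 1)" .
    have ev: "\<forall>\<^sub>F z in at 1 within cball 0 1. cinv (K (cayley z)) = disk_conj K z"
      by (auto simp: eventually_at disk_conj_def intro!: exI[of _ 1])
    have "(disk_conj K \<longlongrightarrow> 1) (at 1 within cball 0 1)"
      using tendsto_cong[OF ev] l by blast
    then show ?thesis using True by (simp add: continuous_within)
  next
    case False
    have c1: "continuous_on (cball 0 1 - {1}) cayley"
      by (rule holomorphic_on_imp_continuous_on[OF holomorphic_on_subset[OF cayley_holomorphic]]) auto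
    have "continuous_on closed_uhp K" using K by (auto simp: uhp_embedding_def)
    from continuous_on_compose2[OF this c1] have c2: "continuous_on (cball 0 1 - {1}) (\<lambda>z. K (cayley z))"
      using cayley_closed_uhp by blast
    have "continuous_on (cball 0 1 - {1}) (\<lambda>z. cinv (K (cayley z)))"
      by (rule continuous_on_compose2[OF holomorphic_on_imp_continuous_on[OF cinv_holomorphic] c2])
         (use cayley_closed_uhp K in \<open>auto simp: uhp_embedding_def\<close>)
    then have "continuous_on (cball 0 1 - {1}) (disk_conj K)"
      by (rule continuous_on_eq) (auto simp: disk_conj_def)
    then have "continuous (at z within (cball 0 1 - {1})) (disk_conj K)"
      using z False by (simp add: continuous_on_eq_continuous_within)
    moreover have "at z within (cball 0 1 - {1}) = at z within cball 0 1"
      by (rule at_within_nhd[of _ "- {1}"]) (use False in auto)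
    ultimately show ?thesis by simp
  qed
qed

lemma disk_conj_inj: "inj_on (disk_conj K) (cball 0 1)"
proof (rule inj_onI)
  fix x y assume xy: "x \<in> cball 0 1" "y \<in> cball 0 1" "disk_conj K x = disk_conj K y"
  show "x = y"
  proof (cases "x = 1 \<or> y = 1")
    case True then show ?thesis using xy(3) cinv_ne_1 by (auto simp: disk_conj_def split: if_splits)
  next
    case False
    then have "K (cayley x) = K (cayley y)" using xy cayley_disk_conj by metis
    moreover have "inj_on K closed_uhp" using K by (auto simp: uhp_embedding_def)
    ultimately have "cayley x = cayley y" using cayley_closed_uhp[OF xy(1)] cayley_closed_uhp[OF xy(2)] False by (auto dest: inj_onD)
    then show ?thesis using False cinv_cayley by metis
  qed
qed

lemma disk_conj_strict: 
  assumes "\<And>w. 0 \<le> Im w \<Longrightarrow> 0 < Im (K w)" "z \<in> cball 0 1" "z \<noteq> 1"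
  shows "disk_conj K z \<in> ball 0 1"
  using cinv_ball[OF assms(1)[OF cayley_closed_uhp[OF assms(2,3)]]] assms(3) by (simp add: disk_conj_def)

lemma disk_conj_compose: "z \<in> cball 0 1 \<Longrightarrow> disk_conj G (disk_conj K z) = disk_conj (\<lambda>w. G (K w)) z"
  using cayley_disk_conj[of z] cinv_ne_1 by (auto simp: disk_conj_def)

lemma disk_conj_deriv_0:
  assumes "K \<i> = \<i>" "(K has_field_derivative d) (at \<i>)"
  shows "(disk_conj K has_field_derivative d) (at 0)"
proof -
  have c: "cayley 0 = \<i>" by (simp add: cayley_def)
  have 1: "(cayley has_field_derivative 2 * \<i>) (at 0)"
    unfolding cayley_def[abs_def] by (auto intro!: derivative_eq_intros)
  have 2: "(cinv has_field_derivative 1 / (2 * \<i>)) (at \<i>)"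
    unfolding cinv_def[abs_def] by (auto intro!: derivative_eq_intros simp: complex_eq_iff)
  have "((\<lambda>z. K (cayley z)) has_field_derivative d * (2 * \<i>)) (at 0)"
    by (rule DERIV_chain2[OF _ 1]) (use assms c in simp)
  moreover have "(cinv has_field_derivative 1 / (2 * \<i>)) (at (K (cayley 0)))"
    using 2 by (simp only: assms c)
  ultimately have "((\<lambda>z. cinv (K (cayley z))) has_field_derivative 1 / (2 * \<i>) * (d * (2 * \<i>))) (at 0)"
    by (rule DERIV_chain2[rotated])
  moreover have "1 / (2 * \<i>) * (d * (2 * \<i>)) = d" by (simp add: field_simps)
  ultimately have 3: "((\<lambda>z. cinv (K (cayley z))) has_field_derivative d) (at 0)" by (simp only:)
  have ev: "\<forall>\<^sub>F z in nhds 0. z \<noteq> (1::complex)" by (rule t1_space_nhds) simp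
  have "\<forall>\<^sub>F z in nhds 0. disk_conj K z = cinv (K (cayley z))"
    using ev by eventually_elim (simp add: disk_conj_def)
  from DERIV_cong_ev[OF refl this refl] 3 show ?thesis by blast
qed

end

section \<open>Closures, boundaries and diameters in the sphere\<close>

lemma Some_in_sphere_closure [simp]: "Some a \<in> sphere_closure E \<longleftrightarrow> a \<in> closure E"
proof
  assume L: "Some a \<in> sphere_closure E"
  show "a \<in> closure E"
    unfolding closure_iff_nhds_not_empty
  proof (intro allI impI)
    fix A V assume "V \<subseteq> A" "open V" "a \<in> V"
    then have "openin riemann_sphere (Some ` V)" "Some a \<in> Some ` V" by (auto simp: riemann_sphere_def)
    then obtain y where "y \<in> Some ` E" "y \<in> Some ` V"
      using L unfolding sphere_closure_def in_closure_of by blast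
    then show "E \<inter> A \<noteq> {}" using \<open>V \<subseteq> A\<close> by auto
  qed
next
  assume L: "a \<in> closure E"
  show "Some a \<in> sphere_closure E"
    unfolding sphere_closure_def in_closure_of
  proof (intro conjI allI impI)
    show "Some a \<in> topspace riemann_sphere" by (simp add: riemann_sphere_def)
    fix T assume T: "Some a \<in> T \<and> openin riemann_sphere T"
    then have "open (Some -` T)"
      using openin_continuous_map_preimage[OF continuous_map_Some, of euclidean T]
      by (simp add: riemann_sphere_def vimage_def)
    then have "E \<inter> Some -` T \<noteq> {}" using L T unfolding closure_iff_nhds_not_empty by blast
    then show "\<exists>y. y \<in> Some ` E \<and> y \<in> T" by blast
  qed
qed

lemma sphere_closure_bounded: "bounded E \<Longrightarrow> sphere_closure E = Some ` closure E"
proof -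
  assume "bounded E"
  then have "closedin riemann_sphere (Some ` closure E)" by (simp add: riemann_sphere_def compact_closure)
  then have "sphere_closure E \<subseteq> Some ` closure E"
    unfolding sphere_closure_def by (intro closure_of_minimal) (use closure_subset in auto)
  then show ?thesis by auto
qed

lemma sphere_closure_mono: "A \<subseteq> B \<Longrightarrow> sphere_closure A \<subseteq> sphere_closure B"
  unfolding sphere_closure_def by (intro closure_of_mono) auto

lemma sphere_boundary_open: 
  assumes "open G" shows "sphere_boundary G = sphere_closure G - Some ` G"
proof -
  have "openin riemann_sphere (Some ` G)" using assms by (simp add: riemann_sphere_def)
  then show ?thesis unfolding sphere_boundary_def sphere_closure_def frontier_of_def
    by (simp add: interior_of_openin)
qed

lemma sphere_boundary_disk: "sphere_boundary (ball 0 1) = Some ` sphere 0 1"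
proof -
  have "sphere_boundary (ball 0 1) = Some ` (cball 0 1 - ball 0 1)"
    by (simp add: sphere_boundary_open sphere_closure_bounded image_set_diff)
  also have "cball (0::complex) 1 - ball 0 1 = sphere 0 1" by auto
  finally show ?thesis .
qed

lemma limitin_sphere_in_closure:
  assumes "limitin riemann_sphere (\<lambda>x. Some (\<gamma> x)) a F" "\<forall>\<^sub>F x in F. \<gamma> x \<in> E" "F \<noteq> bot"
  shows "a \<in> sphere_closure E"
  unfolding sphere_closure_def in_closure_of
proof (intro conjI allI impI)
  show "a \<in> topspace riemann_sphere" using assms(1) by (simp add: limitin_def)
  fix T assume "a \<in> T \<and> openin riemann_sphere T"
  then have "\<forall>\<^sub>F x in F. Some (\<gamma> x) \<in> T" using assms(1) unfolding limitin_def by blast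
  with assms(2) have "\<forall>\<^sub>F x in F. Some (\<gamma> x) \<in> T \<and> \<gamma> x \<in> E" by eventually_elim simp
  then obtain x where "Some (\<gamma> x) \<in> T" "\<gamma> x \<in> E" using assms(3) eventually_happens by blast
  then show "\<exists>y. y \<in> Some ` E \<and> y \<in> T" by blast
qed

lemma compact_space_sphere: "compact_space riemann_sphere"
  by (simp add: riemann_sphere_def)

lemma Hausdorff_space_sphere: "Hausdorff_space riemann_sphere"
  unfolding riemann_sphere_def
  by (simp add: Hausdorff_space_Alexandroff_compactification locally_compact_space_euclidean Hausdorff_space_euclidean)

lemma limitin_sphere_unique:
  "limitin riemann_sphere f a F \<Longrightarrow> limitin riemann_sphere f b F \<Longrightarrow> F \<noteq> bot \<Longrightarrow> a = b"
  using limitin_Hausdorff_unique[OF _ _ _ Hausdorff_space_sphere] by (simp add: trivial_limit_def)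

lemma spherical_diameter_bounds:
  assumes "E \<noteq> {}" "\<And>z w. z \<in> E \<Longrightarrow> w \<in> E \<Longrightarrow> chordal_dist z w \<le> M"
  shows "0 \<le> spherical_diameter E" "spherical_diameter E \<le> M"
proof -
  obtain z where z: "z \<in> E" using assms(1) by blast
  have bdd: "bdd_above ((\<lambda>(z, w). chordal_dist z w) ` (E \<times> E))"
    using assms(2) by (intro bdd_aboveI[of _ M]) auto
  have "chordal_dist z z \<le> spherical_diameter E" unfolding spherical_diameter_def
    using cSUP_upper[OF _ bdd, of "(z, z)"] z by simp
  then show "0 \<le> spherical_diameter E" by (simp add: chordal_dist_def)
  show "spherical_diameter E \<le> M" unfolding spherical_diameter_def
    by (rule cSUP_least) (use assms in auto)
qed

lemma chordal_dist_le: "chordal_dist z w \<le> 2 * cmod (z - w)"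
proof -
  have "1 \<le> sqrt (1 + (cmod z)\<^sup>2)" "1 \<le> sqrt (1 + (cmod w)\<^sup>2)" by simp_all
  then have "1 \<le> sqrt (1 + (cmod z)\<^sup>2) * sqrt (1 + (cmod w)\<^sup>2)"
    using mult_mono[of 1 "sqrt (1 + (cmod z)\<^sup>2)" 1 "sqrt (1 + (cmod w)\<^sup>2)"] by simp
  then have "2 * cmod (z - w) / (sqrt (1 + (cmod z)\<^sup>2) * sqrt (1 + (cmod w)\<^sup>2)) \<le> 2 * cmod (z - w) / 1"
    by (intro divide_left_mono) auto
  then show ?thesis by (simp add: chordal_dist_def)
qed

section \<open>Regions of null-chains\<close>

lemma crosscut_connected: 
  assumes "crosscut G C" shows "connected C" "C \<noteq> {}" "C \<subseteq> G"
proof -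
  obtain \<gamma> :: "real \<Rightarrow> complex" where \<gamma>: "continuous_on {0<..<1} \<gamma>" "\<gamma> ` {0<..<1} = C" "C \<subseteq> G"
    using assms unfolding crosscut_def by blast
  show "connected C" unfolding \<gamma>(2)[symmetric] by (rule connected_continuous_image[OF \<gamma>(1)]) auto
  show "C \<noteq> {}" unfolding \<gamma>(2)[symmetric] by auto
  show "C \<subseteq> G" by fact
qed

lemma null_chain_disjoint: "null_chain G C \<Longrightarrow> C n \<inter> C (Suc n) = {}"
proof -
  assume "null_chain G C"
  then have "sphere_closure (C n) \<inter> sphere_closure (C (Suc n)) = {}" by (simp add: null_chain_def)
  moreover have "C k \<subseteq> closure (C k)" for k by (rule closure_subset)
  ultimately show ?thesis using Some_in_sphere_closure by blast
qed

lemma chain_region_eq: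
  assumes "null_chain G C" "w \<in> C (Suc n)"
  shows "chain_region G C n = connected_component_set (G - C n) w"
proof -
  have cc: "connected (C (Suc n))" "C (Suc n) \<subseteq> G"
    using assms(1) crosscut_connected unfolding null_chain_def by blast+
  have "C (Suc n) \<subseteq> G - C n" using cc null_chain_disjoint[OF assms(1), of n] by blast
  then have "connected_component_set (G - C n) v = connected_component_set (G - C n) w" if "v \<in> C (Suc n)" for v
    using that assms(2) cc(1) by (metis connected_component_eq connected_component_maximal subsetD)
  then show ?thesis unfolding chain_region_def using assms(2) by blast
qed

lemma chain_region_nonempty:
  assumes "null_chain G C" shows "C (Suc n) \<subseteq> chain_region G C n" "chain_region G C n \<noteq> {}" "chain_region G C n \<subseteq> G - C n"
proof -
  have cc: "C (Suc n) \<noteq> {}" "C (Suc n) \<subseteq> G"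
    using assms(1) crosscut_connected unfolding null_chain_def by blast+
  have s: "C (Suc n) \<subseteq> G - C n" using cc null_chain_disjoint[OF assms(1), of n] by blast
  then show 1: "C (Suc n) \<subseteq> chain_region G C n" unfolding chain_region_def
    by (auto intro: connected_component_refl)
  then show "chain_region G C n \<noteq> {}" using cc by blast
  show "chain_region G C n \<subseteq> G - C n" unfolding chain_region_def
    using connected_component_subset by blast
qed

text \<open>Nestedness is not part of the definition of a null-chain. If the region of \<open>C (n+1)\<close> were to leave the region
  \<open>V\<close> of \<open>C n\<close>, it would meet the set \<open>G - V\<close>, which is connected and disjoint from
  \<open>C (n+1)\<close>, and so swallow it together with \<open>C n\<close>; likewise if it met \<open>C n\<close>. But then it would contain
  points of \<open>C 0\<close>, from which \<open>C (n+1)\<close> separates it.\<close>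

lemma chain_region_decreasing:
  assumes G: "connected G" and C: "null_chain G C"
  shows "chain_region G C (Suc n) \<subseteq> chain_region G C n"
proof -
  have cc: "connected (C k)" "C k \<noteq> {}" "C k \<subseteq> G" for k
    using C crosscut_connected unfolding null_chain_def by blast+
  have dj: "C k \<inter> C (Suc k) = {}" for k by (rule null_chain_disjoint[OF C])
  have sep: "separates_in G (C k) (C 0) (C (Suc k))" if "1 \<le> k" for k
    using C that unfolding null_chain_def by blast
  define U V where "U = chain_region G C (Suc n)" "V = chain_region G C n"
  obtain w1 w2 c0 where w: "w1 \<in> C (Suc n)" "w2 \<in> C (Suc (Suc n))" "c0 \<in> C 0" using cc(2) by blast
  have U: "U = connected_component_set (G - C (Suc n)) w2" and V: "V = connected_component_set (G - C n) w1"
    using chain_region_eq[OF C] w by (auto simp: U_V_def)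
  have Umax: "T \<subseteq> U" if "connected T" "T \<subseteq> G - C (Suc n)" "T \<inter> U \<noteq> {}" for T
    using that unfolding U by (metis connected_component_eq connected_component_maximal disjoint_iff)
  have c0U: "c0 \<notin> U"
  proof
    assume "c0 \<in> U"
    then have "connected_component (G - C (Suc n)) c0 w2" unfolding U by (simp add: connected_component_sym)
    then show False using sep[of "Suc n"] w unfolding separates_in_def by auto
  qed
  have w1G: "w1 \<in> G - C n" using w cc dj by blast
  have Vcomp: "V \<in> components (G - C n)" unfolding V components_def using w1G by blast
  have GV: "connected (G - V)" by (rule component_diff_connected[OF cc(1) G cc(3) Vcomp])
  have CV: "C (Suc n) \<subseteq> V" unfolding U_V_def by (rule chain_region_nonempty(1)[OF C])
  have VG: "V \<subseteq> G - C n" unfolding U_V_def by (rule chain_region_nonempty(3)[OF C])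
  have UC: "U \<inter> C n = {}"
  proof (rule ccontr)
    assume m: "U \<inter> C n \<noteq> {}"
    have "c0 \<in> U"
    proof (cases "n = 0")
      case True
      then have "C 0 \<subseteq> U" using m cc dj[of 0] by (intro Umax) auto
      then show ?thesis using w by blast
    next
      case False
      have "c0 \<notin> V"
      proof
        assume "c0 \<in> V"
        then have "connected_component (G - C n) c0 w1" unfolding V by (simp add: connected_component_sym)
        then show False using sep[of n] w False unfolding separates_in_def by auto
      qed
      then have "c0 \<in> G - V" using w cc by blast
      moreover have "G - V \<subseteq> U" using m VG CV cc(3)[of n] by (intro Umax GV) auto
      ultimately show ?thesis by blast
    qed
    then show False using c0U by blast
  qed
  show ?thesis
  proof (rule ccontr)
    assume "\<not> ?thesis"
    then obtain u where u: "u \<in> U" "u \<notin> V" unfolding U_V_def by blast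
    have "u \<in> G" using u unfolding U by (meson DiffD1 connected_component_subset subsetD)
    then have "G - V \<subseteq> U" using u CV by (intro Umax GV) auto
    then show False using UC VG cc(2,3)[of n] by blast
  qed
qed

lemma chain_region_antimono:
  assumes "connected G" "null_chain G C" "m \<le> n"
  shows "chain_region G C n \<subseteq> chain_region G C m"
  using assms(3) by (rule lift_Suc_antimono_le[of "chain_region G C", OF chain_region_decreasing[OF assms(1,2)]])

lemma connected_component_transfer:
  assumes f: "continuous_on D f" and g: "continuous_on (f ` D) g" "\<And>z. z \<in> D \<Longrightarrow> g (f z) = z"
    and S: "S \<subseteq> D" "z \<in> S" "w \<in> S"
  shows "connected_component (f ` S) (f z) (f w) \<longleftrightarrow> connected_component S z w"
proof
  assume "connected_component S z w"
  then obtain T where "connected T" "T \<subseteq> S" "z \<in> T" "w \<in> T" by (auto simp: connected_component_def)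
  moreover have "connected (f ` T)"
    by (rule connected_continuous_image[OF continuous_on_subset[OF f]]) (use calculation S in auto)
  ultimately show "connected_component (f ` S) (f z) (f w)" unfolding connected_component_def
    by (intro exI[of _ "f ` T"]) auto
next
  assume "connected_component (f ` S) (f z) (f w)"
  then obtain T where T: "connected T" "T \<subseteq> f ` S" "f z \<in> T" "f w \<in> T" by (auto simp: connected_component_def)
  have "connected (g ` T)"
    by (rule connected_continuous_image[OF continuous_on_subset[OF g(1)]]) (use T S in auto)
  moreover have "g ` T \<subseteq> S"
  proof (rule image_subsetI)
    fix t assume "t \<in> T"
    then obtain s where "s \<in> S" "t = f s" using T(2) by blast
    then show "g t \<in> S" using g(2)[of s] S(1) by auto
  qed
  moreover have "z \<in> g ` T" "w \<in> g ` T" using T g(2) S by (metis image_eqI subsetD)+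
  ultimately show "connected_component S z w" unfolding connected_component_def by blast
qed

section \<open>Geodesics of the disk around the point 1\<close>

text \<open>In the half-plane these are the semicircles of radius \<open>R\<close> about \<open>0\<close>: as \<open>R\<close> grows they are crosscuts of the
  disk that shrink to \<open>1\<close>. The end points stay away from \<open>1\<close>, unlike those of
  horocycles, so that the boundary extension is available on the closed arcs.\<close>

definition geodesic_arc :: "real \<Rightarrow> complex set" where
  "geodesic_arc R = {z \<in> ball 0 1. cmod (cayley z) = R}"

definition geodesic_cap :: "real \<Rightarrow> complex set" where
  "geodesic_cap R = {z \<in> ball 0 1. R < cmod (cayley z)}"

lemma geodesic_cap_near_1: 
  assumes "z \<in> ball 0 1" "R \<le> cmod (cayley z)" "0 < R" shows "cmod (z - 1) \<le> 2 / R"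
proof -
  have "z \<noteq> 1" using assms(1) by auto
  then have "R * cmod (1 - z) \<le> cmod (1 + z)"
    using assms(2) by (simp add: cayley_def norm_mult norm_divide le_divide_eq)
  also have "\<dots> \<le> 2" using norm_triangle_ineq[of 1 z] assms(1) by simp
  finally show ?thesis using assms(3) by (simp add: le_divide_eq norm_minus_commute mult.commute)
qed

lemma near_1_in_geodesic_cap:
  assumes "0 < R" shows "\<exists>\<epsilon>>0. \<forall>z\<in>ball 0 1. cmod (z - 1) < \<epsilon> \<longrightarrow> z \<in> geodesic_cap R"
proof (intro exI[of _ "1 / (R + 1)"] conjI ballI impI)
  show "0 < 1 / (R + 1)" using assms by simp
  fix z :: complex assume z: "z \<in> ball 0 1" "cmod (z - 1) < 1 / (R + 1)"
  then have "z \<noteq> 1" by auto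
  have "cmod (1 - z) * (R + 1) < 1" using z(2) assms by (simp add: field_simps norm_minus_commute)
  moreover have "cmod (1 + z) \<ge> 2 - cmod (1 - z)"
    using norm_triangle_ineq4[of "1 + z" "z - 1"] by (simp add: norm_minus_commute)
  ultimately have "R * cmod (1 - z) < cmod (1 + z)" by (simp add: algebra_simps)
  then show "z \<in> geodesic_cap R" using z(1) \<open>z \<noteq> 1\<close>
    by (simp add: geodesic_cap_def cayley_def norm_mult norm_divide less_divide_eq)
qed

lemma cexp_uhp: "0 < y \<Longrightarrow> y < pi \<Longrightarrow> 0 < Im (exp (Complex x y))"
  by (simp add: Im_exp sin_gt_zero)

lemma geodesic_arc_param:
  assumes "0 < R"
  shows "geodesic_arc R = (\<lambda>y. cinv (exp (Complex (ln R) y))) ` {0<..<pi}"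
proof (intro set_eqI iffI)
  fix z assume z: "z \<in> geodesic_arc R"
  define w where "w = cayley z"
  have w: "cmod w = R" "0 < Im w" using z cayley_uhp by (auto simp: geodesic_arc_def w_def)
  then have "w \<noteq> 0" by auto
  have a: "0 < Arg w" "Arg w < pi" using w(2) Arg_lt_pi[of w] by auto
  have "exp (Complex (ln R) (Arg w)) = w"
    using \<open>w \<noteq> 0\<close> w(1) exp_Ln[of w] by (metis Arg_def complex_surj Re_Ln)
  moreover have "z \<noteq> 1" using z by (auto simp: geodesic_arc_def)
  ultimately have "cinv (exp (Complex (ln R) (Arg w))) = z" by (simp add: w_def cinv_cayley)
  then show "z \<in> (\<lambda>y. cinv (exp (Complex (ln R) y))) ` {0<..<pi}" using a by force
next
  fix z assume "z \<in> (\<lambda>y. cinv (exp (Complex (ln R) y))) ` {0<..<pi}"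
  then obtain y where y: "0 < y" "y < pi" "z = cinv (exp (Complex (ln R) y))" by auto
  show "z \<in> geodesic_arc R"
    using cexp_uhp[OF y(1,2), of "ln R"] cinv_ball[OF cexp_uhp[OF y(1,2)], of "ln R"] assms y(3)
    by (simp add: geodesic_arc_def cayley_cinv norm_exp_eq_Re less_imp_le)
qed

lemma connected_geodesic_cap: 
  assumes "0 < R" shows "connected (geodesic_cap R)"
proof -
  have "geodesic_cap R = (\<lambda>w. cinv (exp w)) ` {w. ln R < Re w \<and> 0 < Im w \<and> Im w < pi}"
  proof (intro set_eqI iffI)
    fix z assume z: "z \<in> geodesic_cap R"
    define w where "w = cayley z"
    have w: "R < cmod w" "0 < Im w" using z cayley_uhp by (auto simp: geodesic_cap_def w_def)
    then have "w \<noteq> 0" by auto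
    have "0 < Im (Ln w)" "Im (Ln w) < pi" using w(2) Im_Ln_pos_lt[OF \<open>w \<noteq> 0\<close>] Im_Ln_less_pi by auto
    moreover have "ln R < Re (Ln w)" using \<open>w \<noteq> 0\<close> w(1) assms by simp
    moreover have "z \<noteq> 1" using z by (auto simp: geodesic_cap_def)
    then have "cinv (exp (Ln w)) = z" using \<open>w \<noteq> 0\<close> by (simp add: w_def cinv_cayley)
    ultimately show "z \<in> (\<lambda>w. cinv (exp w)) ` {w. ln R < Re w \<and> 0 < Im w \<and> Im w < pi}" by force
  next
    fix z assume "z \<in> (\<lambda>w. cinv (exp w)) ` {w. ln R < Re w \<and> 0 < Im w \<and> Im w < pi}"
    then obtain w where w: "ln R < Re w" "0 < Im w" "Im w < pi" "z = cinv (exp w)" by auto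
    have "0 < Im (exp w)" using w by (simp add: Im_exp sin_gt_zero)
    moreover have "R < exp (Re w)" using w(1) assms by (metis exp_less_cancel_iff exp_ln)
    ultimately show "z \<in> geodesic_cap R" using cinv_ball[of "exp w"] w(4)
      by (simp add: geodesic_cap_def cayley_cinv less_imp_le)
  qed
  moreover have "connected ((\<lambda>w. cinv (exp w)) ` {w. ln R < Re w \<and> 0 < Im w \<and> Im w < pi})"
  proof (rule connected_continuous_image)
    show "continuous_on {w. ln R < Re w \<and> 0 < Im w \<and> Im w < pi} (\<lambda>w. cinv (exp w))"
      by (rule continuous_on_compose2[OF holomorphic_on_imp_continuous_on[OF cinv_holomorphic] continuous_on_exp[OF continuous_on_id]])
         (auto simp: Im_exp intro!: mult_nonneg_nonneg sin_ge_zero)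
    show "connected {w. ln R < Re w \<and> 0 < Im w \<and> Im w < pi}"
      by (rule convex_connected) (auto simp: Collect_conj_eq intro!: convex_Int convex_halfspace_Re_gt convex_halfspace_Im_gt convex_halfspace_Im_lt)
  qed
  ultimately show ?thesis by simp
qed

lemma connected_subset_geodesic_cap:
  assumes "connected T" "T \<subseteq> ball 0 1 - geodesic_arc R" "z \<in> T" "R < cmod (cayley z)"
  shows "T \<subseteq> geodesic_cap R"
proof
  fix w assume w: "w \<in> T"
  have cont: "continuous_on T (\<lambda>z. cmod (cayley z))"
    by (intro continuous_on_norm holomorphic_on_imp_continuous_on holomorphic_on_subset[OF cayley_holomorphic])
       (use assms(2) in auto)
  have "R < cmod (cayley w)"
  proof (rule ccontr)
    assume "\<not> ?thesis"
    then have "R \<in> (\<lambda>z. cmod (cayley z)) ` T"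
      using connectedD_interval[OF connected_continuous_image[OF cont assms(1)], of "cmod (cayley w)" "cmod (cayley z)" R]
        w assms(3,4) by auto
    then show False using assms(2) by (auto simp: geodesic_arc_def)
  qed
  then show "w \<in> geodesic_cap R" using w assms(2) by (auto simp: geodesic_cap_def)
qed

lemma component_geodesic_cap:
  assumes "0 < R" "z \<in> geodesic_cap R"
  shows "connected_component_set (ball 0 1 - geodesic_arc R) z = geodesic_cap R"
proof
  have s: "geodesic_cap R \<subseteq> ball 0 1 - geodesic_arc R" by (auto simp: geodesic_cap_def geodesic_arc_def)
  show "geodesic_cap R \<subseteq> connected_component_set (ball 0 1 - geodesic_arc R) z"
    by (rule connected_component_maximal[OF assms(2) connected_geodesic_cap[OF assms(1)] s])
  show "connected_component_set (ball 0 1 - geodesic_arc R) z \<subseteq> geodesic_cap R"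
    by (rule connected_subset_geodesic_cap[of _ _ z]) (use assms s in \<open>auto simp: geodesic_cap_def intro: connected_component_refl dest: connected_component_in\<close>)
qed

section \<open>Univalent maps without limits at 1\<close>

lemma limitin_compose_filterlim:
  "limitin X f l F \<Longrightarrow> filterlim g F F' \<Longrightarrow> limitin X (\<lambda>x. f (g x)) l F'"
  unfolding limitin_def filterlim_iff by blast

lemma filterlim_reflect_at_left: "filterlim (\<lambda>x::real. 1 - x) (at_right 0) (at_left 1)"
  unfolding filterlim_at
  by (auto simp: eventually_at_filter intro!: tendsto_eq_intros)

lemma filterlim_reflect_at_right: "filterlim (\<lambda>x::real. 1 - x) (at_left 1) (at_right 0)"
  unfolding filterlim_at
  by (auto simp: eventually_at_filter intro!: tendsto_eq_intros)

lemma frequently_at_left_1: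
  "(\<forall>Y<1. \<exists>x. Y < x \<and> 0 < x \<and> x < 1 \<and> Q x) \<longleftrightarrow> \<not> (\<forall>\<^sub>F x in at_left (1::real). \<not> Q x)"
proof -
  have "(\<forall>\<^sub>F x in at_left (1::real). \<not> Q x) \<longleftrightarrow> (\<exists>Y<1. \<forall>x. Y < x \<and> 0 < x \<and> x < 1 \<longrightarrow> \<not> Q x)" (is "?L \<longleftrightarrow> ?R")
  proof
    assume ?L then show ?R unfolding eventually_at_left_field by blast
  next
    assume ?R
    then obtain Y where "Y < 1" "\<forall>x. Y < x \<and> 0 < x \<and> x < 1 \<longrightarrow> \<not> Q x" by blast
    then show ?L unfolding eventually_at_left_field by (intro exI[of _ "max Y 0"]) auto
  qed
  then show ?thesis by blast
qed

lemma eventually_at_left_1_unit: "\<forall>\<^sub>F x in at_left (1::real). x \<in> {0<..<1}"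
  using eventually_at_left_real[of 0 "1::real"] by simp

text \<open>The quantifier pattern \<open>\<forall>Y<1. \<exists>x. Y < x \<and> 0 < x \<and> x < 1\<close>, here and below, says that something happens
  frequently as \<open>x\<close> tends to \<open>1\<close> within the unit interval.\<close>

lemma cluster_sequence_at_left:
  fixes \<eta> :: "real \<Rightarrow> complex"
  assumes freq: "\<forall>Y<1. \<exists>x. Y < x \<and> 0 < x \<and> x < 1 \<and> Q x"
    and K: "compact K" "\<And>x. x \<in> {0<..<1} \<Longrightarrow> \<eta> x \<in> K"
  obtains p X where "p \<in> K" "\<And>n::nat. X n \<in> {0<..<1} \<and> Q (X n)"
    "filterlim X (at_left 1) sequentially" "(\<lambda>n. \<eta> (X n)) \<longlonglongrightarrow> p"
proof -
  have "\<forall>n. \<exists>x. 1 - 1 / real (Suc n) < x \<and> 0 < x \<and> x < 1 \<and> Q x"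
  proof
    fix n :: nat
    have "1 - 1 / real (Suc n) < 1" by simp
    then show "\<exists>x. 1 - 1 / real (Suc n) < x \<and> 0 < x \<and> x < 1 \<and> Q x" using freq by blast
  qed
  then obtain X where X: "\<And>n. 1 - 1 / real (Suc n) < X n \<and> 0 < X n \<and> X n < 1 \<and> Q (X n)" by metis
  have XK: "\<forall>n. \<eta> (X n) \<in> K" using X K(2) by auto
  obtain p r where p: "p \<in> K" "strict_mono r" "((\<lambda>n. \<eta> (X n)) \<circ> r) \<longlonglongrightarrow> p"
    by (rule seq_compactE[OF compact_imp_seq_compact[OF K(1)] XK])
  have "X \<longlonglongrightarrow> 1"
  proof (rule tendsto_sandwich)
    show "\<forall>\<^sub>F n in sequentially. 1 - inverse (real (Suc n)) \<le> X n"
      using X by (intro always_eventually allI) (simp add: inverse_eq_divide less_imp_le)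
    show "\<forall>\<^sub>F n in sequentially. X n \<le> 1" using X by (intro always_eventually allI) (simp add: less_imp_le)
    show "(\<lambda>n. 1 - inverse (real (Suc n))) \<longlonglongrightarrow> 1"
      using tendsto_diff[OF tendsto_const LIMSEQ_inverse_real_of_nat, of 1] by simp
  qed simp
  then have "filterlim X (at_left 1) sequentially"
    unfolding filterlim_at using X by (auto intro!: always_eventually) (metis less_irrefl)
  then have "filterlim (X \<circ> r) (at_left 1) sequentially"
    using filterlim_compose[OF _ filterlim_subseq[OF p(2)]] by (auto simp: o_def)
  then show thesis
    using p X by (intro that[of p "X \<circ> r"]) (auto simp: o_def)
qed

text \<open>In the application \<open>f\<close> is a map of a Loewner chain, \<open>e\<close> a later one in an affine frame, and \<open>\<Phi>\<close> the
  transition between them.\<close>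

locale nonlanding_map =
  fixes e \<Phi> f :: "complex \<Rightarrow> complex"
  assumes e_hol: "e holomorphic_on ball 0 1" and e_inj: "inj_on e (ball 0 1)"
    and \<Phi>_cont: "continuous_on (cball 0 1) \<Phi>" and \<Phi>_inj: "inj_on \<Phi> (cball 0 1)"
    and \<Phi>_hol: "\<Phi> holomorphic_on ball 0 1" and \<Phi>_1: "\<Phi> 1 = 1"
    and \<Phi>_ball: "\<And>z. z \<in> cball 0 1 \<Longrightarrow> z \<noteq> 1 \<Longrightarrow> \<Phi> z \<in> ball 0 1"
    and f_eq: "\<And>z. z \<in> ball 0 1 \<Longrightarrow> f z = e (\<Phi> z)"
    and no_limit: "\<And>\<eta> A. continuous_on {0<..<1} \<eta> \<Longrightarrow> (\<And>x. x \<in> {0<..<1} \<Longrightarrow> \<eta> x \<in> ball 0 1) \<Longrightarrow>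
      (\<eta> \<longlongrightarrow> 1) (at_left (1::real)) \<Longrightarrow> \<not> limitin riemann_sphere (\<lambda>x. Some (e (\<eta> x))) A (at_left 1)"
begin

text \<open>The extension of \<open>f\<close> to the closed disk. At \<open>1\<close> it takes the meaningless value \<open>e 1\<close>; it is only
  used away from \<open>1\<close>.\<close>

definition fb where "fb z = e (\<Phi> z)"
definition G where "G = f ` ball 0 1"
definition finv where "finv = inv_into (ball 0 1) f"
definition pre where "pre C = {z \<in> ball 0 1. f z \<in> C}"

lemma e_cont: "continuous_on (ball 0 1) e" using e_hol holomorphic_on_imp_continuous_on by blast

lemma fb_cont: "continuous_on (cball 0 1 - {1}) fb"
  unfolding fb_def
  by (rule continuous_on_compose2[OF e_cont continuous_on_subset[OF \<Phi>_cont]]) (use \<Phi>_ball in blast)+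

lemma fb_inj: "inj_on fb (cball 0 1 - {1})"
proof (rule inj_onI)
  fix x y assume xy: "x \<in> cball 0 1 - {1}" "y \<in> cball 0 1 - {1}" "fb x = fb y"
  then have "\<Phi> x = \<Phi> y" using inj_onD[OF e_inj, of "\<Phi> x" "\<Phi> y"] \<Phi>_ball by (simp add: fb_def)
  then show "x = y" using inj_onD[OF \<Phi>_inj] xy by simp
qed

lemma f_fb: "z \<in> ball 0 1 \<Longrightarrow> f z = fb z" by (simp add: fb_def f_eq)

lemma ball_cball_1: "z \<in> ball 0 1 \<Longrightarrow> z \<in> cball 0 1 - {1::complex}" by auto

lemma \<Phi>_ball': "z \<in> ball 0 1 \<Longrightarrow> \<Phi> z \<in> ball 0 1"
  using \<Phi>_ball[of z] ball_cball_1[of z] by blast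

lemma f_inj: "inj_on f (ball 0 1)"
proof (rule inj_onI)
  fix x y :: complex assume "x \<in> ball 0 1" "y \<in> ball 0 1" "f x = f y"
  then show "x = y" using inj_onD[OF fb_inj, of x y] ball_cball_1[of x] ball_cball_1[of y] f_fb by metis
qed

lemma f_hol: "f holomorphic_on ball 0 1"
proof -
  have "(e \<circ> \<Phi>) holomorphic_on ball 0 1"
    by (rule holomorphic_on_compose_gen[OF \<Phi>_hol e_hol]) (use \<Phi>_ball' in blast)
  then show ?thesis by (rule holomorphic_transform) (simp add: f_eq)
qed

lemma f_cont: "continuous_on (ball 0 1) f" using f_hol holomorphic_on_imp_continuous_on by blast

lemma G_open: "open G" unfolding G_def by (rule open_mapping_thm3[OF f_hol open_ball f_inj])

lemma G_connected: "connected G" unfolding G_def by (rule connected_continuous_image[OF f_cont connected_ball])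

lemma finv_f: "z \<in> ball 0 1 \<Longrightarrow> finv (f z) = z" unfolding finv_def by (rule inv_into_f_f[OF f_inj])

lemma f_finv: "v \<in> G \<Longrightarrow> f (finv v) = v" unfolding finv_def G_def by (rule f_inv_into_f)

lemma finv_ball: "v \<in> G \<Longrightarrow> finv v \<in> ball 0 1" unfolding finv_def G_def by (rule inv_into_into)

lemma finv_cont: "continuous_on G finv"
proof -
  obtain g where g: "g holomorphic_on G" "\<And>z. z \<in> ball 0 1 \<Longrightarrow> g (f z) = z"
    using holomorphic_has_inverse[OF f_hol open_ball f_inj] unfolding G_def by metis
  have "g v = finv v" if "v \<in> G" for v using g(2)[OF finv_ball[OF that]] f_finv[OF that] by simp
  then show ?thesis by (rule continuous_on_eq[OF holomorphic_on_imp_continuous_on[OF g(1)]])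
qed

lemma boundary_iff: "Some v \<in> sphere_boundary G \<longleftrightarrow> v \<in> closure G \<and> v \<notin> G"
  by (auto simp: sphere_boundary_open[OF G_open])

lemma fb_not_in_G: "z \<in> cball 0 1 \<Longrightarrow> z \<noteq> 1 \<Longrightarrow> z \<notin> ball 0 1 \<Longrightarrow> fb z \<notin> G"
proof
  assume z: "z \<in> cball 0 1" "z \<noteq> 1" "z \<notin> ball 0 1" and "fb z \<in> G"
  then obtain w where w: "w \<in> ball 0 1" "fb z = fb w" unfolding G_def using f_fb by auto
  then have "z = w" using inj_onD[OF fb_inj, of z w] z ball_cball_1[OF w(1)] by blast
  then show False using z w by simp
qed

lemma fb_boundary: "cmod z = 1 \<Longrightarrow> z \<noteq> 1 \<Longrightarrow> Some (fb z) \<in> sphere_boundary G"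
proof -
  assume z: "cmod z = 1" "z \<noteq> 1"
  have "fb z \<in> closure G"
  proof (rule Lim_in_closed_set[OF closed_closure])
    have "(fb \<longlongrightarrow> fb z) (at z within cball 0 1 - {1})"
      using fb_cont z unfolding continuous_on_def by simp
    then show "(fb \<longlongrightarrow> fb z) (at z within ball 0 1)"
      by (rule tendsto_mono[OF at_le, rotated]) auto
    have "\<forall>\<^sub>F x in at z within ball 0 1. x \<in> ball 0 1" by (simp add: eventually_at_filter)
    then show "\<forall>\<^sub>F x in at z within ball 0 1. fb x \<in> closure G"
      by eventually_elim (use f_fb closure_subset in \<open>force simp: G_def\<close>)
    have "z islimpt ball 0 1" using z islimpt_ball[of z 0 1] by simp
    then show "at z within ball 0 1 \<noteq> bot" by (simp add: trivial_limit_within)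
  qed
  then show ?thesis using fb_not_in_G[of z] z by (simp add: boundary_iff)
qed

lemma no_limit_f:
  assumes "continuous_on {0<..<1} \<eta>" "\<And>x. x \<in> {0<..<1} \<Longrightarrow> \<eta> x \<in> cball 0 1 - {1}" "(\<eta> \<longlongrightarrow> 1) (at_left (1::real))"
  shows "\<not> limitin riemann_sphere (\<lambda>x. Some (fb (\<eta> x))) A (at_left 1)"
  unfolding fb_def
proof (rule no_limit)
  show "continuous_on {0<..<1} (\<lambda>x. \<Phi> (\<eta> x))"
    by (rule continuous_on_compose2[OF \<Phi>_cont assms(1)]) (use assms(2) in auto)
  show "\<Phi> (\<eta> x) \<in> ball 0 1" if "x \<in> {0<..<1}" for x using assms(2)[OF that] \<Phi>_ball by blast
  have "((\<lambda>x. \<Phi> (\<eta> x)) \<longlongrightarrow> \<Phi> 1) (at_left 1)"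
  proof (rule continuous_on_tendsto_compose[OF \<Phi>_cont assms(3)])
    show "\<forall>\<^sub>F x in at_left 1. \<eta> x \<in> cball 0 1"
      using eventually_at_left_1_unit by eventually_elim (use assms(2) in blast)
  qed simp
  then show "((\<lambda>x. \<Phi> (\<eta> x)) \<longlongrightarrow> 1) (at_left 1)" by (simp add: \<Phi>_1)
qed

text \<open>By injectivity of the extension, the preimage curve \<open>\<eta>\<close> has at most one cluster point other than \<open>1\<close>, since every such
  cluster point is mapped to \<open>a\<close>. The point \<open>1\<close> alone is impossible by hypothesis, and if \<open>\<eta>\<close> did
  not converge to the other cluster point \<open>p0\<close>, it would by continuity cross a small circle about \<open>p0\<close>
  infinitely often and have a further cluster point there.\<close>

lemma preimage_curve_lands:
  assumes cont: "continuous_on {0<..<1} \<gamma>" and \<gamma>G: "\<And>x. x \<in> {0<..<1} \<Longrightarrow> \<gamma> x \<in> G"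
    and a: "a \<in> sphere_boundary G" and lim: "limitin riemann_sphere (\<lambda>x. Some (\<gamma> x)) a (at_left (1::real))"
  shows "\<exists>\<zeta>. cmod \<zeta> = 1 \<and> \<zeta> \<noteq> 1 \<and> ((\<lambda>x. finv (\<gamma> x)) \<longlongrightarrow> \<zeta>) (at_left 1)"
proof -
  define \<eta> where "\<eta> x = finv (\<gamma> x)" for x
  have \<eta>: "\<eta> x \<in> ball 0 1" "f (\<eta> x) = \<gamma> x" if "x \<in> {0<..<1}" for x
    using finv_ball f_finv \<gamma>G[OF that] by (auto simp: \<eta>_def)
  have \<eta>c: "\<eta> x \<in> cball 0 1" if "x \<in> {0<..<1}" for x using \<eta>(1)[OF that] by simp
  have cont\<eta>: "continuous_on {0<..<1} \<eta>" unfolding \<eta>_def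
    by (rule continuous_on_compose2[OF finv_cont cont]) (use \<gamma>G in blast)
  have cluster: "a = Some (fb p)"
    if "p \<in> cball 0 1" "p \<noteq> 1" "\<And>n. X n \<in> {0<..<1}" "filterlim X (at_left 1) sequentially" "(\<lambda>n. \<eta> (X n)) \<longlonglongrightarrow> p" for p X
  proof -
    have "(\<lambda>n. fb (\<eta> (X n))) \<longlonglongrightarrow> fb p"
    proof (rule continuous_on_tendsto_compose[OF fb_cont that(5)])
      show "p \<in> cball 0 1 - {1}" using that(1,2) by blast
      show "\<forall>\<^sub>F n in sequentially. \<eta> (X n) \<in> cball 0 1 - {1}"
        by (intro always_eventually allI ball_cball_1 \<eta>(1) that(3))
    qed
    moreover have "fb (\<eta> (X n)) = \<gamma> (X n)" for n
      using \<eta>(2)[OF that(3)] f_fb[OF \<eta>(1)[OF that(3)]] by simp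
    ultimately have "limitin riemann_sphere (\<lambda>n. Some (\<gamma> (X n))) (Some (fb p)) sequentially"
      by (simp add: limitin_riemann_sphere_Some)
    from limitin_sphere_unique[OF limitin_compose_filterlim[OF lim that(4)] this] show ?thesis by simp
  qed
  have "\<not> (\<eta> \<longlongrightarrow> 1) (at_left 1)"
  proof
    assume l: "(\<eta> \<longlongrightarrow> 1) (at_left 1)"
    have "\<forall>\<^sub>F x in at_left 1. Some (\<gamma> x) = Some (fb (\<eta> x))"
      using eventually_at_left_1_unit by eventually_elim (use \<eta> f_fb in metis)
    from limitin_transform_eventually[OF this lim]
    show False using no_limit_f[OF cont\<eta> _ l] \<eta>(1) ball_cball_1 by blast
  qed
  then obtain \<epsilon>0 where e0: "\<epsilon>0 > 0" "\<not> (\<forall>\<^sub>F x in at_left 1. dist (\<eta> x) 1 < \<epsilon>0)"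
    unfolding tendsto_iff by blast
  then have "\<forall>Y<1. \<exists>x. Y < x \<and> 0 < x \<and> x < 1 \<and> \<epsilon>0 \<le> dist (\<eta> x) 1"
    unfolding frequently_at_left_1 by (simp add: not_le)
  then obtain p0 X0 where p0: "p0 \<in> cball 0 1" "\<And>n. X0 n \<in> {0<..<1} \<and> \<epsilon>0 \<le> dist (\<eta> (X0 n)) 1"
    "filterlim X0 (at_left 1) sequentially" "(\<lambda>n. \<eta> (X0 n)) \<longlonglongrightarrow> p0"
    by (rule cluster_sequence_at_left[OF _ compact_cball \<eta>c]) blast+
  have "\<epsilon>0 \<le> dist p0 1"
    by (rule LIMSEQ_le_const[OF tendsto_dist[OF p0(4) tendsto_const]]) (use p0(2) in blast)
  then have p1: "p0 \<noteq> 1" using e0 by auto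
  have ap0: "a = Some (fb p0)" by (rule cluster[OF p0(1) p1 _ p0(3,4)]) (use p0(2) in blast)
  have "p0 \<notin> ball 0 1"
  proof
    assume "p0 \<in> ball 0 1"
    then have "fb p0 \<in> G" using f_fb by (force simp: G_def)
    then show False using a ap0 boundary_iff by blast
  qed
  then have np0: "cmod p0 = 1" using p0(1) by simp
  have "(\<eta> \<longlongrightarrow> p0) (at_left 1)"
  proof (rule ccontr)
    assume "\<not> ?thesis"
    then obtain \<epsilon>1 where e1: "\<epsilon>1 > 0" "\<not> (\<forall>\<^sub>F x in at_left 1. dist (\<eta> x) p0 < \<epsilon>1)"
      unfolding tendsto_iff by blast
    then have far: "\<forall>Y<1. \<exists>x. Y < x \<and> 0 < x \<and> x < 1 \<and> \<epsilon>1 \<le> dist (\<eta> x) p0"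
      unfolding frequently_at_left_1 by (simp add: not_le)
    define d where "d = min \<epsilon>1 (dist p0 1 / 2)"
    have d: "0 < d" "d \<le> \<epsilon>1" "d < dist p0 1" using e1 p1 by (auto simp: d_def min_less_iff_disj)
    have "\<exists>x. Y < x \<and> 0 < x \<and> x < 1 \<and> dist (\<eta> x) p0 = d" if Y: "Y < 1" for Y
    proof -
      obtain x1 where x1: "Y < x1" "0 < x1" "x1 < 1" "\<epsilon>1 \<le> dist (\<eta> x1) p0" using far Y by blast
      have "\<forall>\<^sub>F x in at_left 1. Y < x" using eventually_at_left_real[OF Y] by eventually_elim simp
      then have "\<forall>\<^sub>F n in sequentially. Y < X0 n" using p0(3) unfolding filterlim_iff by blast
      moreover have "\<forall>\<^sub>F n in sequentially. dist (\<eta> (X0 n)) p0 < d" using tendstoD[OF p0(4) d(1)] .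
      ultimately have "\<forall>\<^sub>F n in sequentially. Y < X0 n \<and> dist (\<eta> (X0 n)) p0 < d" by eventually_elim simp
      then obtain n where n: "Y < X0 n" "dist (\<eta> (X0 n)) p0 < d" using eventually_happens by force
      define x2 where "x2 = X0 n"
      have x2: "0 < x2" "x2 < 1" "Y < x2" "dist (\<eta> x2) p0 < d" using n p0(2)[of n] by (auto simp: x2_def)
      have c: "continuous_on {min x1 x2..max x1 x2} (\<lambda>x. dist (\<eta> x) p0)"
        by (intro continuous_intros continuous_on_subset[OF cont\<eta>]) (use x1 x2 in auto)
      have "\<exists>x. min x1 x2 \<le> x \<and> x \<le> max x1 x2 \<and> dist (\<eta> x) p0 = d"
      proof (cases "x1 \<le> x2")
        case True
        then show ?thesis using IVT2'[of "\<lambda>x. dist (\<eta> x) p0" x2 d x1] x1 x2 d c by auto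
      next
        case False
        then show ?thesis using IVT'[of "\<lambda>x. dist (\<eta> x) p0" x2 d x1] x1 x2 d c by auto
      qed
      then obtain x where "min x1 x2 \<le> x" "x \<le> max x1 x2" "dist (\<eta> x) p0 = d" by blast
      then show ?thesis using x1 x2 by (intro exI[of _ x]) (auto simp: min_def max_def split: if_splits)
    qed
    then have "\<forall>Y<1. \<exists>x. Y < x \<and> 0 < x \<and> x < 1 \<and> dist (\<eta> x) p0 = d" by blast
    then obtain p X where p: "p \<in> cball 0 1" "\<And>n. X n \<in> {0<..<1} \<and> dist (\<eta> (X n)) p0 = d"
      "filterlim X (at_left 1) sequentially" "(\<lambda>n. \<eta> (X n)) \<longlonglongrightarrow> p"
      by (rule cluster_sequence_at_left[OF _ compact_cball \<eta>c]) blast+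
    have "(\<lambda>n. dist (\<eta> (X n)) p0) \<longlonglongrightarrow> dist p p0" by (intro tendsto_intros p(4))
    then have dp: "dist p p0 = d" using p(2) LIMSEQ_unique[OF _ tendsto_const[of d]] by auto
    then have "p \<noteq> 1" using d by (auto simp: dist_commute)
    have "a = Some (fb p)" by (rule cluster[OF p(1) \<open>p \<noteq> 1\<close> _ p(3,4)]) (use p(2) in blast)
    then have "fb p = fb p0" using ap0 by simp
    then have "p = p0" using inj_onD[OF fb_inj] p(1) p0(1) p1 \<open>p \<noteq> 1\<close> by blast
    then show False using dp d by simp
  qed
  then show ?thesis using np0 p1 unfolding \<eta>_def by blast
qed

lemma preimage_curve_lands_right:
  assumes cont: "continuous_on {0<..<1} \<gamma>" and \<gamma>G: "\<And>x. x \<in> {0<..<1} \<Longrightarrow> \<gamma> x \<in> G"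
    and a: "a \<in> sphere_boundary G" and lim: "limitin riemann_sphere (\<lambda>x. Some (\<gamma> x)) a (at_right (0::real))"
  shows "\<exists>\<zeta>. cmod \<zeta> = 1 \<and> \<zeta> \<noteq> 1 \<and> ((\<lambda>x. finv (\<gamma> x)) \<longlongrightarrow> \<zeta>) (at_right 0)"
proof -
  have "\<exists>\<zeta>. cmod \<zeta> = 1 \<and> \<zeta> \<noteq> 1 \<and> ((\<lambda>x. finv (\<gamma> (1 - x))) \<longlongrightarrow> \<zeta>) (at_left 1)"
  proof (rule preimage_curve_lands[OF _ _ a])
    show "continuous_on {0<..<1} (\<lambda>x. \<gamma> (1 - x))"
      by (rule continuous_on_compose2[OF cont]) (auto intro!: continuous_intros)
    show "limitin riemann_sphere (\<lambda>x. Some (\<gamma> (1 - x))) a (at_left 1)"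
      by (rule limitin_compose_filterlim[OF lim filterlim_reflect_at_left])
  qed (use \<gamma>G in auto)
  then obtain \<zeta> where z: "cmod \<zeta> = 1" "\<zeta> \<noteq> 1" "((\<lambda>x. finv (\<gamma> (1 - x))) \<longlongrightarrow> \<zeta>) (at_left 1)" by blast
  from filterlim_compose[OF z(3) filterlim_reflect_at_right] z show ?thesis by auto
qed

lemma pre_subset: "pre C \<subseteq> ball 0 1" by (auto simp: pre_def)

lemma f_pre: "C \<subseteq> G \<Longrightarrow> f ` pre C = C" by (auto simp: pre_def G_def)

lemma pre_finv: "C \<subseteq> G \<Longrightarrow> pre C = finv ` C"
proof (intro set_eqI iffI)
  fix z assume "z \<in> pre C" then show "z \<in> finv ` C" using finv_f[of z] by (force simp: pre_def)
next
  fix z assume "C \<subseteq> G" "z \<in> finv ` C"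
  then show "z \<in> pre C" using finv_ball f_finv by (auto simp: pre_def simp del: mem_ball mem_ball_0)
qed

text \<open>That preimages of crosscuts end away from \<open>1\<close> is special to maps without limits at \<open>1\<close>; it is the reason why
  a geodesic cap eventually fits into any region of a null-chain.\<close>

lemma crosscut_pre:
  assumes C: "crosscut G C" shows "crosscut (ball 0 1) (pre C)" "1 \<notin> closure (pre C)"
proof -
  obtain \<gamma> a b where \<gamma>: "continuous_on {0<..<1::real} \<gamma>" "inj_on \<gamma> {0<..<1}" "\<gamma> ` {0<..<1} = C" "C \<subseteq> G"
    and ab: "a \<in> sphere_boundary G" "b \<in> sphere_boundary G"
       "limitin riemann_sphere (\<lambda>x. Some (\<gamma> x)) a (at_right 0)"
       "limitin riemann_sphere (\<lambda>x. Some (\<gamma> x)) b (at_left 1)"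
    using C unfolding crosscut_def by blast
  have \<gamma>G: "\<gamma> x \<in> G" if "x \<in> {0<..<1}" for x using \<gamma> that by blast
  define \<eta> where "\<eta> x = finv (\<gamma> x)" for x
  obtain \<zeta>a where za: "cmod \<zeta>a = 1" "\<zeta>a \<noteq> 1" "(\<eta> \<longlongrightarrow> \<zeta>a) (at_right 0)"
    using preimage_curve_lands_right[OF \<gamma>(1) \<gamma>G ab(1,3)] unfolding \<eta>_def by blast
  obtain \<zeta>b where zb: "cmod \<zeta>b = 1" "\<zeta>b \<noteq> 1" "(\<eta> \<longlongrightarrow> \<zeta>b) (at_left 1)"
    using preimage_curve_lands[OF \<gamma>(1) \<gamma>G ab(2,4)] unfolding \<eta>_def by blast
  have cont: "continuous_on {0<..<1} \<eta>" unfolding \<eta>_def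
    by (rule continuous_on_compose2[OF finv_cont \<gamma>(1)]) (use \<gamma>G in blast)
  have im: "\<eta> ` {0<..<1} = pre C" 
  proof -
    have "\<eta> ` {0<..<1} = finv ` \<gamma> ` {0<..<1}" by (simp add: \<eta>_def image_image)
    then show ?thesis using \<gamma>(3) pre_finv[OF \<gamma>(4)] by simp
  qed
  have inj: "inj_on \<eta> {0<..<1}"
  proof (rule inj_onI)
    fix x y assume xy: "x \<in> {0<..<1}" "y \<in> {0<..<1}" "\<eta> x = \<eta> y"
    then have "\<gamma> x = \<gamma> y" using f_finv \<gamma>G unfolding \<eta>_def by metis
    then show "x = y" using \<gamma>(2) xy by (meson inj_onD)
  qed
  show "crosscut (ball 0 1) (pre C)" unfolding crosscut_def
    by (rule exI[of _ \<eta>], rule exI[of _ "Some \<zeta>a"], rule exI[of _ "Some \<zeta>b"])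
       (use cont inj im pre_subset za zb in \<open>auto simp: sphere_boundary_disk limitin_riemann_sphere_Some\<close>)
  define h where "h x = (if x \<le> 0 then \<zeta>a else if 1 \<le> x then \<zeta>b else \<eta> x)" for x
  have h01: "h 0 = \<zeta>a" "h 1 = \<zeta>b" by (simp_all add: h_def)
  have "continuous_on {0..1} h"
  proof (rule continuous_on_IccI)
    have "\<forall>\<^sub>F x in at_right (0::real). x \<in> {0<..<1}" using eventually_at_right_real[of 0 "1::real"] by simp
    then have ev: "\<forall>\<^sub>F x in at_right 0. \<eta> x = h x" by eventually_elim (auto simp: h_def)
    show "(h \<longlongrightarrow> h 0) (at_right 0)" using tendsto_cong[OF ev] za(3) unfolding h01 by blast
    have ev: "\<forall>\<^sub>F x in at_left 1. \<eta> x = h x" using eventually_at_left_1_unit by eventually_elim (auto simp: h_def)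
    show "(h \<longlongrightarrow> h 1) (at_left 1)" using tendsto_cong[OF ev] zb(3) unfolding h01 by blast
    fix x :: real assume x: "0 < x" "x < 1"
    have "(\<eta> \<longlongrightarrow> \<eta> x) (at x)"
      using cont x continuous_on_eq_continuous_at[of "{0<..<1::real}" \<eta>] by (simp add: isCont_def)
    moreover have "\<forall>\<^sub>F y in at x. y \<in> {0<..<1}" using x by (intro eventually_at_in_open') auto
    then have ev: "\<forall>\<^sub>F y in at x. \<eta> y = h y" by eventually_elim (auto simp: h_def)
    moreover have hx: "h x = \<eta> x" using x by (simp add: h_def)
    ultimately show "h \<midarrow>x\<rightarrow> h x" unfolding hx using tendsto_cong[OF ev] by blast
  qed simp
  then have "compact (h ` {0..1})" by (intro compact_continuous_image) auto
  then have "closed (h ` {0..1})" by (rule compact_imp_closed)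
  moreover have "pre C \<subseteq> h ` {0..1}"
  proof
    fix z assume "z \<in> pre C"
    then obtain x where "x \<in> {0<..<1}" "z = \<eta> x" unfolding im[symmetric] by blast
    then have "z = h x" "x \<in> {0..1}" by (auto simp: h_def)
    then show "z \<in> h ` {0..1}" by blast
  qed
  ultimately have "closure (pre C) \<subseteq> h ` {0..1}" by (rule closure_minimal[rotated])
  moreover have "1 \<notin> h ` {0..1}"
  proof
    assume "1 \<in> h ` {0..1}"
    then obtain x where x: "x \<in> {0..1}" "h x = 1" by auto
    have "\<eta> x \<noteq> 1" if "x \<in> {0<..<1}" using finv_ball[OF \<gamma>G[OF that]] unfolding \<eta>_def by auto
    then show False using x za zb by (auto simp: h_def split: if_splits)
  qed
  ultimately show "1 \<notin> closure (pre C)" by blast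
qed

lemma component_transfer:
  assumes C: "C \<subseteq> G" and z: "z \<in> ball 0 1"
  shows "connected_component_set (G - C) (f z) = f ` connected_component_set (ball 0 1 - pre C) z"
proof (cases "z \<in> pre C")
  case True
  then have "z \<notin> ball 0 1 - pre C" "f z \<notin> G - C" by (auto simp: pre_def)
  then show ?thesis by (simp add: connected_component_eq_empty[THEN iffD2])
next
  case False
  have fS: "f ` (ball 0 1 - pre C) = G - C" unfolding G_def pre_def using f_inj by (auto simp: inj_on_def)
  have tr: "connected_component (G - C) (f z) (f w) \<longleftrightarrow> connected_component (ball 0 1 - pre C) z w"
    if "w \<in> ball 0 1 - pre C" for w
    unfolding fS[symmetric]
    by (rule connected_component_transfer[OF f_cont finv_cont[unfolded G_def] finv_f]) (use that z False in auto)
  show ?thesis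
  proof (intro set_eqI iffI)
    fix v assume v: "v \<in> connected_component_set (G - C) (f z)"
    then have "v \<in> G - C" using connected_component_subset by blast
    then obtain w where w: "w \<in> ball 0 1 - pre C" "v = f w" unfolding fS[symmetric] by blast
    then show "v \<in> f ` connected_component_set (ball 0 1 - pre C) z" using tr v by auto
  next
    fix v assume "v \<in> f ` connected_component_set (ball 0 1 - pre C) z"
    then obtain w where w: "connected_component (ball 0 1 - pre C) z w" "v = f w" by auto
    then have "w \<in> ball 0 1 - pre C" using connected_component_in by metis
    then show "v \<in> connected_component_set (G - C) (f z)" using tr w by auto
  qed
qed

lemma chain_region_transfer:
  assumes "\<And>n. C n \<subseteq> G"
  shows "chain_region G C n = f ` chain_region (ball 0 1) (\<lambda>n. pre (C n)) n"
proof -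
  have "chain_region G C n = (\<Union>z\<in>pre (C (Suc n)). connected_component_set (G - C n) (f z))"
    unfolding chain_region_def by (subst f_pre[OF assms, symmetric]) simp
  also have "\<dots> = (\<Union>z\<in>pre (C (Suc n)). f ` connected_component_set (ball 0 1 - pre (C n)) z)"
    by (intro SUP_cong refl component_transfer assms) (use pre_subset in blast)
  finally show ?thesis unfolding chain_region_def by blast
qed

lemma separates_transfer:
  assumes "C \<subseteq> G" "A \<subseteq> G" "B \<subseteq> G"
  shows "separates_in G C A B \<longleftrightarrow> separates_in (ball 0 1) (pre C) (pre A) (pre B)"
proof -
  have 1: "(A \<subseteq> G - C) = (pre A \<subseteq> ball 0 1 - pre C)" if "A \<subseteq> G" for A
  proof -
    have *: "pre A \<inter> pre C = pre (A \<inter> C)" by (auto simp: pre_def)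
    have "f ` pre (A \<inter> C) = A \<inter> C" by (rule f_pre) (use that in blast)
    then have "A \<inter> C = {} \<longleftrightarrow> pre A \<inter> pre C = {}" unfolding * by (metis image_is_empty)
    then show ?thesis using that pre_subset[of A] by blast
  qed
  have 2: "connected_component (G - C) (f x) (f y) \<longleftrightarrow> connected_component (ball 0 1 - pre C) x y"
    if "x \<in> ball 0 1" "y \<in> ball 0 1" for x y
  proof -
    have "connected_component (G - C) (f x) (f y) \<longleftrightarrow> f y \<in> f ` connected_component_set (ball 0 1 - pre C) x"
      using component_transfer[OF assms(1) that(1)] by (metis mem_Collect_eq)
    also have "\<dots> \<longleftrightarrow> y \<in> connected_component_set (ball 0 1 - pre C) x"
      by (rule inj_on_image_mem_iff[OF f_inj that(2)]) (use connected_component_subset in blast)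
    finally show ?thesis by simp
  qed
  have 3: "(\<forall>a\<in>A. \<forall>b\<in>B. \<not> connected_component (G - C) a b) \<longleftrightarrow>
     (\<forall>a\<in>pre A. \<forall>b\<in>pre B. \<not> connected_component (G - C) (f a) (f b))"
    by (subst f_pre[OF assms(2), symmetric], subst f_pre[OF assms(3), symmetric]) simp
  show ?thesis unfolding separates_in_def 3 using 1[OF assms(2)] 1[OF assms(3)] 2 pre_subset by blast
qed

end

section \<open>The prime end at 1\<close>

lemma cmod_cayley: "cmod (cayley z) = cmod (1 + z) / cmod (1 - z)"
  by (simp only: cayley_def norm_mult norm_divide norm_ii mult_1)

lemma closure_geodesic_arc: "closure (geodesic_arc R) \<subseteq> {z \<in> cball 0 1. cmod (1 + z) = R * cmod (1 - z)}"
proof (rule closure_minimal)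
  have "closed (cball 0 1 \<inter> {z::complex. cmod (1 + z) = R * cmod (1 - z)})"
    by (intro closed_Int closed_cball closed_Collect_eq continuous_intros)
  then show "closed {z::complex \<in> cball 0 1. cmod (1 + z) = R * cmod (1 - z)}" by (simp add: Int_def)
  show "geodesic_arc R \<subseteq> {z \<in> cball 0 1. cmod (1 + z) = R * cmod (1 - z)}"
  proof
    fix z assume z: "z \<in> geodesic_arc R"
    then have "1 - z \<noteq> 0" by (auto simp: geodesic_arc_def)
    then show "z \<in> {z \<in> cball 0 1. cmod (1 + z) = R * cmod (1 - z)}"
      using z by (auto simp: geodesic_arc_def cmod_cayley)
  qed
qed

lemma closure_geodesic_arcs_disjoint:
  assumes R: "R \<noteq> R'" "0 < R" "0 < R'"
  shows "closure (geodesic_arc R) \<inter> closure (geodesic_arc R') = {}"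
proof -
  have "False" if "cmod (1 + z) = R * cmod (1 - z)" "cmod (1 + z) = R' * cmod (1 - z)" for z
  proof -
    have "(R - R') * cmod (1 - z) = 0" unfolding left_diff_distrib using that by linarith
    then have "1 - z = 0" using R by simp
    then show False using that by simp
  qed
  then show ?thesis using closure_geodesic_arc by blast
qed

lemma geodesic_arc_crosscut:
  assumes "0 < R" shows "crosscut (ball 0 1) (geodesic_arc R)"
proof -
  define \<gamma> where "\<gamma> x = cinv (exp (Complex (ln R) (pi * x)))" for x :: real
  have eC: "continuous_on X (\<lambda>x. exp (Complex (ln R) (pi * x)))" for X
  proof -
    have "continuous_on X (\<lambda>x. exp (of_real (ln R) + \<i> * of_real (pi * x)))" by (intro continuous_intros)
    moreover have "Complex (ln R) (pi * x) = of_real (ln R) + \<i> * of_real (pi * x)" for x by (simp add: complex_eq_iff)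
    ultimately show ?thesis by simp
  qed
  have up: "0 < Im (exp (Complex (ln R) (pi * x)))" if "x \<in> {0<..<1}" for x
    using that by (intro cexp_uhp) auto
  have up': "0 \<le> Im (exp (Complex (ln R) (pi * x)))" if "x \<in> {0..1}" for x
    using that by (auto simp: Im_exp intro!: mult_nonneg_nonneg sin_ge_zero mult_left_le)
  have cont: "continuous_on {0..1} \<gamma>" unfolding \<gamma>_def
    by (rule continuous_on_compose2[OF holomorphic_on_imp_continuous_on[OF cinv_holomorphic] eC]) (use up' in auto)
  have im: "\<gamma> ` {0<..<1} = geodesic_arc R"
  proof -
    have "{0<..<pi} = (\<lambda>x. pi * x) ` {0<..<1}"
    proof (intro set_eqI iffI)
      fix y :: real assume "y \<in> {0<..<pi}"
      then have "y = pi * (y / pi)" "y / pi \<in> {0<..<1}" by auto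
      then show "y \<in> (\<lambda>x. pi * x) ` {0<..<1}" by blast
    qed auto
    then show ?thesis unfolding geodesic_arc_param[OF assms] \<gamma>_def by (simp add: image_image)
  qed
  have inj: "inj_on \<gamma> {0<..<1}"
  proof (rule inj_onI)
    fix x y assume xy: "x \<in> {0<..<1}" "y \<in> {0<..<1}" "\<gamma> x = \<gamma> y"
    then have "exp (Complex (ln R) (pi * x)) = exp (Complex (ln R) (pi * y))"
      unfolding \<gamma>_def using inj_onD[OF cinv_inj] up[of x] up[of y] by (metis less_imp_le mem_Collect_eq)
    moreover have "\<bar>Im (Complex (ln R) (pi * x)) - Im (Complex (ln R) (pi * y))\<bar> < 2 * pi"
    proof -
      have "\<bar>x - y\<bar> < 1" using xy by auto
      then have "pi * \<bar>x - y\<bar> < pi * 1" by (intro mult_strict_left_mono) auto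
      then show ?thesis by (simp add: abs_mult right_diff_distrib[symmetric])
    qed
    ultimately have "Complex (ln R) (pi * x) = Complex (ln R) (pi * y)"
      by (rule exp_complex_eqI[rotated])
    then show "x = y" by simp
  qed
  have ends: "cmod (\<gamma> 0) = 1" "cmod (\<gamma> 1) = 1" unfolding \<gamma>_def
    by (rule cinv_real_sphere; simp add: Im_exp)+
  have lims: "(\<gamma> \<longlongrightarrow> \<gamma> 0) (at_right 0)" "(\<gamma> \<longlongrightarrow> \<gamma> 1) (at_left 1)"
    using cont continuous_on_Icc_at_rightD[of 0 1 \<gamma>] continuous_on_Icc_at_leftD[of 0 1 \<gamma>] by auto
  show ?thesis unfolding crosscut_def
    by (rule exI[of _ \<gamma>], rule exI[of _ "Some (\<gamma> 0)"], rule exI[of _ "Some (\<gamma> 1)"])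
       (use cont inj im ends lims in \<open>auto simp: sphere_boundary_disk limitin_riemann_sphere_Some geodesic_arc_def
          intro: continuous_on_subset\<close>)
qed

lemma geodesic_arc_closed_disk: "closure (geodesic_arc R) \<subseteq> cball 0 1"
  using closure_geodesic_arc by blast

lemma one_notin_closure_geodesic_arc: "1 \<notin> closure (geodesic_arc R)"
proof
  assume "1 \<in> closure (geodesic_arc R)"
  then have "cmod (1 + 1 :: complex) = R * cmod (1 - 1 :: complex)" using closure_geodesic_arc by blast
  then show False by simp
qed

context nonlanding_map begin

lemma pre_f_image: "A \<subseteq> ball 0 1 \<Longrightarrow> pre (f ` A) = A"
proof (intro set_eqI iffI)
  fix z assume A: "A \<subseteq> ball 0 1" and "z \<in> pre (f ` A)"
  then obtain a where "z \<in> ball 0 1" "a \<in> A" "f z = f a" by (auto simp: pre_def)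
  then show "z \<in> A" using inj_onD[OF f_inj] A by blast
next
  fix z assume "A \<subseteq> ball 0 1" "z \<in> A" then show "z \<in> pre (f ` A)" unfolding pre_def by blast
qed

text \<open>In the coordinate \<open>log H\<close> the disk is a strip of height \<open>pi\<close> and geodesics about \<open>1\<close> are vertical segments. On
  an interval of length \<open>n + 1\<close> there is a segment whose image under the bounded model is
  \<open>O(1 / sqrt (n + 1))\<close>; starting the intervals at \<open>(n + 1)\<^sup>2\<close> keeps them disjoint.\<close>

lemma short_radii:
  obtains R where "strict_mono R" "\<And>n. 0 < R n" "filterlim R at_top sequentially"
    "(\<lambda>n. spherical_diameter (f ` geodesic_arc (R n))) \<longlonglongrightarrow> 0"
proof -
  obtain b \<alpha> s B where b: "b holomorphic_on ball 0 1" "inj_on b (ball 0 1)" "0 < B" and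
    bF: "\<And>z. z \<in> ball 0 1 \<Longrightarrow> b z \<noteq> 0 \<and> cmod (b z) \<le> B \<and> f z = \<alpha> + (1 / b z - s)\<^sup>2"
    using univalent_disk_bounded_model[OF f_hol f_inj] by metis
  obtain C where C: "0 \<le> C" "\<And>w w'. w \<noteq> 0 \<Longrightarrow> w' \<noteq> 0 \<Longrightarrow> cmod w \<le> B \<Longrightarrow> cmod w' \<le> B \<Longrightarrow>
      chordal_dist (\<alpha> + (1 / w - s)\<^sup>2) (\<alpha> + (1 / w' - s)\<^sup>2) \<le> C * cmod (w - w')"
    using chordal_dist_Lipschitz[OF b(3)] by metis
  define g where "g = (\<lambda>w. b (cinv (exp w)))"
  define S where "S = {z. 0 < Im z \<and> Im z < pi}"
  have eS: "0 < Im (exp w)" if "w \<in> S" for w using that by (simp add: S_def Im_exp sin_gt_zero)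
  have bS: "cinv (exp w) \<in> ball 0 1" if "w \<in> S" for w by (rule cinv_ball[OF eS[OF that]])
  have "(\<lambda>w. cinv (exp w)) holomorphic_on S"
  proof -
    have "exp ` S \<subseteq> closed_uhp" using eS less_imp_le by blast
    from holomorphic_on_compose_gen[OF holomorphic_on_exp cinv_holomorphic this]
    show ?thesis by (simp add: o_def)
  qed
  from holomorphic_on_compose_gen[OF this b(1)] have holg: "g holomorphic_on S"
    using bS unfolding g_def o_def by blast
  have injg: "inj_on g S"
  proof (rule inj_onI)
    fix w w' assume w: "w \<in> S" "w' \<in> S" "g w = g w'"
    then have "cinv (exp w) = cinv (exp w')" using inj_onD[OF b(2)] bS unfolding g_def by blast
    then have e: "exp w = exp w'" using inj_onD[OF cinv_inj] eS[OF w(1)] eS[OF w(2)] by (simp add: less_imp_le)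
    have "\<bar>Im w - Im w'\<bar> < 2 * pi" using w by (auto simp: S_def)
    then show "w = w'" using e by (rule exp_complex_eqI)
  qed
  have bdg: "cmod (g w) \<le> B" if "0 < Im w" "Im w < pi" for w using bF[OF bS] that by (simp add: g_def S_def)
  define M where "M = pi / 2 + 2 * B\<^sup>2"
  have "\<forall>n. \<exists>x\<in>{(real n + 1)\<^sup>2..(real n + 1)\<^sup>2 + (real n + 1)}. \<forall>y\<in>{0<..<pi}. \<forall>y'\<in>{0<..<pi}.
      cmod (g (Complex x y) - g (Complex x y')) \<le> M / sqrt (real n + 1)"
    unfolding M_def
    by (intro allI exists_short_crosscut_strip[OF holg[unfolded S_def] injg[unfolded S_def] bdg]) simp_all
  then obtain x where x: "\<And>n. x n \<in> {(real n + 1)\<^sup>2..(real n + 1)\<^sup>2 + (real n + 1)}"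
    and osc: "\<And>n y y'. y \<in> {0<..<pi} \<Longrightarrow> y' \<in> {0<..<pi} \<Longrightarrow>
      cmod (g (Complex (x n) y) - g (Complex (x n) y')) \<le> M / sqrt (real n + 1)"
    by metis
  define R where "R n = exp (x n)" for n
  show thesis
  proof (rule that)
    show "strict_mono R"
    proof (rule strict_mono_Suc_iff[THEN iffD2], rule allI)
      fix n
      have "x n \<le> (real n + 1)\<^sup>2 + (real n + 1)" using x[of n] by simp
      also have "\<dots> < (real (Suc n) + 1)\<^sup>2" by (simp add: power2_eq_square algebra_simps)
      also have "\<dots> \<le> x (Suc n)" using x[of "Suc n"] by simp
      finally show "R n < R (Suc n)" by (simp add: R_def)
    qed
    show "0 < R n" for n by (simp add: R_def)
    have "filterlim x at_top sequentially"
    proof (rule filterlim_at_top_mono[OF filterlim_real_sequentially])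
      show "\<forall>\<^sub>F n in sequentially. real n \<le> x n"
      proof (intro always_eventually allI)
        fix n
        have "real n \<le> (real n + 1)\<^sup>2" by (simp add: power2_eq_square algebra_simps)
        also have "\<dots> \<le> x n" using x[of n] by simp
        finally show "real n \<le> x n" .
      qed
    qed
    then show "filterlim R at_top sequentially" unfolding R_def
      by (rule filterlim_compose[OF exp_at_top])
    have bound: "0 \<le> spherical_diameter (f ` geodesic_arc (R n))"
       "spherical_diameter (f ` geodesic_arc (R n)) \<le> C * (M / sqrt (real n + 1))" for n
    proof -
      have ne: "f ` geodesic_arc (R n) \<noteq> {}" 
        using crosscut_connected(2)[OF geodesic_arc_crosscut[of "R n"]] by (simp add: R_def)
      have "chordal_dist v v' \<le> C * (M / sqrt (real n + 1))"
        if v: "v \<in> f ` geodesic_arc (R n)" "v' \<in> f ` geodesic_arc (R n)" for v v'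
      proof -
        have par: "\<exists>y\<in>{0<..<pi}. u = f (cinv (exp (Complex (x n) y)))" if "u \<in> f ` geodesic_arc (R n)" for u
          using that geodesic_arc_param[of "R n"] by (auto simp: R_def)
        obtain y where y: "y \<in> {0<..<pi}" "v = f (cinv (exp (Complex (x n) y)))" using par[OF v(1)] by blast
        obtain y' where y': "y' \<in> {0<..<pi}" "v' = f (cinv (exp (Complex (x n) y')))" using par[OF v(2)] by blast
        have S: "Complex (x n) y \<in> S" "Complex (x n) y' \<in> S" using y y' by (auto simp: S_def)
        have "chordal_dist v v' \<le> C * cmod (g (Complex (x n) y) - g (Complex (x n) y'))"
          using C(2)[of "g (Complex (x n) y)" "g (Complex (x n) y')"] bF[OF bS[OF S(1)]] bF[OF bS[OF S(2)]] y(2) y'(2)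
          by (simp add: g_def)
        also have "\<dots> \<le> C * (M / sqrt (real n + 1))"
          by (intro mult_left_mono osc y y' C(1))
        finally show ?thesis .
      qed
      from spherical_diameter_bounds[OF ne this]
      show "0 \<le> spherical_diameter (f ` geodesic_arc (R n))"
       "spherical_diameter (f ` geodesic_arc (R n)) \<le> C * (M / sqrt (real n + 1))" by blast+
    qed
    have "(\<lambda>n. C * (M / sqrt (real n + 1))) \<longlonglongrightarrow> 0"
    proof -
      have "filterlim (\<lambda>n. sqrt (real n + 1)) at_top sequentially"
        by (rule filterlim_compose[OF sqrt_at_top])
           (rule filterlim_at_top_mono[OF filterlim_real_sequentially], simp)
      from tendsto_mult[OF tendsto_const tendsto_divide_0[OF tendsto_const filterlim_at_top_imp_at_infinity[OF this]]]
      show ?thesis by simp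
    qed
    then show "(\<lambda>n. spherical_diameter (f ` geodesic_arc (R n))) \<longlonglongrightarrow> 0"
      by (rule tendsto_sandwich[OF _ _ tendsto_const, rotated 2]) (intro always_eventually allI bound)+
  qed
qed

end

locale nonlanding_map_radii = nonlanding_map +
  fixes R :: "nat \<Rightarrow> real"
  assumes R_mono: "strict_mono R" and R_pos: "\<And>n. 0 < R n" and R_lim: "filterlim R at_top sequentially"
    and R_diam: "(\<lambda>n. spherical_diameter (f ` geodesic_arc (R n))) \<longlonglongrightarrow> 0"
begin

definition K where "K n = f ` geodesic_arc (R n)"

lemma geodesic_arc_disk: "geodesic_arc r \<subseteq> ball 0 1" by (auto simp: geodesic_arc_def)
lemma geodesic_cap_disk: "geodesic_cap r \<subseteq> ball 0 1" by (auto simp: geodesic_cap_def)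

lemma K_sub: "K n \<subseteq> G" unfolding K_def G_def using geodesic_arc_disk by blast

lemma pre_K: "pre (K n) = geodesic_arc (R n)" unfolding K_def by (rule pre_f_image[OF geodesic_arc_disk])

lemma arc_in_cap: "m < n \<Longrightarrow> geodesic_arc (R n) \<subseteq> geodesic_cap (R m)"
  using strict_monoD[OF R_mono] by (auto simp: geodesic_arc_def geodesic_cap_def)

lemma arcs_separate: "1 \<le> n \<Longrightarrow> separates_in (ball 0 1) (geodesic_arc (R n)) (geodesic_arc (R 0)) (geodesic_arc (R (Suc n)))"
  unfolding separates_in_def
proof (intro conjI ballI)
  assume n: "1 \<le> n"
  have ne: "R 0 < R n" "R n < R (Suc n)" using strict_monoD[OF R_mono] n by auto
  then show "geodesic_arc (R 0) \<subseteq> ball 0 1 - geodesic_arc (R n)" "geodesic_arc (R (Suc n)) \<subseteq> ball 0 1 - geodesic_arc (R n)"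
    by (auto simp: geodesic_arc_def)
  fix a b assume ab: "a \<in> geodesic_arc (R 0)" "b \<in> geodesic_arc (R (Suc n))"
  have "b \<in> geodesic_cap (R n)" using ab arc_in_cap[of n "Suc n"] by auto
  then have "connected_component_set (ball 0 1 - geodesic_arc (R n)) b = geodesic_cap (R n)"
    by (rule component_geodesic_cap[OF R_pos])
  moreover have "a \<notin> geodesic_cap (R n)" using ab ne by (auto simp: geodesic_arc_def geodesic_cap_def)
  ultimately show "\<not> connected_component (ball 0 1 - geodesic_arc (R n)) a b"
    by (metis connected_component_sym mem_Collect_eq)
qed

lemma small_diameter:
  assumes "C \<noteq> {}" "C \<subseteq> ball 0 1" "0 < r" "\<And>z. z \<in> C \<Longrightarrow> r \<le> cmod (cayley z)"
  shows "0 \<le> spherical_diameter C" "spherical_diameter C \<le> 8 / r"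
proof -
  have "chordal_dist z w \<le> 8 / r" if "z \<in> C" "w \<in> C" for z w
  proof -
    have "cmod (z - w) \<le> cmod (z - 1) + cmod (w - 1)"
      using norm_triangle_ineq4[of "z - 1" "w - 1"] by simp
    also have "\<dots> \<le> 2 / r + 2 / r" using that assms by (intro add_mono geodesic_cap_near_1) auto
    finally show ?thesis using chordal_dist_le[of z w] by simp
  qed
  from spherical_diameter_bounds[OF assms(1) this]
  show "0 \<le> spherical_diameter C" "spherical_diameter C \<le> 8 / r" by blast+
qed

lemma eight_over_R: "(\<lambda>n. 8 / R n) \<longlonglongrightarrow> 0"
  by (rule tendsto_divide_0[OF tendsto_const filterlim_at_top_imp_at_infinity[OF R_lim]])

lemma null_chain_arcs: "null_chain (ball 0 1) (\<lambda>n. geodesic_arc (R n))"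
  unfolding null_chain_def
proof (intro conjI allI impI)
  show "crosscut (ball 0 1) (geodesic_arc (R n))" for n by (rule geodesic_arc_crosscut[OF R_pos])
  show "sphere_closure (geodesic_arc (R n)) \<inter> sphere_closure (geodesic_arc (R (Suc n))) = {}" for n
  proof -
    have "bounded (geodesic_arc r)" for r by (rule bounded_subset[OF bounded_ball geodesic_arc_disk])
    moreover have "closure (geodesic_arc (R n)) \<inter> closure (geodesic_arc (R (Suc n))) = {}"
      by (rule closure_geodesic_arcs_disjoint[OF _ R_pos R_pos]) (use strict_monoD[OF R_mono, of n "Suc n"] in simp)
    ultimately show ?thesis by (auto simp: sphere_closure_bounded)
  qed
  show "1 \<le> n \<Longrightarrow> separates_in (ball 0 1) (geodesic_arc (R n)) (geodesic_arc (R 0)) (geodesic_arc (R (Suc n)))" for n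
    by (rule arcs_separate)
  have "0 \<le> spherical_diameter (geodesic_arc (R n)) \<and> spherical_diameter (geodesic_arc (R n)) \<le> 8 / R n" for n
    using small_diameter[OF crosscut_connected(2)[OF geodesic_arc_crosscut[OF R_pos]] geodesic_arc_disk R_pos, of n]
    by (auto simp: geodesic_arc_def)
  then show "(\<lambda>n. spherical_diameter (geodesic_arc (R n))) \<longlonglongrightarrow> 0"
    by (intro tendsto_sandwich[OF _ _ tendsto_const eight_over_R]) (auto intro!: always_eventually)
qed

lemma arc_region: "chain_region (ball 0 1) (\<lambda>n. geodesic_arc (R n)) n = geodesic_cap (R n)"
proof -
  obtain w where w: "w \<in> geodesic_arc (R (Suc n))"
    using crosscut_connected(2)[OF geodesic_arc_crosscut[OF R_pos]] by blast
  have "w \<in> geodesic_cap (R n)" using w arc_in_cap[of n "Suc n"] by auto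
  then show ?thesis using chain_region_eq[OF null_chain_arcs w] component_geodesic_cap[OF R_pos] by simp
qed

lemma K_region: "chain_region G K n = f ` geodesic_cap (R n)"
  using chain_region_transfer[of K n, OF K_sub] arc_region by (simp add: pre_K)

lemma R_eventually_gt: "\<exists>m. a < R m"
  using filterlim_at_top_dense[THEN iffD1, OF R_lim, rule_format, of a] eventually_happens by force

lemma closure_geodesic_cap: "0 < r \<Longrightarrow> z \<in> closure (geodesic_cap r) \<Longrightarrow> cmod (z - 1) \<le> 2 / r"
proof -
  assume r: "0 < r" "z \<in> closure (geodesic_cap r)"
  have "closure (geodesic_cap r) \<subseteq> cball 1 (2 / r)"
    by (rule closure_minimal) (use geodesic_cap_near_1[OF _ _ r(1)] in \<open>auto simp: geodesic_cap_def dist_norm norm_minus_commute\<close>)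
  then show ?thesis using r by (auto simp: dist_norm norm_minus_commute)
qed

lemma eq_1_if_close: "(\<And>m. cmod (z - 1) \<le> 2 / R m) \<Longrightarrow> z = 1"
proof (rule ccontr)
  assume a: "\<And>m. cmod (z - 1) \<le> 2 / R m" "z \<noteq> 1"
  obtain m where "2 / cmod (z - 1) < R m" using R_eventually_gt by blast
  then show False using a(1)[of m] a(2) R_pos[of m] by (simp add: field_simps)
qed

text \<open>The caps shrink to \<open>1\<close>, so the closures of the regions have nothing else in common; by compactness they
  do have a common point.\<close>

lemma impression_1:
  assumes C: "null_chain (ball 0 1) C" and sq: "\<And>m. \<exists>n. chain_region (ball 0 1) C n \<subseteq> geodesic_cap (R m)"
  shows "chain_impression (ball 0 1) C = {Some 1}"
proof -
  define U where "U n = closure (chain_region (ball 0 1) C n)" for n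
  have sub: "chain_region (ball 0 1) C n \<subseteq> ball 0 1" for n using chain_region_nonempty(3)[OF C] by blast
  have bd: "bounded (chain_region (ball 0 1) C n)" for n by (rule bounded_subset[OF bounded_ball sub])
  have imp: "chain_impression (ball 0 1) C = Some ` (\<Inter>n. U n)"
    unfolding chain_impression_def U_def sphere_closure_bounded[OF bd] by auto
  have "(\<Inter>n. U n) \<noteq> {}"
  proof (rule compact_nest)
    show "compact (U n)" for n unfolding U_def by (simp add: bd compact_closure)
    show "U n \<noteq> {}" for n unfolding U_def using chain_region_nonempty(2)[OF C] by simp
    show "U n \<subseteq> U m" if "m \<le> n" for m n unfolding U_def
      by (intro closure_mono chain_region_antimono[OF connected_ball C that])
  qed
  moreover have "z = 1" if "z \<in> (\<Inter>n. U n)" for z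
  proof (rule eq_1_if_close)
    fix m
    obtain n where "chain_region (ball 0 1) C n \<subseteq> geodesic_cap (R m)" using sq by blast
    then have "z \<in> closure (geodesic_cap (R m))" using that closure_mono unfolding U_def by blast
    then show "cmod (z - 1) \<le> 2 / R m" by (rule closure_geodesic_cap[OF R_pos])
  qed
  ultimately have "(\<Inter>n. U n) = {1}" by blast
  then show ?thesis using imp by simp
qed

lemma K_closure: "sphere_closure (K n) \<subseteq> Some ` fb ` closure (geodesic_arc (R n))"
proof -
  have cl: "closure (geodesic_arc (R n)) \<subseteq> cball 0 1 - {1}"
    using geodesic_arc_closed_disk one_notin_closure_geodesic_arc by blast
  have "compact (closure (geodesic_arc (R n)))"
    using bounded_subset[OF bounded_ball geodesic_arc_disk] by (simp add: compact_closure)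
  then have "compact (fb ` closure (geodesic_arc (R n)))"
    by (intro compact_continuous_image continuous_on_subset[OF fb_cont cl])
  then have "closedin riemann_sphere (Some ` fb ` closure (geodesic_arc (R n)))"
    by (simp add: riemann_sphere_def compact_imp_closed)
  moreover have "K n \<subseteq> fb ` closure (geodesic_arc (R n))"
    unfolding K_def using f_fb geodesic_arc_disk closure_subset by (metis image_mono image_cong subset_iff)
  ultimately show ?thesis unfolding sphere_closure_def by (intro closure_of_minimal image_mono)
qed

lemma null_chain_K: "null_chain G K"
  unfolding null_chain_def
proof (intro conjI allI impI)
  show "crosscut G (K n)" for n
  proof -
    obtain \<gamma> a b where \<gamma>: "continuous_on {0<..<1::real} \<gamma>" "inj_on \<gamma> {0<..<1}" "\<gamma> ` {0<..<1} = geodesic_arc (R n)"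
      and ab: "a \<in> sphere_boundary (ball 0 1)" "b \<in> sphere_boundary (ball 0 1)"
       "limitin riemann_sphere (\<lambda>x. Some (\<gamma> x)) a (at_right 0)"
       "limitin riemann_sphere (\<lambda>x. Some (\<gamma> x)) b (at_left 1)"
      using geodesic_arc_crosscut[OF R_pos[of n]] unfolding crosscut_def by blast
    obtain a' b' where ab': "a = Some a'" "b = Some b'" "cmod a' = 1" "cmod b' = 1"
      using ab(1,2) by (auto simp: sphere_boundary_disk)
    have \<gamma>b: "\<gamma> x \<in> geodesic_arc (R n)" if "x \<in> {0<..<1}" for x using \<gamma>(3) that by blast
    have evr: "\<forall>\<^sub>F x in at_right (0::real). x \<in> {0<..<1}" using eventually_at_right_real[of 0 "1::real"] by simp
    have eva: "\<forall>\<^sub>F x in at_right 0. \<gamma> x \<in> geodesic_arc (R n)" using evr by eventually_elim (rule \<gamma>b)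
    have evb: "\<forall>\<^sub>F x in at_left 1. \<gamma> x \<in> geodesic_arc (R n)" using eventually_at_left_1_unit by eventually_elim (rule \<gamma>b)
    have "a' \<in> closure (geodesic_arc (R n))" "b' \<in> closure (geodesic_arc (R n))"
      using limitin_sphere_in_closure[OF ab(3) eva] limitin_sphere_in_closure[OF ab(4) evb] ab' by auto
    then have n1: "a' \<noteq> 1" "b' \<noteq> 1" using one_notin_closure_geodesic_arc by auto
    have s: "geodesic_arc (R n) \<subseteq> cball 0 1 - {1}" using geodesic_arc_disk ball_cball_1 by blast
    have la: "((\<lambda>x. fb (\<gamma> x)) \<longlongrightarrow> fb a') (at_right 0)"
    proof (rule continuous_on_tendsto_compose[OF fb_cont])
      show "(\<gamma> \<longlongrightarrow> a') (at_right 0)" using ab ab' by (simp add: limitin_riemann_sphere_Some)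
      show "a' \<in> cball 0 1 - {1}" using ab' n1 by simp
      show "\<forall>\<^sub>F x in at_right 0. \<gamma> x \<in> cball 0 1 - {1}" using eva by eventually_elim (use s in blast)
    qed
    have lb: "((\<lambda>x. fb (\<gamma> x)) \<longlongrightarrow> fb b') (at_left 1)"
    proof (rule continuous_on_tendsto_compose[OF fb_cont])
      show "(\<gamma> \<longlongrightarrow> b') (at_left 1)" using ab ab' by (simp add: limitin_riemann_sphere_Some)
      show "b' \<in> cball 0 1 - {1}" using ab' n1 by simp
      show "\<forall>\<^sub>F x in at_left 1. \<gamma> x \<in> cball 0 1 - {1}" using evb by eventually_elim (use s in blast)
    qed
    show ?thesis unfolding crosscut_def
    proof (rule exI[of _ "\<lambda>x. fb (\<gamma> x)"], rule exI[of _ "Some (fb a')"], rule exI[of _ "Some (fb b')"], intro conjI)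
      show "continuous_on {0<..<1} (\<lambda>x. fb (\<gamma> x))"
        by (rule continuous_on_compose2[OF fb_cont \<gamma>(1)]) (use \<gamma>(3) s in blast)
      have "inj_on (fb \<circ> \<gamma>) {0<..<1}"
        by (rule comp_inj_on[OF \<gamma>(2)]) (rule inj_on_subset[OF fb_inj], use \<gamma>(3) s in blast)
      then show "inj_on (\<lambda>x. fb (\<gamma> x)) {0<..<1}" by (simp add: o_def)
      have "fb ` geodesic_arc (R n) = K n" unfolding K_def
        by (intro image_cong refl f_fb[symmetric] subsetD[OF geodesic_arc_disk])
      then show "(\<lambda>x. fb (\<gamma> x)) ` {0<..<1} = K n" using \<gamma>(3) by (metis image_image)
      show "K n \<subseteq> G" by (rule K_sub)
      show "Some (fb a') \<in> sphere_boundary G" "Some (fb b') \<in> sphere_boundary G"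
        using fb_boundary ab' n1 by auto
    qed (use la lb in \<open>auto simp: limitin_riemann_sphere_Some\<close>)
  qed
  show "sphere_closure (K n) \<inter> sphere_closure (K (Suc n)) = {}" for n
  proof -
    have "closure (geodesic_arc (R n)) \<inter> closure (geodesic_arc (R (Suc n))) = {}"
      by (rule closure_geodesic_arcs_disjoint[OF _ R_pos R_pos]) (use strict_monoD[OF R_mono, of n "Suc n"] in simp)
    moreover have "closure (geodesic_arc r) \<subseteq> cball 0 1 - {1}" for r
      using geodesic_arc_closed_disk one_notin_closure_geodesic_arc by blast
    ultimately have "fb ` closure (geodesic_arc (R n)) \<inter> fb ` closure (geodesic_arc (R (Suc n))) = {}"
      using inj_on_image_Int[OF fb_inj, of "closure (geodesic_arc (R n))" "closure (geodesic_arc (R (Suc n)))"] by auto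
    then show ?thesis using K_closure[of n] K_closure[of "Suc n"] by blast
  qed
  show "separates_in G (K n) (K 0) (K (Suc n))" if "1 \<le> n" for n
    using separates_transfer[OF K_sub K_sub K_sub] arcs_separate[OF that] by (simp add: pre_K)
  show "(\<lambda>n. spherical_diameter (K n)) \<longlonglongrightarrow> 0" unfolding K_def by (rule R_diam)
qed

lemma mem_prime_end_map: "C \<in> prime_end_map f 1 \<longleftrightarrow>
    null_chain G C \<and> null_chain (ball 0 1) (\<lambda>n. pre (C n)) \<and> chain_impression (ball 0 1) (\<lambda>n. pre (C n)) = {Some 1}"
  unfolding prime_end_map_def disk_prime_end_def G_def pre_def by auto

lemma null_chain_sub: "null_chain G C \<Longrightarrow> C n \<subseteq> G"
  unfolding null_chain_def crosscut_def by blast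

text \<open>Let \<open>D\<close> be the preimage of a chain in the prime end. Its regions shrink to \<open>1\<close> and
  hence get into every cap. Conversely the crosscut \<open>D m\<close> has no end at \<open>1\<close>, so a small cap misses it, and being connected
  this cap lies in the region of \<open>D m\<close>.\<close>

lemma equiv_if_mem:
  assumes C: "C \<in> prime_end_map f 1" shows "(K, C) \<in> chain_equiv G"
proof -
  define D where "D n = pre (C n)" for n
  have nG: "null_chain G C" and nD: "null_chain (ball 0 1) D" and imp: "chain_impression (ball 0 1) D = {Some 1}"
    using C mem_prime_end_map unfolding D_def by auto
  define U where "U n = chain_region (ball 0 1) D n" for n
  have CU: "chain_region G C n = f ` U n" for n
    using chain_region_transfer[OF null_chain_sub[OF nG]] unfolding U_def D_def by simp
  have Usub: "U n \<subseteq> ball 0 1" for n using chain_region_nonempty(3)[OF nD] unfolding U_def by blast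
  have Uanti: "U n \<subseteq> U m" if "m \<le> n" for m n unfolding U_def by (rule chain_region_antimono[OF connected_ball nD that])
  have bd: "bounded (U n)" for n by (rule bounded_subset[OF bounded_ball Usub])
  have inter: "z = 1" if "\<And>n. z \<in> closure (U n)" for z
  proof -
    have "Some z \<in> chain_impression (ball 0 1) D" using that unfolding chain_impression_def U_def by simp
    then show ?thesis using imp by simp
  qed
  have i: "\<exists>n. U n \<subseteq> geodesic_cap (R m)" for m
  proof -
    obtain \<epsilon> where \<epsilon>: "\<epsilon> > 0" "\<And>z. z \<in> ball 0 1 \<Longrightarrow> cmod (z - 1) < \<epsilon> \<Longrightarrow> z \<in> geodesic_cap (R m)"
      using near_1_in_geodesic_cap[OF R_pos[of m]] by blast
    show ?thesis
    proof (rule ccontr)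
      assume no: "\<nexists>n. U n \<subseteq> geodesic_cap (R m)"
      define Fn where "Fn n = closure (U n) - ball 1 \<epsilon>" for n
      have "\<Inter>(range Fn) \<noteq> {}"
      proof (rule compact_nest)
        show "compact (Fn n)" for n unfolding Fn_def by (intro compact_diff) (auto simp: bd compact_closure)
        show "Fn n \<noteq> {}" for n
        proof -
          obtain z where "z \<in> U n" "z \<notin> geodesic_cap (R m)" using no by blast
          moreover have "z \<in> ball 0 1" by (rule subsetD[OF Usub]) fact
          ultimately have "z \<in> closure (U n)" "\<not> cmod (z - 1) < \<epsilon>" using closure_subset \<epsilon>(2)[of z] by blast+
          then have "z \<in> closure (U n)" "z \<notin> ball 1 \<epsilon>" by (simp_all add: dist_norm norm_minus_commute)
          then show ?thesis unfolding Fn_def by blast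
        qed
        show "Fn n \<subseteq> Fn k" if "k \<le> n" for k n unfolding Fn_def using closure_mono[OF Uanti[OF that]] by blast
      qed
      then obtain z where "\<And>n. z \<in> Fn n" by blast
      then have "z = 1" "z \<notin> ball 1 \<epsilon>" using inter unfolding Fn_def by auto
      then show False using \<epsilon>(1) by simp
    qed
  qed
  have ii: "\<exists>n. geodesic_cap (R n) \<subseteq> U m" for m
  proof -
    have "crosscut G (C m)" using nG unfolding null_chain_def by blast
    then have "1 \<notin> closure (D m)" unfolding D_def by (rule crosscut_pre(2))
    then have "open (- closure (D m))" "1 \<in> - closure (D m)" by auto
    then obtain \<epsilon> where \<epsilon>: "\<epsilon> > 0" "ball 1 \<epsilon> \<subseteq> - closure (D m)" using open_contains_ball by blast
    obtain n where n: "2 / \<epsilon> < R n" using R_eventually_gt by blast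
    have small: "2 / R n < \<epsilon>" using n \<epsilon>(1) R_pos[of n] by (simp add: field_simps)
    have HD: "geodesic_cap (R n) \<subseteq> ball 0 1 - D m"
    proof
      fix z assume z: "z \<in> geodesic_cap (R n)"
      then have "cmod (z - 1) \<le> 2 / R n" using geodesic_cap_near_1[OF _ _ R_pos[of n], of z] by (auto simp: geodesic_cap_def)
      then have "z \<in> ball 1 \<epsilon>" using small by (simp add: dist_norm norm_minus_commute)
      then show "z \<in> ball 0 1 - D m" using \<epsilon>(2) closure_subset z geodesic_cap_disk by blast
    qed
    obtain k where k: "U k \<subseteq> geodesic_cap (R n)" using i by blast
    have "U (max k m) \<subseteq> geodesic_cap (R n)" "U (max k m) \<subseteq> U m" using k Uanti[of k "max k m"] Uanti[of m "max k m"] by auto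
    moreover have "U (max k m) \<noteq> {}" unfolding U_def by (rule chain_region_nonempty(2)[OF nD])
    ultimately obtain u where u: "u \<in> geodesic_cap (R n)" "u \<in> U m" by blast
    obtain w where w: "w \<in> D (Suc m)" using chain_region_nonempty(1)[OF nD] nD crosscut_connected(2) unfolding null_chain_def by blast
    have Um: "U m = connected_component_set (ball 0 1 - D m) w" unfolding U_def by (rule chain_region_eq[OF nD w])
    have "geodesic_cap (R n) \<subseteq> connected_component_set (ball 0 1 - D m) u"
      by (rule connected_component_maximal[OF u(1) connected_geodesic_cap[OF R_pos] HD])
    also have "\<dots> = U m" using u(2) unfolding Um by (metis connected_component_eq)
    finally show ?thesis by blast
  qed
  show ?thesis unfolding chain_equiv_def
  proof (intro CollectI case_prodI conjI allI nG null_chain_K)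
    show "\<exists>n. chain_region G C n \<subseteq> chain_region G K m" for m using i[of m] unfolding CU K_region by (meson image_mono)
    show "\<exists>n. chain_region G K n \<subseteq> chain_region G C m" for m using ii[of m] unfolding CU K_region by (meson image_mono)
  qed
qed

text \<open>What has to be shown is that the preimages \<open>D n\<close> form a null-chain. Since the chain is squeezed by \<open>K\<close>, the \<open>D n\<close>
  lie in small caps, which gives the diameters. Their closures are disjoint because the extension \<open>fb\<close> maps
  them into the disjoint closures of the crosscuts \<open>C n\<close>.\<close>

lemma mem_if_equiv:
  assumes eq: "(K, C) \<in> chain_equiv G" shows "C \<in> prime_end_map f 1"
proof -
  define D where "D n = pre (C n)" for n
  have nG: "null_chain G C" and sq: "\<And>m. \<exists>n. chain_region G C n \<subseteq> chain_region G K m"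
    using eq unfolding chain_equiv_def by auto
  have cross: "crosscut G (C n)" for n using nG unfolding null_chain_def by blast
  have Csub: "C n \<subseteq> G" for n by (rule null_chain_sub[OF nG])
  define U where "U n = chain_region (ball 0 1) D n" for n
  have CU: "chain_region G C n = f ` U n" for n
    using chain_region_transfer[OF Csub] unfolding U_def D_def by simp
  have Usub: "U n \<subseteq> ball 0 1" for n
  proof -
    have "connected_component_set (ball 0 1 - D n) w \<subseteq> ball 0 1" for w using connected_component_subset by blast
    then show ?thesis unfolding U_def chain_region_def by blast
  qed
  have inside: "\<exists>n. \<forall>k\<ge>n. D (Suc k) \<subseteq> geodesic_cap (R m) \<and> U k \<subseteq> geodesic_cap (R m)" for m
  proof -
    obtain n where n: "chain_region G C n \<subseteq> chain_region G K m" using sq by blast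
    have "D (Suc k) \<subseteq> geodesic_cap (R m) \<and> U k \<subseteq> geodesic_cap (R m)" if "n \<le> k" for k
    proof -
      have s: "chain_region G C k \<subseteq> f ` geodesic_cap (R m)"
        using chain_region_antimono[OF G_connected nG that] n K_region by auto
      have img: "A \<subseteq> geodesic_cap (R m)" if "A \<subseteq> ball 0 1" "f ` A \<subseteq> f ` geodesic_cap (R m)" for A
        using that inj_on_image_subset_iff[OF f_inj that(1) geodesic_cap_disk] by blast
      have "C (Suc k) \<subseteq> f ` geodesic_cap (R m)" using s chain_region_nonempty(1)[OF nG, of k] by blast
      then have "f ` D (Suc k) \<subseteq> f ` geodesic_cap (R m)" unfolding D_def using f_pre[OF Csub] by simp
      moreover have "f ` U k \<subseteq> f ` geodesic_cap (R m)" using s CU by simp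
      moreover have "D (Suc k) \<subseteq> ball 0 1" unfolding D_def by (rule pre_subset)
      ultimately show ?thesis using img[of "D (Suc k)"] img[of "U k"] Usub[of k] by blast
    qed
    then show ?thesis by blast
  qed
  have nD: "null_chain (ball 0 1) D" unfolding null_chain_def
  proof (intro conjI allI impI)
    show cD: "crosscut (ball 0 1) (D n)" for n unfolding D_def by (rule crosscut_pre(1)[OF cross])
    show "sphere_closure (D n) \<inter> sphere_closure (D (Suc n)) = {}" for n
    proof -
      have bd: "bounded (D k)" for k unfolding D_def by (rule bounded_subset[OF bounded_ball pre_subset])
      have fbc: "fb p \<in> closure (C k)" if p: "p \<in> closure (D k)" for p k
      proof -
        have "p \<noteq> 1" using p crosscut_pre(2)[OF cross] unfolding D_def by auto
        have "p \<in> cball 0 1" using p closure_minimal[of "D k" "cball 0 1"] pre_subset[of "C k"]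
          unfolding D_def by (meson ball_subset_cball closed_cball order_trans subsetD)
        obtain u where u: "\<And>n. u n \<in> D k" "u \<longlonglongrightarrow> p" using p closure_sequential by blast
        have ub: "u n \<in> ball 0 1" "f (u n) \<in> C k" for n using u(1)[of n] by (auto simp: D_def pre_def)
        have "(\<lambda>n. fb (u n)) \<longlonglongrightarrow> fb p"
          by (rule continuous_on_tendsto_compose[OF fb_cont u(2)])
             (use \<open>p \<noteq> 1\<close> \<open>p \<in> cball 0 1\<close> ub ball_cball_1 in \<open>auto intro!: always_eventually simp del: mem_ball mem_ball_0\<close>)
        moreover have "fb (u n) \<in> C k" for n using ub(2)[of n] f_fb[OF ub(1)] by simp
        ultimately show ?thesis unfolding closure_sequential
          by (intro exI[of _ "\<lambda>n. fb (u n)"] conjI allI)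
      qed
      have "closure (D n) \<inter> closure (D (Suc n)) = {}"
      proof (rule ccontr)
        assume "closure (D n) \<inter> closure (D (Suc n)) \<noteq> {}"
        then obtain p where "fb p \<in> closure (C n)" "fb p \<in> closure (C (Suc n))" using fbc by blast
        then have "Some (fb p) \<in> sphere_closure (C n) \<inter> sphere_closure (C (Suc n))" by simp
        then show False using nG unfolding null_chain_def by blast
      qed
      then show ?thesis by (auto simp: sphere_closure_bounded[OF bd])
    qed
    show "separates_in (ball 0 1) (D n) (D 0) (D (Suc n))" if "1 \<le> n" for n
      using separates_transfer[OF Csub Csub Csub, of n 0 "Suc n"] nG that unfolding null_chain_def D_def by blast
    show "(\<lambda>n. spherical_diameter (D n)) \<longlonglongrightarrow> 0"
    proof (rule tendstoI)
      fix \<epsilon> :: real assume "\<epsilon> > 0"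
      obtain m where m: "8 / \<epsilon> < R m" using R_eventually_gt by blast
      have small: "8 / R m < \<epsilon>" using m \<open>\<epsilon> > 0\<close> R_pos[of m] by (simp add: field_simps)
      obtain n where n: "\<And>k. k \<ge> n \<Longrightarrow> D (Suc k) \<subseteq> geodesic_cap (R m)" using inside by blast
      have "dist (spherical_diameter (D k)) 0 < \<epsilon>" if "k \<ge> Suc n" for k
      proof -
        have "D k \<subseteq> geodesic_cap (R m)" using n[of "k - 1"] that by simp
        then have far: "R m \<le> cmod (cayley z)" if "z \<in> D k" for z using that by (auto simp: geodesic_cap_def)
        from small_diameter[OF crosscut_connected(2)[OF cD[of k]] crosscut_connected(3)[OF cD[of k]] R_pos[of m] far]
        show ?thesis using small by simp
      qed
      then show "\<forall>\<^sub>F k in sequentially. dist (spherical_diameter (D k)) 0 < \<epsilon>"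
        unfolding eventually_sequentially by blast
    qed
  qed
  have "chain_impression (ball 0 1) D = {Some 1}"
    by (rule impression_1[OF nD]) (use inside in \<open>unfold U_def, blast\<close>)
  then show ?thesis using nG nD unfolding mem_prime_end_map D_def by simp
qed

lemma prime_end_map_eq: "prime_end_map f 1 = chain_equiv G `` {K}"
  using equiv_if_mem mem_if_equiv by blast

lemma K_mem: "K \<in> prime_end_map f 1"
  using mem_if_equiv null_chain_K unfolding chain_equiv_def by auto

theorem is_prime_end: "prime_end_map f 1 \<in> prime_ends (f ` ball 0 1)"
  using null_chain_K unfolding prime_end_map_eq prime_ends_def G_def[symmetric] by (intro quotientI) simp

lemma tail_tends_to_1:
  assumes "\<And>n. \<forall>\<^sub>F x in F. \<eta> x \<in> geodesic_cap (R n)" shows "(\<eta> \<longlongrightarrow> 1) F"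
proof (rule tendstoI)
  fix \<epsilon> :: real assume "\<epsilon> > 0"
  obtain m where m: "2 / \<epsilon> < R m" using R_eventually_gt by blast
  have small: "2 / R m < \<epsilon>" using m \<open>\<epsilon> > 0\<close> R_pos[of m] by (simp add: field_simps)
  show "\<forall>\<^sub>F x in F. dist (\<eta> x) 1 < \<epsilon>" using assms[of m]
  proof eventually_elim
    case (elim x)
    then have "cmod (\<eta> x - 1) \<le> 2 / R m" using geodesic_cap_near_1[OF _ _ R_pos[of m]] by (auto simp: geodesic_cap_def)
    then show ?case using small by (simp add: dist_norm)
  qed
qed

text \<open>A curve that tends to the prime end has a preimage that gets into all caps and so tends to \<open>1\<close>.\<close>

theorem no_reachable_point: "\<not> contains_reachable_point (f ` ball 0 1) (prime_end_map f 1) A"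
proof
  assume "contains_reachable_point (f ` ball 0 1) (prime_end_map f 1) A"
  then obtain \<gamma> :: "real \<Rightarrow> complex" where \<gamma>: "continuous_on {0..<1} \<gamma>" "\<gamma> ` {0..<1} \<subseteq> G"
      "limitin riemann_sphere (\<lambda>x. Some (\<gamma> x)) A (at_left 1)"
      "\<And>n. \<forall>\<^sub>F x in at_left 1. \<gamma> x \<in> chain_region G K n"
    using K_mem unfolding contains_reachable_point_def G_def[symmetric] by blast
  have \<gamma>G: "\<gamma> x \<in> G" if "x \<in> {0<..<1}" for x using \<gamma>(2) that by force
  define \<eta> where "\<eta> x = finv (\<gamma> x)" for x
  have \<eta>: "\<eta> x \<in> ball 0 1" "fb (\<eta> x) = \<gamma> x" if "x \<in> {0<..<1}" for x
    using finv_ball[OF \<gamma>G[OF that]] f_finv[OF \<gamma>G[OF that]] f_fb unfolding \<eta>_def by auto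
  have cont: "continuous_on {0<..<1} \<eta>" unfolding \<eta>_def
    by (rule continuous_on_compose2[OF finv_cont continuous_on_subset[OF \<gamma>(1)]]) (use \<gamma>G in auto)
  have "\<forall>\<^sub>F x in at_left 1. \<eta> x \<in> geodesic_cap (R n)" for n
    using \<gamma>(4)[of n] 
  proof eventually_elim
    case (elim x)
    then obtain z where "z \<in> geodesic_cap (R n)" "\<gamma> x = f z" unfolding K_region by blast
    moreover have "z \<in> ball 0 1" by (rule subsetD[OF geodesic_cap_disk]) fact
    ultimately show ?case using finv_f[of z] unfolding \<eta>_def by simp
  qed
  then have "(\<eta> \<longlongrightarrow> 1) (at_left 1)" by (rule tail_tends_to_1)
  from no_limit_f[OF cont _ this, of A] \<eta>(1) ball_cball_1
  have "\<not> limitin riemann_sphere (\<lambda>x. Some (fb (\<eta> x))) A (at_left 1)" by blast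
  moreover have "\<forall>\<^sub>F x in at_left 1. Some (\<gamma> x) = Some (fb (\<eta> x))"
    using eventually_at_left_1_unit by eventually_elim (simp add: \<eta>(2))
  from limitin_transform_eventually[OF this \<gamma>(3)]
  have "limitin riemann_sphere (\<lambda>x. Some (fb (\<eta> x))) A (at_left 1)" .
  ultimately show False by blast
qed

text \<open>Equivalent chains have the same impression, so it is that of \<open>K\<close>. If it were a point \<open>A\<close>, then by compactness the
  images of the caps would shrink to \<open>A\<close>, and \<open>f x\<close> would tend to \<open>A\<close> as the real number \<open>x\<close> tends to \<open>1\<close>.\<close>

theorem nontrivial: "\<not> trivial_prime_end (f ` ball 0 1) (prime_end_map f 1)"
proof
  assume "trivial_prime_end (f ` ball 0 1) (prime_end_map f 1)"
  then obtain A where A: "impression G (prime_end_map f 1) = {A}" unfolding trivial_prime_end_def G_def by blast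
  have "chain_impression G K \<subseteq> chain_impression G C" if C: "C \<in> prime_end_map f 1" for C
  proof -
    have "\<exists>n. chain_region G K n \<subseteq> chain_region G C m" for m
      using equiv_if_mem[OF C] unfolding chain_equiv_def by auto
    then show ?thesis unfolding chain_impression_def using sphere_closure_mono by (meson INT_greatest INT_lower UNIV_I subset_trans)
  qed
  then have "impression G (prime_end_map f 1) = chain_impression G K" unfolding impression_def using K_mem by blast
  then have A: "chain_impression G K = {A}" using A by simp
  define cl where "cl n = sphere_closure (chain_region G K n)" for n
  have Acl: "(\<Inter>n. cl n) = {A}" using A unfolding chain_impression_def cl_def .
  have cl_closed: "closedin riemann_sphere (cl n)" for n unfolding cl_def sphere_closure_def by simp
  have AT: "A \<in> topspace riemann_sphere" using Acl closedin_subset[OF cl_closed[of 0]] by blast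
  have lim: "limitin riemann_sphere (\<lambda>x. Some (fb (of_real x))) A (at_left 1)" unfolding limitin_def
  proof (intro conjI allI impI AT)
    fix U assume U: "openin riemann_sphere U \<and> A \<in> U"
    have "\<exists>n. cl n \<subseteq> U"
    proof (rule ccontr)
      assume no: "\<nexists>n. cl n \<subseteq> U"
      have "(\<Inter>n. cl n - U) \<noteq> {}"
      proof (rule compact_space_imp_nest[OF compact_space_sphere])
        show "closedin riemann_sphere (cl n - U)" for n using cl_closed U by (intro closedin_diff) auto
        show "cl n - U \<noteq> {}" for n using no by blast
        show "decseq (\<lambda>n. cl n - U)"
          using sphere_closure_mono[OF chain_region_antimono[OF G_connected null_chain_K]]
          unfolding decseq_def cl_def by blast
      qed
      then show False using Acl U by blast
    qed
    then obtain n where n: "cl n \<subseteq> U" by blast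
    obtain \<epsilon> where \<epsilon>: "\<epsilon> > 0" "\<And>z. z \<in> ball 0 1 \<Longrightarrow> cmod (z - 1) < \<epsilon> \<Longrightarrow> z \<in> geodesic_cap (R n)"
      using near_1_in_geodesic_cap[OF R_pos[of n]] by blast
    have "\<forall>\<^sub>F x in at_left (1::real). x \<in> {1 - \<epsilon><..<1}" using eventually_at_left_real[of "1 - \<epsilon>" 1] \<epsilon>(1) by simp
    then show "\<forall>\<^sub>F x in at_left 1. Some (fb (of_real x)) \<in> U" using eventually_at_left_1_unit
    proof eventually_elim
      case (elim x)
      have b: "complex_of_real x \<in> ball 0 1" using elim by simp
      have "cmod (complex_of_real x - 1) = \<bar>x - 1\<bar>" by (metis norm_of_real of_real_1 of_real_diff)
      then have "complex_of_real x \<in> geodesic_cap (R n)" using elim \<epsilon>(2)[OF b] by simp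
      then have "fb (of_real x) \<in> chain_region G K n" using f_fb[OF b] unfolding K_region by (metis image_eqI)
      then have "Some (fb (of_real x)) \<in> cl n" unfolding cl_def using closure_subset by auto
      then show ?case using n by blast
    qed
  qed
  have "\<not> limitin riemann_sphere (\<lambda>x. Some (fb (of_real x))) A (at_left 1)"
    by (rule no_limit_f) (auto intro!: continuous_intros tendsto_eq_intros)
  then show False using lim by blast
qed


end

section \<open>Failure of local connectedness\<close>

lemma cluster_point_compactin:
  assumes K: "compactin X K" and freq: "\<forall>Y<1. \<exists>x. Y < x \<and> 0 < x \<and> x < 1 \<and> g x \<in> K"
  shows "\<exists>A\<in>K. \<forall>U. openin X U \<and> A \<in> U \<longrightarrow> (\<forall>Y<1. \<exists>x::real. Y < x \<and> 0 < x \<and> x < 1 \<and> g x \<in> U)"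
proof (rule ccontr)
  assume "\<not> ?thesis"
  then have "\<forall>A\<in>K. \<exists>U. openin X U \<and> A \<in> U \<and> (\<exists>Y<1. \<forall>x. Y < x \<and> 0 < x \<and> x < 1 \<longrightarrow> g x \<notin> U)" by meson
  then obtain U Y where UY: "\<And>A. A \<in> K \<Longrightarrow> openin X (U A) \<and> A \<in> U A \<and> Y A < (1::real) \<and> (\<forall>x. Y A < x \<and> 0 < x \<and> x < 1 \<longrightarrow> g x \<notin> U A)"
    by metis
  have "\<exists>\<F>. finite \<F> \<and> \<F> \<subseteq> U ` K \<and> K \<subseteq> \<Union>\<F>"
    using K UY unfolding compactin_def by (intro K[unfolded compactin_def, THEN conjunct2, rule_format]) auto
  then obtain F where F: "finite F" "F \<subseteq> K" "K \<subseteq> \<Union>(U ` F)" by (metis finite_subset_image)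
  define m where "m = Max (insert 0 (Y ` F))"
  have m: "m < 1" "\<And>A. A \<in> F \<Longrightarrow> Y A \<le> m" unfolding m_def using F UY by (auto simp: Max_less_iff)
  obtain x where x: "m < x" "0 < x" "x < 1" "g x \<in> K" using freq m(1) by blast
  then obtain A where A: "A \<in> F" "g x \<in> U A" using F by blast
  then have "Y A < x" using m(2)[OF A(1)] x by simp
  then show False using UY[of A] A F x by blast
qed

context nonlanding_map begin

text \<open>The part of the circle just above \<open>1\<close>, parametrized by the real part.\<close>

definition upper_arc :: "real \<Rightarrow> complex" where "upper_arc x = Complex x (sqrt (1 - x\<^sup>2))"

lemma upper_arc_unit: 
  assumes "x \<in> {0<..<1}" shows "cmod (upper_arc x) = 1" "upper_arc x \<noteq> 1" "0 < Im (upper_arc x)"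
proof -
  have "x\<^sup>2 < 1" using assms by (simp add: power_less_one_iff abs_square_less_1)
  then show "cmod (upper_arc x) = 1" "0 < Im (upper_arc x)" by (auto simp: upper_arc_def cmod_def)
  show "upper_arc x \<noteq> 1" using assms by (auto simp: upper_arc_def complex_eq_iff)
qed

lemma upper_arc_cont: "continuous_on S upper_arc"
proof -
  have "continuous_on S (\<lambda>x. of_real x + \<i> * of_real (sqrt (1 - x\<^sup>2)))" by (intro continuous_intros)
  moreover have "upper_arc = (\<lambda>x. of_real x + \<i> * of_real (sqrt (1 - x\<^sup>2)))"
    by (auto simp: upper_arc_def fun_eq_iff complex_eq_iff)
  ultimately show ?thesis by (simp only:)
qed

lemma upper_arc_cball: "x \<in> {0<..<1} \<Longrightarrow> upper_arc x \<in> cball 0 1 - {1}"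
  using upper_arc_unit by auto

lemma upper_arc_tendsto: "(upper_arc \<longlongrightarrow> 1) (at_left 1)"
proof -
  have "(upper_arc \<longlongrightarrow> upper_arc 1) (at_left 1)"
    using upper_arc_cont[of UNIV] unfolding continuous_on_def by (metis UNIV_I at_le subset_UNIV tendsto_mono)
  moreover have "upper_arc 1 = 1" by (simp add: upper_arc_def complex_eq_iff)
  ultimately show ?thesis by simp
qed

definition boundary_curve where "boundary_curve x = Some (fb (upper_arc x))"

lemma boundary_curve_in_boundary: "x \<in> {0<..<1} \<Longrightarrow> boundary_curve x \<in> sphere_boundary G"
  unfolding boundary_curve_def by (rule fb_boundary) (use upper_arc_unit in auto)

text \<open>The extension \<open>fb\<close> is \<open>e\<close> after the embedding \<open>\<Phi>\<close> of the closed disk into the open disk together with \<open>1\<close>. Near \<open>\<Phi> z\<close> for a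
  point \<open>z\<close> of the arc, the boundary of \<open>f ` ball 0 1\<close> is therefore, inside \<open>e ` ball 0 1\<close>, the \<open>e\<close>-image of the Jordan curve \<open>\<Phi> ` sphere 0 1\<close>, and
  removing the compact rest of this curve isolates the open arc.\<close>

lemma boundary_arc_open:
  assumes x: "0 < x1" "x1 < x2" "x2 < 1"
  obtains N' where "openin riemann_sphere N'" "N' \<inter> sphere_boundary G = boundary_curve ` {x1<..<x2}"
proof -
  define W where "W = {z. 0 < Im z \<and> x1 < Re z \<and> Re z < x2}"
  have W: "open W" unfolding W_def Collect_conj_eq
    by (intro open_Int open_halfspace_Im_gt open_halfspace_Re_gt open_halfspace_Re_lt)
  have arcW: "upper_arc ` {x1<..<x2} = sphere 0 1 \<inter> W"
  proof (intro set_eqI iffI)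
    fix z assume "z \<in> upper_arc ` {x1<..<x2}"
    then obtain t where t: "t \<in> {x1<..<x2}" "z = upper_arc t" by blast
    then have "t \<in> {0<..<1}" using x by auto
    then show "z \<in> sphere 0 1 \<inter> W" using upper_arc_unit[of t] t by (simp add: W_def) (simp add: upper_arc_def)
  next
    fix z assume z: "z \<in> sphere 0 1 \<inter> W"
    then have "(Re z)\<^sup>2 + (Im z)\<^sup>2 = 1" using cmod_power2[of z] by simp
    then have "Im z = sqrt (1 - (Re z)\<^sup>2)" using z by (intro real_sqrt_unique[symmetric]) (auto simp: W_def)
    then have "z = upper_arc (Re z)" by (simp add: upper_arc_def complex_eq_iff)
    then show "z \<in> upper_arc ` {x1<..<x2}" using z by (auto simp: W_def)
  qed
  have "compact (sphere 0 1 - W)" by (intro compact_diff W) simp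
  then have cM: "compact (\<Phi> ` (sphere 0 1 - W))"
    by (intro compact_continuous_image continuous_on_subset[OF \<Phi>_cont]) auto
  define N where "N = ball 0 1 - \<Phi> ` (sphere 0 1 - W)"
  have N: "open N" unfolding N_def by (intro open_Diff compact_imp_closed cM) simp
  have NB: "N \<subseteq> ball 0 1" unfolding N_def by blast
  have open_e: "open (e ` V)" if "open V" "V \<subseteq> ball 0 1" for V
    by (rule open_mapping_thm3[OF holomorphic_on_subset[OF e_hol that(2)] that(1) inj_on_subset[OF e_inj that(2)]])
  show thesis
  proof (rule that[of "Some ` e ` N"])
    show "openin riemann_sphere (Some ` e ` N)" using open_e[OF N NB] by (simp add: riemann_sphere_def)
    show "Some ` e ` N \<inter> sphere_boundary G = boundary_curve ` {x1<..<x2}"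
    proof (intro set_eqI iffI)
      fix v assume "v \<in> boundary_curve ` {x1<..<x2}"
      then obtain t where t: "t \<in> {x1<..<x2}" "v = boundary_curve t" by blast
      have t01: "t \<in> {0<..<1}" using t(1) x by auto
      have pc: "upper_arc t \<in> cball 0 1" "upper_arc t \<noteq> 1" using upper_arc_cball[OF t01] by blast+
      have inW: "upper_arc t \<in> W" using arcW t(1) by blast
      have "\<Phi> (upper_arc t) \<notin> \<Phi> ` (sphere 0 1 - W)"
      proof
        assume "\<Phi> (upper_arc t) \<in> \<Phi> ` (sphere 0 1 - W)"
        then obtain z where z: "z \<in> sphere 0 1" "z \<notin> W" "\<Phi> (upper_arc t) = \<Phi> z" by blast
        then have "upper_arc t = z" using inj_onD[OF \<Phi>_inj z(3) pc(1)] by simp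
        then show False using z inW by simp
      qed
      then have "\<Phi> (upper_arc t) \<in> N" unfolding N_def using \<Phi>_ball[OF pc] by blast
      then have "v \<in> Some ` e ` N" using t(2) unfolding boundary_curve_def fb_def by blast
      then show "v \<in> Some ` e ` N \<inter> sphere_boundary G" using boundary_curve_in_boundary[OF t01] t(2) by simp
    next
      fix v assume v: "v \<in> Some ` e ` N \<inter> sphere_boundary G"
      then obtain u where u: "u \<in> N" "v = Some (e u)" by blast
      have uG: "e u \<in> closure G" "e u \<notin> G" using v u boundary_iff by auto
      have "u \<in> \<Phi> ` cball 0 1"
      proof (rule ccontr)
        assume n: "u \<notin> \<Phi> ` cball 0 1"
        have "compact (\<Phi> ` cball 0 1)" by (intro compact_continuous_image \<Phi>_cont) simp
        then have o: "open (ball 0 1 - \<Phi> ` cball 0 1)" by (intro open_Diff compact_imp_closed) auto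
        have "open (e ` (ball 0 1 - \<Phi> ` cball 0 1))" by (rule open_e[OF o]) blast
        moreover have "e u \<in> e ` (ball 0 1 - \<Phi> ` cball 0 1)" using n u NB by blast
        ultimately have "G \<inter> e ` (ball 0 1 - \<Phi> ` cball 0 1) \<noteq> {}"
          by (rule closure_iff_nhds_not_empty[THEN iffD1, rule_format, OF uG(1) subset_refl])
        then obtain v' where v': "v' \<in> G" "v' \<in> e ` (ball 0 1 - \<Phi> ` cball 0 1)"
          unfolding ex_in_conv[symmetric] by (elim exE IntE)
        then obtain z where z1: "z \<in> ball 0 1" "v' = f z" unfolding G_def by blast
        obtain u' where "u' \<in> ball 0 1 - \<Phi> ` cball 0 1" "v' = e u'" using v'(2) by (rule imageE)
        then have z: "u' \<in> ball 0 1" "u' \<notin> \<Phi> ` cball 0 1" "z \<in> ball 0 1" "e u' = f z" using z1 by simp_all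
        then have "u' = \<Phi> z" using inj_onD[OF e_inj _ z(1) \<Phi>_ball'[OF z(3)]] f_eq[OF z(3)] by simp
        then show False using z by auto
      qed
      then obtain z where z: "z \<in> cball 0 1" "u = \<Phi> z" by blast
      have "z \<notin> ball 0 1"
      proof
        assume "z \<in> ball 0 1"
        then have "e u \<in> G" using f_eq[of z] z(2) unfolding G_def by (metis image_eqI)
        then show False using uG by blast
      qed
      then have "z \<in> sphere 0 1" using z by simp
      then have "z \<in> sphere 0 1 \<inter> W" using u z unfolding N_def by blast
      then obtain t where "t \<in> {x1<..<x2}" "z = upper_arc t" using arcW by blast
      then show "v \<in> boundary_curve ` {x1<..<x2}" using u z unfolding boundary_curve_def fb_def by blast
    qed
  qed
qed

text \<open>The boundary curve has no limit, so by compactness it has two cluster points \<open>A\<close> and \<open>B\<close>. A connected neighbourhood \<open>Q\<close>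
  of \<open>A\<close> in the boundary, away from \<open>B\<close>, contains a point of the curve that lies between two
  points near \<open>B\<close>. The piece between these two is open in the boundary and, with its end points, closed,
  so it contains \<open>Q\<close> and with it \<open>A\<close>. But then \<open>A\<close> is interior to \<open>e ` ball 0 1\<close>, and cannot be a limit of
  points \<open>e (\<Phi> z)\<close> with \<open>z \<rightarrow> 1\<close>.\<close>

theorem boundary_not_locally_connected:
  "\<not> locally_connected_space (subtopology riemann_sphere (sphere_boundary (f ` ball 0 1)))"
proof
  define S where "S = sphere_boundary G"
  assume "locally_connected_space (subtopology riemann_sphere (sphere_boundary (f ` ball 0 1)))"
  then have lc: "neighbourhood_base_of (connectedin (subtopology riemann_sphere S)) (subtopology riemann_sphere S)"
    unfolding locally_connected_space_def S_def G_def .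
  have top: "boundary_curve x \<in> topspace riemann_sphere" for x by (simp add: riemann_sphere_def boundary_curve_def)
  have freq0: "\<forall>Y<1. \<exists>x::real. Y < x \<and> 0 < x \<and> x < 1 \<and> boundary_curve x \<in> topspace riemann_sphere"
  proof (intro allI impI)
    fix Y :: real assume "Y < 1"
    then show "\<exists>x. Y < x \<and> 0 < x \<and> x < 1 \<and> boundary_curve x \<in> topspace riemann_sphere"
      using top by (intro exI[of _ "(max Y 0 + 1) / 2"]) auto
  qed
  obtain A where A: "A \<in> topspace riemann_sphere"
    "\<And>U Y. openin riemann_sphere U \<Longrightarrow> A \<in> U \<Longrightarrow> Y < 1 \<Longrightarrow> \<exists>x. Y < x \<and> 0 < x \<and> x < 1 \<and> boundary_curve x \<in> U"
    using cluster_point_compactin[OF compact_space_sphere[unfolded compact_space_def] freq0] by blast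
  have "\<not> limitin riemann_sphere boundary_curve A (at_left 1)" unfolding boundary_curve_def
    by (rule no_limit_f[OF upper_arc_cont upper_arc_cball upper_arc_tendsto])
  then obtain U1 where U1: "openin riemann_sphere U1" "A \<in> U1" "\<not> (\<forall>\<^sub>F x in at_left 1. boundary_curve x \<in> U1)"
    unfolding limitin_def using A(1) by blast
  have fr: "\<forall>Y<1. \<exists>x. Y < x \<and> 0 < x \<and> x < 1 \<and> boundary_curve x \<in> topspace riemann_sphere - U1"
    using U1(3) top frequently_at_left_1[of "\<lambda>x. boundary_curve x \<in> topspace riemann_sphere - U1"] by simp
  have cp: "compactin riemann_sphere (topspace riemann_sphere - U1)"
    by (rule closedin_compact_space[OF compact_space_sphere]) (use U1(1) in blast)
  obtain B where B: "B \<in> topspace riemann_sphere - U1"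
    "\<And>U Y. openin riemann_sphere U \<Longrightarrow> B \<in> U \<Longrightarrow> Y < 1 \<Longrightarrow> \<exists>x. Y < x \<and> 0 < x \<and> x < 1 \<and> boundary_curve x \<in> U"
    using cluster_point_compactin[OF cp fr] by blast
  have "A \<noteq> B" using B U1 by blast
  then obtain U U' where U: "openin riemann_sphere U" "openin riemann_sphere U'" "A \<in> U" "B \<in> U'" "disjnt U U'"
    using Hausdorff_space_sphere A(1) B(1) unfolding Hausdorff_space_def by blast
  have AS: "A \<in> S"
  proof (rule ccontr)
    assume "A \<notin> S"
    have "closedin riemann_sphere S" unfolding S_def sphere_boundary_def by (rule closedin_frontier_of)
    then have "openin riemann_sphere (topspace riemann_sphere - S)" by blast
    then obtain x where "0 < x" "x < 1" "boundary_curve x \<in> topspace riemann_sphere - S" 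
      using A(2)[of "topspace riemann_sphere - S" 0] A(1) \<open>A \<notin> S\<close> by auto
    then show False using boundary_curve_in_boundary[of x] unfolding S_def by auto
  qed
  have nb: "neighbourhood_base_at A (connectedin (subtopology riemann_sphere S)) (subtopology riemann_sphere S)"
    using lc AS A(1) unfolding neighbourhood_base_of_def by simp
  have "openin (subtopology riemann_sphere S) (S \<inter> U)" using U(1) by (simp add: openin_subtopology_Int2)
  moreover have "A \<in> S \<inter> U" using AS U(3) by blast
  ultimately obtain V Q where VQ: "openin (subtopology riemann_sphere S) V" "connectedin (subtopology riemann_sphere S) Q"
      "A \<in> V" "V \<subseteq> Q" "Q \<subseteq> S \<inter> U"
    using nb[unfolded neighbourhood_base_at_def, rule_format, of "S \<inter> U"] by metis
  obtain T where T: "openin riemann_sphere T" "V = T \<inter> S" using VQ(1) unfolding openin_subtopology by blast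
  obtain x1 where x1: "0 < x1" "x1 < 1" "boundary_curve x1 \<in> U'" using B(2)[OF U(2,4), of 0] by auto
  obtain x where x: "x1 < x" "x < 1" "boundary_curve x \<in> T" using A(2)[OF T(1) _ x1(2)] VQ(3) T(2) by blast
  obtain x2 where x2: "x < x2" "x2 < 1" "boundary_curve x2 \<in> U'" using B(2)[OF U(2,4) x(2)] by blast
  have xQ: "boundary_curve x \<in> Q" using x x1 T(2) VQ(4) boundary_curve_in_boundary[of x] unfolding S_def by auto
  have "x1 < x2" using x x2 by linarith
  from boundary_arc_open[OF x1(1) this x2(2)]
  obtain N' where N': "openin riemann_sphere N'" "N' \<inter> S = boundary_curve ` {x1<..<x2}"
    unfolding S_def by blast
  \<comment> \<open>\<open>J\<close> is closed, and it agrees on \<open>Q\<close> with the relatively open arc because \<open>Q\<close> avoids the end points.\<close>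
  define J where "J = boundary_curve ` {x1..x2}"
  have Jsub: "{x1..x2} \<subseteq> {0<..<1}" using x1(1) x2(2) by (simp add: subset_iff)
  have contfb: "continuous_on {x1..x2} (\<lambda>t. fb (upper_arc t))"
  proof (rule continuous_on_compose2[OF fb_cont upper_arc_cont], rule image_subsetI)
    fix t assume "t \<in> {x1..x2}"
    then show "upper_arc t \<in> cball 0 1 - {1}" by (rule upper_arc_cball[OF subsetD[OF Jsub]])
  qed
  have "compact ((\<lambda>t. fb (upper_arc t)) ` {x1..x2})" by (rule compact_continuous_image[OF contfb]) simp
  then have "closedin riemann_sphere (Some ` (\<lambda>t. fb (upper_arc t)) ` {x1..x2})"
    by (simp add: riemann_sphere_def compact_imp_closed)
  then have Jc: "closedin riemann_sphere J" unfolding J_def boundary_curve_def by (simp add: image_image)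
  have QO: "Q \<inter> N' = Q \<inter> J"
  proof -
    have "boundary_curve x1 \<notin> Q" "boundary_curve x2 \<notin> Q" using VQ(5) U(5) x1(3) x2(3) unfolding disjnt_def by blast+
    moreover have "{x1..x2} = insert x1 (insert x2 {x1<..<x2})" using x x2 by auto
    ultimately have "Q \<inter> J = Q \<inter> boundary_curve ` {x1<..<x2}" unfolding J_def by auto
    then show ?thesis using N'(2) VQ(5) by blast
  qed
  have cQ: "connectedin riemann_sphere Q" using VQ(2) by (simp add: connectedin_subtopology)
  have "Q \<subseteq> N' \<union> (topspace riemann_sphere - J)" using QO cQ connectedin_subset_topspace by blast
  moreover have "N' \<inter> (topspace riemann_sphere - J) \<inter> Q = {}" using QO by blast
  moreover have "N' \<inter> Q \<noteq> {}"
  proof -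
    have "boundary_curve x \<in> J" unfolding J_def using x x2 by auto
    then show ?thesis using xQ QO by blast
  qed
  ultimately have "(topspace riemann_sphere - J) \<inter> Q = {}"
    using cQ N'(1) Jc unfolding connectedin by blast
  then have "A \<in> J" using VQ(3,4) A(1) by blast
  then obtain t where t: "t \<in> {0<..<1}" "A = boundary_curve t" unfolding J_def using Jsub by blast
  define w where "w = \<Phi> (upper_arc t)"
  have w: "w \<in> ball 0 1" unfolding w_def by (rule \<Phi>_ball) (use upper_arc_cball[OF t(1)] in blast)+
  define \<rho> where "\<rho> = (1 + cmod w) / 2"
  have \<rho>: "cmod w < \<rho>" "\<rho> < 1" using w by (auto simp: \<rho>_def)
  have sub: "ball (0::complex) \<rho> \<subseteq> ball 0 1" using \<rho> by auto
  have "open (e ` ball 0 \<rho>)"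
    by (rule open_mapping_thm3[OF holomorphic_on_subset[OF e_hol sub] open_ball inj_on_subset[OF e_inj sub]])
  then have op: "openin riemann_sphere (Some ` e ` ball 0 \<rho>)" by (simp add: riemann_sphere_def)
  have Ain: "A \<in> Some ` e ` ball 0 \<rho>" using t \<rho> unfolding boundary_curve_def fb_def w_def[symmetric] by auto
  have "((\<lambda>x. \<Phi> (upper_arc x)) \<longlongrightarrow> \<Phi> 1) (at_left 1)"
  proof (rule continuous_on_tendsto_compose[OF \<Phi>_cont upper_arc_tendsto])
    show "\<forall>\<^sub>F x in at_left 1. upper_arc x \<in> cball 0 1"
      using eventually_at_left_1_unit by eventually_elim (use upper_arc_cball in blast)
  qed simp
  then have "((\<lambda>x. cmod (\<Phi> (upper_arc x))) \<longlongrightarrow> 1) (at_left 1)" using tendsto_norm \<Phi>_1 by fastforce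
  then have "\<forall>\<^sub>F x in at_left 1. \<rho> < cmod (\<Phi> (upper_arc x))" using order_tendstoD(1) \<rho>(2) by blast
  then obtain Y where Y: "Y < 1" "\<And>x. Y < x \<Longrightarrow> x < 1 \<Longrightarrow> \<rho> < cmod (\<Phi> (upper_arc x))"
    unfolding eventually_at_left_field by blast
  obtain y where y: "Y < y" "0 < y" "y < 1" "boundary_curve y \<in> Some ` e ` ball 0 \<rho>" using A(2)[OF op Ain Y(1)] by blast
  then obtain u where u: "u \<in> ball 0 \<rho>" "e (\<Phi> (upper_arc y)) = e u" unfolding boundary_curve_def fb_def by auto
  have "y \<in> {0<..<1}" using y by simp
  note yc = upper_arc_cball[OF this]
  have "\<Phi> (upper_arc y) \<in> ball 0 1" by (rule \<Phi>_ball) (use yc in blast)+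
  then have "\<Phi> (upper_arc y) = u" using inj_onD[OF e_inj u(2)] u(1) sub by blast
  then show False using Y(2)[OF y(1,3)] u(1) by simp
qed

theorem nonlanding_boundary:
  "prime_end_map f 1 \<in> prime_ends (f ` ball 0 1)"
  "\<not> trivial_prime_end (f ` ball 0 1) (prime_end_map f 1)"
  "\<not> contains_reachable_point (f ` ball 0 1) (prime_end_map f 1) A"
  "\<not> locally_connected_space (subtopology riemann_sphere (sphere_boundary (f ` ball 0 1)))"
proof -
  obtain R where R: "strict_mono R" "\<And>n. 0 < R n" "filterlim R at_top sequentially"
    "(\<lambda>n. spherical_diameter (f ` geodesic_arc (R n))) \<longlonglongrightarrow> 0" using short_radii by blast
  interpret nonlanding_map_radii e \<Phi> f R by unfold_locales (use R in auto)
  show "prime_end_map f 1 \<in> prime_ends (f ` ball 0 1)" by (rule is_prime_end)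
  show "\<not> trivial_prime_end (f ` ball 0 1) (prime_end_map f 1)" by (rule nontrivial)
  show "\<not> contains_reachable_point (f ` ball 0 1) (prime_end_map f 1) A" by (rule no_reachable_point)
  show "\<not> locally_connected_space (subtopology riemann_sphere (sphere_boundary (f ` ball 0 1)))"
    by (rule boundary_not_locally_connected)
qed

end

section \<open>Blocks of rotating steps\<close>

text \<open>The parameters of a step whose derivative at \<open>\<i>\<close> has the argument \<open>A = pi / m\<close>. Relative to the pole, \<open>\<i>\<close> has the polar
  form \<open>step_radius m * cis (pi - A)\<close>, and the time is such that it moves to a point with argument
  \<open>pi - 2 A\<close>; the derivative of the flow is the quotient of these two. The pole lies at the distance
  \<open>step_gap m\<close> below the real line: positive, so that the closed half-plane is mapped into the open
  one, yet of order \<open>1 / m\<^sup>2\<close>, so that even \<open>m\<close> steps lose little of the modulus of the derivative.\<close>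

definition step_angle :: "nat \<Rightarrow> real" where "step_angle m = pi / real m"
definition step_gap :: "nat \<Rightarrow> real" where "step_gap m = 1 / (real m)\<^sup>2"
definition step_radius :: "nat \<Rightarrow> real" where "step_radius m = (1 + step_gap m) / sin (step_angle m)"
definition step_centre :: "nat \<Rightarrow> real" where "step_centre m = step_radius m * cos (step_angle m)"
definition step_time :: "nat \<Rightarrow> real" where "step_time m = (step_radius m)\<^sup>2 / (4 * cos (2 * step_angle m))"

abbreviation unit_step :: "nat \<Rightarrow> complex \<Rightarrow> complex" where
  "unit_step m \<equiv> step (step_centre m) (step_gap m) (step_time m)"

definition normal_step :: "nat \<Rightarrow> complex \<Rightarrow> complex" where
  "normal_step m w = (unit_step m w - of_real (Re (unit_step m \<i>))) / of_real (Im (unit_step m \<i>))"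

lemma step_trig:
  assumes "8 \<le> m"
  shows "0 < step_angle m" "step_angle m \<le> pi / 8" "0 < sin (step_angle m)" "0 < cos (step_angle m)"
    "0 < cos (2 * step_angle m)" "0 < sin (2 * step_angle m)" "0 < step_gap m" "0 < step_radius m" "0 < step_time m"
    "1 / 4 \<le> step_time m"
proof -
  have m: "real m \<ge> 8" using assms by simp
  show A: "0 < step_angle m" using m by (simp add: step_angle_def)
  show A8: "step_angle m \<le> pi / 8" 
    unfolding step_angle_def by (rule divide_left_mono) (use m in auto)
  show s: "0 < sin (step_angle m)" by (rule sin_gt_zero) (use A A8 pi_gt_zero in linarith)+
  show "0 < cos (step_angle m)" by (rule cos_gt_zero_pi) (use A A8 pi_gt_zero in linarith)+
  show c2: "0 < cos (2 * step_angle m)" by (rule cos_gt_zero_pi) (use A A8 pi_gt_zero in linarith)+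
  show "0 < sin (2 * step_angle m)" by (rule sin_gt_zero) (use A A8 pi_gt_zero in linarith)+
  show g: "0 < step_gap m" using m by (simp add: step_gap_def)
  show r: "0 < step_radius m" using g s by (simp add: step_radius_def)
  show t: "0 < step_time m" using r c2 by (simp add: step_time_def)
  have "sin (step_angle m) \<le> 1 + step_gap m" using g sin_le_one[of "step_angle m"] by linarith
  then have "1 \<le> step_radius m" using s by (simp add: step_radius_def le_divide_eq)
  then have "1 \<le> (step_radius m)\<^sup>2" by (simp add: one_le_power)
  moreover have "4 * cos (2 * step_angle m) \<le> 4" by simp
  ultimately have "1 / 4 \<le> (step_radius m)\<^sup>2 / (4 * cos (2 * step_angle m))" using c2 by (intro frac_le) auto
  then show "1 / 4 \<le> step_time m" by (simp add: step_time_def)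
qed

lemma unit_step_base:
  assumes m: "8 \<le> m"
  defines "A \<equiv> step_angle m"
  defines "u0 \<equiv> \<i> - (of_real (step_centre m) - \<i> * of_real (step_gap m))"
  defines "\<nu> \<equiv> step_radius m / sqrt (2 * cos (2 * A))"
  shows "u0 = of_real (step_radius m) * cis (pi - A)" "uhp_root (step_time m) u0 = of_real \<nu> * cis (pi - 2 * A)"
    "0 < \<nu>" "0 < Im u0"
proof -
  note t = step_trig[OF m, folded A_def]
  have "step_radius m * sin A = 1 + step_gap m" using t by (simp add: step_radius_def A_def)
  then show u0: "u0 = of_real (step_radius m) * cis (pi - A)"
    by (simp add: u0_def complex_eq_iff step_centre_def A_def)
  show \<nu>: "0 < \<nu>" using t by (simp add: \<nu>_def)
  show I: "0 < Im u0" using t by (simp add: u0_def)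
  have nu2: "\<nu>\<^sup>2 = (step_radius m)\<^sup>2 / (2 * cos (2 * A))" using t by (simp add: \<nu>_def power_divide)
  show "uhp_root (step_time m) u0 = of_real \<nu> * cis (pi - 2 * A)"
  proof (rule uhp_root_unique[OF I less_imp_le[OF t(9)]])
    show "0 < Im (of_real \<nu> * cis (pi - 2 * A))" using \<nu> t by simp
    have d1: "(cis (pi - x))\<^sup>2 = cis (- (2 * x))" for x
    proof -
      have "(cis (pi - x))\<^sup>2 = cis (2 * (pi - x))" using Complex.DeMoivre[of "pi - x" 2] by simp
      also have "\<dots> = cis (2 * pi - 2 * x)" by (simp add: algebra_simps)
      also have "\<dots> = cis (- (2 * x))" by (simp add: complex_eq_iff cos_diff sin_diff)
      finally show ?thesis .
    qed
    define k2 c where "k2 = (step_radius m)\<^sup>2" "c = cos (2 * A)"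
    have c: "c > 0" using t by (simp add: k2_c_def)
    have st: "step_time m = k2 / (4 * c)" by (simp add: step_time_def k2_c_def A_def)
    have nk: "\<nu>\<^sup>2 = k2 / (2 * c)" using nu2 by (simp add: k2_c_def)
    have "(of_real \<nu> * cis (pi - 2 * A))\<^sup>2 = of_real (\<nu>\<^sup>2) * cis (- (4 * A))"
      by (simp add: power_mult_distrib d1 flip: of_real_power)
    also have "\<dots> = of_real k2 * cis (- (2 * A)) - of_real (2 * step_time m)"
    proof -
      have c4: "cos (4 * A) = 2 * c\<^sup>2 - 1" "sin (4 * A) = 2 * sin (2 * A) * c"
        using cos_double_cos[of "2 * A"] sin_double[of "2 * A"] by (simp_all add: k2_c_def)
      have "k2 / (2 * c) * (2 * c\<^sup>2 - 1) = k2 * c - 2 * (k2 / (4 * c))"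
        using c by (simp add: field_simps power2_eq_square)
      then have "\<nu>\<^sup>2 * cos (4 * A) = k2 * cos (2 * A) - 2 * step_time m"
        unfolding c4 nk st by (simp add: k2_c_def)
      moreover have "\<nu>\<^sup>2 * sin (4 * A) = k2 * sin (2 * A)"
        unfolding c4 nk using c by (simp add: field_simps)
      ultimately show ?thesis by (simp add: complex_eq_iff del: of_real_power)
    qed
    also have "of_real k2 * cis (- (2 * A)) = u0\<^sup>2"
      unfolding u0 power_mult_distrib d1 by (simp add: k2_c_def)
    finally show "(of_real \<nu> * cis (pi - 2 * A))\<^sup>2 = u0\<^sup>2 - of_real (2 * step_time m)" .
  qed
qed

lemma unit_step_i_Im: 
  assumes "8 \<le> m" shows "1 < Im (unit_step m \<i>)"
proof -
  note t = step_trig[OF assms]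
  define u0 where "u0 = \<i> - (of_real (step_centre m) - \<i> * of_real (step_gap m))"
  have "Im u0 < Im (uhp_root (step_time m) u0)"
    by (rule uhp_root_Im_ge(2)) (use t in \<open>auto simp: u0_def\<close>)
  then show "1 < Im (unit_step m \<i>)" by (simp add: step_def u0_def)
qed

lemma normal_step_i: "8 \<le> m \<Longrightarrow> normal_step m \<i> = \<i>"
  using unit_step_i_Im[of m] by (simp add: normal_step_def complex_eq_iff)

lemma normal_step_affine:
  assumes "8 \<le> m"
  shows "normal_step m w = of_real (- Re (unit_step m \<i>) / Im (unit_step m \<i>)) + of_real (1 / Im (unit_step m \<i>)) * unit_step m w"
  using unit_step_i_Im[OF assms] by (simp add: normal_step_def field_simps)

lemma normal_step_embedding: 
  assumes "8 \<le> m" shows "uhp_embedding (normal_step m)" "0 \<le> Im w \<Longrightarrow> 0 < Im (normal_step m w)"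
proof -
  note t = step_trig[OF assms]
  have y: "0 < 1 / Im (unit_step m \<i>)" using unit_step_i_Im[OF assms] by simp
  have h: "hydrodynamic (step_time m) (unit_step m)" by (rule hydrodynamic_step(1)) (use t in auto)
  have "uhp_embedding (\<lambda>w. of_real (- Re (unit_step m \<i>) / Im (unit_step m \<i>)) + of_real (1 / Im (unit_step m \<i>)) * unit_step m w)"
    by (rule uhp_embedding_compose[OF uhp_embedding_affine[OF y] hydrodynamic_imp_embedding[OF h]])
  then show "uhp_embedding (normal_step m)" by (rule uhp_embedding_cong) (simp add: normal_step_affine[OF assms])
  assume "0 \<le> Im w"
  then have "0 < Im (unit_step m w)" using hydrodynamic_step(2)[of "step_gap m" "step_time m"] t by auto
  then show "0 < Im (normal_step m w)" unfolding normal_step_affine[OF assms] using y by simp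
qed

text \<open>The flow has the derivative \<open>u0 / S u0\<close> at \<open>\<i>\<close>, where \<open>S\<close> is the root and \<open>u0\<close> is \<open>\<i>\<close> relative to the pole, and normalising divides it by
  the height \<open>Y\<close> of the image of \<open>\<i>\<close>. The modulus is \<open>1 - O(1/m\<^sup>2)\<close>: without the gap it
  would be \<open>cos (2 A) / cos A\<close>.\<close>

lemma normal_step_deriv:
  assumes m: "8 \<le> m"
  obtains \<rho> where "(normal_step m has_field_derivative of_real \<rho> * cis (pi / real m)) (at \<i>)"
    "cos (2 * step_angle m) / (1 + step_gap m) \<le> \<rho>"
proof -
  note t = step_trig[OF m]
  define A u0 \<nu> where "A = step_angle m" "u0 = \<i> - (of_real (step_centre m) - \<i> * of_real (step_gap m))"
    "\<nu> = step_radius m / sqrt (2 * cos (2 * step_angle m))"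
  note d = A_u0_\<nu>_def
  have b: "u0 = of_real (step_radius m) * cis (pi - A)" "uhp_root (step_time m) u0 = of_real \<nu> * cis (pi - 2 * A)" "0 < \<nu>" "0 < Im u0"
    using unit_step_base[OF m] by (simp_all add: d)
  define Y where "Y = Im (unit_step m \<i>)"
  have Y1: "1 < Y" using unit_step_i_Im[OF m] by (simp add: Y_def)
  have Yv: "Y = \<nu> * sin (2 * A) - step_gap m"
  proof -
    have "unit_step m \<i> = uhp_root (step_time m) u0 + (of_real (step_centre m) - \<i> * of_real (step_gap m))"
      by (simp add: step_def d)
    then show ?thesis unfolding Y_def b(2) by simp
  qed
  define \<rho> where "\<rho> = step_radius m / (\<nu> * Y)"
  have "((\<lambda>w. uhp_root (step_time m) (w - (of_real (step_centre m) - \<i> * of_real (step_gap m)))) has_field_derivative u0 / uhp_root (step_time m) u0 * 1) (at \<i>)"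
    by (rule DERIV_chain2[of "uhp_root (step_time m)"])
       (use uhp_root_has_field_derivative[OF b(4) less_imp_le[OF t(9)]] in \<open>auto simp: d intro!: derivative_eq_intros\<close>)
  then have us: "(unit_step m has_field_derivative u0 / uhp_root (step_time m) u0) (at \<i>)"
    unfolding step_def[abs_def] by (auto intro!: derivative_eq_intros)
  have "(normal_step m has_field_derivative u0 / uhp_root (step_time m) u0 / of_real Y) (at \<i>)"
    unfolding normal_step_def[abs_def] Y_def using us Y1[unfolded Y_def]
    by (auto intro!: derivative_eq_intros)
  moreover have "u0 / uhp_root (step_time m) u0 / of_real Y = of_real \<rho> * cis (pi / real m)"
  proof -
    have c: "cis (pi - A) = cis (pi - 2 * A) * cis A" by (simp add: cis_mult)
    have "u0 / uhp_root (step_time m) u0 / of_real Y = of_real \<rho> * cis A"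
      unfolding b(2) unfolding b(1) c \<rho>_def using b(3) Y1 by simp
    then show ?thesis by (simp add: A_u0_\<nu>_def(1) step_angle_def)
  qed
  ultimately have "(normal_step m has_field_derivative of_real \<rho> * cis (pi / real m)) (at \<i>)" by simp
  moreover have "cos (2 * A) / (1 + step_gap m) \<le> \<rho>"
  proof -
    have sq: "\<nu>\<^sup>2 = (step_radius m)\<^sup>2 / (2 * cos (2 * A))" using t by (simp add: d power_divide)
    have "\<nu> * Y \<le> \<nu> * (\<nu> * sin (2 * A))" using b(3) t Yv by (intro mult_left_mono) auto
    also have "\<dots> = (step_radius m)\<^sup>2 * (sin (2 * A) / (2 * cos (2 * A)))"
      using sq by (simp add: power2_eq_square mult.assoc[symmetric])
    finally have le: "\<nu> * Y \<le> (step_radius m)\<^sup>2 * (sin (2 * A) / (2 * cos (2 * A)))" .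
    have "cos (2 * A) / (1 + step_gap m) * (\<nu> * Y) \<le> cos (2 * A) / (1 + step_gap m) * ((step_radius m)\<^sup>2 * (sin (2 * A) / (2 * cos (2 * A))))"
      using le t by (intro mult_left_mono) (auto simp: d)
    also have "\<dots> = step_radius m * cos A"
    proof -
      have e1: "step_radius m * sin A = 1 + step_gap m" using t by (simp add: step_radius_def d)
      have "sin (2 * A) = 2 * sin A * cos A" by (rule sin_double)
      moreover have "cos (2 * A) > 0" "1 + step_gap m > 0" using t by (auto simp: d)
      ultimately have "cos (2 * A) / (1 + step_gap m) * ((step_radius m)\<^sup>2 * (sin (2 * A) / (2 * cos (2 * A))))
         = step_radius m * (step_radius m * sin A) * cos A / (1 + step_gap m)"
        by (simp add: power2_eq_square)
      then show ?thesis unfolding e1 using t by simp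
    qed
    also have "\<dots> \<le> step_radius m" using t by (simp add: mult_left_le)
    finally show ?thesis using b(3) Y1 by (simp add: \<rho>_def le_divide_eq)
  qed
  ultimately show thesis using that by (simp add: d)
qed

lemma normal_step_iterate:
  assumes m: "8 \<le> m"
  shows "uhp_embedding (normal_step m ^^ k)" "(normal_step m ^^ k) \<i> = \<i>"
    "0 < k \<Longrightarrow> 0 \<le> Im w \<Longrightarrow> 0 < Im ((normal_step m ^^ k) w)"
proof -
  show e: "uhp_embedding (normal_step m ^^ k)" for k
  proof (induction k)
    case 0
    have "uhp_embedding (\<lambda>z. z)" by (rule hydrodynamic_imp_embedding[OF hydrodynamic_id])
    then show ?case by (simp add: id_def)
  next
    case (Suc k)
    from uhp_embedding_compose[OF normal_step_embedding(1)[OF m] this] show ?case by (simp add: o_def)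
  qed
  show "(normal_step m ^^ k) \<i> = \<i>" by (induction k) (auto simp: normal_step_i[OF m])
  assume "0 < k" "0 \<le> Im w"
  then obtain j where "k = Suc j" by (cases k) auto
  moreover have "0 \<le> Im ((normal_step m ^^ j) w)" using e[of j] \<open>0 \<le> Im w\<close> by (auto simp: uhp_embedding_def)
  ultimately show "0 < Im ((normal_step m ^^ k) w)" using normal_step_embedding(2)[OF m] by simp
qed

definition block :: "nat \<Rightarrow> complex \<Rightarrow> complex" where
  "block m = disk_conj (normal_step m ^^ m)"

text \<open>Bounds the distance of the derivative of a block at \<open>0\<close> from \<open>-1\<close>.\<close>

definition defect :: "nat \<Rightarrow> real" where "defect m = 21 / real m"

text \<open>The \<open>m\<close> rotations by \<open>pi / m\<close> add up to a half turn, and the moduli \<open>1 - O(1/m\<^sup>2)\<close> multiply to at least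
  \<open>1 - O(1/m)\<close> by Bernoulli's inequality.\<close>

lemma block_derivative:
  assumes m: "8 \<le> m"
  obtains \<beta> where "(block m has_field_derivative - of_real \<beta>) (at 0)" "1 - \<beta> \<le> defect m"
proof -
  note t = step_trig[OF m]
  obtain \<rho> where \<rho>: "(normal_step m has_field_derivative of_real \<rho> * cis (pi / real m)) (at \<i>)"
    "cos (2 * step_angle m) / (1 + step_gap m) \<le> \<rho>" by (rule normal_step_deriv[OF m])
  have it: "(normal_step m ^^ k has_field_derivative (of_real \<rho> * cis (pi / real m)) ^ k) (at \<i>)" for k
  proof (induction k)
    case 0 show ?case by (simp add: id_def)
  next
    case (Suc k)
    have "((\<lambda>w. normal_step m ((normal_step m ^^ k) w)) has_field_derivative
      of_real \<rho> * cis (pi / real m) * (of_real \<rho> * cis (pi / real m)) ^ k) (at \<i>)"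
      by (rule DERIV_chain2[OF _ Suc]) (use \<rho>(1) in \<open>simp add: normal_step_iterate(2)[OF m]\<close>)
    then show ?case by (simp add: o_def)
  qed
  have "(of_real \<rho> * cis (pi / real m)) ^ m = - complex_of_real (\<rho> ^ m)"
    using m Complex.DeMoivre[of "pi / real m" m] by (simp add: power_mult_distrib)
  with it[of m] have "(normal_step m ^^ m has_field_derivative - complex_of_real (\<rho> ^ m)) (at \<i>)" by simp
  then have der: "(block m has_field_derivative - of_real (\<rho> ^ m)) (at 0)"
    unfolding block_def by (intro disk_conj_deriv_0 normal_step_iterate[OF m]) auto
  define x where "x = 1 / real m"
  have mr: "real m \<ge> 8" using m by simp
  have x: "0 < x" "x \<le> 1/8" using mr by (auto simp: x_def field_simps)
  have cosb: "1 - 2 * (pi * x)\<^sup>2 \<le> cos (2 * (pi * x))"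
  proof -
    have "cos (2 * (pi * x)) = 1 - 2 * (sin (pi * x))\<^sup>2" by (rule cos_double_sin)
    moreover have "\<bar>sin (pi * x)\<bar> \<le> \<bar>pi * x\<bar>" by (rule abs_sin_x_le_abs_x)
    then have "(sin (pi * x))\<^sup>2 \<le> (pi * x)\<^sup>2" by (simp only: abs_le_square_iff)
    ultimately show ?thesis by simp
  qed
  have pi2: "pi\<^sup>2 \<le> 10"
  proof -
    have "pi \<le> 3.15" using pi_approx by simp
    then have "pi\<^sup>2 \<le> 3.15\<^sup>2" by (intro power_mono) auto
    then show ?thesis by (simp add: power2_eq_square)
  qed
  have sx: "0 \<le> x\<^sup>2" "x\<^sup>2 \<le> 1 / 64" using power_mono[OF x(2), of 2] x by (auto simp: power2_eq_square)
  have lo: "1 - 21 * x\<^sup>2 \<le> \<rho>"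
  proof -
    have c1: "1 - 20 * x\<^sup>2 \<le> cos (2 * (pi * x))"
    proof -
      have "(pi * x)\<^sup>2 \<le> 10 * x\<^sup>2" unfolding power_mult_distrib by (intro mult_right_mono pi2) simp
      then show ?thesis using cosb by simp
    qed
    have "(1 - 21 * x\<^sup>2) * (1 + x\<^sup>2) \<le> 1 - 20 * x\<^sup>2" using sx by (simp add: algebra_simps)
    also have "\<dots> \<le> cos (2 * (pi * x))" by (rule c1)
    finally have "(1 - 21 * x\<^sup>2) * (1 + x\<^sup>2) \<le> cos (2 * (pi * x))" .
    moreover have "0 < 1 + x\<^sup>2" using sx by linarith
    ultimately have "1 - 21 * x\<^sup>2 \<le> cos (2 * (pi * x)) / (1 + x\<^sup>2)" by (simp only: pos_le_divide_eq)
    then show ?thesis using \<rho>(2) by (simp add: step_angle_def step_gap_def x_def power_divide)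
  qed
  have "1 + real m * (- (21 * x\<^sup>2)) \<le> (1 + (- (21 * x\<^sup>2))) ^ m"
    by (rule Bernoulli_inequality) (use sx in simp)
  also have "\<dots> \<le> \<rho> ^ m" using lo sx by (intro power_mono) auto
  finally have "1 - real m * (21 * x\<^sup>2) \<le> \<rho> ^ m" by simp
  moreover have "real m * (21 * x\<^sup>2) = 21 / real m" using mr by (simp add: x_def power2_eq_square)
  ultimately have "1 - \<rho> ^ m \<le> defect m" by (simp add: defect_def)
  with der show thesis by (rule that)
qed

lemma block_facts:
  assumes m: "8 \<le> m"
  shows "continuous_on (cball 0 1) (block m)" "inj_on (block m) (cball 0 1)" "block m holomorphic_on ball 0 1"
    "block m 1 = 1" "z \<in> cball 0 1 \<Longrightarrow> z \<noteq> 1 \<Longrightarrow> block m z \<in> ball 0 1" "block m 0 = 0"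
proof -
  note n = normal_step_iterate[OF m, of m]
  show "continuous_on (cball 0 1) (block m)" "inj_on (block m) (cball 0 1)" "block m holomorphic_on ball 0 1" "block m 1 = 1"
    unfolding block_def using disk_conj_continuous[OF n(1)] disk_conj_inj[OF n(1)] disk_conj_holomorphic[OF n(1)] by auto
  show "z \<in> cball 0 1 \<Longrightarrow> z \<noteq> 1 \<Longrightarrow> block m z \<in> ball 0 1"
    unfolding block_def by (rule disk_conj_strict[OF n(1) n(3)]) (use m in auto)
  show "block m 0 = 0" using n(2) by (simp add: block_def disk_conj_def cayley_def cinv_def)
qed

text \<open>With \<open>B z = z h z\<close> and \<open>\<bar>h\<bar> \<le> 1\<close>, the function \<open>H = \<beta> + \<kappa> + h\<close> has nonnegative real part and the value \<open>\<kappa>\<close> at \<open>0\<close>.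
  Schwarz's lemma for its Cayley transform \<open>(H - \<kappa>) / (H + \<kappa>)\<close> gives the Harnack bound
  \<open>\<bar>H z\<bar> \<le> \<kappa> (1 + \<bar>z\<bar>) / (1 - \<bar>z\<bar>)\<close>.\<close>

lemma near_minus_identity:
  assumes B: "B holomorphic_on ball 0 1" "\<And>z. z \<in> ball 0 1 \<Longrightarrow> B z \<in> ball 0 1" "B 0 = 0"
    and der: "(B has_field_derivative - of_real \<beta>) (at 0)" and \<kappa>: "1 - \<beta> \<le> \<kappa>" "0 < \<kappa>"
    and z: "cmod z < 1"
  shows "cmod (B z) \<le> cmod z" "cmod (B z + z) \<le> 2 * \<kappa> / (1 - cmod z)"
proof -
  have Bz: "cmod (B z) < 1" if "cmod z < 1" for z using B(2)[of z] that by simp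
  show S1: "cmod (B z) \<le> cmod z" by (rule Schwarz_Lemma(1)[OF B(1,3) Bz z])
  obtain h where h: "h holomorphic_on ball 0 1" "\<And>z. cmod z < 1 \<Longrightarrow> B z = z * h z" "deriv B 0 = h 0"
    using Schwarz3[OF B(1,3)] by metis
  have h0: "h 0 = - of_real \<beta>" using h(3) DERIV_imp_deriv[OF der] by simp
  have h1: "cmod (h w) \<le> 1" if w: "cmod w < 1" for w
  proof (cases "w = 0")
    case True
    then show ?thesis using Schwarz_Lemma(2)[OF B(1,3) Bz w] h(3) by simp
  next
    case False
    have "cmod (B w) \<le> cmod w" by (rule Schwarz_Lemma(1)[OF B(1,3) Bz w])
    then show ?thesis using h(2)[OF w] False by (simp add: norm_mult)
  qed
  define c where "c = \<beta> + \<kappa>"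
  have c1: "1 \<le> c" using \<kappa> by (simp add: c_def)
  define H where "H w = of_real c + h w" for w
  have H0: "H 0 = of_real \<kappa>" by (simp add: H_def h0 c_def)
  have ReH: "0 \<le> Re (H w)" if "cmod w < 1" for w
    using h1[OF that] abs_Re_le_cmod[of "h w"] c1 by (simp add: H_def)
  define q where "q w = (H w - of_real \<kappa>) / (H w + of_real \<kappa>)" for w
  have den: "H w + of_real \<kappa> \<noteq> 0" if "cmod w < 1" for w
  proof
    assume "H w + of_real \<kappa> = 0"
    then have "Re (H w + of_real \<kappa>) = 0" by simp
    then show False using ReH[OF that] \<kappa> by simp
  qed
  have qhol: "q holomorphic_on ball 0 1" unfolding q_def H_def
    by (intro holomorphic_intros h(1)) (use den in \<open>auto simp: H_def\<close>)
  have q0: "q 0 = 0" by (simp add: q_def H0)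
  have q1: "cmod (q w) \<le> 1" if w: "cmod w < 1" for w
  proof -
    have "(cmod (H w + of_real \<kappa>))\<^sup>2 - (cmod (H w - of_real \<kappa>))\<^sup>2 = 4 * \<kappa> * Re (H w)"
      by (simp add: cmod_power2) (simp add: power2_eq_square algebra_simps)
    moreover have "0 \<le> 4 * \<kappa> * Re (H w)" using ReH[OF w] \<kappa>(2) by simp
    ultimately have "(cmod (H w - of_real \<kappa>))\<^sup>2 \<le> (cmod (H w + of_real \<kappa>))\<^sup>2" by linarith
    then have "cmod (H w - of_real \<kappa>) \<le> cmod (H w + of_real \<kappa>)" by (rule power2_le_imp_le) simp
    then show ?thesis using den[OF w] by (simp add: q_def norm_divide)
  qed
  \<comment> \<open>The modulus of \<open>q\<close> may be \<open>1\<close> here; the Schwarz lemma, which asks for a strict bound, is applied to \<open>s q\<close>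
    with \<open>s < 1\<close>.\<close>
  have qz: "cmod (q z) \<le> cmod z"
  proof (rule field_le_mult_one_interval)
    fix s :: real assume s: "0 < s" "s < 1"
    have "(\<lambda>w. of_real s * q w) holomorphic_on ball 0 1" by (intro holomorphic_intros qhol)
    moreover have "cmod (of_real s * q w) < 1" if "cmod w < 1" for w
    proof -
      have "s * cmod (q w) \<le> s * 1" using q1[OF that] s by (intro mult_left_mono) auto
      moreover have "cmod (of_real s * q w) = s * cmod (q w)" using s by (simp add: norm_mult)
      ultimately show ?thesis using s by linarith
    qed
    ultimately have "cmod (of_real s * q z) \<le> cmod z"
      by (intro Schwarz_Lemma(1)[of "\<lambda>w. of_real s * q w"] z) (auto simp: q0)
    then show "s * cmod (q z) \<le> cmod z" using s by (simp add: norm_mult)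
  qed
  have "H z * (1 - q z) = of_real \<kappa> * (1 + q z)" using den[OF z] by (simp add: q_def field_simps)
  then have e: "cmod (H z) * cmod (1 - q z) = \<kappa> * cmod (1 + q z)"
    using \<kappa>(2) by (metis abs_of_pos norm_mult norm_of_real)
  have "cmod (H z) * (1 - cmod z) \<le> cmod (H z) * cmod (1 - q z)"
    using qz norm_triangle_ineq2[of 1 "q z"] by (intro mult_left_mono) auto
  also have "\<dots> \<le> \<kappa> * (1 + cmod z)"
    unfolding e using qz norm_triangle_ineq[of 1 "q z"] \<kappa>(2) by (intro mult_left_mono) auto
  finally have Hb: "cmod (H z) * (1 - cmod z) \<le> \<kappa> * (1 + cmod z)" .
  have "c \<le> 1 + \<kappa>"
  proof -
    have "cmod (h 0) \<le> 1" by (rule h1) simp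
    then show ?thesis by (simp add: h0 c_def)
  qed
  then have "\<bar>c - 1\<bar> \<le> \<kappa>" using c1 by linarith
  then have "cmod (of_real c - 1 :: complex) \<le> \<kappa>"
    using norm_of_real[of "c - 1", where 'a = complex] by simp
  moreover have e2: "h z + 1 = H z - (of_real c - 1)" by (simp add: H_def)
  ultimately have "cmod (h z + 1) \<le> cmod (H z) + \<kappa>"
    unfolding e2 using norm_triangle_ineq4[of "H z" "of_real c - 1"] by linarith
  then have "cmod (h z + 1) * (1 - cmod z) \<le> (cmod (H z) + \<kappa>) * (1 - cmod z)" using z by (intro mult_right_mono) auto
  also have "\<dots> \<le> 2 * \<kappa>" using Hb by (simp add: algebra_simps)
  finally have hb: "cmod (h z + 1) \<le> 2 * \<kappa> / (1 - cmod z)" using z by (simp add: le_divide_eq)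
  have "cmod (B z + z) = cmod z * cmod (h z + 1)" using h(2)[OF z] by (simp add: norm_mult[symmetric] algebra_simps)
  also have "\<dots> \<le> 1 * cmod (h z + 1)" using z by (intro mult_right_mono) auto
  finally show "cmod (B z + z) \<le> 2 * \<kappa> / (1 - cmod z)" using hb by simp
qed

section \<open>The evolution family of a sequence of steps\<close>

lemma set_lebesgue_integral_const: "u \<le> t \<Longrightarrow> (LINT \<xi>:{u..t}|lebesgue. c) = c * (t - u)" for c u t :: real
  by (simp add: set_lebesgue_integral_def)

text \<open>In the \<open>j\<close>-th time interval the step for \<open>\<mu> j\<close> is run, in an affine frame in which the current image of \<open>\<i>\<close> is
  again \<open>\<i>\<close>. The bound \<open>8\<close> makes the angle \<open>2 pi / m\<close> acute.\<close>

locale step_sequence =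
  fixes \<mu> :: "nat \<Rightarrow> nat"
  assumes \<mu>: "\<And>j. 8 \<le> \<mu> j"
begin

primrec frame_scale :: "nat \<Rightarrow> real" where
  "frame_scale 0 = 1"
| "frame_scale (Suc j) = frame_scale j * Im (unit_step (\<mu> j) \<i>)"

primrec frame_shift :: "nat \<Rightarrow> real" where
  "frame_shift 0 = 0"
| "frame_shift (Suc j) = frame_shift j + frame_scale j * Re (unit_step (\<mu> j) \<i>)"

definition flow :: "nat \<Rightarrow> real \<Rightarrow> complex \<Rightarrow> complex" where
  "flow j = step (frame_shift j + step_centre (\<mu> j) * frame_scale j) (step_gap (\<mu> j) * frame_scale j)"

primrec switch_time :: "nat \<Rightarrow> real" where
  "switch_time 0 = 0"
| "switch_time (Suc j) = switch_time j + step_time (\<mu> j) * (frame_scale j)\<^sup>2"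

text \<open>The time \<open>t\<close> restricted to the \<open>j\<close>-th interval: \<open>clamp j t - clamp j s\<close> is the time that the \<open>j\<close>-th flow runs
  between \<open>s\<close> and \<open>t\<close>.\<close>

definition clamp :: "nat \<Rightarrow> real \<Rightarrow> real" where "clamp j t = max (switch_time j) (min t (switch_time (Suc j)))"

primrec evol_upto :: "nat \<Rightarrow> real \<Rightarrow> real \<Rightarrow> complex \<Rightarrow> complex" where
  "evol_upto 0 s t z = z"
| "evol_upto (Suc n) s t z = flow n (clamp n t - clamp n s) (evol_upto n s t z)"

text \<open>Flows that start after \<open>t\<close> run for no time, so any \<open>n\<close> with \<open>t \<le> switch_time n\<close> gives the same map
  (\<open>evol_eq\<close>).\<close>

definition evol :: "real \<Rightarrow> real \<Rightarrow> complex \<Rightarrow> complex" where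
  "evol s t = evol_upto (SOME n. t \<le> switch_time n) s t"

lemma frame_scale_ge_1: "1 \<le> frame_scale j"
proof (induction j)
  case (Suc j)
  have "1 * 1 \<le> frame_scale j * Im (unit_step (\<mu> j) \<i>)"
    using Suc unit_step_i_Im[OF \<mu>[of j]] by (intro mult_mono) auto
  then show ?case by simp
qed simp

lemma frame_scale_pos: "0 < frame_scale j" using frame_scale_ge_1[of j] by linarith

text \<open>The steps last at least a fixed time, since the frames grow; so the construction reaches all times.\<close>

lemma switch_time_Suc: "switch_time j + 1 / 4 \<le> switch_time (Suc j)"
proof -
  have "1 / 4 * 1 \<le> step_time (\<mu> j) * (frame_scale j)\<^sup>2"
    using step_trig(10)[OF \<mu>[of j]] frame_scale_ge_1[of j] by (intro mult_mono) (auto simp: one_le_power)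
  then show ?thesis by simp
qed

lemma switch_time_mono: "i \<le> j \<Longrightarrow> switch_time i \<le> switch_time j"
  by (rule lift_Suc_mono_le[of switch_time]) (use switch_time_Suc in \<open>smt (verit) divide_pos_pos\<close>)

lemma switch_time_ge: "real n / 4 \<le> switch_time n"
proof (induction n)
  case (Suc n)
  have "real (Suc n) / 4 = real n / 4 + 1 / 4" by (simp add: add_divide_distrib)
  then show ?case using Suc switch_time_Suc[of n] by linarith
qed simp

lemma switch_time_nonneg: "0 \<le> switch_time n" using switch_time_mono[of 0 n] by simp

lemma switch_time_unbounded: "\<exists>n. t \<le> switch_time n"
proof -
  obtain n :: nat where "4 * t \<le> real n" using real_arch_simple by blast
  then have "t \<le> real n / 4" by simp
  then show ?thesis using switch_time_ge[of n] by (intro exI[of _ n]) linarith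
qed

lemma clamp_mono: "s \<le> t \<Longrightarrow> clamp j s \<le> clamp j t" by (auto simp: clamp_def)

lemma clamp_below: "t \<le> switch_time j \<Longrightarrow> clamp j t = switch_time j" by (auto simp: clamp_def)

lemma clamp_above: "switch_time (Suc j) \<le> t \<Longrightarrow> clamp j t = switch_time (Suc j)"
  using switch_time_mono[of j "Suc j"] unfolding clamp_def by simp

lemma clamp_sum: "0 \<le> t \<Longrightarrow> (\<Sum>j<n. clamp j t - switch_time j) = min t (switch_time n)"
proof (induction n)
  case (Suc n)
  then show ?case using switch_time_mono[of n "Suc n"] unfolding sum.lessThan_Suc clamp_def by (simp only:) (simp add: min_def max_def)
qed simp

lemma flow_gap: "0 < step_gap (\<mu> j) * frame_scale j"
  using step_trig(7)[OF \<mu>[of j]] frame_scale_pos[of j] by simp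

lemma flow_hydrodynamic: "0 \<le> a \<Longrightarrow> hydrodynamic a (flow j a)"
  unfolding flow_def by (rule hydrodynamic_step(1)[OF flow_gap])

lemma flow_strict: "0 < a \<Longrightarrow> 0 \<le> Im z \<Longrightarrow> 0 < Im (flow j a z)"
  unfolding flow_def by (rule hydrodynamic_step(2)[OF flow_gap]) auto

lemma flow_0: "0 \<le> Im z \<Longrightarrow> flow j 0 z = z"
  unfolding flow_def by (rule step_0[OF flow_gap])

lemma flow_add: "0 \<le> Im z \<Longrightarrow> 0 \<le> a \<Longrightarrow> 0 \<le> b \<Longrightarrow> flow j b (flow j a z) = flow j (a + b) z"
  unfolding flow_def by (rule step_add[OF flow_gap])

lemma evol_upto_hydrodynamic:
  assumes "s \<le> t" shows "hydrodynamic (\<Sum>j<n. clamp j t - clamp j s) (evol_upto n s t)"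
proof (induction n)
  case 0
  have "hydrodynamic 0 (evol_upto 0 s t)" by (rule hydrodynamic_cong[OF hydrodynamic_id]) simp
  then show ?case by (simp only: lessThan_0 sum.empty)
next
  case (Suc n)
  have a: "0 \<le> clamp n t - clamp n s" using clamp_mono[OF assms] by simp
  from hydrodynamic_compose[OF Suc flow_hydrodynamic[OF a, of n] a]
  show ?case unfolding sum.lessThan_Suc by (rule hydrodynamic_cong) simp
qed

lemma evol_upto_Im: "s \<le> t \<Longrightarrow> 0 \<le> Im z \<Longrightarrow> 0 \<le> Im (evol_upto n s t z)"
  using evol_upto_hydrodynamic[of s t n] by (auto simp: hydrodynamic_def intro: order_trans)

lemma evol_upto_strict:
  assumes "s \<le> t" "0 \<le> Im z" "0 < (\<Sum>j<n. clamp j t - clamp j s)"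
  shows "0 < Im (evol_upto n s t z)"
  using assms(3)
proof (induction n)
  case (Suc n)
  show ?case
  proof (cases "0 < clamp n t - clamp n s")
    case True
    then show ?thesis using flow_strict evol_upto_Im[OF assms(1,2)] by simp
  next
    case False
    then have "clamp n t - clamp n s = 0" using clamp_mono[OF assms(1), of n] by simp
    then show ?thesis using Suc evol_upto_Im[OF assms(1,2), of n] by (simp add: flow_0)
  qed
qed simp

lemma evol_upto_stable:
  assumes "s \<le> t" "0 \<le> Im z" "t \<le> switch_time n" shows "evol_upto (n + d) s t z = evol_upto n s t z"
proof (induction d)
  case (Suc d)
  have "t \<le> switch_time (n + d)" using assms(3) switch_time_mono[of n "n + d"] by simp
  then have "clamp (n + d) t - clamp (n + d) s = 0" using clamp_below assms(1) by simp
  then show ?case using Suc evol_upto_Im[OF assms(1,2), of n] by (simp add: flow_0)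
qed simp

lemma evol_eq:
  assumes "s \<le> t" "0 \<le> Im z" "t \<le> switch_time n" shows "evol s t z = evol_upto n s t z"
proof -
  define N where "N = (SOME n. t \<le> switch_time n)"
  have N: "t \<le> switch_time N" unfolding N_def by (rule someI_ex[OF switch_time_unbounded])
  have "evol_upto N s t z = evol_upto (max N n) s t z" "evol_upto n s t z = evol_upto (max N n) s t z"
    using evol_upto_stable[OF assms(1,2) N, of "max N n - N"] evol_upto_stable[OF assms, of "max N n - n"] by auto
  then show ?thesis unfolding evol_def N_def by simp
qed

lemma evol_upto_trivial:
  assumes "switch_time n \<le> u" "u \<le> t" "0 \<le> Im z" shows "evol_upto n u t z = z"
  using assms(1)
proof (induction n)
  case (Suc n)
  then have "switch_time n \<le> u" "switch_time (Suc n) \<le> t" using switch_time_mono[of n "Suc n"] assms(2) by simp_all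
  then have "evol_upto n u t z = z" "clamp n t - clamp n u = 0" using Suc clamp_above by simp_all
  then show ?case using assms(3) by (simp add: flow_0)
qed simp

lemma evol_upto_compose:
  assumes "0 \<le> s" "s \<le> u" "u \<le> t" "0 \<le> Im z"
  shows "evol_upto n s t z = evol_upto n u t (evol_upto n s u z)"
proof (induction n)
  case (Suc n)
  have Im1: "0 \<le> Im (evol_upto n s u z)" by (rule evol_upto_Im[OF assms(2,4)])
  have nn: "0 \<le> clamp n u - clamp n s" "0 \<le> clamp n t - clamp n u" using clamp_mono assms by simp_all
  show ?case
  proof (cases "u \<le> switch_time n")
    case True
    then have "clamp n u - clamp n s = 0" "clamp n u = clamp n s" using clamp_below assms(2) by simp_all
    then show ?thesis using Suc Im1 by (simp add: flow_0)
  next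
    case False
    then have triv: "evol_upto n u t w = w" if "0 \<le> Im w" for w by (intro evol_upto_trivial assms that) simp
    have "evol_upto n s t z = evol_upto n s u z" using Suc triv[OF Im1] by simp
    moreover have "0 \<le> Im (flow n (clamp n u - clamp n s) (evol_upto n s u z))"
      using evol_upto_Im[OF assms(2,4), of "Suc n"] by simp
    ultimately show ?thesis using triv flow_add[OF Im1 nn, of n] by simp
  qed
qed simp

lemma evol_total: "0 \<le> s \<Longrightarrow> s \<le> t \<Longrightarrow> t \<le> switch_time n \<Longrightarrow> (\<Sum>j<n. clamp j t - clamp j s) = t - s"
proof -
  assume a: "0 \<le> s" "s \<le> t" "t \<le> switch_time n"
  have "(\<Sum>j<n. clamp j t - clamp j s) = (\<Sum>j<n. clamp j t - switch_time j) - (\<Sum>j<n. clamp j s - switch_time j)"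
    by (simp add: sum_subtractf)
  then show ?thesis using clamp_sum[of t n] clamp_sum[of s n] a by simp
qed

lemma evol_hydrodynamic:
  assumes "0 \<le> s" "s \<le> t" shows "hydrodynamic (t - s) (evol s t)"
proof -
  obtain n where n: "t \<le> switch_time n" using switch_time_unbounded by blast
  have "hydrodynamic (t - s) (evol_upto n s t)"
    using evol_upto_hydrodynamic[OF assms(2), of n] evol_total[OF assms n] by simp
  then show ?thesis by (rule hydrodynamic_cong) (simp add: evol_eq[OF assms(2) _ n])
qed

lemma evol_strict:
  assumes "0 \<le> s" "s < t" "0 \<le> Im z" shows "0 < Im (evol s t z)"
proof -
  obtain n where n: "t \<le> switch_time n" using switch_time_unbounded by blast
  show ?thesis using evol_upto_strict[OF _ assms(3), of s t n] evol_total[of s t n] assms n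
    by (simp add: evol_eq[OF _ assms(3) n])
qed

lemma evol_compose:
  assumes "0 \<le> s" "s \<le> u" "u \<le> t" "0 \<le> Im z"
  shows "evol s t z = evol u t (evol s u z)"
proof -
  obtain n where n: "t \<le> switch_time n" using switch_time_unbounded by blast
  have I: "0 \<le> Im (evol_upto n s u z)" by (rule evol_upto_Im[OF assms(2,4)])
  have "u \<le> switch_time n" "s \<le> t" using n assms by auto
  then show ?thesis
    using evol_upto_compose[OF assms, of n] evol_eq[OF assms(2,4), of n] evol_eq[OF assms(3) I n] evol_eq[OF _ assms(4) n, of s]
    by simp
qed

lemma evol_Im: "0 \<le> s \<Longrightarrow> s \<le> t \<Longrightarrow> 0 \<le> Im z \<Longrightarrow> Im z \<le> Im (evol s t z)"
  using evol_hydrodynamic[of s t] by (auto simp: hydrodynamic_def)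

lemma evol_refl: "0 \<le> s \<Longrightarrow> 0 < Im z \<Longrightarrow> evol s s z = z"
  using evol_hydrodynamic[of s s] by (auto simp: hydrodynamic_def)

lemma evol_bound: "0 \<le> s \<Longrightarrow> s \<le> t \<Longrightarrow> 0 < Im z \<Longrightarrow> cmod (evol s t z - z) \<le> (t - s) / Im z"
  using evol_hydrodynamic[of s t] by (auto simp: hydrodynamic_def)

definition frame :: "nat \<Rightarrow> complex \<Rightarrow> complex" where
  "frame j w = of_real (frame_shift j) + of_real (frame_scale j) * w"

definition unframe :: "nat \<Rightarrow> complex \<Rightarrow> complex" where
  "unframe j w = of_real (- frame_shift j / frame_scale j) + of_real (1 / frame_scale j) * w"

lemma frame_embedding: "uhp_embedding (frame j)" "uhp_embedding (unframe j)"
  unfolding frame_def[abs_def] unframe_def[abs_def] using frame_scale_pos[of j] by (intro uhp_embedding_affine; simp)+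

lemma frame_unframe: "frame j (unframe j w) = w"
  using frame_scale_pos[of j] by (simp add: frame_def unframe_def field_simps)

lemma unframe_Im: "0 < Im w \<Longrightarrow> 0 < Im (unframe j w)"
  using frame_scale_pos[of j] by (simp add: unframe_def)

text \<open>In the moving frames the transition over one interval is the normalised step.\<close>

lemma evol_step:
  assumes "0 \<le> Im w" shows "evol (switch_time j) (switch_time (Suc j)) (frame j w) = frame (Suc j) (normal_step (\<mu> j) w)"
proof -
  have F: "0 \<le> Im (frame j w)" using assms frame_scale_pos[of j] by (simp add: frame_def)
  have TT: "switch_time j \<le> switch_time (Suc j)" by (rule switch_time_mono) simp
  have c: "clamp j (switch_time (Suc j)) - clamp j (switch_time j) = step_time (\<mu> j) * (frame_scale j)\<^sup>2"
    using clamp_above[of j "switch_time (Suc j)"] clamp_below[of "switch_time j" j] by simp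
  have "evol (switch_time j) (switch_time (Suc j)) (frame j w) = evol_upto (Suc j) (switch_time j) (switch_time (Suc j)) (frame j w)"
    by (rule evol_eq[OF TT F order_refl])
  also have "\<dots> = flow j (step_time (\<mu> j) * (frame_scale j)\<^sup>2) (evol_upto j (switch_time j) (switch_time (Suc j)) (frame j w))"
    unfolding evol_upto.simps c ..
  also have "evol_upto j (switch_time j) (switch_time (Suc j)) (frame j w) = frame j w"
    by (rule evol_upto_trivial[OF order_refl TT F])
  also have "flow j (step_time (\<mu> j) * (frame_scale j)\<^sup>2) (frame j w) = of_real (frame_shift j) + of_real (frame_scale j) * unit_step (\<mu> j) w"
    unfolding flow_def frame_def
    by (rule step_scale) (use step_trig[OF \<mu>[of j]] assms frame_scale_pos[of j] in auto)
  also have "\<dots> = frame (Suc j) (normal_step (\<mu> j) w)"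
    using unit_step_i_Im[OF \<mu>[of j]] frame_scale_pos[of j] by (simp add: frame_def normal_step_def field_simps)
  finally show ?thesis .
qed

definition \<phi> :: "real \<Rightarrow> real \<Rightarrow> complex \<Rightarrow> complex" where "\<phi> s t = disk_conj (evol s t)"

lemma evol_embedding: "0 \<le> s \<Longrightarrow> s \<le> t \<Longrightarrow> uhp_embedding (evol s t)"
  by (rule hydrodynamic_imp_embedding[OF evol_hydrodynamic])

lemma \<phi>_disk_algebra: "0 \<le> s \<Longrightarrow> s \<le> t \<Longrightarrow> \<phi> s t \<in> disk_algebra"
  unfolding disk_algebra_def \<phi>_def
  using disk_conj_holomorphic[OF evol_embedding] disk_conj_continuous[OF evol_embedding] by blast

lemma \<phi>_compose: 
  assumes "0 \<le> s" "s \<le> u" "u \<le> t" "z \<in> ball 0 1" shows "\<phi> s t z = \<phi> u t (\<phi> s u z)"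
proof -
  have z: "z \<in> cball 0 1" "z \<noteq> 1" using assms(4) by auto
  have "\<phi> u t (\<phi> s u z) = disk_conj (\<lambda>w. evol u t (evol s u w)) z"
    unfolding \<phi>_def by (rule disk_conj_compose[OF evol_embedding[OF assms(1,2)] z(1)])
  also have "\<dots> = \<phi> s t z" unfolding \<phi>_def disk_conj_def
    using z evol_compose[OF assms(1-3) cayley_closed_uhp[OF z]] by simp
  finally show ?thesis by simp
qed

lemma \<phi>_Lipschitz:
  assumes "0 \<le> s" "s \<le> u" "u \<le> t" "z \<in> ball 0 1"
  shows "cmod (\<phi> s u z - \<phi> s t z) \<le> 2 / Im (cayley z) * (t - u)"
proof -
  define w where "w = cayley z"
  have w: "0 < Im w" using cayley_uhp[OF assms(4)] by (simp add: w_def)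
  have z1: "z \<noteq> 1" using assms(4) by auto
  have I1: "Im w \<le> Im (evol s u w)" and I2: "Im w \<le> Im (evol s t w)" using evol_Im[of s _ w] assms w by auto
  have "cmod (\<phi> s u z - \<phi> s t z) = cmod (cinv (evol s u w) - cinv (evol s t w))"
    using z1 by (simp add: \<phi>_def disk_conj_def w_def)
  also have "\<dots> \<le> 2 * cmod (evol s u w - evol s t w)" using w I1 I2 by (intro cinv_Lipschitz) auto
  also have "evol s t w = evol u t (evol s u w)" by (rule evol_compose) (use assms w in auto)
  also have "cmod (evol s u w - evol u t (evol s u w)) \<le> (t - u) / Im (evol s u w)"
    using evol_bound[of u t "evol s u w"] assms w I1 by (simp add: norm_minus_commute)
  also have "\<dots> \<le> (t - u) / Im w" using w I1 assms by (intro divide_left_mono) auto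
  finally show ?thesis by (simp add: w_def)
qed

lemma \<phi>_evolution_family: "evolution_family \<infinity> \<phi>"
  unfolding evolution_family_def
proof (intro conjI allI impI ballI)
  show "\<phi> s t holomorphic_on ball 0 1" if "0 \<le> s \<and> s \<le> t" for s t
    unfolding \<phi>_def using that by (intro disk_conj_holomorphic evol_embedding) auto
  show "\<phi> s t ` ball 0 1 \<subseteq> ball 0 1" if "0 \<le> s \<and> s \<le> t" for s t
    unfolding \<phi>_def using that by (intro image_subsetI disk_conj_ball evol_embedding) auto
  show "\<phi> s s z = z" if "0 \<le> s" "z \<in> ball 0 1" for s z
    using that cinv_cayley[of z] evol_refl[OF that(1) cayley_uhp[OF that(2)]] by (auto simp: \<phi>_def disk_conj_def)
  show "\<phi> s t z = \<phi> u t (\<phi> s u z)" if "0 \<le> s \<and> s \<le> u \<and> u \<le> t" "z \<in> ball 0 1" for s u t z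
    using that by (intro \<phi>_compose) auto
  show "\<exists>k. nonneg_Ld \<infinity> S k \<and> (\<forall>s u t. 0 \<le> s \<and> s \<le> u \<and> u \<le> t \<and> t \<le> S \<longrightarrow>
          cmod (\<phi> s u z - \<phi> s t z) \<le> (LINT \<xi>:{u..t}|lebesgue. k \<xi>))"
    if z: "z \<in> ball 0 1" and "0 < S" for z S
  proof (intro exI[of _ "\<lambda>_. 2 / Im (cayley z)"] conjI allI impI)
    show "nonneg_Ld \<infinity> S (\<lambda>_. 2 / Im (cayley z))"
      unfolding nonneg_Ld_def using cayley_uhp[OF z] by auto
    show "cmod (\<phi> s u z - \<phi> s t z) \<le> (LINT \<xi>:{u..t}|lebesgue. 2 / Im (cayley z))"
      if "0 \<le> s \<and> s \<le> u \<and> u \<le> t \<and> t \<le> S" for s u t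
      using \<phi>_Lipschitz[OF _ _ _ z, of s u t] that by (simp add: set_lebesgue_integral_const)
  qed
qed simp

lemma \<phi>_disk_P0: 
  assumes "0 \<le> s" "s \<le> t" shows "\<phi> s t \<in> disk_P0"
  unfolding disk_P0_def
proof (intro CollectI bexI[of _ "evol s t"] ballI)
  note h = evol_hydrodynamic[OF assms, unfolded hydrodynamic_def]
  show "\<phi> s t z = (cayley_inv \<circ> evol s t \<circ> cayley) z" if z: "z \<in> ball 0 1" for z
  proof -
    have "0 < Im (evol s t (cayley z))" using evol_Im[OF assms, of "cayley z"] cayley_uhp[OF z] by linarith
    then show ?thesis using z by (auto simp: \<phi>_def disk_conj_def cayley_inv_eq)
  qed
  show "evol s t \<in> half_plane_P0"
    unfolding half_plane_P0_def univalent_on_def upper_half_plane_def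
  proof (intro CollectI conjI)
    show "evol s t holomorphic_on {z. 0 < Im z}" using h by blast
    show "inj_on (evol s t) {z. 0 < Im z}" using h by (auto intro: inj_on_subset)
    show "evol s t ` {z. 0 < Im z} \<subseteq> {z. 0 < Im z}" using h by (auto intro: less_le_trans)
    have "cmod (evol s t z - z) \<le> (t - s + 1) / Im z" if "0 < Im z" for z
      by (rule order_trans[OF evol_bound[OF assms that]]) (use that in \<open>simp add: divide_right_mono\<close>)
    then show "\<exists>C>0. \<forall>z\<in>{z. 0 < Im z}. cmod (evol s t z - z) \<le> C / Im z"
      using assms by (intro exI[of _ "t - s + 1"]) auto
  qed
qed

text \<open>The least constant is at most \<open>t - s\<close> by the hydrodynamic bound and at least that by the behaviour at
  infinity.\<close>

lemma ell_\<phi>: 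
  assumes "0 \<le> s" "s \<le> t" shows "ell (\<phi> s t) = t - s"
proof -
  have eq: "(cayley \<circ> \<phi> s t \<circ> cayley_inv) z = evol s t z" if z: "0 < Im z" for z
  proof -
    have "cinv z \<in> ball 0 1" by (rule cinv_ball[OF z])
    then have "cayley (disk_conj (evol s t) (cinv z)) = evol s t (cayley (cinv z))"
      using cayley_disk_conj[OF evol_embedding[OF assms], of "cinv z"] cinv_ne_1[of z] by simp
    then show ?thesis using z by (simp add: cayley_inv_eq \<phi>_def cayley_cinv)
  qed
  show ?thesis unfolding ell_def half_plane_ell_def
  proof (rule Least_equality)
    show "\<forall>z\<in>upper_half_plane. cmod ((cayley \<circ> \<phi> s t \<circ> cayley_inv) z - z) \<le> (t - s) / Im z"
      using eq evol_bound[OF assms] by (simp add: upper_half_plane_def)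
    fix C assume "\<forall>z\<in>upper_half_plane. cmod ((cayley \<circ> \<phi> s t \<circ> cayley_inv) z - z) \<le> C / Im z"
    note a = this
    have "cmod (evol s t z - z) \<le> C / Im z" if "0 < Im z" for z
      using bspec[OF a, of z] that unfolding eq[OF that] by (simp add: upper_half_plane_def)
    then show "t - s \<le> C" using hydrodynamic_bound_ge[OF evol_hydrodynamic[OF assms]] assms by simp
  qed
qed

lemma \<phi>_goryainov_ba: "goryainov_ba_family \<infinity> \<phi>"
  unfolding goryainov_ba_family_def
proof (intro conjI allI impI \<phi>_evolution_family)
  show "\<phi> s t \<in> disk_P0" if "0 \<le> s \<and> s \<le> t" for s t using \<phi>_disk_P0 that by blast
  fix S :: real assume "0 < S"
  show "abs_continuous_on_interval 0 S (\<lambda>t. ell (\<phi> 0 t))"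
    unfolding abs_continuous_on_interval_def
  proof (intro allI impI)
    fix \<epsilon> :: real assume \<epsilon>: "0 < \<epsilon>"
    show "\<exists>\<delta>>0. \<forall>(n::nat) l r. (\<forall>i<n. 0 \<le> l i \<and> l i \<le> r i \<and> r i \<le> S) \<and>
       disjoint_family_on (\<lambda>i. {l i<..<r i}) {..<n} \<and> (\<Sum>i<n. r i - l i) < \<delta> \<longrightarrow>
       (\<Sum>i<n. \<bar>ell (\<phi> 0 (r i)) - ell (\<phi> 0 (l i))\<bar>) < \<epsilon>"
    proof (intro exI[of _ \<epsilon>] conjI allI impI \<epsilon>)
      fix n :: nat and l r :: "nat \<Rightarrow> real"
      assume a: "(\<forall>i<n. 0 \<le> l i \<and> l i \<le> r i \<and> r i \<le> S) \<and>
         disjoint_family_on (\<lambda>i. {l i<..<r i}) {..<n} \<and> (\<Sum>i<n. r i - l i) < \<epsilon>"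
      have "(\<Sum>i<n. \<bar>ell (\<phi> 0 (r i)) - ell (\<phi> 0 (l i))\<bar>) = (\<Sum>i<n. r i - l i)"
      proof (rule sum.cong)
        fix i assume "i \<in> {..<n}"
        then have "0 \<le> l i" "l i \<le> r i" using a by auto
        then show "\<bar>ell (\<phi> 0 (r i)) - ell (\<phi> 0 (l i))\<bar> = r i - l i" by (simp add: ell_\<phi>)
      qed simp
      then show "(\<Sum>i<n. \<bar>ell (\<phi> 0 (r i)) - ell (\<phi> 0 (l i))\<bar>) < \<epsilon>" using a by simp
    qed
  qed
qed

end

section \<open>The choice of the blocks\<close>

lemma disk_chain_block:
  assumes "\<And>n. 8 \<le> M n" shows "disk_chain (\<lambda>n. block (M n))"
  by unfold_locales (use block_facts[OF assms] in blast)+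

lemma compose_from_cong: "(\<And>j. j < k + d \<Longrightarrow> B j = B' j) \<Longrightarrow> compose_from B k d z = compose_from B' k d z"
  by (induction d) auto

text \<open>The lengths are chosen by recursion: \<open>M n\<close> is large in terms of the radii \<open>r 0, \<dots>, r n\<close>, and \<open>r n\<close> depends on
  \<open>M 0, \<dots>, M (n - 1)\<close> only.\<close>

lemma exists_block_sequence:
  obtains M \<delta> r where "\<And>n. 8 \<le> M n" "block_chain (\<lambda>n. block (M n)) (\<lambda>n. defect (M n)) \<delta> r"
    "\<And>n k z. k < n \<Longrightarrow> z \<in> cball 0 1 \<Longrightarrow> cmod (z - 1) = \<delta> n \<Longrightarrow>
        cmod (compose_from (\<lambda>n. block (M n)) k (n - k) z - 1) \<le> 1/4 \<and>
        cmod (compose_from (\<lambda>n. block (M n)) k (n - k) z) \<le> r n"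
proof -
  define crossing where "crossing M n \<delta> r \<longleftrightarrow> 0 < \<delta> \<and> \<delta> \<le> 1 / real (Suc n) \<and> 0 \<le> r \<and> r < 1 \<and>
     (\<forall>k z. k < n \<and> z \<in> cball 0 1 \<and> cmod (z - 1) = \<delta> \<longrightarrow>
       cmod (compose_from (\<lambda>j. block (max 8 (M j))) k (n - k) z - 1) \<le> 1/4 \<and>
       cmod (compose_from (\<lambda>j. block (max 8 (M j))) k (n - k) z) \<le> r)" for M :: "nat \<Rightarrow> nat" and n \<delta> r
  \<comment> \<open>The radius must be a function of the sequence, defined for every sequence, in order to serve in the recursion.
    Replacing \<open>M j\<close> by \<open>max 8 (M j)\<close> guarantees its existence.\<close>
  define rad where "rad M n = (SOME r. \<exists>\<delta>. crossing M n \<delta> r)" for M n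
  have ex: "\<exists>\<delta>. crossing M n \<delta> (rad M n)" for M n
  proof -
    interpret disk_chain "\<lambda>j. block (max 8 (M j))" by (rule disk_chain_block) simp
    obtain \<delta> r where "0 < \<delta>" "\<delta> \<le> 1 / real (Suc n)" "0 \<le> r" "r < 1"
      "\<And>k z. k < n \<Longrightarrow> z \<in> cball 0 1 \<Longrightarrow> cmod (z - 1) = \<delta> \<Longrightarrow>
         cmod (blocks k (n - k) z - 1) \<le> 1/4 \<and> cmod (blocks k (n - k) z) \<le> r"
      by (rule crossing_radius[of n]) blast
    then have "crossing M n \<delta> r" unfolding crossing_def by blast
    then have "\<exists>r \<delta>. crossing M n \<delta> r" by blast
    then show ?thesis unfolding rad_def by (rule someI_ex)
  qed
  have local: "rad M n = rad M' n" if "\<And>j. j < n \<Longrightarrow> M j = M' j" for M M' n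
  proof -
    have "compose_from (\<lambda>j. block (max 8 (M j))) k (n - k) z = compose_from (\<lambda>j. block (max 8 (M' j))) k (n - k) z"
      if "k < n" for k z
      by (rule compose_from_cong) (use \<open>k < n\<close> \<open>\<And>j. j < n \<Longrightarrow> M j = M' j\<close> in auto)
    then have "crossing M n = crossing M' n" unfolding crossing_def by (intro ext) auto
    then show ?thesis unfolding rad_def by simp
  qed
  define P where "P M n m \<longleftrightarrow> 8 \<le> m \<and> (\<forall>i\<le>n. 2 * defect m / (1 - rad M i) \<le> (1/2)^(n + 4))" for M n m
  have "\<exists>M. \<forall>n. P M n (M n)"
  proof (rule dependent_wf_choice[OF wf_less])
    fix M M' :: "nat \<Rightarrow> nat" and n m
    assume a: "\<And>z. (z, n) \<in> {(x, y). x < y} \<Longrightarrow> M z = M' z"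
    have "rad M i = rad M' i" if "i \<le> n" for i by (rule local) (use a that in auto)
    then show "P M n m = P M' n m" unfolding P_def by auto
  next
    fix M n
    have lim: "(\<lambda>m. 2 * defect m / (1 - rad M i)) \<longlonglongrightarrow> 2 * 0 / (1 - rad M i)" for i
      unfolding defect_def using ex[of M i] by (intro tendsto_intros lim_const_over_n) (auto simp: crossing_def)
    have "\<forall>\<^sub>F m in sequentially. 2 * defect m / (1 - rad M i) < (1/2)^(n + 4)" for i
      using order_tendstoD(2)[OF lim] by simp
    then have "\<forall>\<^sub>F m in sequentially. \<forall>i\<in>{..n}. 2 * defect m / (1 - rad M i) < (1/2)^(n + 4)"
      by (intro eventually_ball_finite) auto
    then have "\<forall>\<^sub>F m in sequentially. P M n m" using eventually_ge_at_top[of 8]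
      unfolding P_def by eventually_elim (auto intro: less_imp_le)
    then show "\<exists>m. P M n m" using eventually_happens trivial_limit_sequentially by blast
  qed
  then obtain M where M: "\<And>n. 8 \<le> M n" "\<And>i n. i \<le> n \<Longrightarrow> 2 * defect (M n) / (1 - rad M i) \<le> (1/2)^(n + 4)"
    unfolding P_def by blast
  have max: "(\<lambda>j. block (max 8 (M j))) = (\<lambda>j. block (M j))" using M(1) by (simp add: max_def)
  obtain \<delta> where "\<And>n. crossing M n (\<delta> n) (rad M n)" using ex[of M] by metis
  note \<delta> = this[unfolded crossing_def max]
  interpret disk_chain "\<lambda>n. block (M n)" by (rule disk_chain_block[OF M(1)])
  have near: "cmod (block (M n) z) \<le> cmod z" "cmod (block (M n) z + z) \<le> 2 * defect (M n) / (1 - cmod z)"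
    if "cmod z < 1" for n z
  proof -
    obtain \<beta> where "(block (M n) has_field_derivative - of_real \<beta>) (at 0)" "1 - \<beta> \<le> defect (M n)"
      by (rule block_derivative[OF M(1)])
    moreover have "0 < defect (M n)" using M(1)[of n] by (simp add: defect_def)
    ultimately show "cmod (block (M n) z) \<le> cmod z" "cmod (block (M n) z + z) \<le> 2 * defect (M n) / (1 - cmod z)"
      using near_minus_identity[OF B_hol B_in_ball block_facts(6)[OF M(1)] _ _ _ that] by blast+
  qed
  show thesis
  proof (rule that[OF M(1)])
    show "block_chain (\<lambda>n. block (M n)) (\<lambda>n. defect (M n)) \<delta> (rad M)"
    proof unfold_locales
      show "\<delta> \<longlonglongrightarrow> 0"
      proof (rule tendsto_sandwich[OF _ _ tendsto_const LIMSEQ_inverse_real_of_nat])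
        show "\<forall>\<^sub>F n in sequentially. 0 \<le> \<delta> n" using \<delta> by (intro always_eventually allI) (blast intro: less_imp_le)
        show "\<forall>\<^sub>F n in sequentially. \<delta> n \<le> inverse (real (Suc n))"
          using \<delta> by (intro always_eventually allI) (simp add: inverse_eq_divide)
      qed
      show "0 \<le> defect (M n)" for n by (simp add: defect_def)
    qed (use \<delta> M(2) near in blast)+
    show "cmod (blocks k (n - k) z - 1) \<le> 1/4 \<and> cmod (blocks k (n - k) z) \<le> rad M n"
      if "k < n" "z \<in> cball 0 1" "cmod (z - 1) = \<delta> n" for k n z
      using \<delta>[of n] that by blast
  qed
qed

section \<open>Loewner chains of the evolution family\<close>

context step_sequence
begin

definition framed :: "(real \<Rightarrow> complex \<Rightarrow> complex) \<Rightarrow> nat \<Rightarrow> complex \<Rightarrow> complex" where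
  "framed f j z = f (switch_time j) (disk_conj (frame j) z)"

context
  fixes f assumes chain: "loewner_chain f" and assoc: "chain_associated_with f \<phi>"
begin

lemma chain_univalent:
  assumes "0 \<le> t" shows "f t holomorphic_on ball 0 1" "inj_on (f t) (ball 0 1)"
proof -
  obtain d where "loewner_chain_of_order d f" using chain unfolding loewner_chain_def by (rule exE)
  then have "\<forall>t\<ge>0. univalent_on (f t) (ball 0 1)" unfolding loewner_chain_of_order_def by (elim conjE)
  with assms have "univalent_on (f t) (ball 0 1)" by (simp only: simp_thms)
  then show "f t holomorphic_on ball 0 1" "inj_on (f t) (ball 0 1)" unfolding univalent_on_def by simp_all
qed

lemma chain_eq:
  assumes "0 \<le> s" "s \<le> t" "z \<in> ball 0 1" shows "f s z = f t (\<phi> s t z)"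
proof -
  have "\<forall>s t. 0 \<le> s \<and> s \<le> t \<longrightarrow> (\<forall>z\<in>ball 0 1. f t (\<phi> s t z) = f s z)"
    using assoc unfolding chain_associated_with_def .
  then have "\<forall>z\<in>ball 0 1. f t (\<phi> s t z) = f s z" using assms(1,2) by blast
  then show ?thesis using assms(3) by metis
qed

lemma framed_univalent: "framed f j holomorphic_on ball 0 1" "inj_on (framed f j) (ball 0 1)"
proof -
  have sub: "disk_conj (frame j) ` ball 0 1 \<subseteq> ball 0 1" by (intro image_subsetI disk_conj_ball frame_embedding)
  have eq: "framed f j = f (switch_time j) \<circ> disk_conj (frame j)" by (auto simp: framed_def)
  show "framed f j holomorphic_on ball 0 1" unfolding eq
    by (rule holomorphic_on_compose_gen[OF disk_conj_holomorphic[OF frame_embedding(1)] chain_univalent(1)[OF switch_time_nonneg] sub])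
  have "inj_on (disk_conj (frame j)) (ball 0 1)"
    by (rule inj_on_subset[OF disk_conj_inj[OF frame_embedding(1)] ball_subset_cball])
  then show "inj_on (framed f j) (ball 0 1)" unfolding eq
    by (rule comp_inj_on) (rule inj_on_subset[OF chain_univalent(2)[OF switch_time_nonneg] sub])
qed

lemma disk_conj_cong:
  assumes "\<And>w. 0 < Im w \<Longrightarrow> K w = K' w" "z \<in> ball 0 1" shows "disk_conj K z = disk_conj K' z"
  unfolding disk_conj_def using assms(1)[OF cayley_uhp[OF assms(2)]] by simp

lemma framed_step:
  assumes z: "z \<in> ball 0 1"
  shows "framed f j z = framed f (Suc j) (disk_conj (normal_step (\<mu> j)) z)"
proof -
  have zc: "z \<in> cball 0 1" using z by simp
  have TT: "switch_time j \<le> switch_time (Suc j)" by (rule switch_time_mono) simp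
  have "framed f j z = f (switch_time (Suc j)) (\<phi> (switch_time j) (switch_time (Suc j)) (disk_conj (frame j) z))"
    unfolding framed_def by (rule chain_eq[OF switch_time_nonneg TT disk_conj_ball[OF frame_embedding(1) z]])
  also have "\<phi> (switch_time j) (switch_time (Suc j)) (disk_conj (frame j) z) = disk_conj (\<lambda>w. evol (switch_time j) (switch_time (Suc j)) (frame j w)) z"
    unfolding \<phi>_def by (rule disk_conj_compose[OF frame_embedding(1) zc])
  also have "\<dots> = disk_conj (\<lambda>w. frame (Suc j) (normal_step (\<mu> j) w)) z"
    by (rule disk_conj_cong[OF evol_step z]) simp
  also have "\<dots> = disk_conj (frame (Suc j)) (disk_conj (normal_step (\<mu> j)) z)"
    by (rule disk_conj_compose[OF normal_step_embedding(1)[OF \<mu>] zc, symmetric])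
  finally show ?thesis unfolding framed_def .
qed

text \<open>Equal consecutive steps combine to a power of the normalised step, which for \<open>d = m\<close> is a block.\<close>

lemma framed_steps:
  assumes z: "z \<in> ball 0 1" and m: "8 \<le> m"
  shows "(\<And>i. i < d \<Longrightarrow> \<mu> (a + i) = m) \<Longrightarrow> framed f a z = framed f (a + d) (disk_conj (normal_step m ^^ d) z)"
proof (induction d)
  case 0
  have "z \<noteq> 1" using z by auto
  then show ?case by (simp add: disk_conj_def cinv_cayley)
next
  case (Suc d)
  have b: "disk_conj (normal_step m ^^ d) z \<in> ball 0 1"
    by (rule disk_conj_ball[OF normal_step_iterate(1)[OF m] z])
  have "framed f a z = framed f (a + d) (disk_conj (normal_step m ^^ d) z)" using Suc by simp
  also have "\<dots> = framed f (Suc (a + d)) (disk_conj (normal_step m) (disk_conj (normal_step m ^^ d) z))"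
    using framed_step[OF b, of "a + d"] Suc.prems[of d] by simp
  also have "disk_conj (normal_step m) (disk_conj (normal_step m ^^ d) z) = disk_conj (normal_step m ^^ Suc d) z"
    using disk_conj_compose[OF normal_step_iterate(1)[OF m, of d], of z "normal_step m"] z by (simp add: o_def)
  finally show ?case by (simp only: add_Suc_right)
qed

text \<open>The transition from \<open>t\<close> to a strictly later time sends the closed half-plane into the open one, and \<open>f t\<close> factors through it.\<close>

lemma chain_nonlanding_map:
  assumes nl: "\<And>\<eta> A. continuous_on {0<..<1} \<eta> \<Longrightarrow> (\<And>x. x \<in> {0<..<1} \<Longrightarrow> \<eta> x \<in> ball 0 1) \<Longrightarrow>
      (\<eta> \<longlongrightarrow> 1) (at_left (1::real)) \<Longrightarrow> \<not> limitin riemann_sphere (\<lambda>x. Some (framed f j (\<eta> x))) A (at_left 1)"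
    and t: "0 \<le> t" "t < switch_time j"
  shows "nonlanding_map (framed f j) (disk_conj (\<lambda>w. unframe j (evol t (switch_time j) w))) (f t)"
proof -
  have tT: "t \<le> switch_time j" using t by simp
  have K: "uhp_embedding (\<lambda>w. unframe j (evol t (switch_time j) w))"
    by (rule uhp_embedding_compose[OF frame_embedding(2) evol_embedding[OF t(1) tT]])
  have strict: "0 < Im (unframe j (evol t (switch_time j) w))" if "0 \<le> Im w" for w
    by (rule unframe_Im[OF evol_strict[OF t that]])
  show ?thesis
  proof
    show "f t z = framed f j (disk_conj (\<lambda>w. unframe j (evol t (switch_time j) w)) z)" if z: "z \<in> ball 0 1" for z
    proof -
      have "disk_conj (frame j) (disk_conj (\<lambda>w. unframe j (evol t (switch_time j) w)) z) = \<phi> t (switch_time j) z"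
        using disk_conj_compose[OF K, of z "frame j"] z by (simp add: frame_unframe \<phi>_def)
      then show ?thesis unfolding framed_def using chain_eq[OF t(1) tT z] by simp
    qed
    show "disk_conj (\<lambda>w. unframe j (evol t (switch_time j) w)) z \<in> ball 0 1" if "z \<in> cball 0 1" "z \<noteq> 1" for z
      by (rule disk_conj_strict[OF K strict that])
  qed (use framed_univalent disk_conj_continuous[OF K] disk_conj_inj[OF K] disk_conj_holomorphic[OF K] nl in \<open>simp_all del: mem_ball mem_ball_0\<close>)
qed

end

end

theorem proposition7p3:
  shows "\<exists>\<phi> :: real \<Rightarrow> real \<Rightarrow> complex \<Rightarrow> complex.
    goryainov_ba_family \<infinity> \<phi> \<and>
    (\<forall>s t. 0 \<le> s \<and> s \<le> t \<longrightarrow> ell (\<phi> s t) = t - s) \<and>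
    (\<forall>s t. 0 \<le> s \<and> s \<le> t \<longrightarrow> \<phi> s t \<in> disk_algebra) \<and>
    (\<forall>f. loewner_chain f \<and> chain_associated_with f \<phi> \<longrightarrow>
      (\<forall>t\<ge>0.
        prime_end_map (f t) 1 \<in> prime_ends (f t ` \<bbbD>) \<and>
        \<not> trivial_prime_end (f t ` \<bbbD>) (prime_end_map (f t) 1) \<and>
        (\<forall>A. \<not> contains_reachable_point (f t ` \<bbbD>) (prime_end_map (f t) 1) A) \<and>
        \<not> locally_connected_space
            (subtopology riemann_sphere (sphere_boundary (f t ` \<bbbD>)))))"
proof -
  obtain M \<delta> r where M: "\<And>n. 8 \<le> M n" and bc: "block_chain (\<lambda>n. block (M n)) (\<lambda>n. defect (M n)) \<delta> r"
    and cross: "\<And>n k z. k < n \<Longrightarrow> z \<in> cball 0 1 \<Longrightarrow> cmod (z - 1) = \<delta> n \<Longrightarrow>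
        cmod (compose_from (\<lambda>n. block (M n)) k (n - k) z - 1) \<le> 1/4 \<and>
        cmod (compose_from (\<lambda>n. block (M n)) k (n - k) z) \<le> r n"
    by (rule exists_block_sequence) blast
  interpret block_chain "\<lambda>n. block (M n)" "\<lambda>n. defect (M n)" \<delta> r by (rule bc)
  \<comment> \<open>The \<open>k\<close>-th block consists of the steps \<open>J k, \<dots>, J (k + 1) - 1\<close>, all with the parameter \<open>M k\<close>.\<close>
  define J where "J k = (\<Sum>i<k. M i)" for k
  define \<mu> where "\<mu> j = M (LEAST k. j < J (Suc k))" for j
  have J_Suc: "J (Suc k) = J k + M k" for k by (simp add: J_def)
  have J_mono: "i \<le> k \<Longrightarrow> J i \<le> J k" for i k by (rule lift_Suc_mono_le[of J]) (simp_all add: J_Suc)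
  have J_ge: "k \<le> J k" for k
  proof (induction k)
    case (Suc k)
    then show ?case using M[of k] by (simp add: J_Suc)
  qed simp
  have \<mu>_J: "\<mu> (J k + i) = M k" if "i < M k" for k i
  proof -
    have "(LEAST k'. J k + i < J (Suc k')) = k"
    proof (rule Least_equality)
      show "J k + i < J (Suc k)" using that by (simp add: J_Suc)
      fix y assume y: "J k + i < J (Suc y)"
      show "k \<le> y"
      proof (rule ccontr)
        assume "\<not> k \<le> y"
        then have "J (Suc y) \<le> J k" by (intro J_mono) simp
        then show False using y by simp
      qed
    qed
    then show ?thesis by (simp add: \<mu>_def)
  qed
  interpret step_sequence \<mu> by unfold_locales (simp add: \<mu>_def M)
  show ?thesis
  proof (rule exI[of _ \<phi>], intro conjI allI impI \<phi>_goryainov_ba)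
    show "ell (\<phi> s t) = t - s" "\<phi> s t \<in> disk_algebra" if "0 \<le> s \<and> s \<le> t" for s t
      using that ell_\<phi> \<phi>_disk_algebra by blast+
    fix f t assume f: "loewner_chain f \<and> chain_associated_with f \<phi>" and t: "0 \<le> (t::real)"
    have univ: "framed f (J k) holomorphic_on ball 0 1" "inj_on (framed f (J k)) (ball 0 1)" for k
      using framed_univalent f by blast+
    have rec: "framed f (J k) z = framed f (J (Suc k)) (block (M k) z)" if "z \<in> ball 0 1" for k z
      unfolding block_def J_Suc by (rule framed_steps) (use f M \<mu>_J that in auto)
    obtain n where "t < switch_time n" using switch_time_unbounded[of "t + 1"] by (metis less_add_one less_le_trans)
    then have before: "t < switch_time (J n)" using switch_time_mono[OF J_ge[of n]] by linarith
    have "nonlanding_map (framed f (J n)) (disk_conj (\<lambda>w. unframe (J n) (evol t (switch_time (J n)) w))) (f t)"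
      by (rule chain_nonlanding_map[OF _ _ no_limit_at_1[of "\<lambda>k. framed f (J k)", OF univ rec cross] t before])
         (use f in blast)+
    then interpret nonlanding_map "framed f (J n)" "disk_conj (\<lambda>w. unframe (J n) (evol t (switch_time (J n)) w))" "f t" .
    show "prime_end_map (f t) 1 \<in> prime_ends (f t ` \<bbbD>)"
      "\<not> trivial_prime_end (f t ` \<bbbD>) (prime_end_map (f t) 1)"
      "\<not> locally_connected_space (subtopology riemann_sphere (sphere_boundary (f t ` \<bbbD>)))"
      by (rule nonlanding_boundary)+
    show "\<not> contains_reachable_point (f t ` \<bbbD>) (prime_end_map (f t) 1) A" for A
      by (rule nonlanding_boundary)
  qed
qed

end
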